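(* Consider the distributed single-stage stochastic MPEC and the inexact distributed zeroth-order gradient tracking scheme with constant stepsize $\gamma_k\equiv\gamma>0$ described in the context, under the network, lower-boundedness, Lipschitz, lower-level VI and sampling assumptions stated there. **(a) [Non-asymptotic error bounds]** Suppose the lower-level approximations satisfy the inexactness condition of the context with deterministic $\varepsilon_k\ge 0$, and $$\gamma \le \min\Big\{\tfrac{\sqrt{1-\lambda_{\mathbf W}^2}}{10\sqrt3\lambda_{\mathbf W}^2},\tfrac{1-\lambda_{\mathbf W}^2}{20\lambda_{\mathbf W}^3},\tfrac{(1-\lambda_{\mathbf W}^2)^2}{20\lambda_{\mathbf W}^2},\tfrac16,\tfrac{1-\lambda_{\mathbf W}^2}{9\lambda_{\mathbf W}}\Big\}\Big(\tfrac{\eta}{\sqrt n L_0}\Big).$$ Let $K^*$ be uniform on $\{0,\ldots,K-1\}$, independent of the algorithm. Then for any $K\ge1$ the following hold. (a-i) [Stationarity error bound] $$\begin{aligned} \mathbb E[\mathrm{dist}^2(0,\partial_\eta f(\bar x_{K^*}))]\le{}& \tfrac{4(\mathbb E[f^\eta(\bar x_0)]-\inf_x f^\eta(x))}{\gamma K}+\tfrac{96\sqrt{2\pi}L_0^3n^{3/2}\gamma}{m\eta}+\tfrac{2L_0^2n}{\eta^2K}\Big(1+\tfrac{20}{1-\lambda_{\mathbf W}^2}\Big)\mathbb E\Big[\tfrac{\|\mathbf x_0-\mathbf 1\bar x_0\|^2}{m}\Big]\\ &+\tfrac{320\gamma^2\lambda_{\mathbf W}^4L_0^2n}{(1-\lambda_{\mathbf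 W}^2)^3\eta^2K}\Big(\tfrac1m\mathbb E[\|\nabla\mathbf f^\eta(\mathbf x_0)\|^2]+16\sqrt{2\pi}L_0^2n+\tfrac{\tilde L_0^2n^2\varepsilon_0}{\eta^2}\Big)\\ &+\tfrac{25600\sqrt{2\pi}n^3L_0^6\gamma^4\lambda_{\mathbf W}^4(3+\lambda_{\mathbf W}^2)}{m\eta^4(1-\lambda_{\mathbf W}^2)^2}+\Big(\tfrac{160\gamma^2\lambda_{\mathbf W}^2L_0^4n^2}{\eta^2(1-\lambda_{\mathbf W}^2)^3}\Big)32\sqrt{2\pi}\Big(\|\mathbf W\|^2+\tfrac{11}{2}\lambda_{\mathbf W}^2\Big)\\ &+\Big(\tfrac{160\gamma^2\lambda_{\mathbf W}^2L_0^4n^3}{\eta^4(1-\lambda_{\mathbf W}^2)^3}\Big)\Big(\tfrac{5\lambda_{\mathbf W}^2\tilde L_0^2}{L_0^2}\Big)\Big(\tfrac{1+3\lambda_{\mathbf W}^2}{1-\lambda_{\mathbf W}^2}\Big)\tfrac{\sum_{k=0}^{K-1}\varepsilon_{k+1}}{K}\\ &+\Big(\tfrac{160\gamma^2\lambda_{\mathbf W}^2L_0^4n^3}{\eta^4(1-\lambda_{\mathbf W}^2)^3}\Big)\Big(\tfrac{2\|\mathbf W\|^2\tilde L_0^2}{L_0^2}+\Big(\tfrac{5\lambda_{\mathbf W}^2\tilde L_0^2}{L_0^2}\Big)\Big(\tfrac{1+3\lambda_{\mathbf W}^2}{1-\lambda_{\mathbf W}^2}\Big)+\tfrac{300\lambda_{\mathbf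 W}^4\gamma^2\tilde L_0^2n}{\eta^2(1-\lambda_{\mathbf W}^2)^2}\Big)\tfrac{\sum_{k=0}^{K-1}\varepsilon_k}{K}\\ &+\Big(1+\tfrac{3\gamma L_0\sqrt n}{2\eta}\Big)\Big(\tfrac{4\tilde L_0^2n^2}{\eta^2}\Big)\tfrac{\sum_{k=0}^{K-1}\varepsilon_k}{K}. \end{aligned}$$ (a-ii) [Consensus error bound] With $H_{n,\eta,\gamma}\triangleq 1+\tfrac{8L_0^2n}{\eta^2}\Big(\tfrac{80\gamma^2\lambda_{\mathbf W}^2L_0^2n}{\eta^2(1-\lambda_{\mathbf W}^2)^3}\Big)\Big(\tfrac{30\gamma^2\lambda_{\mathbf W}^2}{1-\lambda_{\mathbf W}^2}\Big)$, $$\begin{aligned} \mathbb E\Big[\tfrac{\|\mathbf x_{K^*}-\mathbf 1\bar x_{K^*}\|^2}{m}\Big]\le{}&\tfrac{160H_{n,\eta,\gamma}\gamma^2\lambda_{\mathbf W}^4}{(1-\lambda_{\mathbf W}^2)^3K}\Big(\tfrac1m\mathbb E[\|\nabla\mathbf f^\eta(\mathbf x_0)\|^2]+16\sqrt{2\pi}L_0^2n+\tfrac{\tilde L_0^2n^2\varepsilon_0}{\eta^2}\Big)\\ &+\Big(\tfrac{80\gamma^2\lambda_{\mathbf W}^2L_0^2n}{(1-\lambda_{\mathbf W}^2)^3}\Big)32H_{n,\eta,\gamma}\sqrt{2\pi}\Big(\|\mathbf W\|^2+\tfrac{11}{2}\lambda_{\mathbf W}^2\Big)+\tfrac{12800H_{n,\eta,\gamma}\sqrt{2\pi}n^2L_0^4\gamma^4\lambda_{\mathbf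 W}^4(3+\lambda_{\mathbf W}^2)}{m\eta^2(1-\lambda_{\mathbf W}^2)^2}\\ &+H_{n,\eta,\gamma}\Big(\tfrac{80\gamma^2\lambda_{\mathbf W}^2L_0^2n^2}{\eta^2(1-\lambda_{\mathbf W}^2)^3}\Big)\Big(\tfrac{2\|\mathbf W\|^2\tilde L_0^2}{L_0^2}+\Big(\tfrac{5\lambda_{\mathbf W}^2\tilde L_0^2}{L_0^2}\Big)\Big(\tfrac{1+3\lambda_{\mathbf W}^2}{1-\lambda_{\mathbf W}^2}\Big)+\tfrac{300\lambda_{\mathbf W}^4\gamma^2\tilde L_0^2n}{\eta^2(1-\lambda_{\mathbf W}^2)^2}\Big)\tfrac{\sum_{k=0}^{K-1}\varepsilon_k}{K}\\ &+H_{n,\eta,\gamma}\Big(\tfrac{80\gamma^2\lambda_{\mathbf W}^2L_0^2n^2}{\eta^2(1-\lambda_{\mathbf W}^2)^3}\Big)\Big(\tfrac{5\lambda_{\mathbf W}^2\tilde L_0^2}{L_0^2}\Big)\Big(\tfrac{1+3\lambda_{\mathbf W}^2}{1-\lambda_{\mathbf W}^2}\Big)\tfrac{\sum_{k=0}^{K-1}\varepsilon_{k+1}}{K}\\ &+H_{n,\eta,\gamma}\Big(1+\tfrac{3\gamma L_0\sqrt n}{2\eta}\Big)\Big(\tfrac{16\tilde L_0^2n^2}{\eta^2}\Big)\tfrac{\sum_{k=0}^{K-1}\varepsilon_k}{K}+\tfrac{H_{n,\eta,\gamma}}{K}\Big(1+\tfrac{20}{1-\lambda_{\mathbf W}^2}\Big)\mathbb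 E\Big[\tfrac{\|\mathbf x_0-\mathbf 1\bar x_0\|^2}{m}\Big]\\ &+\tfrac{16H_{n,\eta,\gamma}(\mathbb E[f^\eta(\bar x_0)]-\inf_xf^\eta(x))}{\gamma K}+H_{n,\eta,\gamma}\Big(\tfrac{384\sqrt{2\pi}L_0^3n^{3/2}\gamma}{m\eta}\Big). \end{aligned}$$ **(b) [Complexity bounds]** Suppose at iteration $k$ the inexact lower-level solutions are generated by the stochastic approximation method of the context, terminated after $t_k=\lceil n^{1/2}(k+\hat\Gamma)^a/\eta^{2/3}\rceil$ iterations, where $a>0.5$. Let $\epsilon>0$ be arbitrary, and let $K_\epsilon$ denote the number of upper-level iterations needed to guarantee $\mathbb E[\mathrm{dist}^2(0,\partial_\eta f(\bar x_{K_\epsilon^*}))]\le\epsilon$, where $K_\epsilon^*$ is uniform on $\{0,\ldots,K_\epsilon-1\}$. (b-i) [Upper-level iteration/sample complexity] Suppose $\gamma=\frac{\eta^{2/3}}{\sqrt{n^{3/2}K_\epsilon}L_0^{3/2}}$ with $$K_\epsilon\ge\max\Big\{1,\Big(\max\Big\{\tfrac{10\sqrt3\lambda_{\mathbf W}^2}{\sqrt{1-\lambda_{\mathbf W}^2}},\tfrac{20\lambda_{\mathbf W}^3}{1-\lambda_{\mathbf W}^2},\tfrac{20\lambda_{\mathbf W}^2}{(1-\lambda_{\mathbf W}^2)^2},6,\tfrac{9\lambda_{\mathbf W}}{1-\lambda_{\mathbf W}^2}\Big\}\Big)^2\tfrac{1}{\eta^{2/3}L_0n^{1/2}}\Big\}.$$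 Then $$\begin{aligned} K_\epsilon=\mathcal O\Big(&\tfrac{n^{3/2}L_0^3}{\eta^{4/3}}\epsilon^{-2}+\tfrac{L_0^3n^{3/2}}{\eta^{2/3}m^2}\epsilon^{-2}+\tfrac{L_0^2n\,\mathbb E[\frac1m\|\mathbf x_0-\mathbf 1\bar x_0\|^2]}{\eta^2(1-\lambda_{\mathbf W}^2)}\epsilon^{-1}+\tfrac{\lambda_{\mathbf W}^2L_0^{1/2}n^{1/4}}{\eta^{1/3}(1-\lambda_{\mathbf W}^2)^{3/2}}\epsilon^{-1/2}\\ &+\tfrac{\lambda_{\mathbf W}^2\tilde L_0n^{3/4}\sqrt{\varepsilon_0}}{L_0^{1/2}\eta^{4/3}(1-\lambda_{\mathbf W}^2)^{3/2}}\epsilon^{-1/2}+\tfrac{\lambda_{\mathbf W}^2L_0n^{1/2}(\lambda_{\mathbf W}^2+\|\mathbf W\|^2)}{\eta^{2/3}(1-\lambda_{\mathbf W}^2)^3}\epsilon^{-1}+\tfrac{\lambda_{\mathbf W}^2(3+\lambda_{\mathbf W}^2)^{1/2}}{\eta^{2/3}\sqrt m(1-\lambda_{\mathbf W}^2)}\epsilon^{-1/2}\Big)+J_\epsilon, \end{aligned}$$ where: (1) If $a\in(\frac12,1)$, $$\begin{aligned}J_\epsilon=\mathcal O\Big(&\Big[\tfrac{\kappa_F\lambda_{\mathbf W}^2n}{L_0\eta^2(1-\lambda_{\mathbf W}^2)^3(1-a)}\Big(\|\mathbf W\|^2\tilde L_0^2+\tfrac{\lambda_{\mathbf W}^4\tilde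 L_0^2}{1-\lambda_{\mathbf W}^2}\Big)\Big]^{\frac1{1+a}}\epsilon^{-\frac1{1+a}}+\Big(\tfrac{\kappa_F\tilde L_0^2n^{3/2}}{\eta^{4/3}(1-a)}\Big)^{\frac1a}\epsilon^{-\frac1a}\\&+\Big(\tfrac{\kappa_F\lambda_{\mathbf W}^6n^{1/2}\tilde L_0^2}{L_0^2\eta^{8/3}(1-\lambda_{\mathbf W}^2)^5(1-a)}\Big)^{\frac1{2+a}}\epsilon^{-\frac1{2+a}}+\Big(\tfrac{\kappa_F\tilde L_0^2n^{5/4}}{L_0^{1/2}\eta^{5/3}(1-a)}\Big)^{\frac1{a+1/2}}\epsilon^{-\frac1{a+1/2}}\Big).\end{aligned}$$ (2) If $a=1$, $$\begin{aligned}J_\epsilon=\tilde{\mathcal O}\Big(&\Big[\tfrac{\kappa_F\lambda_{\mathbf W}^2n}{L_0\eta^2(1-\lambda_{\mathbf W}^2)^3}\Big(\|\mathbf W\|^2\tilde L_0^2+\tfrac{\lambda_{\mathbf W}^4\tilde L_0^2}{1-\lambda_{\mathbf W}^2}\Big)\Big]^{\frac12}\epsilon^{-\frac12}+\Big(\tfrac{\kappa_F\lambda_{\mathbf W}^6n^{1/2}\tilde L_0^2}{L_0^2\eta^{8/3}(1-\lambda_{\mathbf W}^2)^5}\Big)^{\frac13}\epsilon^{-\frac13}\\&+\Big(\tfrac{\kappa_F\tilde L_0^2n^{5/4}}{L_0^{1/2}\eta^{5/3}}\Big)^{\frac23}\epsilon^{-\frac23}+\Big(\tfrac{\kappa_F\tilde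 L_0^2n^{3/2}}{\eta^{4/3}}\Big)\epsilon^{-1}\Big).\end{aligned}$$ (3) If $a>1$, $$\begin{aligned}J_\epsilon=\mathcal O\Big(&\Big[\tfrac{a\kappa_F\lambda_{\mathbf W}^2n}{L_0\eta^2(1-\lambda_{\mathbf W}^2)^3(a-1)}\Big(\|\mathbf W\|^2\tilde L_0^2+\tfrac{\lambda_{\mathbf W}^4\tilde L_0^2}{1-\lambda_{\mathbf W}^2}\Big)\Big]^{\frac12}\epsilon^{-\frac12}+\Big(\tfrac{a\kappa_F\lambda_{\mathbf W}^6n^{1/2}\tilde L_0^2}{L_0^2\eta^{8/3}(1-\lambda_{\mathbf W}^2)^5(a-1)}\Big)^{\frac13}\epsilon^{-\frac13}\\&+\Big(\tfrac{a\kappa_F\tilde L_0^2n^{5/4}}{L_0^{1/2}\eta^{5/3}(a-1)}\Big)^{\frac23}\epsilon^{-\frac23}+\Big(\tfrac{a\kappa_F\tilde L_0^2n^{3/2}}{\eta^{4/3}(a-1)}\Big)\epsilon^{-1}\Big).\end{aligned}$$ (b-ii) [Overall iteration/sample complexity] To guarantee $\mathbb E[\mathrm{dist}^2(0,\partial_\eta f(\bar x_{K_\epsilon^*}))]\le\epsilon$, the overall (upper- plus lower-level) iteration/sample complexity is $\mathcal O\big(n^{1/2}K_\epsilon^{1+a}/\eta^{2/3}\big)$, with $K_\epsilon$ as in (b-i).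
   Context: **Problem (single-stage).** $m$ agents minimize $f(x)=\frac1m\sum_{i=1}^m f_i(x)$ over $x\in\mathbb R^n$, with $f_i(x)=\mathbb E[\tilde f_i(x,\boldsymbol\xi_i)]$ and $\tilde f_i(x,\xi_i)=\tilde h_i(x,z_i(x),\xi_i)$, where $\boldsymbol\xi_i$ is an $\mathbb R^d$-valued random vector, $\tilde h_i:\mathbb R^n\times\mathbb R^p\times\mathbb R^d\to\mathbb R$, and $z_i(x)\in\mathbb R^p$ is the unique solution of the variational inequality $\mathrm{VI}(\mathcal Z_i(x),F_i(x,\cdot))$: $z_i(x)\in\mathcal Z_i(x)$ and $F_i(x,z_i(x))^\top(z-z_i(x))\ge0$ for all $z\in\mathcal Z_i(x)$; here $F_i(x,z)=\mathbb E[\tilde F_i(x,z,\boldsymbol\xi_i)]$. **Notation.** $\|\cdot\|$ is the Euclidean norm of vectors and the Frobenius norm of matrices. $\mathbf 1\in\mathbb R^m$ is the all-ones vector. For local copies $x_{i,k},y_{i,k}\in\mathbb R^n$: $\mathbf x_k=[x_{1,k},\ldots,x_{m,k}]^\top$, $\mathbf y_k=[y_{1,k},\ldots,y_{m,k}]^\top\in\mathbb R^{m\times n}$, $\bar x_k=\frac1m\mathbf 1^\top\mathbf x_k$, $\bar y_k=\frac1m\mathbf 1^\top\mathbf y_k$. For $\eta>0$, $f_i^\eta(x)=\mathbb E_{\mathbf u}[f_i(x+\eta\mathbf u)]$ with $\mathbf u$ uniform on the closed unit ball $\mathbb B$ of $\mathbb R^n$; $f^\eta=\frac1m\sum_if_i^\eta$;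 $\nabla\mathbf f^\eta(\mathbf x)=[\nabla f_1^\eta(x_1),\ldots,\nabla f_m^\eta(x_m)]^\top$. $\partial f$ is the Clarke generalized gradient and $\partial_\eta f(x)=\mathrm{conv}\big(\bigcup_{y\in x+\eta\mathbb B}\partial f(y)\big)$. **Assumptions.** *Network:* agents communicate over an undirected connected graph on $\{1,\ldots,m\}$; the mixing matrix $\mathbf W=[w_{ij}]\in\mathbb R^{m\times m}$ (compatible with the graph) is doubly stochastic and $w_{ii}>0$ for some $i$. $\lambda_{\mathbf W}$ is the spectral norm of $\mathbf W-\frac1m\mathbf 1\mathbf 1^\top$, and under this assumption $0\le\lambda_{\mathbf W}<1$. Terms with $\lambda_{\mathbf W}=0$ in a denominator inside a minimum are read as $+\infty$. *Lower-boundedness:* $\min_xf(x)>-\infty$. *Lipschitz:* for each $i$ and $\xi_i$, $\tilde h_i(x,\cdot,\xi_i)$ is $\tilde L_0(\xi_i)$-Lipschitz (for every $x$), with $\tilde L_0=\max_i\sqrt{\mathbb E[\tilde L_0^2(\boldsymbol\xi_i)]}<\infty$; and $x\mapsto\tilde h_i(x,z_i(x),\xi_i)$ is $L_0(\xi_i)$-Lipschitz with $L_0=\max_i\sqrt{\mathbb E[L_0^2(\boldsymbol\xi_i)]}<\infty$. *Lower-level VI:* $F_i(x,\cdot)$ is $\mu_F$-strongly monotone and $L_F$-Lipschitz uniformly in $x$; $\mathcal Z_i(x)\subseteq\mathbb R^p$ is nonempty, closed, convex; $\sup_x\sup_{z_1,z_2\in\mathcal Z_i(x)}\|z_1-z_2\|^2\le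 D_i$. $\kappa_F=L_F/\mu_F$. *Sampling:* for each agent the samples $\xi_{i,k}$ of $\boldsymbol\xi_i$ are iid over $k$, the vectors $v_{i,k}$ are iid uniform on the unit sphere $\mathbb S\subset\mathbb R^n$, all $\xi_{i,k},v_{i,k}$ are mutually independent (also across agents), and independent of the lower-level solver's samples. **Upper-level scheme (inexact DiZS-GT$^{1s}$).** Random $x_{i,0}$; $y_{i,0}=0$, $g_{i,-1}^{\eta,\varepsilon_{-1}}=0$. For $k\ge0$: draw $\xi_{i,k},v_{i,k}$; compute approximations $z_{i,\varepsilon_k}(x_{i,k}\pm\eta v_{i,k})$ of $z_i(x_{i,k}\pm\eta v_{i,k})$; set $g_{i,k}^{\eta,\varepsilon_k}=\frac n{2\eta}\big(\tilde h_i(x_{i,k}+\eta v_{i,k},z_{i,\varepsilon_k}(x_{i,k}+\eta v_{i,k}),\xi_{i,k})-\tilde h_i(x_{i,k}-\eta v_{i,k},z_{i,\varepsilon_k}(x_{i,k}-\eta v_{i,k}),\xi_{i,k})\big)v_{i,k}$; $y_{i,k+1}=\sum_jw_{ij}(y_{j,k}+g_{j,k}^{\eta,\varepsilon_k}-g_{j,k-1}^{\eta,\varepsilon_{k-1}})$; $x_{i,k+1}=\sum_jw_{ij}(x_{j,k}-\gamma_k y_{j,k+1})$. **Inexactness condition.** $\mathbb E[\|z_{i,\varepsilon_k}(x)-z_i(x)\|^2\mid x]\le\varepsilon_k$ a.s. for any random $x\in\mathbb R^n$, with $\varepsilon_k$ deterministic (in particular, at $x=x_{i,k}\pm\eta v_{i,k}$,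 conditionally on the past of the algorithm and $v_{i,k}$). **Lower-level stochastic approximation method.** For input $\hat x=x_{i,k}\pm\eta v_{i,k}$: start at a random $z_0\in\mathcal Z_i(\hat x)$; for $t=0,\ldots,t_k-1$ set $z_{t+1}=\Pi_{\mathcal Z_i(\hat x)}[z_t-\hat\gamma_t\tilde F_i(\hat x,z_t,\xi_t)]$, $\hat\gamma_t=\frac{\hat\gamma}{t+\hat\Gamma}$, with $\hat\gamma>\frac1{\mu_F}$, $\hat\Gamma>\frac{\hat\gamma L_F^2}{\mu_F}$, $\Pi$ the Euclidean projection, and output $z_{i,\varepsilon_k}(\hat x)=z_{t_k}$. The samples $\xi_t$ are iid with $\mathbb E[\tilde F_i(x,z,\xi_t)\mid x,z]=F_i(x,z)$ and $\mathbb E[\|\tilde F_i(x,z,\xi_t)-F_i(x,z)\|^2\mid x,z]\le\nu_F^2$. In (b), $\varepsilon_k=\max\{\nu_F^2\hat\gamma^2(\mu_F\hat\gamma-1)^{-1},\hat\Gamma\max_iD_i\}\frac1{t_k+\hat\Gamma}$. **Order notation.** $\mathcal O$ hides constants independent of $\epsilon,n,\eta,L_0,\tilde L_0,\lambda_{\mathbf W},\|\mathbf W\|$ (they may depend on the initial gap $\mathbb E[f^\eta(\bar x_0)]-\inf f^\eta$, on $D_i,\nu_F,\mu_F,\hat\gamma,\hat\Gamma$, and in (b-ii) on $m$); $\tilde{\mathcal O}$ additionally hides logarithmic factors.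
   Formalization: In (b-i) the bound on K_ε is the rounded-up maximum of the assumed lower threshold and C times the stated terms; (b-ii) is stated for K_ε when η^{2/3} ≤ n^{1/2}K_ε^a, and for all small ε with K_ε replaced by its bound, as the rounding in t_k breaks it for large η. *)

theory Defs
  imports "HOL-Probability.Probability"
begin

section \<open>Nonsmooth analysis and randomized smoothing\<close>

definition clarke_dirderiv :: "('a::real_normed_vector \<Rightarrow> real) \<Rightarrow> 'a \<Rightarrow> 'a \<Rightarrow> ereal" where
  "clarke_dirderiv f x d =
     Limsup (nhds x \<times>\<^sub>F at_right 0) (\<lambda>(y, t). ereal ((f (y + t *\<^sub>R d) - f y) / t))"

definition clarke_gradient :: "('a::real_inner \<Rightarrow> real) \<Rightarrow> 'a \<Rightarrow> 'a set" where
  "clarke_gradient f x = {g. \<forall>d. ereal (g \<bullet> d) \<le> clarke_dirderiv f x d}"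

definition clarke_eta_gradient :: "real \<Rightarrow> ('a::real_inner \<Rightarrow> real) \<Rightarrow> 'a \<Rightarrow> 'a set" where
  "clarke_eta_gradient \<eta> f x = convex hull (\<Union>y\<in>cball x \<eta>. clarke_gradient f y)"

definition smoothed :: "real \<Rightarrow> ('a::euclidean_space \<Rightarrow> real) \<Rightarrow> 'a \<Rightarrow> real" where
  "smoothed \<eta> f x = (\<integral>u. f (x + \<eta> *\<^sub>R u) \<partial>uniform_measure lborel (cball 0 1))"

definition gradient :: "('a::real_inner \<Rightarrow> real) \<Rightarrow> 'a \<Rightarrow> 'a" where
  "gradient f x = (THE g. GDERIV f x :> g)"

text \<open>The uniform law on the unit sphere is the law of \<open>u / norm u\<close> for \<open>u\<close> uniform on the
  unit ball; this covers dimension one, where the sphere consists of two points.\<close>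

definition uniform_sphere :: "'a::euclidean_space measure" where
  "uniform_sphere = distr (uniform_measure lborel (cball 0 1)) borel sgn"


section \<open>The communication network\<close>

definition doubly_stochastic :: "real^'m^'m \<Rightarrow> bool" where
  "doubly_stochastic W \<longleftrightarrow> (\<forall>i j. 0 \<le> W $ i $ j) \<and>
     (\<forall>i. (\<Sum>j\<in>UNIV. W $ i $ j) = 1) \<and> (\<forall>j. (\<Sum>i\<in>UNIV. W $ i $ j) = 1)"

text \<open>Compatibility of the weights with the graph is the usual convention: off the diagonal, a
  weight is positive exactly on the edges.\<close>

definition network :: "('m \<times> 'm) set \<Rightarrow> real^'m^'m \<Rightarrow> bool" where
  "network E W \<longleftrightarrow> sym E \<and> irrefl E \<and> (\<forall>i j. (i, j) \<in> E\<^sup>*) \<and>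
     (\<forall>i j. i \<noteq> j \<longrightarrow> (0 < W $ i $ j \<longleftrightarrow> (i, j) \<in> E)) \<and>
     doubly_stochastic W \<and> (\<exists>i. 0 < W $ i $ i)"

definition lambda_W :: "real^'m^'m \<Rightarrow> real" where
  "lambda_W W = onorm ((*v) (W - (\<chi> i j. 1 / real CARD('m))))"

text \<open>A family of local copies is stored as a matrix whose rows are the copies; its \<open>norm\<close> is the
  Frobenius norm.\<close>

definition average :: "real^'n^'m \<Rightarrow> real^'n" where
  "average X = (1 / real CARD('m)) *\<^sub>R (\<Sum>i\<in>UNIV. X $ i)"

definition deviation :: "real^'n^'m \<Rightarrow> real^'n^'m" where
  "deviation X = (\<chi> i. X $ i - average X)"

definition consensus_error :: "real^'n^'m \<Rightarrow> real" where
  "consensus_error X = (norm (deviation X))\<^sup>2 / real CARD('m)"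


section \<open>The single-stage stochastic MPEC\<close>

text \<open>\<open>law i\<close> is the distribution of the random vector of agent \<open>i\<close>, \<open>cost i x z \<xi>\<close> its sampled
  objective, \<open>vmap i x z \<xi>\<close> its sampled lower-level map and \<open>feas i x\<close> its lower-level feasible
  set. \<open>lipx i\<close> and \<open>lipz i\<close> are the sample-dependent Lipschitz constants of the implicit
  objective in \<open>x\<close> and of the cost in \<open>z\<close>.\<close>

record ('n, 'm, 'p, 'd) mpec =
  law  :: "'m \<Rightarrow> (real^'d) measure"
  cost :: "'m \<Rightarrow> real^'n \<Rightarrow> real^'p \<Rightarrow> real^'d \<Rightarrow> real"
  vmap :: "'m \<Rightarrow> real^'n \<Rightarrow> real^'p \<Rightarrow> real^'d \<Rightarrow> real^'p"
  feas :: "'m \<Rightarrow> real^'n \<Rightarrow> (real^'p) set"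
  lipx :: "'m \<Rightarrow> real^'d \<Rightarrow> real"
  lipz :: "'m \<Rightarrow> real^'d \<Rightarrow> real"

definition solves_VI :: "'a::real_inner set \<Rightarrow> ('a \<Rightarrow> 'a) \<Rightarrow> 'a \<Rightarrow> bool" where
  "solves_VI C G z \<longleftrightarrow> z \<in> C \<and> (\<forall>z'\<in>C. G z \<bullet> (z' - z) \<ge> 0)"

definition mean_vmap :: "('n::finite, 'm::finite, 'p::finite, 'd::finite) mpec \<Rightarrow> 'm \<Rightarrow> real^'n \<Rightarrow> real^'p \<Rightarrow> real^'p"
  where "mean_vmap P i x z = (\<integral>\<xi>. vmap P i x z \<xi> \<partial>law P i)"

definition zsol :: "('n::finite, 'm::finite, 'p::finite, 'd::finite) mpec \<Rightarrow> 'm \<Rightarrow> real^'n \<Rightarrow> real^'p"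
  where "zsol P i x = (THE z. solves_VI (feas P i x) (mean_vmap P i x) z)"

definition agent_obj :: "('n::finite, 'm::finite, 'p::finite, 'd::finite) mpec \<Rightarrow> 'm \<Rightarrow> real^'n \<Rightarrow> real"
  where "agent_obj P i x = (\<integral>\<xi>. cost P i x (zsol P i x) \<xi> \<partial>law P i)"

definition objective :: "('n::finite, 'm::finite, 'p::finite, 'd::finite) mpec \<Rightarrow> real^'n \<Rightarrow> real"
  where "objective P x = (1 / real CARD('m)) * (\<Sum>i\<in>UNIV. agent_obj P i x)"

definition smoothed_obj :: "('n::finite, 'm::finite, 'p::finite, 'd::finite) mpec \<Rightarrow> real \<Rightarrow> real^'n \<Rightarrow> real"
  where "smoothed_obj P \<eta> x = (1 / real CARD('m)) * (\<Sum>i\<in>UNIV. smoothed \<eta> (agent_obj P i) x)"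

definition stacked_gradient :: "('n::finite, 'm::finite, 'p::finite, 'd::finite) mpec \<Rightarrow> real \<Rightarrow> real^'n^'m \<Rightarrow> real^'n^'m"
  where "stacked_gradient P \<eta> X = (\<chi> i. gradient (smoothed \<eta> (agent_obj P i)) (X $ i))"

definition L0 :: "('n::finite, 'm::finite, 'p::finite, 'd::finite) mpec \<Rightarrow> real"
  where "L0 P = Max (range (\<lambda>i. sqrt (\<integral>\<xi>. (lipx P i \<xi>)\<^sup>2 \<partial>law P i)))"

definition Lt0 :: "('n::finite, 'm::finite, 'p::finite, 'd::finite) mpec \<Rightarrow> real"
  where "Lt0 P = Max (range (\<lambda>i. sqrt (\<integral>\<xi>. (lipz P i \<xi>)\<^sup>2 \<partial>law P i)))"

text \<open>The measurability and integrability that give meaning to the expectations. Joint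
  measurability of the projection says that \<open>feas i\<close> is a measurable set-valued map; with it the
  solution map \<open>zsol\<close> and the lower-level iterates are measurable.\<close>

definition well_posed :: "('n::finite, 'm::finite, 'p::finite, 'd::finite) mpec \<Rightarrow> bool" where
  "well_posed P \<longleftrightarrow> (\<forall>i.
     prob_space (law P i) \<and> sets (law P i) = sets borel \<and>
     (\<lambda>(x, z, \<xi>). cost P i x z \<xi>) \<in> borel_measurable borel \<and>
     (\<lambda>(x, z, \<xi>). vmap P i x z \<xi>) \<in> borel_measurable borel \<and>
     (\<lambda>(x, w). closest_point (feas P i x) w) \<in> borel_measurable borel \<and>
     (\<forall>x z. integrable (law P i) (vmap P i x z)) \<and>
     (\<forall>x. integrable (law P i) (cost P i x (zsol P i x))))"

definition lipschitz_data :: "('n::finite, 'm::finite, 'p::finite, 'd::finite) mpec \<Rightarrow> bool" where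
  "lipschitz_data P \<longleftrightarrow> (\<forall>i.
     lipz P i \<in> borel_measurable borel \<and> integrable (law P i) (\<lambda>\<xi>. (lipz P i \<xi>)\<^sup>2) \<and>
     lipx P i \<in> borel_measurable borel \<and> integrable (law P i) (\<lambda>\<xi>. (lipx P i \<xi>)\<^sup>2) \<and>
     (\<forall>\<xi> x. (lipz P i \<xi>)-lipschitz_on UNIV (\<lambda>z. cost P i x z \<xi>)) \<and>
     (\<forall>\<xi>. (lipx P i \<xi>)-lipschitz_on UNIV (\<lambda>x. cost P i x (zsol P i x) \<xi>)))"

definition lower_level ::
  "('n::finite, 'm::finite, 'p::finite, 'd::finite) mpec \<Rightarrow> real \<Rightarrow> real \<Rightarrow> ('m \<Rightarrow> real) \<Rightarrow> bool" where
  "lower_level P \<mu> L D \<longleftrightarrow> 0 < \<mu> \<and> (\<forall>i x.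
     (\<forall>z z'. (mean_vmap P i x z - mean_vmap P i x z') \<bullet> (z - z') \<ge> \<mu> * (norm (z - z'))\<^sup>2) \<and>
     L-lipschitz_on UNIV (mean_vmap P i x) \<and>
     feas P i x \<noteq> {} \<and> closed (feas P i x) \<and> convex (feas P i x) \<and>
     (\<forall>z\<in>feas P i x. \<forall>z'\<in>feas P i x. (norm (z - z'))\<^sup>2 \<le> D i))"


section \<open>Sampling and the upper-level scheme\<close>

definition events_of :: "'w measure \<Rightarrow> ('w \<Rightarrow> 'a::topological_space) \<Rightarrow> 'w set set" where
  "events_of M X = {X -` B \<inter> space M | B. B \<in> sets borel}"

text \<open>\<open>S\<close> is the information carried by the initial point and by the randomness of the
  lower-level solver.\<close>

datatype 'm source = Solver | Sample 'm nat | Direction 'm nat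

primrec source_events ::
  "'w measure \<Rightarrow> 'w measure \<Rightarrow> ('m \<Rightarrow> nat \<Rightarrow> 'w \<Rightarrow> real^'d) \<Rightarrow> ('m \<Rightarrow> nat \<Rightarrow> 'w \<Rightarrow> real^'n) \<Rightarrow>
    'm source \<Rightarrow> 'w set set" where
  "source_events M S \<xi> v Solver = sets S"
| "source_events M S \<xi> v (Sample i k) = events_of M (\<xi> i k)"
| "source_events M S \<xi> v (Direction i k) = events_of M (v i k)"

definition sampling ::
  "('n::finite, 'm::finite, 'p::finite, 'd::finite) mpec \<Rightarrow> 'w measure \<Rightarrow> 'w measure \<Rightarrow>
    ('m \<Rightarrow> nat \<Rightarrow> 'w \<Rightarrow> real^'d) \<Rightarrow> ('m \<Rightarrow> nat \<Rightarrow> 'w \<Rightarrow> real^'n) \<Rightarrow> bool" where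
  "sampling P M S \<xi> v \<longleftrightarrow> subalgebra M S \<and>
     (\<forall>i k. \<xi> i k \<in> borel_measurable M \<and> distr M borel (\<xi> i k) = law P i) \<and>
     (\<forall>i k. v i k \<in> borel_measurable M \<and> distr M borel (v i k) = uniform_sphere) \<and>
     prob_space.indep_sets M (source_events M S \<xi> v) UNIV"

definition query :: "real \<Rightarrow> bool \<Rightarrow> real^'n \<Rightarrow> real^'n \<Rightarrow> real^'n" where
  "query \<eta> s x u = (if s then x + \<eta> *\<^sub>R u else x - \<eta> *\<^sub>R u)"

text \<open>\<open>za s k i\<close> is the approximation of \<open>zsol P i\<close> at the query point with sign \<open>s\<close> in
  iteration \<open>k\<close>.\<close>

definition zo_gradient ::
  "('n::finite, 'm::finite, 'p::finite, 'd::finite) mpec \<Rightarrow> real \<Rightarrow>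
    ('m \<Rightarrow> nat \<Rightarrow> 'w \<Rightarrow> real^'d) \<Rightarrow> ('m \<Rightarrow> nat \<Rightarrow> 'w \<Rightarrow> real^'n) \<Rightarrow>
    (bool \<Rightarrow> nat \<Rightarrow> 'm \<Rightarrow> 'w \<Rightarrow> real^'p) \<Rightarrow> (nat \<Rightarrow> 'w \<Rightarrow> real^'n^'m) \<Rightarrow> nat \<Rightarrow> 'w \<Rightarrow> real^'n^'m" where
  "zo_gradient P \<eta> \<xi> v za x k \<omega> = (\<chi> i.
     (real CARD('n) / (2 * \<eta>) *
       (cost P i (query \<eta> True (x k \<omega> $ i) (v i k \<omega>)) (za True k i \<omega>) (\<xi> i k \<omega>)
        - cost P i (query \<eta> False (x k \<omega> $ i) (v i k \<omega>)) (za False k i \<omega>) (\<xi> i k \<omega>))) *\<^sub>R v i k \<omega>)"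

definition dizs_gt ::
  "('n::finite, 'm::finite, 'p::finite, 'd::finite) mpec \<Rightarrow> real^'m^'m \<Rightarrow> real \<Rightarrow> real \<Rightarrow> 'w measure \<Rightarrow>
    ('m \<Rightarrow> nat \<Rightarrow> 'w \<Rightarrow> real^'d) \<Rightarrow> ('m \<Rightarrow> nat \<Rightarrow> 'w \<Rightarrow> real^'n) \<Rightarrow>
    (bool \<Rightarrow> nat \<Rightarrow> 'm \<Rightarrow> 'w \<Rightarrow> real^'p) \<Rightarrow> ('w \<Rightarrow> real^'n^'m) \<Rightarrow>
    (nat \<Rightarrow> 'w \<Rightarrow> real^'n^'m) \<Rightarrow> (nat \<Rightarrow> 'w \<Rightarrow> real^'n^'m) \<Rightarrow> bool" where
  "dizs_gt P W \<eta> \<gamma> M \<xi> v za x0 x y \<longleftrightarrow> (\<forall>\<omega>\<in>space M.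
     x 0 \<omega> = x0 \<omega> \<and> y 0 \<omega> = 0 \<and>
     (\<forall>k. y (Suc k) \<omega> = W ** (y k \<omega> + zo_gradient P \<eta> \<xi> v za x k \<omega>
              - (case k of 0 \<Rightarrow> 0 | Suc l \<Rightarrow> zo_gradient P \<eta> \<xi> v za x l \<omega>)) \<and>
          x (Suc k) \<omega> = W ** (x k \<omega> - \<gamma> *\<^sub>R y (Suc k) \<omega>)))"

text \<open>\<open>available\<close> is the information the solver call of agent \<open>i\<close> in iteration \<open>k\<close> may depend on;
  \<open>past\<close> is what the algorithm has produced before that call, together with \<open>v i k\<close>.\<close>

definition available ::
  "'w measure \<Rightarrow> 'w measure \<Rightarrow> ('m \<Rightarrow> nat \<Rightarrow> 'w \<Rightarrow> real^'d) \<Rightarrow> ('m \<Rightarrow> nat \<Rightarrow> 'w \<Rightarrow> real^'n) \<Rightarrow>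
    nat \<Rightarrow> 'm \<Rightarrow> 'w measure" where
  "available M S \<xi> v k i = sigma (space M)
     (sets S \<union> (\<Union>j. \<Union>l\<in>{..<k}. events_of M (\<xi> j l) \<union> events_of M (v j l)) \<union> events_of M (v i k))"

definition past ::
  "'w measure \<Rightarrow> ('w \<Rightarrow> real^'n^'m) \<Rightarrow> ('m \<Rightarrow> nat \<Rightarrow> 'w \<Rightarrow> real^'d) \<Rightarrow> ('m \<Rightarrow> nat \<Rightarrow> 'w \<Rightarrow> real^'n) \<Rightarrow>
    (bool \<Rightarrow> nat \<Rightarrow> 'm \<Rightarrow> 'w \<Rightarrow> real^'p) \<Rightarrow> nat \<Rightarrow> 'm \<Rightarrow> 'w measure" where
  "past M x0 \<xi> v za k i = sigma (space M)
     (events_of M x0 \<union>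
      (\<Union>j. \<Union>l\<in>{..<k}. events_of M (\<xi> j l) \<union> events_of M (v j l) \<union> (\<Union>s. events_of M (za s l j))) \<union>
      events_of M (v i k))"

definition inexact ::
  "('n::finite, 'm::finite, 'p::finite, 'd::finite) mpec \<Rightarrow> real \<Rightarrow> (nat \<Rightarrow> real) \<Rightarrow> 'w measure \<Rightarrow> 'w measure \<Rightarrow>
    ('m \<Rightarrow> nat \<Rightarrow> 'w \<Rightarrow> real^'d) \<Rightarrow> ('m \<Rightarrow> nat \<Rightarrow> 'w \<Rightarrow> real^'n) \<Rightarrow>
    (bool \<Rightarrow> nat \<Rightarrow> 'm \<Rightarrow> 'w \<Rightarrow> real^'p) \<Rightarrow> ('w \<Rightarrow> real^'n^'m) \<Rightarrow> (nat \<Rightarrow> 'w \<Rightarrow> real^'n^'m) \<Rightarrow> bool" where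
  "inexact P \<eta> \<epsilon> M S \<xi> v za x0 x \<longleftrightarrow> (\<forall>s k i.
     za s k i \<in> borel_measurable (available M S \<xi> v k i) \<and>
     (AE \<omega> in M. nn_cond_exp M (past M x0 \<xi> v za k i)
         (\<lambda>\<omega>'. ennreal ((norm (za s k i \<omega>' - zsol P i (query \<eta> s (x k \<omega>' $ i) (v i k \<omega>'))))\<^sup>2)) \<omega>
       \<le> ennreal (\<epsilon> k)))"

text \<open>\<open>Ks\<close> is uniform on \<open>{0..<K}\<close> and independent of all randomness of the algorithm.\<close>

definition random_horizon ::
  "'w measure \<Rightarrow> 'w measure \<Rightarrow> ('m \<Rightarrow> nat \<Rightarrow> 'w \<Rightarrow> real^'d) \<Rightarrow> ('m \<Rightarrow> nat \<Rightarrow> 'w \<Rightarrow> real^'n) \<Rightarrow>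
    nat \<Rightarrow> ('w \<Rightarrow> nat) \<Rightarrow> bool" where
  "random_horizon M S \<xi> v K Ks \<longleftrightarrow>
     Ks \<in> measurable M (count_space UNIV) \<and>
     distr M (count_space UNIV) Ks = measure_pmf (pmf_of_set {..<K}) \<and>
     prob_space.indep_set M
       (sigma_sets (space M) (\<Union>s. source_events M S \<xi> v s))
       {Ks -` A \<inter> space M | A. True}"

definition stationarity_error ::
  "('n::finite, 'm::finite, 'p::finite, 'd::finite) mpec \<Rightarrow> real \<Rightarrow> 'w measure \<Rightarrow>
    (nat \<Rightarrow> 'w \<Rightarrow> real^'n^'m) \<Rightarrow> ('w \<Rightarrow> nat) \<Rightarrow> ennreal" where
  "stationarity_error P \<eta> M x Ks =
     (\<integral>\<^sup>+\<omega>. ennreal ((infdist 0 (clarke_eta_gradient \<eta> (objective P) (average (x (Ks \<omega>) \<omega>))))\<^sup>2) \<partial>M)"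


section \<open>The lower-level stochastic approximation method\<close>

text \<open>The solver's information splits into \<open>J\<close> (initial point, choice of starting points) and the
  samples \<open>\<zeta> i k s r\<close>, \<open>r\<close> being the inner counter. The samples of agent \<open>i\<close> have common law
  \<open>Q i\<close>.\<close>

definition solver_info ::
  "'w measure \<Rightarrow> 'w measure \<Rightarrow> ('m \<Rightarrow> nat \<Rightarrow> bool \<Rightarrow> nat \<Rightarrow> 'w \<Rightarrow> real^'d) \<Rightarrow> 'w measure" where
  "solver_info M J \<zeta> = sigma (space M) (sets J \<union> (\<Union>i k s r. events_of M (\<zeta> i k s r)))"

definition lower_sampling ::
  "('n::finite, 'm::finite, 'p::finite, 'd::finite) mpec \<Rightarrow> real \<Rightarrow> 'w measure \<Rightarrow> 'w measure \<Rightarrow>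
    ('m \<Rightarrow> (real^'d) measure) \<Rightarrow> ('m \<Rightarrow> nat \<Rightarrow> bool \<Rightarrow> nat \<Rightarrow> 'w \<Rightarrow> real^'d) \<Rightarrow> bool" where
  "lower_sampling P \<nu> M J Q \<zeta> \<longleftrightarrow> subalgebra M J \<and>
     (\<forall>i k s r. \<zeta> i k s r \<in> borel_measurable M \<and> distr M borel (\<zeta> i k s r) = Q i) \<and>
     prob_space.indep_sets M
       (\<lambda>c. case c of None \<Rightarrow> sets J | Some (i, k, s, r) \<Rightarrow> events_of M (\<zeta> i k s r)) UNIV \<and>
     (\<forall>i x z. integrable (Q i) (vmap P i x z) \<and>
        (\<integral>\<xi>. vmap P i x z \<xi> \<partial>Q i) = mean_vmap P i x z \<and>
        (\<integral>\<^sup>+\<xi>. ennreal ((norm (vmap P i x z \<xi> - mean_vmap P i x z))\<^sup>2) \<partial>Q i) \<le> ennreal (\<nu>\<^sup>2))"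

definition start_info ::
  "'w measure \<Rightarrow> 'w measure \<Rightarrow> ('m \<Rightarrow> nat \<Rightarrow> 'w \<Rightarrow> real^'d) \<Rightarrow> ('m \<Rightarrow> nat \<Rightarrow> 'w \<Rightarrow> real^'n) \<Rightarrow>
    ('m \<Rightarrow> nat \<Rightarrow> bool \<Rightarrow> nat \<Rightarrow> 'w \<Rightarrow> real^'d) \<Rightarrow> nat \<Rightarrow> 'm \<Rightarrow> 'w measure" where
  "start_info M J \<xi> v \<zeta> k i = sigma (space M)
     (sets J \<union>
      (\<Union>j. \<Union>l\<in>{..<k}. events_of M (\<xi> j l) \<union> events_of M (v j l) \<union> (\<Union>s r. events_of M (\<zeta> j l s r))) \<union>
      events_of M (v i k))"

definition sa_solver ::
  "('n::finite, 'm::finite, 'p::finite, 'd::finite) mpec \<Rightarrow> real \<Rightarrow> real \<Rightarrow> real \<Rightarrow> (nat \<Rightarrow> nat) \<Rightarrow>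
    'w measure \<Rightarrow> 'w measure \<Rightarrow>
    ('m \<Rightarrow> nat \<Rightarrow> 'w \<Rightarrow> real^'d) \<Rightarrow> ('m \<Rightarrow> nat \<Rightarrow> 'w \<Rightarrow> real^'n) \<Rightarrow>
    ('m \<Rightarrow> nat \<Rightarrow> bool \<Rightarrow> nat \<Rightarrow> 'w \<Rightarrow> real^'d) \<Rightarrow> (nat \<Rightarrow> 'w \<Rightarrow> real^'n^'m) \<Rightarrow>
    (bool \<Rightarrow> nat \<Rightarrow> 'm \<Rightarrow> nat \<Rightarrow> 'w \<Rightarrow> real^'p) \<Rightarrow> (bool \<Rightarrow> nat \<Rightarrow> 'm \<Rightarrow> 'w \<Rightarrow> real^'p) \<Rightarrow> bool" where
  "sa_solver P \<eta> gh Gh t M J \<xi> v \<zeta> x zl za \<longleftrightarrow> (\<forall>s k i.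
     zl s k i 0 \<in> borel_measurable (start_info M J \<xi> v \<zeta> k i) \<and>
     (\<forall>\<omega>\<in>space M. let xh = query \<eta> s (x k \<omega> $ i) (v i k \<omega>) in
        zl s k i 0 \<omega> \<in> feas P i xh \<and>
        (\<forall>r<t k. zl s k i (Suc r) \<omega> = closest_point (feas P i xh)
           (zl s k i r \<omega> - (gh / (real r + Gh)) *\<^sub>R vmap P i xh (zl s k i r \<omega>) (\<zeta> i k s r \<omega>))) \<and>
        za s k i \<omega> = zl s k i (t k) \<omega>))"

definition inner_iterations :: "real \<Rightarrow> real \<Rightarrow> real \<Rightarrow> real \<Rightarrow> nat \<Rightarrow> nat" where
  "inner_iterations n \<eta> Gh a k = nat \<lceil>n powr (1/2) * (real k + Gh) powr a / \<eta> powr (2/3)\<rceil>"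

definition sa_constant :: "real \<Rightarrow> real \<Rightarrow> real \<Rightarrow> real \<Rightarrow> ('m::finite \<Rightarrow> real) \<Rightarrow> real" where
  "sa_constant \<mu> \<nu> gh Gh D = max (\<nu>\<^sup>2 * gh\<^sup>2 / (\<mu> * gh - 1)) (Gh * Max (range D))"


section \<open>Error bounds\<close>

text \<open>\<open>l\<close> stands for \<open>lambda_W W\<close> and \<open>w\<close> for the Frobenius norm of \<open>W\<close>; \<open>gap\<close> is the initial
  optimality gap, \<open>G\<close> the initial mean squared norm of the stacked gradient divided by \<open>m\<close>, and
  \<open>V\<close> the mean initial consensus error. In \<open>stepsize_factor\<close>, terms with denominator zero count
  as infinite.\<close>

definition stepsize_factor :: "real \<Rightarrow> real" where
  "stepsize_factor l = (if l = 0 then 1/6 else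
     Min {sqrt (1 - l\<^sup>2) / (10 * sqrt 3 * l\<^sup>2), (1 - l\<^sup>2) / (20 * l^3), (1 - l\<^sup>2)\<^sup>2 / (20 * l\<^sup>2),
          1/6, (1 - l\<^sup>2) / (9 * l)})"

definition stationarity_bound ::
  "real \<Rightarrow> real \<Rightarrow> real \<Rightarrow> real \<Rightarrow> real \<Rightarrow> real \<Rightarrow> real \<Rightarrow> real \<Rightarrow> real \<Rightarrow> real \<Rightarrow> real \<Rightarrow>
    (nat \<Rightarrow> real) \<Rightarrow> nat \<Rightarrow> real" where
  "stationarity_bound n m \<eta> \<gamma> l w L Lt gap G V \<epsilon> K =
     4 * gap / (\<gamma> * K)
   + 96 * sqrt (2 * pi) * L^3 * n powr (3/2) * \<gamma> / (m * \<eta>)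
   + 2 * L\<^sup>2 * n / (\<eta>\<^sup>2 * K) * (1 + 20 / (1 - l\<^sup>2)) * V
   + 320 * \<gamma>\<^sup>2 * l^4 * L\<^sup>2 * n / ((1 - l\<^sup>2)^3 * \<eta>\<^sup>2 * K)
       * (G + 16 * sqrt (2 * pi) * L\<^sup>2 * n + Lt\<^sup>2 * n\<^sup>2 * \<epsilon> 0 / \<eta>\<^sup>2)
   + 25600 * sqrt (2 * pi) * n^3 * L^6 * \<gamma>^4 * l^4 * (3 + l\<^sup>2) / (m * \<eta>^4 * (1 - l\<^sup>2)\<^sup>2)
   + (160 * \<gamma>\<^sup>2 * l\<^sup>2 * L^4 * n\<^sup>2 / (\<eta>\<^sup>2 * (1 - l\<^sup>2)^3)) * 32 * sqrt (2 * pi) * (w\<^sup>2 + 11/2 * l\<^sup>2)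
   + (160 * \<gamma>\<^sup>2 * l\<^sup>2 * L^4 * n^3 / (\<eta>^4 * (1 - l\<^sup>2)^3))
       * (5 * l\<^sup>2 * Lt\<^sup>2 / L\<^sup>2) * ((1 + 3 * l\<^sup>2) / (1 - l\<^sup>2)) * ((\<Sum>k<K. \<epsilon> (Suc k)) / K)
   + (160 * \<gamma>\<^sup>2 * l\<^sup>2 * L^4 * n^3 / (\<eta>^4 * (1 - l\<^sup>2)^3))
       * (2 * w\<^sup>2 * Lt\<^sup>2 / L\<^sup>2 + (5 * l\<^sup>2 * Lt\<^sup>2 / L\<^sup>2) * ((1 + 3 * l\<^sup>2) / (1 - l\<^sup>2))
          + 300 * l^4 * \<gamma>\<^sup>2 * Lt\<^sup>2 * n / (\<eta>\<^sup>2 * (1 - l\<^sup>2)\<^sup>2)) * ((\<Sum>k<K. \<epsilon> k) / K)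
   + (1 + 3 * \<gamma> * L * sqrt n / (2 * \<eta>)) * (4 * Lt\<^sup>2 * n\<^sup>2 / \<eta>\<^sup>2) * ((\<Sum>k<K. \<epsilon> k) / K)"

definition H_const :: "real \<Rightarrow> real \<Rightarrow> real \<Rightarrow> real \<Rightarrow> real \<Rightarrow> real" where
  "H_const n \<eta> \<gamma> l L = 1 + (8 * L\<^sup>2 * n / \<eta>\<^sup>2)
     * (80 * \<gamma>\<^sup>2 * l\<^sup>2 * L\<^sup>2 * n / (\<eta>\<^sup>2 * (1 - l\<^sup>2)^3)) * (30 * \<gamma>\<^sup>2 * l\<^sup>2 / (1 - l\<^sup>2))"

definition consensus_bound ::
  "real \<Rightarrow> real \<Rightarrow> real \<Rightarrow> real \<Rightarrow> real \<Rightarrow> real \<Rightarrow> real \<Rightarrow> real \<Rightarrow> real \<Rightarrow> real \<Rightarrow> real \<Rightarrow>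
    (nat \<Rightarrow> real) \<Rightarrow> nat \<Rightarrow> real" where
  "consensus_bound n m \<eta> \<gamma> l w L Lt gap G V \<epsilon> K = (let H = H_const n \<eta> \<gamma> l L in
     160 * H * \<gamma>\<^sup>2 * l^4 / ((1 - l\<^sup>2)^3 * K)
       * (G + 16 * sqrt (2 * pi) * L\<^sup>2 * n + Lt\<^sup>2 * n\<^sup>2 * \<epsilon> 0 / \<eta>\<^sup>2)
   + (80 * \<gamma>\<^sup>2 * l\<^sup>2 * L\<^sup>2 * n / (1 - l\<^sup>2)^3) * 32 * H * sqrt (2 * pi) * (w\<^sup>2 + 11/2 * l\<^sup>2)
   + 12800 * H * sqrt (2 * pi) * n\<^sup>2 * L^4 * \<gamma>^4 * l^4 * (3 + l\<^sup>2) / (m * \<eta>\<^sup>2 * (1 - l\<^sup>2)\<^sup>2)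
   + H * (80 * \<gamma>\<^sup>2 * l\<^sup>2 * L\<^sup>2 * n\<^sup>2 / (\<eta>\<^sup>2 * (1 - l\<^sup>2)^3))
       * (2 * w\<^sup>2 * Lt\<^sup>2 / L\<^sup>2 + (5 * l\<^sup>2 * Lt\<^sup>2 / L\<^sup>2) * ((1 + 3 * l\<^sup>2) / (1 - l\<^sup>2))
          + 300 * l^4 * \<gamma>\<^sup>2 * Lt\<^sup>2 * n / (\<eta>\<^sup>2 * (1 - l\<^sup>2)\<^sup>2)) * ((\<Sum>k<K. \<epsilon> k) / K)
   + H * (80 * \<gamma>\<^sup>2 * l\<^sup>2 * L\<^sup>2 * n\<^sup>2 / (\<eta>\<^sup>2 * (1 - l\<^sup>2)^3))
       * (5 * l\<^sup>2 * Lt\<^sup>2 / L\<^sup>2) * ((1 + 3 * l\<^sup>2) / (1 - l\<^sup>2)) * ((\<Sum>k<K. \<epsilon> (Suc k)) / K)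
   + H * (1 + 3 * \<gamma> * L * sqrt n / (2 * \<eta>)) * (16 * Lt\<^sup>2 * n\<^sup>2 / \<eta>\<^sup>2) * ((\<Sum>k<K. \<epsilon> k) / K)
   + H / K * (1 + 20 / (1 - l\<^sup>2)) * V
   + 16 * H * gap / (\<gamma> * K)
   + H * (384 * sqrt (2 * pi) * L^3 * n powr (3/2) * \<gamma> / (m * \<eta>)))"


section \<open>Complexity bounds\<close>

definition horizon_stepsize :: "real \<Rightarrow> real \<Rightarrow> real \<Rightarrow> nat \<Rightarrow> real" where
  "horizon_stepsize n \<eta> L K = \<eta> powr (2/3) / (sqrt (n powr (3/2) * K) * L powr (3/2))"

definition horizon_threshold :: "real \<Rightarrow> real \<Rightarrow> real \<Rightarrow> real \<Rightarrow> real" where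
  "horizon_threshold n \<eta> l L = max 1
     ((Max {10 * sqrt 3 * l\<^sup>2 / sqrt (1 - l\<^sup>2), 20 * l^3 / (1 - l\<^sup>2), 20 * l\<^sup>2 / (1 - l\<^sup>2)\<^sup>2,
            6, 9 * l / (1 - l\<^sup>2)})\<^sup>2 * (1 / (\<eta> powr (2/3) * L * n powr (1/2))))"

text \<open>The number of iterations needed to guarantee an error of at most \<open>e\<close>, among the admissible
  horizons (those above the threshold); \<open>err K\<close> is the error of the run with horizon \<open>K\<close>, whose
  stepsize depends on \<open>K\<close>.\<close>

definition iterations_needed :: "real \<Rightarrow> (nat \<Rightarrow> ennreal) \<Rightarrow> real \<Rightarrow> nat" where
  "iterations_needed thr err e = (LEAST N. thr \<le> real N \<and> (\<forall>K\<ge>N. err K \<le> ennreal e))"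

definition upper_terms ::
  "real \<Rightarrow> real \<Rightarrow> real \<Rightarrow> real \<Rightarrow> real \<Rightarrow> real \<Rightarrow> real \<Rightarrow> real \<Rightarrow> real \<Rightarrow> real \<Rightarrow> real" where
  "upper_terms n m \<eta> l w L Lt V \<epsilon>0 e =
     n powr (3/2) * L^3 / \<eta> powr (4/3) * e powr (-2)
   + L^3 * n powr (3/2) / (\<eta> powr (2/3) * m\<^sup>2) * e powr (-2)
   + L\<^sup>2 * n * V / (\<eta>\<^sup>2 * (1 - l\<^sup>2)) * e powr (-1)
   + l\<^sup>2 * L powr (1/2) * n powr (1/4) / (\<eta> powr (1/3) * (1 - l\<^sup>2) powr (3/2)) * e powr (-1/2)
   + l\<^sup>2 * Lt * n powr (3/4) * sqrt \<epsilon>0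
       / (L powr (1/2) * \<eta> powr (4/3) * (1 - l\<^sup>2) powr (3/2)) * e powr (-1/2)
   + l\<^sup>2 * L * n powr (1/2) * (l\<^sup>2 + w\<^sup>2) / (\<eta> powr (2/3) * (1 - l\<^sup>2)^3) * e powr (-1)
   + l\<^sup>2 * (3 + l\<^sup>2) powr (1/2) / (\<eta> powr (2/3) * sqrt m * (1 - l\<^sup>2)) * e powr (-1/2)"

definition soft :: "real \<Rightarrow> real" where
  "soft g = g * (1 + ln (1 + g))"

text \<open>The arguments of the order symbols in the lower-level contribution. For \<open>a = 1\<close> the
  logarithmic factor of the soft order is written out by \<open>soft\<close>.\<close>

definition lower_terms ::
  "real \<Rightarrow> real \<Rightarrow> real \<Rightarrow> real \<Rightarrow> real \<Rightarrow> real \<Rightarrow> real \<Rightarrow> real \<Rightarrow> real \<Rightarrow> real" where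
  "lower_terms a n \<eta> l w L Lt \<kappa> e = (
     if a < 1 then
       ((\<kappa> * l\<^sup>2 * n / (L * \<eta>\<^sup>2 * (1 - l\<^sup>2)^3 * (1 - a))) * (w\<^sup>2 * Lt\<^sup>2 + l^4 * Lt\<^sup>2 / (1 - l\<^sup>2)))
            powr (1/(1+a)) * e powr (- 1/(1+a))
       + (\<kappa> * Lt\<^sup>2 * n powr (3/2) / (\<eta> powr (4/3) * (1 - a))) powr (1/a) * e powr (- 1/a)
       + (\<kappa> * l^6 * n powr (1/2) * Lt\<^sup>2 / (L\<^sup>2 * \<eta> powr (8/3) * (1 - l\<^sup>2)^5 * (1 - a)))
            powr (1/(2+a)) * e powr (- 1/(2+a))
       + (\<kappa> * Lt\<^sup>2 * n powr (5/4) / (L powr (1/2) * \<eta> powr (5/3) * (1 - a)))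
            powr (1/(a+1/2)) * e powr (- 1/(a+1/2))
     else if a = 1 then soft (
       ((\<kappa> * l\<^sup>2 * n / (L * \<eta>\<^sup>2 * (1 - l\<^sup>2)^3)) * (w\<^sup>2 * Lt\<^sup>2 + l^4 * Lt\<^sup>2 / (1 - l\<^sup>2)))
            powr (1/2) * e powr (-1/2)
       + (\<kappa> * l^6 * n powr (1/2) * Lt\<^sup>2 / (L\<^sup>2 * \<eta> powr (8/3) * (1 - l\<^sup>2)^5))
            powr (1/3) * e powr (-1/3)
       + (\<kappa> * Lt\<^sup>2 * n powr (5/4) / (L powr (1/2) * \<eta> powr (5/3))) powr (2/3) * e powr (-2/3)
       + (\<kappa> * Lt\<^sup>2 * n powr (3/2) / \<eta> powr (4/3)) * e powr (-1))
     else
       ((a * \<kappa> * l\<^sup>2 * n / (L * \<eta>\<^sup>2 * (1 - l\<^sup>2)^3 * (a - 1))) * (w\<^sup>2 * Lt\<^sup>2 + l^4 * Lt\<^sup>2 / (1 - l\<^sup>2)))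
            powr (1/2) * e powr (-1/2)
       + (a * \<kappa> * l^6 * n powr (1/2) * Lt\<^sup>2 / (L\<^sup>2 * \<eta> powr (8/3) * (1 - l\<^sup>2)^5 * (a - 1)))
            powr (1/3) * e powr (-1/3)
       + (a * \<kappa> * Lt\<^sup>2 * n powr (5/4) / (L powr (1/2) * \<eta> powr (5/3) * (a - 1))) powr (2/3) * e powr (-2/3)
       + (a * \<kappa> * Lt\<^sup>2 * n powr (3/2) / (\<eta> powr (4/3) * (a - 1))) * e powr (-1))"

text \<open>Admissible values of the constants hidden by the order symbols. They are given explicitly
  because the dimensions are types: a constant quantified existentially in a theorem could depend
  on the dimensions. \<open>upper_const\<close> depends on the initial gap and on the constant of the inner
  method only, and \<open>overall_const\<close> on \<open>m\<close>, on the offset \<open>Gh\<close> and on the exponent \<open>a\<close>. The values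
  are generous.\<close>

definition upper_const :: "real \<Rightarrow> real \<Rightarrow> real" where
  "upper_const gap q = 10^8 * (1 + gap\<^sup>2 + q\<^sup>2)\<^sup>2"

definition overall_const :: "real \<Rightarrow> real \<Rightarrow> real \<Rightarrow> real" where
  "overall_const m Gh a = 2 powr (1 + a) * m * (3 + 2 * Gh powr a)"

text \<open>In every iteration each of the \<open>m\<close> agents draws one upper-level sample and calls the solver
  twice.\<close>

definition overall_complexity :: "nat \<Rightarrow> (nat \<Rightarrow> nat) \<Rightarrow> nat \<Rightarrow> nat" where
  "overall_complexity m t K = (\<Sum>k<K. m * (1 + 2 * t k))"

end

theory Submission
 imports Defs "HOL-Probability.Probability"
begin

text \<open>Each gradient sample is split into the smoothed gradient, a noise that is orthogonal to everything
 independent of the current sample and direction, and a bias of order \<open>n * sqrt \<epsilon> / \<eta>\<close>. The noise of one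
 agent has second moment of order \<open>n * L0^2\<close>, not \<open>n^2 * L0^2\<close>: along half turns of a pair of vectors uniform in a ball
 an antipodal difference is an integral of directional derivatives, which are small on average. The tracked
 direction is correspondingly a martingale part plus a part driven by gradient increments; the latter, the consensus error and
 the step form a small-gain loop under the stepsize condition. The descent lemma for the smoothed objective
 then bounds its mean squared gradient, which dominates the distance of \<open>0\<close> to the \<open>\<eta>\<close>-Clarke gradient
 because the smoothed gradient averages Clarke gradients. The horizon bounds follow by checking each term.\<close>

text \<open>Differentiability enters only through ball averages: their gradient comes from the
  volume of the shell swept by a translation, so Lipschitz data suffice. The factor 1/n in the
  sphere moments comes from the invariance of Lebesgue measure under reflections and swaps of
  coordinates. It yields the Lipschitz constant L0 * sqrt n / \<eta> of the smoothed gradients and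
  the noise level pi^2 * n * L0^2, which lies below the 16 * sqrt (2 * pi) * L0^2 * n of the stated
  bounds. Error bounds and horizon bounds start from the same closed forms
  \<open>consensus_rate\<close> and \<open>stationarity_rate\<close>. The obstacle on the
  probabilistic side is dependence: iterates and solver outputs are built from each other.
  Information is therefore indexed by sets of sources, independence is proved once for disjoint
  sets, and conditioning becomes integration over one source with the others frozen. The upper-level
  analysis asks for unconditional second moments of the solver error, which the inexactness
  condition and the stochastic approximation method both deliver; for the latter, a single inner
  sample at a time is removed from the solver's information.\<close>

text \<open>The bare names of these facts are those of the Henstock-Kurzweil integral.\<close>

lemmas sq_eq = power2_eq_square
lemmas bintegrable_add = Bochner_Integration.integrable_add
lemmas bintegrable_bound = Bochner_Integration.integrable_bound
lemmas bintegrable_cong = Bochner_Integration.integrable_cong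
lemmas bintegrable_diff = Bochner_Integration.integrable_diff
lemmas bintegrable_sum = Bochner_Integration.integrable_sum
lemmas bintegral_add = Bochner_Integration.integral_add
lemmas bintegral_cong = Bochner_Integration.integral_cong
lemmas bintegral_diff = Bochner_Integration.integral_diff
lemmas bintegral_sum = Bochner_Integration.integral_sum

abbreviation "sph == uniform_sphere"
abbreviation "ball1 == indicator (cball 0 1)"

section \<open>Polar coordinates\<close>

definition reflect :: "'a::euclidean_space => 'a => 'a" where
 "reflect b x = x - (2 * (x \<bullet> b)) *\<^sub>R b"

lemma reflect_measurable [measurable]: "reflect b \<in> borel_measurable borel"
 unfolding reflect_def [abs_def] by measurable

text \<open>The map is diagonal with entries 1 and -1, so the factor in the affine change of
  variables is 1.\<close>

lemma lborel_reflect: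
 fixes b :: "'a::euclidean_space"
 assumes b: "b \<in> Basis"
 shows "distr lborel borel (reflect b) = lborel"
proof -
 define c where "c j = (if j = b then - 1 else 1 :: real)" for j :: 'a
 have T: "reflect b x = 0 + (\<Sum>j\<in>Basis. (c j * (x \<bullet> j)) *\<^sub>R j)" for x :: 'a
 proof (rule euclidean_eqI)
  fix i :: 'a assume i: "i \<in> Basis"
  show "reflect b x \<bullet> i = (0 + (\<Sum>j\<in>Basis. (c j * (x \<bullet> j)) *\<^sub>R j)) \<bullet> i"
   using i b by (simp add: reflect_def c_def inner_diff_left inner_Basis algebra_simps)
 qed
 have "lborel = density (distr lborel borel (%x. 0 + (\<Sum>j\<in>Basis. (c j * (x \<bullet> j)) *\<^sub>R j))) (%_. (\<Prod>j\<in>(Basis::'a set). \<bar>c j\<bar>))"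
  by (rule lborel_affine_euclidean) (simp add: c_def)
 also have "(\<Prod>j\<in>(Basis::'a set). \<bar>c j\<bar>) = 1"
  by (rule prod.neutral) (auto simp: c_def)
 finally show ?thesis
  unfolding T[symmetric] by (simp add: density_1)
qed

definition swap_basis :: "'a::euclidean_space => 'a => 'a => 'a" where
 "swap_basis b c x = (\<Sum>j\<in>Basis. (x \<bullet> Transposition.transpose b c j) *\<^sub>R j)"

lemma swap_basis_measurable [measurable]: "swap_basis b c \<in> borel_measurable borel"
 unfolding swap_basis_def [abs_def] by measurable

lemma transpose_Basis:
 "b \<in> Basis ==> c \<in> Basis ==> j \<in> Basis ==> Transposition.transpose b c j \<in> Basis"
 by (metis Transposition.transpose_def)

lemma prod_transpose_Basis:
 fixes b c :: "'a::euclidean_space"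
 assumes "b \<in> Basis" "c \<in> Basis"
 shows "(\<Prod>j\<in>Basis. g (Transposition.transpose b c j)) = prod g Basis"
 by (rule prod.reindex_bij_betw) (use assms in \<open>auto intro!: bij_betwI[where g="Transposition.transpose b c"] simp: transpose_Basis\<close>)

lemma sum_transpose_Basis:
 fixes b c :: "'a::euclidean_space"
 assumes "b \<in> Basis" "c \<in> Basis"
 shows "(\<Sum>j\<in>Basis. g (Transposition.transpose b c j)) = sum g Basis"
 by (rule sum.reindex_bij_betw) (use assms in \<open>auto intro!: bij_betwI[where g="Transposition.transpose b c"] simp: transpose_Basis\<close>)

lemma swap_basis_inner:
 "j \<in> Basis ==> swap_basis b c x \<bullet> j = x \<bullet> Transposition.transpose b c j"
 by (simp add: swap_basis_def)

text \<open>Preimages of boxes are boxes with permuted sides, and a volume, being a product of side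
  lengths, does not see their order.\<close>

lemma lborel_swap_basis:
 fixes b c :: "'a::euclidean_space"
 assumes bc: "b \<in> Basis" "c \<in> Basis"
 shows "distr lborel borel (swap_basis b c) = lborel"
proof (rule lborel_eqI[symmetric])
 fix l u :: 'a assume le: "!!b. b \<in> Basis ==> l \<bullet> b <= u \<bullet> b"
 let ?t = "Transposition.transpose b c"
 have "x \<in> swap_basis b c -` box l u \<longleftrightarrow> x \<in> box (swap_basis b c l) (swap_basis b c u)" for x
 proof -
  have "x \<in> swap_basis b c -` box l u \<longleftrightarrow> (\<forall>j\<in>Basis. l \<bullet> j < x \<bullet> ?t j & x \<bullet> ?t j < u \<bullet> j)"
   by (simp add: mem_box swap_basis_inner)
  also have "... \<longleftrightarrow> (\<forall>j\<in>Basis. l \<bullet> ?t j < x \<bullet> j & x \<bullet> j < u \<bullet> ?t j)"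
   using bc by (metis transpose_involutory transpose_Basis)
  finally show ?thesis by (simp add: mem_box swap_basis_inner)
 qed
 hence "swap_basis b c -` box l u = box (swap_basis b c l) (swap_basis b c u)" by blast
 hence "emeasure (distr lborel borel (swap_basis b c)) (box l u)
   = emeasure lborel (box (swap_basis b c l) (swap_basis b c u))"
  by (simp add: emeasure_distr)
 also have "... = (\<Prod>j\<in>Basis. (u - l) \<bullet> ?t j)"
  using le bc by (subst emeasure_lborel_box) (auto simp: swap_basis_inner transpose_Basis inner_diff_left intro!: prod.cong)
 also have "... = (\<Prod>j\<in>Basis. (u - l) \<bullet> j)"
  using bc by (subst prod_transpose_Basis) simp_all
 finally show "emeasure (distr lborel borel (swap_basis b c)) (box l u) = (\<Prod>b\<in>Basis. (u - l) \<bullet> b)"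
  by simp
qed simp

lemma norm_reflect: "b \<in> Basis ==> norm (reflect b x) = norm x"
 by (simp add: norm_eq reflect_def inner_diff inner_commute algebra_simps)

lemma norm_swap_basis:
 fixes b c :: "'a::euclidean_space"
 assumes "b \<in> Basis" "c \<in> Basis"
 shows "norm (swap_basis b c x) = norm x"
proof -
 have "(\<Sum>j\<in>Basis. (x \<bullet> Transposition.transpose b c j) * (x \<bullet> Transposition.transpose b c j)) = (\<Sum>j\<in>Basis. (x \<bullet> j) * (x \<bullet> j))"
  by (rule sum_transpose_Basis[OF assms])
 thus ?thesis unfolding norm_eq by (subst (1 2) euclidean_inner) (simp add: swap_basis_inner)
qed

text \<open>Reflections kill the mixed moments and swaps make the pure ones equal, so the matrix of
  second moments is a multiple of the identity; its trace fixes the multiple. Every later gain of a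
  factor \<open>1 / DIM('a)\<close> goes back to this lemma.\<close>

lemma radial_moment:
 fixes a :: "'a::euclidean_space" and k :: "real => real"
 assumes [measurable]: "k \<in> borel_measurable borel"
  and k: "integrable lborel (%y::'a. k (norm y) * (norm y)^2)"
  and nn: "!!r. 0 <= k r"
 shows "integrable lborel (%y. k (norm y) * (a \<bullet> y)^2)"
  and "(\<integral>y. k (norm y) * (a \<bullet> y)^2 \<partial>lborel) = (norm a)^2 / real DIM('a) * (\<integral>y. k (norm y) * (norm y)^2 \<partial>(lborel :: 'a measure))"
proof -
 have int: "integrable lborel (%y::'a. k (norm y) * (y \<bullet> b) * (y \<bullet> c))" if "b \<in> Basis" "c \<in> Basis" for b c :: 'a
 proof (rule bintegrable_bound[OF k])
  show "AE x in lborel. norm (k (norm x) * (x \<bullet> b) * (x \<bullet> c)) <= norm (k (norm x) * (norm x)^2)"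
  proof (rule AE_I2)
   fix x :: 'a
   have "\<bar>x \<bullet> b\<bar> * \<bar>x \<bullet> c\<bar> <= norm x * norm x"
    using that by (intro mult_mono Basis_le_norm) auto
   thus "norm (k (norm x) * (x \<bullet> b) * (x \<bullet> c)) <= norm (k (norm x) * (norm x)^2)"
    using nn[of "norm x"] by (simp add: abs_mult sq_eq mult.assoc mult_left_mono)
  qed
 qed simp
 have off: "(\<integral>y. k (norm y) * (y \<bullet> b) * (y \<bullet> c) \<partial>lborel) = 0" if bc: "b \<in> Basis" "c \<in> Basis" "b ~= c" for b c :: 'a
 proof -
  have "(\<integral>y. k (norm y) * (y \<bullet> b) * (y \<bullet> c) \<partial>lborel)
    = (\<integral>y. k (norm y) * (y \<bullet> b) * (y \<bullet> c) \<partial>distr lborel borel (reflect b))"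
   using bc by (simp add: lborel_reflect)
  also have "... = (\<integral>y. k (norm (reflect b y)) * (reflect b y \<bullet> b) * (reflect b y \<bullet> c) \<partial>lborel)"
   by (subst integral_distr) simp_all
  also have "... = (\<integral>y. - (k (norm y) * (y \<bullet> b) * (y \<bullet> c)) \<partial>lborel)"
   using bc by (intro bintegral_cong)
    (simp_all only: norm_reflect, simp_all add: reflect_def inner_diff_left inner_Basis algebra_simps)
  finally show ?thesis by simp
 qed
 have eq: "(\<integral>y. k (norm y) * (y \<bullet> b) * (y \<bullet> b) \<partial>lborel) = (\<integral>y. k (norm y) * (y \<bullet> c) * (y \<bullet> c) \<partial>lborel)"
  if bc: "b \<in> Basis" "c \<in> Basis" for b c :: 'a
 proof -
  have "(\<integral>y. k (norm y) * (y \<bullet> b) * (y \<bullet> b) \<partial>lborel)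
    = (\<integral>y. k (norm y) * (y \<bullet> b) * (y \<bullet> b) \<partial>distr lborel borel (swap_basis b c))"
   using bc by (simp add: lborel_swap_basis)
  also have "... = (\<integral>y. k (norm (swap_basis b c y)) * (swap_basis b c y \<bullet> b) * (swap_basis b c y \<bullet> b) \<partial>lborel)"
   by (subst integral_distr) simp_all
  also have "... = (\<integral>y. k (norm y) * (y \<bullet> c) * (y \<bullet> c) \<partial>lborel)"
   using bc by (intro bintegral_cong) (simp_all add: norm_swap_basis swap_basis_inner)
  finally show ?thesis .
 qed
 have ex: "k (norm y) * (a \<bullet> y)^2 = (\<Sum>b\<in>Basis. \<Sum>c\<in>Basis. (a \<bullet> b) * (a \<bullet> c) * (k (norm y) * (y \<bullet> b) * (y \<bullet> c)))" for y
  by (subst euclidean_inner[of a y]) (simp add: sq_eq sum_product sum_distrib_left mult_ac)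
 show "integrable lborel (%y. k (norm y) * (a \<bullet> y)^2)"
  unfolding ex by (intro bintegrable_sum integrable_mult_right int)
 obtain b0 :: 'a where b0: "b0 \<in> Basis" using nonempty_Basis by blast
 define v where "v = (\<integral>y. k (norm y) * (y \<bullet> b0) * (y \<bullet> b0) \<partial>lborel)"
 have dg: "(\<integral>y. k (norm y) * (y \<bullet> b) * (y \<bullet> c) \<partial>lborel) = (if b = c then v else 0)" if "b \<in> Basis" "c \<in> Basis" for b c :: 'a
  using off[of b c] eq[of b b0] that b0 by (auto simp: v_def)
 have "(\<integral>y. k (norm y) * (a \<bullet> y)^2 \<partial>lborel)
   = (\<Sum>b\<in>Basis. \<Sum>c\<in>Basis. (a \<bullet> b) * (a \<bullet> c) * (\<integral>y. k (norm y) * (y \<bullet> b) * (y \<bullet> c) \<partial>lborel))"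
  unfolding ex
  by (subst bintegral_sum, (intro bintegrable_sum integrable_mult_right int; assumption))+
    (intro sum.cong refl, subst bintegral_sum, auto intro!: integrable_mult_right int)
 also have "... = (\<Sum>b\<in>Basis. (a \<bullet> b) * (a \<bullet> b) * v)"
  by (intro sum.cong refl) (simp add: dg if_distrib cong: if_cong)
 also have "... = (norm a)^2 * v"
  by (subst power2_norm_eq_inner, subst euclidean_inner) (simp add: sum_distrib_right)
 finally have 1: "(\<integral>y. k (norm y) * (a \<bullet> y)^2 \<partial>lborel) = (norm a)^2 * v" .
 have ex2: "k (norm y) * (norm y)^2 = (\<Sum>b\<in>Basis. k (norm y) * (y \<bullet> b) * (y \<bullet> b))" for y :: 'a
  by (subst power2_norm_eq_inner, subst euclidean_inner) (simp add: sum_distrib_left mult_ac)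
 have "(\<integral>y. k (norm y) * (norm y)^2 \<partial>(lborel :: 'a measure)) = (\<Sum>b\<in>(Basis::'a set). v)"
  unfolding ex2 by (subst bintegral_sum) (auto intro!: int sum.cong simp: dg)
 hence 2: "(\<integral>y. k (norm y) * (norm y)^2 \<partial>(lborel :: 'a measure)) = real DIM('a) * v" by simp
 show "(\<integral>y. k (norm y) * (a \<bullet> y)^2 \<partial>lborel) = (norm a)^2 / real DIM('a) * (\<integral>y. k (norm y) * (norm y)^2 \<partial>(lborel :: 'a measure))"
  unfolding 1 2 by simp
qed

section \<open>Cones, the uniform law on the sphere, and polar disintegration\<close>

lemma emeasure_cball_less_top [simp]: "emeasure lborel (cball (c::'a::euclidean_space) r) < top"
 using emeasure_lborel_cball_finite[of c r] by simp

lemma emeasure_cball_ne_top [simp]: "emeasure lborel (cball (c::'a::euclidean_space) r) ~= top"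
 using emeasure_cball_less_top[of c r] by (simp add: less_top)

lemma indicator_cball_measurable [measurable]:
 "(indicator (cball c R) :: 'a => 'b::{real_normed_algebra_1}) \<in> borel_measurable (borel::'a::euclidean_space measure)"
 "(indicator (cball c R) :: 'a => ennreal) \<in> borel_measurable (borel::'a::euclidean_space measure)"
 by (intro borel_measurable_indicator borel_measurable_indicator' borel_closed closed_cball)+

lemma finite_measure_ball: "finite_measure (density lborel (indicator (cball (c::'a::euclidean_space) R)))"
proof (rule finite_measureI)
 have "emeasure (density lborel (indicator (cball c R))) UNIV = (\<integral>\<^sup>+x. indicator (cball c R) x * indicator UNIV x \<partial>lborel)"
  by (rule emeasure_density) simp_all
 thus "emeasure (density lborel (indicator (cball c R))) (space (density lborel (indicator (cball c R)))) ~= \<infinity>"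
  by simp
qed

lemma emeasure_ball_density:
 fixes B :: "'a::euclidean_space set"
 assumes "B \<in> sets borel"
 shows "emeasure (density lborel (indicator (cball c R))) B = emeasure lborel (cball c R \<inter> B)"
 using assms by (subst emeasure_density) (simp_all add: indicator_inter_arith[symmetric])

text \<open>A positive scaling does not change \<open>sgn\<close>, so it maps cones over
  \<open>A\<close> to cones over \<open>A\<close>. This homogeneity is what makes direction and
  radius independent.\<close>

lemma measure_cone:
 fixes A :: "'a::euclidean_space set"
 assumes [measurable]: "A \<in> sets borel" and r: "0 <= r"
 shows "measure lborel {u \<in> cball 0 r. sgn u \<in> A} = r ^ DIM('a) * measure lborel {u \<in> cball 0 1. sgn u \<in> A}"
proof (cases "r = 0")
 case True
 have "measure lborel {u \<in> cball 0 0. sgn u \<in> A} <= measure lborel {0::'a}"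
  by (rule measure_mono_fmeasurable) (auto simp: fmeasurable_def)
 with True show ?thesis by (simp add: measure_le_0_iff)
next
 case False
 with r have r: "0 < r" by simp
 define X where "X = {u \<in> cball 0 r. sgn u \<in> A}"
 have [measurable]: "X \<in> sets borel" unfolding X_def by measurable
 have X: "{x. r *\<^sub>R x \<in> X} = {u \<in> cball 0 1. sgn u \<in> A}"
  using r by (auto simp: X_def sgn_scaleR field_simps)
 have "emeasure lborel X = emeasure (density (distr lborel borel (%x. 0 + r *\<^sub>R x)) (%_. \<bar>r\<bar>^DIM('a))) X"
  by (subst lborel_affine[of r 0]) (use r in simp_all)
 also have "... = ennreal (r ^ DIM('a)) * emeasure (distr lborel borel (%x. 0 + r *\<^sub>R x)) X"
  using r by (subst emeasure_density_const) simp_all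
 also have "emeasure (distr lborel borel (%x. 0 + r *\<^sub>R x)) X = emeasure lborel {x. r *\<^sub>R x \<in> X}"
  by (subst emeasure_distr) (auto simp: vimage_def)
 finally have "emeasure lborel X = ennreal (r ^ DIM('a)) * emeasure lborel {u \<in> cball 0 1. sgn u \<in> A}"
  unfolding X .
 thus ?thesis using r unfolding X_def measure_def by (simp add: enn2real_mult)
qed

lemma cone_fmeasurable:
 fixes A :: "'a::euclidean_space set"
 assumes [measurable]: "A \<in> sets borel"
 shows "{u \<in> cball 0 r. sgn u \<in> A} \<in> fmeasurable lborel"
proof (rule fmeasurableI2[of "cball 0 r"])
 show "{u \<in> cball 0 r. sgn u \<in> A} \<in> sets lborel" by measurable
qed (auto simp: fmeasurable_def)

text \<open>A shell is a difference of two cones. The clamp \<open>min R (max x 0)\<close> admits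
  every real threshold, since laws of the radius will be compared on all half lines.\<close>

lemma measure_cone_shell:
 fixes A :: "'a::euclidean_space set"
 assumes [measurable]: "A \<in> sets borel" and R: "0 < R"
 shows "measure lborel {u \<in> cball 0 R. x < norm u & sgn u \<in> A}
  = (R ^ DIM('a) - (min R (max x 0)) ^ DIM('a)) * measure lborel {u \<in> cball 0 1. sgn u \<in> A}"
proof (cases "x < 0")
 case True
 hence "{u \<in> cball 0 R. x < norm u & sgn u \<in> A} = {u \<in> cball 0 R. sgn u \<in> A}"
  by (auto intro: less_le_trans)
 with True R measure_cone[OF assms(1), of R] show ?thesis by (simp add: zero_power)
next
 case False
 define t where "t = min R x"
 have t: "0 <= t" "t <= R" using False R by (auto simp: t_def)
 have "{u \<in> cball 0 R. x < norm u & sgn u \<in> A} = {u \<in> cball 0 R. sgn u \<in> A} - {u \<in> cball 0 t. sgn u \<in> A}"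
  by (auto simp: t_def)
 also have "measure lborel ... = measure lborel {u \<in> cball 0 R. sgn u \<in> A} - measure lborel {u \<in> cball 0 t. sgn u \<in> A}"
  using t by (intro measurable_measure_Diff cone_fmeasurable) (auto intro: fmeasurableD cone_fmeasurable)
 finally show ?thesis using False R t measure_cone[OF assms(1), of R] measure_cone[OF assms(1), of t]
  by (simp add: t_def algebra_simps max_def)
qed

lemma ball_measure_pos: "0 < measure lborel (cball (0::'a::euclidean_space) 1)"
 using content_cball_pos[of 1 "0::'a"] by (simp add: measure_completion)

lemma ball_emeasure: "emeasure lborel (cball (0::'a::euclidean_space) 1) = ennreal (measure lborel (cball (0::'a) 1))"
 by (rule emeasure_eq_ennreal_measure) simp

lemma ball_emeasure_nz: "emeasure lborel (cball (0::'a::euclidean_space) 1) ~= 0"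
 "emeasure lborel (cball (0::'a::euclidean_space) 1) ~= \<infinity>"
 using ball_measure_pos[where 'a='a] by (auto simp: ball_emeasure)

lemma prob_space_uniform_ball: "prob_space (uniform_measure lborel (cball (0::'a::euclidean_space) 1))"
 by (rule prob_space_uniform_measure) (rule ball_emeasure_nz)+

lemma sgn_measurable [measurable]: "(sgn :: 'a::euclidean_space => 'a) \<in> borel_measurable borel"
 unfolding sgn_div_norm [abs_def] by measurable

lemma prob_space_uniform_sphere: "prob_space (sph :: 'a::euclidean_space measure)"
 unfolding uniform_sphere_def
 by (intro prob_space.prob_space_distr prob_space_uniform_ball) simp

lemma sets_uniform_sphere [measurable_cong, simp]: "sets (sph :: 'a::euclidean_space measure) = sets borel"
 by (simp add: uniform_sphere_def)

lemma space_uniform_sphere [simp]: "space (sph :: 'a::euclidean_space measure) = UNIV"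
 by (simp add: uniform_sphere_def)

lemma emeasure_uniform_sphere:
 fixes A :: "'a::euclidean_space set"
 assumes [measurable]: "A \<in> sets borel"
 shows "emeasure sph A = ennreal (measure lborel {u \<in> cball 0 1. sgn u \<in> A} / measure lborel (cball (0::'a) 1))"
proof -
 have *: "cball 0 1 \<inter> (sgn -` A) = {u \<in> cball (0::'a) 1. sgn u \<in> A}" by auto
 have m: "sgn -` A \<in> sets (borel :: 'a measure)"
  using measurable_sets[OF sgn_measurable assms] by simp
 have "emeasure sph A = emeasure lborel {u \<in> cball 0 1. sgn u \<in> A} / emeasure lborel (cball (0::'a) 1)"
  unfolding uniform_sphere_def using m ball_emeasure_nz(1)[where 'a='a]
  by (subst emeasure_distr) (simp_all add: *)
 also have "... = ennreal (measure lborel {u \<in> cball 0 1. sgn u \<in> A} / measure lborel (cball (0::'a) 1))"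
  using ball_measure_pos[where 'a='a] cone_fmeasurable[OF assms, of 1]
  by (subst ball_emeasure, subst emeasure_eq_measure2) (auto simp: divide_ennreal)
 finally show ?thesis .
qed

lemma AE_uniform_sphere_norm: "AE v in (sph :: 'a::euclidean_space measure). norm v = 1"
proof -
 have "AE u in (lborel :: 'a measure). u \<in> cball 0 1 \<longrightarrow> norm (sgn u) = 1"
  using AE_lborel_singleton[of "0::'a"] by eventually_elim (simp add: norm_sgn)
 hence "AE u in uniform_measure lborel (cball (0::'a) 1). norm (sgn u) = 1"
  by (rule AE_uniform_measureI[rotated]) simp
 thus ?thesis unfolding uniform_sphere_def by (subst AE_distr_iff) auto
qed

text \<open>Rectangles suffice. For a fixed set of directions both sides are finite measures in the
  radius, and on half lines \<open>measure_cone_shell\<close> splits off the direction as a constant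
  factor.\<close>

lemma polar_measure:
 assumes R: "0 < R"
 shows "distr (density lborel (indicator (cball (0::'a::euclidean_space) R))) (borel \<Otimes>\<^sub>M borel) (%u. (sgn u, norm u))
  = sph \<Otimes>\<^sub>M distr (density lborel (indicator (cball (0::'a) R))) borel norm"
proof (rule pair_measure_eqI[symmetric])
 let ?D = "density lborel (indicator (cball (0::'a) R))"
 interpret S: prob_space "sph :: 'a measure" by (rule prob_space_uniform_sphere)
 interpret D: finite_measure ?D
  by (rule finite_measure_ball)
 interpret N: finite_measure "distr ?D borel norm" by (rule D.finite_measure_distr) simp
 show "sigma_finite_measure (sph :: 'a measure)" ..
 show "sigma_finite_measure (distr ?D borel norm)" ..
 show "sets (sph \<Otimes>\<^sub>M distr ?D borel norm) = sets (distr ?D (borel \<Otimes>\<^sub>M borel) (%u. (sgn u, norm u)))"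
  by (simp cong: sets_pair_measure_cong)
 fix A :: "'a set" and B :: "real set"
 assume "A \<in> sets sph" and "B \<in> sets (distr ?D borel norm)"
 hence A[measurable]: "A \<in> sets borel" and B[measurable]: "B \<in> sets borel" by simp_all
 \<comment> \<open>The ball restricted to the directions in \<open>A\<close>; its radial law is to
   be a multiple of the radial law of the whole ball.\<close>
 define E where "E = density lborel (indicator {u \<in> cball (0::'a) R. sgn u \<in> A})"
 have [measurable]: "{u \<in> cball (0::'a) R. sgn u \<in> A} \<in> sets borel" by measurable
 have Ee: "emeasure (distr E borel norm) C = emeasure lborel {u \<in> cball (0::'a) R. norm u \<in> C & sgn u \<in> A}"
  if [measurable]: "C \<in> sets borel" for C
 proof -
  have [measurable]: "norm -` C \<in> sets (borel :: 'a measure)"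
   using measurable_sets[of norm "borel :: 'a measure" borel C] by simp
  have "emeasure (distr E borel norm) C = emeasure lborel ({u \<in> cball (0::'a) R. sgn u \<in> A} \<inter> norm -` C)"
   unfolding E_def by (subst emeasure_distr)
    (auto simp: emeasure_density indicator_inter_arith[symmetric])
  also have "{u \<in> cball (0::'a) R. sgn u \<in> A} \<inter> norm -` C = {u \<in> cball (0::'a) R. norm u \<in> C & sgn u \<in> A}" by auto
  finally show ?thesis .
 qed
 have fin: "{u \<in> cball (0::'a) R. norm u \<in> C & sgn u \<in> A} \<in> fmeasurable lborel" if [measurable]: "C \<in> sets borel" for C
  by (rule fmeasurableI2[OF cone_fmeasurable[OF A, of R]]) auto
 have De: "emeasure (distr ?D borel norm) C = emeasure lborel {u \<in> cball (0::'a) R. norm u \<in> C}"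
  if [measurable]: "C \<in> sets borel" for C
 proof -
  have [measurable]: "norm -` C \<in> sets (borel :: 'a measure)"
   using measurable_sets[of norm "borel :: 'a measure" borel C] by simp
  have "emeasure (distr ?D borel norm) C = emeasure lborel (cball (0::'a) R \<inter> norm -` C)"
   by (subst emeasure_distr) (auto simp: emeasure_ball_density)
  also have "cball (0::'a) R \<inter> norm -` C = {u \<in> cball (0::'a) R. norm u \<in> C}" by auto
  finally show ?thesis .
 qed
 have finD: "{u \<in> cball (0::'a) R. norm u \<in> C} \<in> fmeasurable lborel" if [measurable]: "C \<in> sets borel" for C
  by (rule fmeasurableI2[OF cone_fmeasurable[of UNIV R]]) auto
 have eq: "distr E borel norm = scale_measure (emeasure sph A) (distr ?D borel norm)"
 proof (rule measure_eqI_lessThan)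
  fix x :: real
  show "emeasure (distr E borel norm) {x<..} < \<infinity>"
   using fin[of "{x<..}"] by (subst Ee) (auto simp: fmeasurable_def)
  have "emeasure (distr E borel norm) {x<..} = ennreal (measure lborel {u \<in> cball (0::'a) R. x < norm u & sgn u \<in> A})"
   using fin[of "{x<..}"] by (subst Ee) (auto simp: emeasure_eq_measure2)
  also have "measure lborel {u \<in> cball (0::'a) R. x < norm u & sgn u \<in> A}
    = (measure lborel {u \<in> cball 0 1. sgn u \<in> A} / measure lborel (cball (0::'a) 1)) *
     measure lborel {u \<in> cball (0::'a) R. x < norm u}"
  proof -
   have "{u \<in> cball (0::'a) 1. sgn u \<in> UNIV} = cball 0 1" by auto
   with measure_cone_shell[OF A R, of x] measure_cone_shell[of "UNIV::'a set" R x] R ball_measure_pos[where 'a='a]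
   show ?thesis by (simp del: mem_cball mem_cball_0)
  qed
  also have "ennreal ... = emeasure sph A * emeasure lborel {u \<in> cball (0::'a) R. x < norm u}"
   proof -
   have "emeasure lborel {u \<in> cball (0::'a) R. x < norm u} = ennreal (measure lborel {u \<in> cball (0::'a) R. x < norm u})"
    using finD[of "{x<..}"] by (auto simp: emeasure_eq_measure2)
   thus ?thesis
    by (simp only: emeasure_uniform_sphere[OF A], subst ennreal_mult[symmetric]) simp_all
  qed
  finally show "emeasure (distr E borel norm) {x<..} = emeasure (scale_measure (emeasure sph A) (distr ?D borel norm)) {x<..}"
   by (simp add: De)
 qed simp_all
 have [measurable]: "sgn -` A \<in> sets (borel :: 'a measure)" "norm -` B \<in> sets (borel :: 'a measure)"
  using measurable_sets[OF sgn_measurable A] measurable_sets[of norm "borel :: 'a measure" borel B] by simp_all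
 have "emeasure sph A * emeasure (distr ?D borel norm) B = emeasure (distr E borel norm) B"
  unfolding eq by simp
 also have "... = emeasure lborel {u \<in> cball (0::'a) R. norm u \<in> B & sgn u \<in> A}" by (rule Ee) simp
 also have "{u \<in> cball (0::'a) R. norm u \<in> B & sgn u \<in> A} = cball 0 R \<inter> ((%u. (sgn u, norm u)) -` (A \<times> B))" by auto
 also have "emeasure lborel ... = emeasure (distr ?D (borel \<Otimes>\<^sub>M borel) (%u. (sgn u, norm u))) (A \<times> B)"
 proof -
  have "(%u::'a. (sgn u, norm u)) -` (A \<times> B) = sgn -` A \<inter> norm -` B" by auto
  thus ?thesis
   by (subst emeasure_distr) (auto simp: emeasure_ball_density)
 qed
 finally show "emeasure sph A * emeasure (distr ?D borel norm) B
   = emeasure (distr ?D (borel \<Otimes>\<^sub>M borel) (%u. (sgn u, norm u))) (A \<times> B)" .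
qed

lemma polar_nn_integral:
 fixes k :: "'a::euclidean_space => real => ennreal"
 assumes R: "0 < R" and [measurable]: "case_prod k \<in> borel_measurable (borel \<Otimes>\<^sub>M borel)"
 shows "(\<integral>\<^sup>+u. k (sgn u) (norm u) * indicator (cball 0 R) u \<partial>lborel)
  = (\<integral>\<^sup>+v. (\<integral>\<^sup>+u. k v (norm u) * indicator (cball (0::'a) R) u \<partial>lborel) \<partial>sph)"
proof -
 let ?D = "density lborel (indicator (cball (0::'a) R))"
 interpret D: finite_measure ?D
  by (rule finite_measure_ball)
 interpret N: finite_measure "distr ?D borel norm" by (rule D.finite_measure_distr) simp
 have "(\<integral>\<^sup>+u. k (sgn u) (norm u) * indicator (cball 0 R) u \<partial>lborel) = (\<integral>\<^sup>+u. k (sgn u) (norm u) \<partial>?D)"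
  by (subst nn_integral_density) (simp_all add: mult.commute)
 also have "... = (\<integral>\<^sup>+p. case_prod k p \<partial>distr ?D (borel \<Otimes>\<^sub>M borel) (%u. (sgn u, norm u)))"
  by (subst nn_integral_distr) auto
 also have "... = (\<integral>\<^sup>+v. (\<integral>\<^sup>+r. k v r \<partial>distr ?D borel norm) \<partial>sph)"
  unfolding polar_measure[OF R] by (subst N.nn_integral_fst[symmetric]) simp_all
 also have "... = (\<integral>\<^sup>+v. (\<integral>\<^sup>+u. k v (norm u) * indicator (cball (0::'a) R) u \<partial>lborel) \<partial>sph)"
  by (intro nn_integral_cong) (simp add: nn_integral_distr nn_integral_density mult.commute)
 finally show ?thesis .
qed

lemma polar_integral:
 fixes k :: "'a::euclidean_space => real => real"
 assumes R: "0 < R" and [measurable]: "case_prod k \<in> borel_measurable (borel \<Otimes>\<^sub>M borel)"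
  and bd: "!!v r. \<bar>k v r\<bar> <= C"
 shows "(\<integral>u. indicator (cball 0 R) u * k (sgn u) (norm u) \<partial>lborel)
  = (\<integral>v. (\<integral>u. indicator (cball (0::'a) R) u * k v (norm u) \<partial>lborel) \<partial>sph)"
proof -
 let ?D = "density lborel (%u. ennreal (indicator (cball (0::'a) R) u))"
 have Deq: "density lborel (indicator (cball (0::'a) R)) = ?D"
  by (intro arg_cong2[where f=density] refl ext) (simp add: indicator_def)
 interpret D: finite_measure ?D using finite_measure_ball[of "0::'a" R] by (simp only: Deq)
 interpret N: finite_measure "distr ?D borel norm" by (rule D.finite_measure_distr) simp
 interpret S: prob_space "sph :: 'a measure" by (rule prob_space_uniform_sphere)
 interpret SN: pair_sigma_finite "sph :: 'a measure" "distr ?D borel norm" ..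
 interpret Q: finite_measure "(sph :: 'a measure) \<Otimes>\<^sub>M distr ?D borel norm"
  by (rule finite_measure_pair_measure) (rule N.finite_measure_axioms S.finite_measure_axioms)+
 have "(\<integral>u. indicator (cball 0 R) u * k (sgn u) (norm u) \<partial>lborel) = (\<integral>u. k (sgn u) (norm u) \<partial>?D)"
  by (subst integral_density) simp_all
 also have "... = (\<integral>p. case_prod k p \<partial>distr ?D (borel \<Otimes>\<^sub>M borel) (%u. (sgn u, norm u)))"
  by (subst integral_distr) simp_all
 also have "... = (\<integral>v. (\<integral>r. k v r \<partial>distr ?D borel norm) \<partial>sph)"
  unfolding polar_measure[OF R, where 'a='a, unfolded Deq]
  by (subst SN.integral_fst'[symmetric]) (auto intro!: Q.integrable_const_bound[where B=C] simp: bd split_beta)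
 also have "... = (\<integral>v. (\<integral>u. indicator (cball (0::'a) R) u * k v (norm u) \<partial>lborel) \<partial>sph)"
  by (intro bintegral_cong refl) (simp add: integral_distr integral_density)
 finally show ?thesis .
qed

lemma integral_uniform_ball:
 fixes g :: "'a::euclidean_space => real"
 assumes [measurable]: "g \<in> borel_measurable borel"
 shows "(\<integral>u. g u \<partial>uniform_measure lborel (cball 0 1))
  = (\<integral>u. ball1 u * g u \<partial>lborel) / measure lborel (cball (0::'a) 1)"
proof -
 let ?b = "measure lborel (cball (0::'a) 1)"
 have "uniform_measure lborel (cball (0::'a) 1) = density lborel (%u. ennreal (ball1 u / ?b))"
  unfolding uniform_measure_def using ball_measure_pos[where 'a='a]
  by (intro arg_cong2[where f=density] refl ext) (auto simp: indicator_def ball_emeasure divide_ennreal[of 1, simplified])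
 hence "(\<integral>u. g u \<partial>uniform_measure lborel (cball 0 1)) = (\<integral>u. (ball1 u / ?b) * g u \<partial>lborel)"
  by (simp add: integral_density)
 also have "... = (\<integral>u. (ball1 u * g u) / ?b \<partial>lborel)"
  by simp
 finally show ?thesis by simp
qed

lemma integrable_ball_bounded:
 fixes g :: "'a::euclidean_space => real"
 assumes [measurable]: "g \<in> borel_measurable borel" and bd: "!!u. u \<in> cball c R ==> \<bar>g u\<bar> <= C"
 shows "integrable lborel (%u. indicator (cball c R) u * g u)"
proof (rule bintegrable_bound)
 show "integrable lborel (%u. C * indicator (cball c R) u :: real)"
  by (intro integrable_mult_right integrable_real_indicator) simp_all
 show "AE u in lborel. norm (indicator (cball c R) u * g u) <= norm (C * indicator (cball c R) u :: real)"
  using bd by (intro AE_I2) (force simp: indicator_def)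
qed simp

section \<open>First-order change of a ball average under a translation\<close>

lemma power_second_order:
 "\<exists>C\<ge>0. \<forall>y::real. \<bar>y\<bar> <= 1 \<longrightarrow> \<bar>(1 + y) ^ n - 1 - real n * y\<bar> <= C * y^2"
proof (induction n)
 case 0 show ?case by (intro exI[of _ 0]) simp
next
 case (Suc n)
 then obtain C where C: "0 <= C" "!!y::real. \<bar>y\<bar> <= 1 ==> \<bar>(1 + y) ^ n - 1 - real n * y\<bar> <= C * y^2" by blast
 show ?case
 proof (intro exI[of _ "2 * C + real n"] conjI allI impI)
  show "0 <= 2 * C + real n" using C by simp
  fix y :: real assume y: "\<bar>y\<bar> <= 1"
  have "(1 + y) ^ Suc n - 1 - real (Suc n) * y = (1 + y) * ((1 + y) ^ n - 1 - real n * y) + real n * y^2"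
   by (simp add: algebra_simps sq_eq)
  also have "\<bar>...\<bar> <= \<bar>1 + y\<bar> * \<bar>(1 + y) ^ n - 1 - real n * y\<bar> + real n * y^2"
   by (intro order.trans[OF abs_triangle_ineq]) (simp add: abs_mult)
  also have "... <= 2 * (C * y^2) + real n * y^2"
   using y C(2)[OF y] by (intro add_right_mono mult_mono) auto
  finally show "\<bar>(1 + y) ^ Suc n - 1 - real (Suc n) * y\<bar> <= (2 * C + real n) * y^2"
   by (simp add: algebra_simps)
 qed
qed

text \<open>For a unit vector \<open>v\<close> this is the distance from the origin, in direction
  \<open>v\<close>, to the boundary of the unit ball centred at \<open>h\<close>: the larger root r
  of \<open>norm (r *\<^sub>R v - h) = 1\<close>. For \<open>norm h <= 1/2\<close> the origin lies
  inside that ball, so the ball is described by this radius alone.\<close>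

definition radius :: "'a::euclidean_space => 'a => real" where
 "radius h v = v \<bullet> h + sqrt (1 - (norm h)^2 + (v \<bullet> h)^2)"

lemma radius_measurable [measurable]: "radius h \<in> borel_measurable borel"
 unfolding radius_def [abs_def] by measurable

lemma radius_approx:
 assumes v: "norm v = 1" and h: "norm h <= 1/2"
 shows "\<bar>radius h v - 1 - v \<bullet> h\<bar> <= (norm h)^2" "\<bar>radius h v - 1\<bar> <= 2 * norm h"
proof -
 have vh: "\<bar>v \<bullet> h\<bar> <= norm h" using Cauchy_Schwarz_ineq2[of v h] v by simp
 define s where "s = (norm h)^2 - (v \<bullet> h)^2"
 have h2: "(norm h)^2 <= norm h * 1" unfolding sq_eq using h by (intro mult_left_mono) auto
 have s: "0 <= s" "s <= (norm h)^2" using vh abs_le_square_iff[of "v \<bullet> h" "norm h"] by (auto simp: s_def)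
 have "1 - s <= sqrt (1 - s)"
  using s h h2 by (intro real_le_rsqrt) (auto simp: sq_eq intro!: mult_left_le)
 moreover have "sqrt (1 - s) <= 1" using s by simp
 ultimately have *: "\<bar>sqrt (1 - s) - 1\<bar> <= (norm h)^2" using s by linarith
 have e: "radius h v = v \<bullet> h + sqrt (1 - s)" by (simp add: radius_def s_def algebra_simps)
 show "\<bar>radius h v - 1 - v \<bullet> h\<bar> <= (norm h)^2" using * e by simp
 show "\<bar>radius h v - 1\<bar> <= 2 * norm h" using * e vh h2 by linarith
qed

lemma power2_le_1_norm: "norm y <= 1 \<longleftrightarrow> (norm y)^2 <= 1"
 using abs_le_square_iff[of "norm y" 1] by simp

lemma shifted_ball_radial:
 assumes u: "u ~= 0" and h: "norm h <= 1/2"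
 shows "norm (u - h) <= 1 \<longleftrightarrow> norm u <= radius h (sgn u)"
proof -
 define r v where "r = norm u" and "v = sgn u"
 have uv: "u = r *\<^sub>R v" and r: "0 < r" and v: "norm v = 1"
  using u by (auto simp: r_def v_def sgn_div_norm)
 have vh: "\<bar>v \<bullet> h\<bar> <= norm h" using Cauchy_Schwarz_ineq2[of v h] v by simp
 have vh2: "(v \<bullet> h)^2 <= (norm h)^2" using vh abs_le_square_iff[of "v \<bullet> h" "norm h"] by auto
 have h2: "(norm h)^2 <= (1/2)^2" using h by (intro power_mono) auto
 let ?q = "1 - (norm h)^2 + (v \<bullet> h)^2"
 have q: "0 <= ?q" using h2 by (simp add: sq_eq)
 have "norm (u - h) <= 1 \<longleftrightarrow> (norm (u - h))^2 <= 1" by (simp add: power2_le_1_norm)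
 also have "(norm (u - h))^2 = r^2 - 2 * r * (v \<bullet> h) + (norm h)^2"
  using v unfolding uv power2_norm_eq_inner by (simp add: inner_diff algebra_simps inner_commute sq_eq norm_eq_1)
 also have "(r^2 - 2 * r * (v \<bullet> h) + (norm h)^2 <= 1) \<longleftrightarrow> (r - v \<bullet> h)^2 <= ?q"
  by (auto simp: sq_eq algebra_simps)
 also have "... \<longleftrightarrow> \<bar>r - v \<bullet> h\<bar> <= sqrt ?q"
  using q by (metis abs_of_nonneg real_sqrt_abs real_sqrt_le_iff)
 also have "... \<longleftrightarrow> r <= v \<bullet> h + sqrt ?q"
 proof -
  have "v \<bullet> h - r <= sqrt ?q"
  proof -
   have "\<bar>v \<bullet> h\<bar> <= sqrt ?q"
    using h2 by (intro real_le_rsqrt) (auto simp: sq_eq)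
   thus ?thesis using r by linarith
  qed
  thus ?thesis by linarith
 qed
 finally show ?thesis by (simp add: radius_def r_def v_def)
qed

lemma lipschitz_measurable:
 fixes f :: "'a::euclidean_space => 'b::metric_space"
 shows "K-lipschitz_on UNIV f ==> f \<in> borel_measurable borel"
 by (intro borel_measurable_continuous_onI lipschitz_on_continuous_on)

lemma lborel_integral_shift:
 fixes g :: "'a::euclidean_space => real"
 assumes "g \<in> borel_measurable borel"
 shows "(\<integral>u. g (u - h) \<partial>lborel) = (\<integral>u. g u \<partial>lborel)"
proof -
 have "lborel = density (distr lborel borel (%x::'a. (-h) + 1 *\<^sub>R x)) (%_. ennreal (\<bar>1\<bar>^DIM('a)))"
  by (rule lborel_affine) simp
 hence e: "lborel = distr lborel borel (%x::'a. x - h)" by (simp add: density_1)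
 have "(\<integral>u. g u \<partial>lborel) = (\<integral>u. g u \<partial>distr lborel borel (%x::'a. x - h))" by (simp only: e[symmetric])
 also have "... = (\<integral>u. g (u - h) \<partial>lborel)" using assms by (subst integral_distr) simp_all
 finally show ?thesis by simp
qed

lemma measure_cball_lborel:
 "0 <= r ==> measure lborel (cball (0::'a::euclidean_space) r) = r ^ DIM('a) * measure lborel (cball (0::'a) 1)"
proof -
 assume r: "0 <= r"
 have "{u \<in> cball (0::'a) t. sgn u \<in> UNIV} = cball 0 t" for t by auto
 with measure_cone[of "UNIV::'a set" r] r show ?thesis by (simp del: mem_cball mem_cball_0)
qed

text \<open>Moving the ball by \<open>h\<close> changes the average only on the difference of the
  two balls, which lies in a shell of half-width \<open>norm h\<close> around the unit sphere. On
  the shell \<phi> is replaced by its value at the radial projection, with an error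
  \<open>K * norm h\<close> on a set of measure O(\<open>norm h\<close>). In polar coordinates the
  remaining integral is the radial excess \<open>radius h v ^ n - 1\<close>, that is n (v . h) up to
  second order, and the sphere integral appears.\<close>

lemma smoothed_one_expansion:
 fixes \<phi> :: "'a::euclidean_space => real"
 assumes lip: "K-lipschitz_on UNIV \<phi>"
 shows "\<exists>C. \<forall>h. norm h <= 1/2 \<longrightarrow>
  \<bar>smoothed 1 \<phi> (x + h) - smoothed 1 \<phi> x
   - h \<bullet> (real DIM('a) *\<^sub>R (\<integral>v. \<phi> (x + v) *\<^sub>R v \<partial>sph))\<bar> <= C * (norm h)^2"
proof -
 interpret S: prob_space "sph :: 'a measure" by (rule prob_space_uniform_sphere)
 have K: "0 <= K" using lip by (rule lipschitz_on_nonneg)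
 note [measurable] = lipschitz_measurable[OF lip]
 let ?n = "DIM('a)"
 define b where "b = measure lborel (cball (0::'a) 1)"
 have b: "0 < b" unfolding b_def by (rule ball_measure_pos)
 define A where "A = \<bar>\<phi> x\<bar> + 4 * K"
 have lipd: "\<bar>\<phi> y - \<phi> z\<bar> <= K * norm (y - z)" for y z
  using lipschitz_onD[OF lip, of y z] by (simp add: dist_norm)
 have A: "\<bar>\<phi> (x + u)\<bar> <= A" if "norm u <= 4" for u
  using lipd[of "x + u" x] mult_left_mono[OF that K] by (simp add: A_def)
 have A0: "0 <= A" using K by (simp add: A_def)
 obtain Cn where Cn: "0 <= Cn" "!!y::real. \<bar>y\<bar> <= 1 ==> \<bar>(1 + y) ^ ?n - 1 - real ?n * y\<bar> <= Cn * y^2"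
  using power_second_order by blast
 have sm: "smoothed 1 \<phi> y = (\<integral>u. ball1 u * \<phi> (y + u) \<partial>lborel) / b" for y
  unfolding smoothed_def b_def by (subst integral_uniform_ball) simp_all
 \<comment> \<open>The value at the radial projection onto the sphere, which depends on the
   direction of \<open>u\<close> alone.\<close>
 define q where "q u = \<phi> (x + sgn u)" for u
 have [measurable]: "q \<in> borel_measurable borel" unfolding q_def [abs_def] by measurable
 have qA: "\<bar>q u\<bar> <= A" for u unfolding q_def by (rule A) (simp add: norm_sgn)
 have main: "\<bar>smoothed 1 \<phi> (x + h) - smoothed 1 \<phi> x
   - h \<bullet> (real ?n *\<^sub>R (\<integral>v. \<phi> (x + v) *\<^sub>R v \<partial>sph))\<bar>
   <= (2 * K * (real ?n + Cn) + A * (4 * Cn + real ?n)) * (norm h)^2" if h: "norm h <= 1/2" for h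
 proof -
  let ?t = "norm h"
  \<comment> \<open>Signed indicator of the difference between the shifted ball and the original
    one.\<close>
  define X where "X u = indicator (cball h 1) u - (ball1 u :: real)" for u
  have [measurable]: "X \<in> borel_measurable borel" unfolding X_def [abs_def] by measurable
  have in2: "u \<in> cball 0 2" if "u \<in> cball h 1" for u
   using that h norm_triangle_sub[of u h] by (auto simp: dist_norm norm_minus_commute)
  have chi2: "indicator (cball 0 2) u * X u = X u" for u
   using in2[of u] by (auto simp: X_def indicator_def)
  have chib: "\<bar>X u\<bar> <= 1" for u by (auto simp: X_def indicator_def)
  \<comment> \<open>Indicator of a concentric shell that contains the difference of the balls;
    unlike \<open>X\<close> it has an explicit integral.\<close>
  define R :: "'a => real" where "R u = indicator (cball 0 (1 + ?t)) u - indicator (cball 0 (1 - ?t)) u" for u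
  have chiR: "\<bar>X u\<bar> <= R u" for u
   using norm_triangle_sub[of u h] norm_triangle_sub[of h u] norm_triangle_ineq4[of u h]
   by (auto simp: X_def R_def indicator_def dist_norm norm_minus_commute)
  have chin: "X u ~= 0 ==> \<bar>norm u - 1\<bar> <= ?t" for u
   using chiR[of u] by (cases "norm u <= 1 + ?t"; cases "norm u <= 1 - ?t") (auto simp: R_def indicator_def abs_le_iff)
  have intR: "integrable lborel R" "(\<integral>u. R u \<partial>lborel) = b * ((1 + ?t) ^ ?n - (1 - ?t) ^ ?n)"
  proof -
   have i: "integrable lborel (indicator (cball (0::'a) r) :: 'a => real)" for r
    by (intro integrable_real_indicator) simp_all
   thus "integrable lborel R" unfolding R_def [abs_def] by (intro bintegrable_diff)
   show "(\<integral>u. R u \<partial>lborel) = b * ((1 + ?t) ^ ?n - (1 - ?t) ^ ?n)"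
    unfolding R_def using h measure_cball_lborel[where 'a='a, of "1 + ?t"] measure_cball_lborel[where 'a='a, of "1 - ?t"]
    by (subst bintegral_diff) (auto intro!: i simp: b_def algebra_simps)
  qed
  have iphi: "integrable lborel (%u. indicator (cball c 1) u * \<phi> (x + u))" if "norm c <= 1" for c :: 'a
  proof (rule integrable_ball_bounded)
   fix u assume "u \<in> cball c 1"
   with that show "\<bar>\<phi> (x + u)\<bar> <= A" using norm_triangle_sub[of u c]
    by (intro A) (auto simp: dist_norm norm_minus_commute)
  qed simp
  have iq: "integrable lborel (%u. indicator (cball c 1) u * q u)" for c :: 'a
   by (rule integrable_ball_bounded[OF _ qA]) simp
  have shift: "(\<integral>u. ball1 u * \<phi> (x + h + u) \<partial>lborel) = (\<integral>u. indicator (cball h 1) u * \<phi> (x + u) \<partial>lborel)"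
  proof -
   have "(\<integral>u. indicator (cball h 1) u * \<phi> (x + u) \<partial>lborel)
     = (\<integral>u. ball1 (u - h) * \<phi> (x + h + (u - h)) \<partial>lborel)"
    by (intro bintegral_cong) (auto simp: indicator_def dist_norm norm_minus_commute)
   also have "... = (\<integral>u. ball1 u * \<phi> (x + h + u) \<partial>lborel)"
    by (rule lborel_integral_shift) simp
   finally show ?thesis by simp
  qed
  have diff: "b * (smoothed 1 \<phi> (x + h) - smoothed 1 \<phi> x) = (\<integral>u. X u * \<phi> (x + u) \<partial>lborel)"
  proof -
   have "(\<integral>u. X u * \<phi> (x + u) \<partial>lborel)
    = (\<integral>u. indicator (cball h 1) u * \<phi> (x + u) - ball1 u * \<phi> (x + u) \<partial>lborel)"
    by (simp add: X_def algebra_simps)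
   also have "... = (\<integral>u. indicator (cball h 1) u * \<phi> (x + u) \<partial>lborel) - (\<integral>u. ball1 u * \<phi> (x + u) \<partial>lborel)"
    using h by (intro bintegral_diff iphi) auto
   finally show ?thesis using b by (simp add: sm shift diff_divide_distrib[symmetric])
  qed
  have ichiphi: "integrable lborel (%u. X u * \<phi> (x + u))"
   using bintegrable_diff[OF iphi[of h] iphi[of 0]] h by (simp add: X_def algebra_simps)
  have ichiq: "integrable lborel (%u. X u * q u)"
   using bintegrable_diff[OF iq[of h] iq[of 0]] by (simp add: X_def algebra_simps)
  have bin: "(1 + ?t) ^ ?n - (1 - ?t) ^ ?n <= 2 * (real ?n + Cn) * ?t"
  proof -
   have "?t^2 <= ?t * 1" unfolding sq_eq using h by (intro mult_left_mono) auto
   hence "Cn * ?t^2 <= Cn * ?t" using Cn(1) by (intro mult_left_mono) auto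
   with Cn(2)[of ?t] Cn(2)[of "- ?t"] h show ?thesis by (auto simp: algebra_simps abs_le_iff)
  qed
  have I1: "\<bar>(\<integral>u. X u * \<phi> (x + u) \<partial>lborel) - (\<integral>u. X u * q u \<partial>lborel)\<bar> <= b * (2 * K * (real ?n + Cn) * ?t^2)"
  proof -
   have pt: "\<bar>X u * (\<phi> (x + u) - q u)\<bar> <= K * ?t * R u" for u
   proof (cases "X u = 0")
    case True thus ?thesis using chiR[of u] K by auto
   next
    case False
    hence n: "\<bar>norm u - 1\<bar> <= ?t" by (rule chin)
    hence u: "u ~= 0" using h by auto
    have "u - sgn u = (norm u - 1) *\<^sub>R sgn u" using u by (simp add: sgn_div_norm algebra_simps)
    hence "norm (u - sgn u) = \<bar>norm u - 1\<bar>" using u by (simp add: norm_sgn)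
    hence "\<bar>\<phi> (x + u) - q u\<bar> <= K * ?t"
     using lipd[of "x + u" "x + sgn u"] mult_left_mono[OF n K] by (simp add: q_def)
    hence "\<bar>X u\<bar> * \<bar>\<phi> (x + u) - q u\<bar> <= R u * (K * ?t)"
     using chiR[of u] K by (intro mult_mono) auto
    thus ?thesis by (simp add: abs_mult mult.commute)
   qed
   have "\<bar>(\<integral>u. X u * \<phi> (x + u) \<partial>lborel) - (\<integral>u. X u * q u \<partial>lborel)\<bar> = \<bar>\<integral>u. X u * (\<phi> (x + u) - q u) \<partial>lborel\<bar>"
    by (subst bintegral_diff[symmetric, OF ichiphi ichiq]) (simp add: algebra_simps)
   also have "... <= (\<integral>u. \<bar>X u * (\<phi> (x + u) - q u)\<bar> \<partial>lborel)" by (rule integral_abs_bound)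
   also have "... <= (\<integral>u. K * ?t * R u \<partial>lborel)"
   proof (rule integral_mono)
    have "integrable lborel (%u. X u * \<phi> (x + u) - X u * q u)"
     by (rule bintegrable_diff[OF ichiphi ichiq])
    thus "integrable lborel (%u. \<bar>X u * (\<phi> (x + u) - q u)\<bar>)"
     by (intro integrable_abs) (simp add: algebra_simps)
   qed (auto intro!: intR pt)
   also have "... = K * ?t * (b * ((1 + ?t) ^ ?n - (1 - ?t) ^ ?n))" by (simp add: intR)
   also have "... <= K * ?t * (b * (2 * (real ?n + Cn) * ?t))"
    using K b bin by (intro mult_left_mono) auto
   finally show ?thesis by (simp add: sq_eq algebra_simps)
  qed
  define k where "k v r = \<phi> (x + v) * ((if r <= radius h v then 1 else 0) - (if r <= 1 then 1 else 0))" for v :: 'a and r :: real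
  \<comment> \<open>\<open>polar_integral\<close> asks for one bound over all \<open>v\<close>,
    while \<phi> is bounded only near \<open>x\<close>; the cut-off at norm 1 keeps all directions
    that occur.\<close>
  define k' where "k' v r = (if norm v <= 1 then k v r else 0)" for v :: 'a and r :: real
  have km[measurable]: "case_prod k' \<in> borel_measurable (borel \<Otimes>\<^sub>M borel)"
   unfolding k'_def k_def by measurable
  have "AE u in lborel. X u * q u = indicator (cball 0 2) u * k' (sgn u) (norm u)"
   using AE_lborel_singleton[of "0::'a"]
  proof eventually_elim
   fix u :: 'a assume u: "u ~= 0"
   have Xu: "X u = (if norm u <= radius h (sgn u) then 1 else 0) - (if norm u <= 1 then 1 else 0)"
    using shifted_ball_radial[OF u h] by (auto simp: X_def indicator_def dist_norm norm_minus_commute)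
   thus "X u * q u = indicator (cball 0 2) u * k' (sgn u) (norm u)"
   proof -
    have "k' (sgn u) (norm u) = q u * X u"
     using Xu u by (simp add: k'_def k_def q_def norm_sgn)
    thus ?thesis using chi2[of u] by (metis mult.commute mult.left_commute)
   qed
  qed
  hence "(\<integral>u. X u * q u \<partial>lborel) = (\<integral>u. indicator (cball 0 2) u * k' (sgn u) (norm u) \<partial>lborel)"
   by (intro integral_cong_AE) simp_all
  also have "... = (\<integral>v. (\<integral>u. indicator (cball (0::'a) 2) u * k' v (norm u) \<partial>lborel) \<partial>sph)"
  proof (rule polar_integral[OF _ km])
   fix v :: 'a and r :: real
   show "\<bar>k' v r\<bar> <= A" using A[of v] A0 by (auto simp: k'_def k_def abs_mult)
  qed simp
  also have "... = (\<integral>v. b * (\<phi> (x + v) * (radius h v ^ ?n - 1)) \<partial>sph)"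
  proof (rule integral_cong_AE)
   show "AE v in sph. (\<integral>u. indicator (cball (0::'a) 2) u * k' v (norm u) \<partial>lborel)
     = b * (\<phi> (x + v) * (radius h v ^ ?n - 1))"
    using AE_uniform_sphere_norm
   proof eventually_elim
    fix v :: 'a assume v: "norm v = 1"
    let ?\<rho> = "radius h v"
    have \<rho>: "0 <= ?\<rho>" "?\<rho> <= 2" using radius_approx(2)[OF v h] h by linarith+
    have "(\<integral>u. indicator (cball (0::'a) 2) u * k' v (norm u) \<partial>lborel)
     = (\<integral>u. \<phi> (x + v) * (indicator (cball (0::'a) ?\<rho>) u - ball1 u) \<partial>lborel)"
     using \<rho> v by (intro bintegral_cong) (auto simp: k'_def k_def indicator_def)
    also have "... = \<phi> (x + v) * (measure lborel (cball (0::'a) ?\<rho>) - measure lborel (cball (0::'a) 1))"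
     by (subst integral_mult_right_zero, subst bintegral_diff) (auto intro!: integrable_real_indicator)
    also have "... = b * (\<phi> (x + v) * (?\<rho> ^ ?n - 1))"
     using \<rho> by (subst measure_cball_lborel) (auto simp: b_def algebra_simps)
    finally show "(\<integral>u. indicator (cball (0::'a) 2) u * k' v (norm u) \<partial>lborel) = b * (\<phi> (x + v) * (?\<rho> ^ ?n - 1))" .
   qed
  qed measurable
  finally have I2: "(\<integral>u. X u * q u \<partial>lborel) = b * (\<integral>v. \<phi> (x + v) * (radius h v ^ ?n - 1) \<partial>sph)"
   by simp
  have rhob: "\<bar>radius h v ^ ?n - 1 - real ?n * (v \<bullet> h)\<bar> <= (4 * Cn + real ?n) * ?t^2" if v: "norm v = 1" for v
  proof -
   let ?y = "radius h v - 1"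
   have y: "\<bar>?y\<bar> <= 2 * ?t" by (rule radius_approx(2)[OF v h])
   hence y1: "\<bar>?y\<bar> <= 1" using h by linarith
   have "?y^2 <= (2 * ?t)^2" using power_mono[OF y, of 2] by simp
   hence "Cn * ?y^2 <= Cn * (2 * ?t)^2" using Cn(1) by (rule mult_left_mono)
   with Cn(2)[OF y1] have 1: "\<bar>radius h v ^ ?n - 1 - real ?n * ?y\<bar> <= 4 * Cn * ?t^2"
    by (simp add: power_mult_distrib)
   have "\<bar>?y - v \<bullet> h\<bar> <= ?t^2" by (rule radius_approx(1)[OF v h])
   hence "real ?n * \<bar>?y - v \<bullet> h\<bar> <= real ?n * ?t^2" by (intro mult_left_mono) auto
   hence 2: "\<bar>real ?n * ?y - real ?n * (v \<bullet> h)\<bar> <= real ?n * ?t^2"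
    by (simp add: abs_mult right_diff_distrib[symmetric])
   show ?thesis using 1 2 unfolding distrib_right by linarith
  qed
  have iv1: "integrable sph (%v. \<phi> (x + v) * (radius h v ^ ?n - 1))"
  proof (rule S.integrable_const_bound[where B="A * (3 ^ ?n)"])
   show "AE v in sph. norm (\<phi> (x + v) * (radius h v ^ ?n - 1)) <= A * (3 ^ ?n)"
    using AE_uniform_sphere_norm
   proof eventually_elim
    fix v :: 'a assume v: "norm v = 1"
    have \<rho>: "0 <= radius h v" "radius h v <= 3" using radius_approx(2)[OF v h] h by linarith+
    hence "0 <= radius h v ^ ?n" "radius h v ^ ?n <= 3 ^ ?n" "(1::real) <= 3 ^ ?n" by (auto intro: power_mono)
    hence "\<bar>radius h v ^ ?n - 1\<bar> <= 3 ^ ?n" by linarith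
    thus "norm (\<phi> (x + v) * (radius h v ^ ?n - 1)) <= A * (3 ^ ?n)"
     using A[of v] v A0 unfolding real_norm_def abs_mult by (intro mult_mono) auto
   qed
  qed simp
  have iv2: "integrable sph (%v. \<phi> (x + v) *\<^sub>R v)"
  proof (rule S.integrable_const_bound[where B=A])
   show "AE v in sph. norm (\<phi> (x + v) *\<^sub>R v) <= A"
    using AE_uniform_sphere_norm by eventually_elim (use A in simp)
  qed simp
  have iv3: "integrable sph (%v. real ?n * (\<phi> (x + v) * (v \<bullet> h)))"
   using integrable_inner_left[of h, OF _ , of sph "%v. \<phi> (x + v) *\<^sub>R v"] iv2
   by (intro integrable_mult_right) simp
  have lin: "h \<bullet> (real ?n *\<^sub>R (\<integral>v. \<phi> (x + v) *\<^sub>R v \<partial>sph)) = (\<integral>v. real ?n * (\<phi> (x + v) * (v \<bullet> h)) \<partial>sph)"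
  proof -
   have "(\<integral>v. \<phi> (x + v) *\<^sub>R v \<partial>sph) \<bullet> h = (\<integral>v. (\<phi> (x + v) *\<^sub>R v) \<bullet> h \<partial>sph)"
    using iv2 by (intro integral_inner_left[symmetric]) auto
   thus ?thesis by (simp add: inner_commute)
  qed
  have I3: "\<bar>(\<integral>v. \<phi> (x + v) * (radius h v ^ ?n - 1) \<partial>sph)
    - (\<integral>v. real ?n * (\<phi> (x + v) * (v \<bullet> h)) \<partial>sph)\<bar> <= A * ((4 * Cn + real ?n) * ?t^2)"
  proof -
   have "\<bar>(\<integral>v. \<phi> (x + v) * (radius h v ^ ?n - 1) \<partial>sph)
    - (\<integral>v. real ?n * (\<phi> (x + v) * (v \<bullet> h)) \<partial>sph)\<bar>
    = \<bar>\<integral>v. \<phi> (x + v) * (radius h v ^ ?n - 1 - real ?n * (v \<bullet> h)) \<partial>sph\<bar>"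
    by (subst bintegral_diff[symmetric, OF iv1 iv3]) (simp add: algebra_simps)
   also have "... <= (\<integral>v. \<bar>\<phi> (x + v) * (radius h v ^ ?n - 1 - real ?n * (v \<bullet> h))\<bar> \<partial>sph)"
    by (rule integral_abs_bound)
   also have "... <= (\<integral>v. A * ((4 * Cn + real ?n) * ?t^2) \<partial>(sph :: 'a measure))"
   proof (rule integral_mono_AE)
    have "integrable sph (%v. \<phi> (x + v) * (radius h v ^ ?n - 1) - real ?n * (\<phi> (x + v) * (v \<bullet> h)))"
     by (rule bintegrable_diff[OF iv1 iv3])
    thus "integrable sph (%v. \<bar>\<phi> (x + v) * (radius h v ^ ?n - 1 - real ?n * (v \<bullet> h))\<bar>)"
     by (intro integrable_abs) (simp add: algebra_simps)
    show "AE v in sph. \<bar>\<phi> (x + v) * (radius h v ^ ?n - 1 - real ?n * (v \<bullet> h))\<bar> <= A * ((4 * Cn + real ?n) * ?t^2)"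
     using AE_uniform_sphere_norm
    proof eventually_elim
     fix v :: 'a assume v: "norm v = 1"
     show "\<bar>\<phi> (x + v) * (radius h v ^ ?n - 1 - real ?n * (v \<bullet> h))\<bar> <= A * ((4 * Cn + real ?n) * ?t^2)"
      unfolding abs_mult using A[of v] v rhob[OF v] A0 by (intro mult_mono) auto
    qed
   qed simp
   also have "... = A * ((4 * Cn + real ?n) * ?t^2)" using S.prob_space by simp
   finally show ?thesis .
  qed
  let ?E1 = "2 * K * (real ?n + Cn) * ?t^2" and ?E2 = "A * ((4 * Cn + real ?n) * ?t^2)"
  let ?D = "smoothed 1 \<phi> (x + h) - smoothed 1 \<phi> x"
  have "\<bar>b * (?D - (\<integral>v. \<phi> (x + v) * (radius h v ^ ?n - 1) \<partial>sph))\<bar> <= b * ?E1"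
   using I1 unfolding diff[symmetric] I2 right_diff_distrib[symmetric] .
  hence "\<bar>?D - (\<integral>v. \<phi> (x + v) * (radius h v ^ ?n - 1) \<partial>sph)\<bar> <= ?E1"
   using b by (simp add: abs_mult)
  hence "\<bar>?D - (\<integral>v. real ?n * (\<phi> (x + v) * (v \<bullet> h)) \<partial>sph)\<bar> <= ?E1 + ?E2"
   using I3 by linarith
  thus ?thesis unfolding lin by (simp add: algebra_simps)
 qed
 show ?thesis by (rule exI) (use main in blast)
qed

section \<open>Randomized smoothing\<close>

lemma eventually_ne_at: "\<forall>\<^sub>F h in at (a :: 'a::topological_space). h ~= a"
 by (simp add: eventually_at_filter)

lemma abs_inner_le_norm:
 fixes v d :: "'a::real_inner"
 shows "norm v = 1 ==> \<bar>v \<bullet> d\<bar> <= norm d"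
 by (metis Cauchy_Schwarz_ineq2 mult_1)

lemma integral_uniform_sphere:
 fixes g :: "'a::euclidean_space => real"
 assumes [measurable]: "g \<in> borel_measurable borel"
 shows "(\<integral>v. g v \<partial>sph) = (\<integral>u. ball1 u * g (sgn u) \<partial>lborel) / measure lborel (cball (0::'a) 1)"
 unfolding uniform_sphere_def by (subst integral_distr) (simp_all add: integral_uniform_ball)

lemma lborel_integral_uminus:
 fixes g :: "'a::euclidean_space => real"
 assumes "g \<in> borel_measurable borel"
 shows "(\<integral>u. g (- u) \<partial>lborel) = (\<integral>u. g u \<partial>lborel)"
proof -
 have "lborel = density (distr lborel borel (%x::'a. 0 + (- 1) *\<^sub>R x)) (%_. ennreal (\<bar>- 1\<bar>^DIM('a)))"
  by (rule lborel_affine) simp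
 hence e: "lborel = distr lborel borel (uminus :: 'a => 'a)" by (simp add: density_1)
 have "(\<integral>u. g u \<partial>lborel) = (\<integral>u. g u \<partial>distr lborel borel (uminus :: 'a => 'a))" by (simp only: e[symmetric])
 also have "... = (\<integral>u. g (- u) \<partial>lborel)" using assms by (subst integral_distr) simp_all
 finally show ?thesis by simp
qed

lemma uniform_sphere_uminus:
 fixes g :: "'a::euclidean_space => real"
 assumes [measurable]: "g \<in> borel_measurable borel"
 shows "(\<integral>v. g (- v) \<partial>sph) = (\<integral>v. g v \<partial>sph)"
proof -
 have "(\<integral>u. ball1 (- u) * g (sgn (- u)) \<partial>lborel) = (\<integral>u. indicator (cball (0::'a) 1) u * g (sgn u) \<partial>lborel)"
  by (rule lborel_integral_uminus) simp
 moreover have "ball1 (- u) = (indicator (cball (0::'a) 1) u :: real)" for u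
  by (simp add: indicator_def)
 ultimately show ?thesis by (simp add: integral_uniform_sphere sgn_minus)
qed

lemma uniform_sphere_moment:
 fixes d :: "'a::euclidean_space"
 shows "(\<integral>v. (d \<bullet> v)^2 \<partial>sph) = (norm d)^2 / real DIM('a)"
proof -
 \<comment> \<open>With the weight 1/r^2 the radial moment counts directions only:
   \<open>k (norm y) * (norm y)^2\<close> is the indicator of the ball up to the origin.\<close>
 define k where "k r = (if 0 < r & r <= 1 then 1 / r^2 else 0)" for r :: real
 have [measurable]: "k \<in> borel_measurable borel" unfolding k_def by measurable
 let ?b = "measure lborel (cball (0::'a) 1)"
 have i: "integrable lborel (indicator (cball (0::'a) 1) :: 'a => real)"
  by (intro integrable_real_indicator) simp_all
 have ae: "AE y in lborel. k (norm y) * (norm y)^2 = indicator (cball (0::'a) 1) y"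
  using AE_lborel_singleton[of "0::'a"] by eventually_elim (simp add: k_def indicator_def)
 have ki: "integrable lborel (%y::'a. k (norm y) * (norm y)^2)"
  by (rule integrable_cong_AE_imp[OF i]) (use ae in \<open>auto elim: eventually_mono\<close>)
 have kv: "(\<integral>y. k (norm y) * (norm y)^2 \<partial>(lborel :: 'a measure)) = ?b"
  by (subst integral_cong_AE[OF _ _ ae]) simp_all
 have "(\<integral>u. ball1 u * (d \<bullet> sgn u)^2 \<partial>lborel) = (\<integral>u. k (norm u) * (d \<bullet> u)^2 \<partial>lborel)"
  by (intro bintegral_cong) (auto simp: k_def indicator_def sgn_div_norm power_mult_distrib power_divide divide_simps)
 also have "... = (norm d)^2 / real DIM('a) * ?b"
  unfolding kv[symmetric] by (rule radial_moment(2)[OF _ ki]) (simp_all add: k_def)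
 finally show ?thesis
  using ball_measure_pos[where 'a='a] by (subst integral_uniform_sphere) simp_all
qed

lemma integrable_sphere_bounded:
 fixes g :: "'a::euclidean_space => 'b::{banach, second_countable_topology}"
 assumes "g \<in> borel_measurable borel" and "!!v. norm v = 1 ==> norm (g v) <= C"
 shows "integrable sph g"
proof -
 interpret S: prob_space "sph :: 'a measure" by (rule prob_space_uniform_sphere)
 show ?thesis
 proof (rule S.integrable_const_bound[where B=C])
  show "AE v in sph. norm (g v) <= C"
   using AE_uniform_sphere_norm by eventually_elim (use assms in blast)
 qed (use assms in simp)
qed

lemma lipschitz_diff:
 fixes f :: "'a::real_normed_vector => real"
 shows "K-lipschitz_on UNIV f ==> \<bar>f x - f y\<bar> <= K * norm (x - y)"
 by (drule lipschitz_onD[of K UNIV f x y]) (simp_all add: dist_norm)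

lemma lipschitz_bounded_sphere:
 fixes f :: "'a::real_normed_vector => real"
 assumes lip: "K-lipschitz_on UNIV f" and v: "norm v <= 1" and e: "0 <= \<eta>"
 shows "\<bar>f (x + \<eta> *\<^sub>R v)\<bar> <= \<bar>f x\<bar> + K * \<eta>"
proof -
 have "\<bar>f (x + \<eta> *\<^sub>R v) - f x\<bar> <= K * norm (\<eta> *\<^sub>R v)" using lipschitz_diff[OF lip, of "x + \<eta> *\<^sub>R v" x] by simp
 also have "... <= K * (\<eta> * 1)"
  using v e lipschitz_on_nonneg[OF lip] by (intro mult_left_mono) (auto intro: mult_left_le)
 finally show ?thesis by simp
qed

text \<open>The gradient of \<open>smoothed \<eta> f\<close> as a flux through the sphere of radius
  \<eta>, which needs no derivative of \<open>f\<close>. The factor n / \<eta> is the ratio of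
  surface area to volume of a ball of radius \<eta>.\<close>

definition sphere_gradient :: "real => ('a::euclidean_space => real) => 'a => 'a" where
 "sphere_gradient \<eta> f x = (real DIM('a) / \<eta>) *\<^sub>R (\<integral>v. f (x + \<eta> *\<^sub>R v) *\<^sub>R v \<partial>sph)"

lemma smoothed_gderiv_one:
 fixes \<phi> :: "'a::euclidean_space => real"
 assumes lip: "K-lipschitz_on UNIV \<phi>"
 shows "GDERIV (smoothed 1 \<phi>) x :> sphere_gradient 1 \<phi> x"
proof -
 obtain C where C: "!!h. norm h <= 1/2 ==>
  \<bar>smoothed 1 \<phi> (x + h) - smoothed 1 \<phi> x - h \<bullet> sphere_gradient 1 \<phi> x\<bar> <= C * (norm h)^2"
  using smoothed_one_expansion[OF lip, of x] unfolding sphere_gradient_def by auto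
 show ?thesis unfolding gderiv_def has_derivative_at
 proof
  show "bounded_linear (%h. h \<bullet> sphere_gradient 1 \<phi> x)" by (rule bounded_linear_inner_left)
  show "(%h. norm (smoothed 1 \<phi> (x + h) - smoothed 1 \<phi> x - h \<bullet> sphere_gradient 1 \<phi> x) / norm h) \<midarrow>0\<rightarrow> 0"
  proof (rule Lim_null_comparison)
   show "(%h::'a. C * norm h) \<midarrow>0\<rightarrow> 0" by (auto intro!: tendsto_eq_intros)
   have "\<forall>\<^sub>F h in at (0::'a). norm h <= 1/2" unfolding eventually_at by (intro exI[of _ "1/2"]) (auto simp: dist_norm)
   thus "\<forall>\<^sub>F h in at 0. norm (norm (smoothed 1 \<phi> (x + h) - smoothed 1 \<phi> x - h \<bullet> sphere_gradient 1 \<phi> x) / norm h) <= C * norm h"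
    using eventually_ne_at[of "0::'a"]
   proof eventually_elim
    case (elim h)
    thus ?case using C[of h] by (simp add: field_simps sq_eq)
   qed
  qed
 qed
qed

lemma smoothed_gderiv:
 fixes f :: "'a::euclidean_space => real"
 assumes lip: "K-lipschitz_on UNIV f" and eta: "0 < \<eta>"
 shows "GDERIV (smoothed \<eta> f) x :> sphere_gradient \<eta> f x"
proof -
 let ?f = "%y. f (\<eta> *\<^sub>R y)"
 have lip1: "(K * \<eta>)-lipschitz_on UNIV ?f"
 proof (rule lipschitz_onI)
  fix y z :: 'a
  show "dist (?f y) (?f z) <= K * \<eta> * dist y z"
   using lipschitz_diff[OF lip, of "\<eta> *\<^sub>R y" "\<eta> *\<^sub>R z"] eta
   by (simp add: dist_norm scaleR_diff_right[symmetric] mult.assoc)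
 qed (use eta lipschitz_on_nonneg[OF lip] in simp)
 have sm: "smoothed \<eta> f = (%x. smoothed 1 ?f (x /\<^sub>R \<eta>))"
  using eta by (intro ext) (simp add: smoothed_def scaleR_add_right)
 have "(smoothed 1 ?f has_derivative (%h. h \<bullet> sphere_gradient 1 ?f (x /\<^sub>R \<eta>))) (at (x /\<^sub>R \<eta>))"
  using smoothed_gderiv_one[OF lip1, of "x /\<^sub>R \<eta>"] by (simp add: gderiv_def)
 moreover have "((%x. x /\<^sub>R \<eta>) has_derivative (%h. h /\<^sub>R \<eta>)) (at x)"
  by (auto intro!: derivative_eq_intros)
 ultimately have "((%x. smoothed 1 ?f (x /\<^sub>R \<eta>)) has_derivative (%h. (h /\<^sub>R \<eta>) \<bullet> sphere_gradient 1 ?f (x /\<^sub>R \<eta>))) (at x)"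
  by (rule has_derivative_compose[rotated])
 moreover have "sphere_gradient 1 ?f (x /\<^sub>R \<eta>) = \<eta> *\<^sub>R sphere_gradient \<eta> f x"
  using eta by (simp add: sphere_gradient_def scaleR_add_right)
 ultimately show ?thesis using eta unfolding gderiv_def sm by (simp add: mult.assoc[symmetric])
qed

lemma GDERIV_along:
 assumes "GDERIV f (x + t *\<^sub>R h) :> D"
 shows "((%t. f (x + t *\<^sub>R h)) has_real_derivative (h \<bullet> D)) (at t)"
proof -
 have "((%t. f (x + t *\<^sub>R h)) has_derivative (%s. (s *\<^sub>R h) \<bullet> D)) (at t)"
  using assms unfolding gderiv_def
  by (rule has_derivative_compose[rotated]) (auto intro!: derivative_eq_intros)
 moreover have "(%s. (s *\<^sub>R h) \<bullet> D) = (*) (h \<bullet> D)" by (simp add: fun_eq_iff)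
 ultimately show ?thesis by (simp only: has_field_derivative_def)
qed

lemma gradient_norm_le:
 fixes f :: "'a::euclidean_space => real"
 assumes lip: "K-lipschitz_on UNIV f" and D: "GDERIV f x :> D"
 shows "norm D <= K"
proof (cases "D = 0")
 case True thus ?thesis using lipschitz_on_nonneg[OF lip] by simp
next
 case False
 have "((%t. f (x + t *\<^sub>R D)) has_real_derivative (D \<bullet> D)) (at 0)"
  by (rule GDERIV_along) (use D in simp)
 hence "((%t. (f (x + t *\<^sub>R D) - f x) / t) \<longlongrightarrow> D \<bullet> D) (at 0)"
  by (simp add: has_field_derivative_iff)
 moreover have "\<forall>\<^sub>F t in at 0. (f (x + t *\<^sub>R D) - f x) / t <= K * norm D"
 proof (rule eventually_mono[OF eventually_ne_at])
  fix t :: real assume "t ~= 0"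
  have "(f (x + t *\<^sub>R D) - f x) / t <= \<bar>(f (x + t *\<^sub>R D) - f x) / t\<bar>" by (rule abs_ge_self)
  also have "... <= K * norm D"
   using lipschitz_diff[OF lip, of "x + t *\<^sub>R D" x] \<open>t ~= 0\<close> by (simp add: divide_simps mult_ac)
  finally show "(f (x + t *\<^sub>R D) - f x) / t <= K * norm D" .
 qed
 ultimately have "D \<bullet> D <= K * norm D"
  by (rule tendsto_upperbound) simp
 with False show ?thesis by (simp add: dot_square_norm sq_eq)
qed

lemma integral_uniform_ball_const: "(\<integral>u. c \<partial>uniform_measure lborel (cball (0::'a::euclidean_space) 1)) = (c::real)"
 using prob_space.prob_space[OF prob_space_uniform_ball[where 'a='a]] by simp

lemma integrable_uniform_ball_lipschitz:
 fixes f :: "'a::euclidean_space => real"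
 assumes lip: "K-lipschitz_on UNIV f" and "0 <= \<eta>"
 shows "integrable (uniform_measure lborel (cball 0 1)) (%u. f (x + \<eta> *\<^sub>R u))"
proof -
 interpret prob_space "uniform_measure lborel (cball (0::'a) 1)" by (rule prob_space_uniform_ball)
 note [measurable] = lipschitz_measurable[OF lip]
 show ?thesis
 proof (rule integrable_const_bound[where B="\<bar>f x\<bar> + K * \<eta>"])
  show "AE u in uniform_measure lborel (cball 0 1). norm (f (x + \<eta> *\<^sub>R u)) <= \<bar>f x\<bar> + K * \<eta>"
   by (rule AE_uniform_measureI) (use lipschitz_bounded_sphere[OF lip] assms in auto)
 qed simp
qed

lemma smoothed_mono:
 fixes f g :: "'a::euclidean_space => real"
 assumes "K-lipschitz_on UNIV f" "K'-lipschitz_on UNIV g" "0 <= \<eta>"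
  and "!!u. norm u <= 1 ==> f (x + \<eta> *\<^sub>R u) <= g (y + \<eta> *\<^sub>R u) + c"
 shows "smoothed \<eta> f x <= smoothed \<eta> g y + c"
proof -
 interpret prob_space "uniform_measure lborel (cball (0::'a) 1)" by (rule prob_space_uniform_ball)
 have "smoothed \<eta> f x <= (\<integral>u. g (y + \<eta> *\<^sub>R u) + c \<partial>uniform_measure lborel (cball 0 1))"
  unfolding smoothed_def
  by (intro integral_mono_AE integrable_uniform_ball_lipschitz[OF assms(1,3)] bintegrable_add
    integrable_uniform_ball_lipschitz[OF assms(2,3)] integrable_const AE_uniform_measureI) (use assms in auto)
 also have "... = smoothed \<eta> g y + c"
  unfolding smoothed_def
  by (subst bintegral_add) (use assms integral_uniform_ball_const in \<open>auto intro: integrable_uniform_ball_lipschitz\<close>)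
 finally show ?thesis .
qed

lemma smoothed_lipschitz:
 fixes f :: "'a::euclidean_space => real"
 assumes lip: "K-lipschitz_on UNIV f" and eta: "0 <= \<eta>"
 shows "K-lipschitz_on UNIV (smoothed \<eta> f)"
proof (rule lipschitz_onI)
 have *: "smoothed \<eta> f x <= smoothed \<eta> f y + K * dist x y" for x y
  by (rule smoothed_mono[OF lip lip eta])
    (use lipschitz_diff[OF lip] in \<open>smt (verit, best) add_diff_cancel_right dist_norm\<close>)
 show "dist (smoothed \<eta> f x) (smoothed \<eta> f y) <= K * dist x y" for x y
  using *[of x y] *[of y x] by (simp add: dist_real_def dist_commute abs_le_iff)
qed (rule lipschitz_on_nonneg[OF lip])

lemma smoothed_close:
 fixes f :: "'a::euclidean_space => real"
 assumes lip: "K-lipschitz_on UNIV f" and eta: "0 <= \<eta>"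
 shows "\<bar>smoothed \<eta> f x - f x\<bar> <= K * \<eta>"
proof -
 have c: "0-lipschitz_on UNIV (%_::'a. f x)" by (simp add: lipschitz_on_def)
 have s: "smoothed \<eta> (%_::'a. f x) x = f x" by (simp only: smoothed_def integral_uniform_ball_const)
 have K: "0 <= K" by (rule lipschitz_on_nonneg[OF lip])
 have d: "\<bar>f (x + \<eta> *\<^sub>R u) - f x\<bar> <= K * \<eta>" if "norm u <= 1" for u
 proof -
  have "\<bar>f (x + \<eta> *\<^sub>R u) - f x\<bar> <= K * norm (\<eta> *\<^sub>R u)" using lipschitz_diff[OF lip, of "x + \<eta> *\<^sub>R u" x] by simp
  also have "... <= K * \<eta>" using that eta K by (intro mult_left_mono) (auto intro: mult_left_le)
  finally show ?thesis .
 qed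
 have "smoothed \<eta> f x <= smoothed \<eta> (%_::'a. f x) x + K * \<eta>"
  by (rule smoothed_mono[OF lip c eta]) (use d in \<open>force simp: abs_le_iff\<close>)
 moreover have "smoothed \<eta> (%_::'a. f x) x <= smoothed \<eta> f x + K * \<eta>"
  by (rule smoothed_mono[OF c lip eta]) (use d in \<open>force simp: abs_le_iff\<close>)
 ultimately show ?thesis unfolding s by linarith
qed

lemma sphere_gradient_integrable:
 fixes f :: "'a::euclidean_space => real"
 assumes lip: "K-lipschitz_on UNIV f" and eta: "0 <= \<eta>"
 shows "integrable sph (%v. f (x + \<eta> *\<^sub>R v) *\<^sub>R v)"
 by (rule integrable_sphere_bounded[where C="\<bar>f x\<bar> + K * \<eta>"])
   (use lipschitz_bounded_sphere[OF lip] eta lipschitz_measurable[OF lip] in auto)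

lemma sphere_gradient_inner:
 fixes f :: "'a::euclidean_space => real"
 assumes lip: "K-lipschitz_on UNIV f" and eta: "0 <= \<eta>"
 shows "sphere_gradient \<eta> f x \<bullet> d = (real DIM('a) / \<eta>) * (\<integral>v. f (x + \<eta> *\<^sub>R v) * (v \<bullet> d) \<partial>sph)"
proof -
 have "(\<integral>v. f (x + \<eta> *\<^sub>R v) *\<^sub>R v \<partial>sph) \<bullet> d = (\<integral>v. (f (x + \<eta> *\<^sub>R v) *\<^sub>R v) \<bullet> d \<partial>sph)"
  by (intro integral_inner_left[symmetric]) (use sphere_gradient_integrable[OF assms] in auto)
 thus ?thesis by (simp add: sphere_gradient_def)
qed

text \<open>The representation is averaged with its image under v to -v. The result has the
  two-point form of the estimator, which makes the estimator unbiased.\<close>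

lemma sphere_gradient_inner_sym:
 fixes f :: "'a::euclidean_space => real"
 assumes lip: "K-lipschitz_on UNIV f" and eta: "0 <= \<eta>"
 shows "sphere_gradient \<eta> f x \<bullet> d
  = (\<integral>v. real DIM('a) / (2 * \<eta>) * (f (x + \<eta> *\<^sub>R v) - f (x - \<eta> *\<^sub>R v)) * (v \<bullet> d) \<partial>sph)"
proof -
 note [measurable] = lipschitz_measurable[OF lip]
 let ?I = "\<integral>v. f (x + \<eta> *\<^sub>R v) * (v \<bullet> d) \<partial>sph"
 have i: "integrable sph (%v. f (x + \<eta> *\<^sub>R v) * (v \<bullet> d))"
  using integrable_inner_left[of d, OF _, of sph "%v. f (x + \<eta> *\<^sub>R v) *\<^sub>R v"] sphere_gradient_integrable[OF assms] by simp
 have "integrable sph (%v. f (x - \<eta> *\<^sub>R v) *\<^sub>R v)"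
  by (rule integrable_sphere_bounded[where C="\<bar>f x\<bar> + K * \<eta>"])
   (use lipschitz_bounded_sphere[OF lip, of "- _" \<eta> x] eta in auto)
 hence i2: "integrable sph (%v. f (x - \<eta> *\<^sub>R v) * (v \<bullet> d))"
  using integrable_inner_left[of d, OF _, of sph "%v. f (x - \<eta> *\<^sub>R v) *\<^sub>R v"] by simp
 have "(\<integral>v. f (x + \<eta> *\<^sub>R (- v)) * ((- v) \<bullet> d) \<partial>sph) = ?I"
  by (rule uniform_sphere_uminus) simp
 hence m: "(\<integral>v. f (x - \<eta> *\<^sub>R v) * (v \<bullet> d) \<partial>sph) = - ?I" by simp
 have "(\<integral>v. real DIM('a) / (2 * \<eta>) * (f (x + \<eta> *\<^sub>R v) - f (x - \<eta> *\<^sub>R v)) * (v \<bullet> d) \<partial>sph)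
   = real DIM('a) / (2 * \<eta>) * (\<integral>v. f (x + \<eta> *\<^sub>R v) * (v \<bullet> d) - f (x - \<eta> *\<^sub>R v) * (v \<bullet> d) \<partial>sph)"
  by (subst integral_mult_right_zero[symmetric]) (simp add: algebra_simps)
 also have "... = real DIM('a) / (2 * \<eta>) * (2 * ?I)"
  by (subst bintegral_diff[OF i i2]) (simp add: m)
 finally show ?thesis using sphere_gradient_inner[OF assms, of x d] by simp
qed

text \<open>The variance of \<open>\<bar>v \<bullet> d\<bar>\<close> is nonnegative and its second
  moment is known. A typical component of a unit vector is of order 1/sqrt n.\<close>

lemma uniform_sphere_abs_moment:
 fixes d :: "'a::euclidean_space"
 shows "(\<integral>v. \<bar>v \<bullet> d\<bar> \<partial>sph) <= norm d / sqrt (real DIM('a))"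
proof -
 interpret S: prob_space "sph :: 'a measure" by (rule prob_space_uniform_sphere)
 have i1: "integrable sph (%v. \<bar>v \<bullet> d\<bar>)" "integrable sph (%v. (d \<bullet> v)^2)"
  by (rule integrable_sphere_bounded[where C="norm d"], simp, simp add: abs_inner_le_norm)
    (rule integrable_sphere_bounded[where C="(norm d)^2"], simp,
    use power_mono[OF abs_inner_le_norm[of _ d], of _ 2] in \<open>simp add: inner_commute\<close>)
 let ?e = "\<integral>v. \<bar>v \<bullet> d\<bar> \<partial>sph"
 have "0 <= (\<integral>v. (\<bar>v \<bullet> d\<bar> - ?e)^2 \<partial>sph)" by simp
 also have "... = (\<integral>v. (d \<bullet> v)^2 - 2 * ?e * \<bar>v \<bullet> d\<bar> + ?e^2 \<partial>sph)"
  by (simp add: power2_diff inner_commute algebra_simps)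
 also have "... = (norm d)^2 / real DIM('a) - 2 * ?e * ?e + ?e^2"
  using i1 S.prob_space by (simp add: uniform_sphere_moment)
 finally have "?e^2 <= (norm d)^2 / real DIM('a)" by (simp add: sq_eq)
 hence "?e <= sqrt ((norm d)^2 / real DIM('a))" by (rule real_le_rsqrt)
 thus ?thesis by (simp add: real_sqrt_divide)
qed

text \<open>The difference \<open>d\<close> of the two gradients is paired with itself. The
  increments of \<open>f\<close> are bounded uniformly in \<open>v\<close>, so the first absolute
  moment of \<open>v \<bullet> d\<close> remains, and it reduces n / \<eta> to sqrt n /
  \<eta>.\<close>

lemma sphere_gradient_lipschitz:
 fixes f :: "'a::euclidean_space => real"
 assumes lip: "K-lipschitz_on UNIV f" and eta: "0 < \<eta>"
 shows "norm (sphere_gradient \<eta> f x - sphere_gradient \<eta> f y) <= K * sqrt (real DIM('a)) / \<eta> * norm (x - y)"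
proof -
 note [measurable] = lipschitz_measurable[OF lip]
 let ?n = "real DIM('a)"
 have K: "0 <= K" by (rule lipschitz_on_nonneg[OF lip])
 define d where "d = sphere_gradient \<eta> f x - sphere_gradient \<eta> f y"
 have i: "integrable sph (%v. f (z + \<eta> *\<^sub>R v) * (v \<bullet> d))" for z
  using integrable_inner_left[of d, OF _, of sph "%v. f (z + \<eta> *\<^sub>R v) *\<^sub>R v"] sphere_gradient_integrable[OF lip, of \<eta> z] eta by simp
 have i1: "integrable sph (%v. \<bar>v \<bullet> d\<bar>)"
  by (rule integrable_sphere_bounded[where C="norm d"], simp, simp add: abs_inner_le_norm)
 have "(norm d)^2 = d \<bullet> d" by (rule power2_norm_eq_inner)
 also have "... = ?n / \<eta> * ((\<integral>v. f (x + \<eta> *\<^sub>R v) * (v \<bullet> d) \<partial>sph) - (\<integral>v. f (y + \<eta> *\<^sub>R v) * (v \<bullet> d) \<partial>sph))"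
  using eta by (subst (1) d_def) (simp add: inner_diff_left sphere_gradient_inner[OF lip] right_diff_distrib)
 also have "... = ?n / \<eta> * (\<integral>v. (f (x + \<eta> *\<^sub>R v) - f (y + \<eta> *\<^sub>R v)) * (v \<bullet> d) \<partial>sph)"
  by (subst bintegral_diff[OF i i, symmetric]) (simp add: left_diff_distrib)
 also have "... <= ?n / \<eta> * (\<integral>v. K * norm (x - y) * \<bar>v \<bullet> d\<bar> \<partial>sph)"
 proof (intro mult_left_mono integral_mono)
  show "integrable sph (%v. (f (x + \<eta> *\<^sub>R v) - f (y + \<eta> *\<^sub>R v)) * (v \<bullet> d))"
   using bintegrable_diff[OF i i] by (simp add: left_diff_distrib)
  fix v
  have "(f (x + \<eta> *\<^sub>R v) - f (y + \<eta> *\<^sub>R v)) * (v \<bullet> d) <= \<bar>f (x + \<eta> *\<^sub>R v) - f (y + \<eta> *\<^sub>R v)\<bar> * \<bar>v \<bullet> d\<bar>"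
   by (metis abs_ge_self abs_mult)
  also have "... <= K * norm (x - y) * \<bar>v \<bullet> d\<bar>"
   using lipschitz_diff[OF lip, of "x + \<eta> *\<^sub>R v" "y + \<eta> *\<^sub>R v"] by (intro mult_right_mono) auto
  finally show "(f (x + \<eta> *\<^sub>R v) - f (y + \<eta> *\<^sub>R v)) * (v \<bullet> d) <= K * norm (x - y) * \<bar>v \<bullet> d\<bar>" .
 qed (use eta i1 in auto)
 also have "... = ?n / \<eta> * (K * norm (x - y)) * (\<integral>v. \<bar>v \<bullet> d\<bar> \<partial>sph)" by simp
 also have "... <= ?n / \<eta> * (K * norm (x - y)) * (norm d / sqrt ?n)"
  using K eta by (intro mult_left_mono uniform_sphere_abs_moment) auto
 also have "... = (K / \<eta> * norm (x - y) * norm d) * (?n / sqrt ?n)"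
  by simp
 also have "... = (K * sqrt ?n / \<eta> * norm (x - y)) * norm d"
  by (subst real_div_sqrt) simp_all
 finally have "norm d * norm d <= (K * sqrt ?n / \<eta> * norm (x - y)) * norm d"
  by (simp add: sq_eq)
 hence "norm d <= K * sqrt ?n / \<eta> * norm (x - y)" if "d ~= 0"
  by (rule mult_right_le_imp_le) (use that in simp)
 moreover have "0 <= K * sqrt ?n / \<eta> * norm (x - y)" using K eta by simp
 ultimately show ?thesis unfolding d_def[symmetric] by (cases "d = 0") auto
qed

lemma descent_lemma:
 fixes F :: "'a::real_inner => real"
 assumes D: "!!x. GDERIV F x :> G x" and L: "!!x y. norm (G x - G y) <= \<beta> * norm (x - y)"
 shows "F y <= F x + G x \<bullet> (y - x) + \<beta> / 2 * (norm (y - x))^2"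
proof -
 define h where "h = y - x"
 \<comment> \<open>The function along the segment minus the claimed upper bound; its derivative is
   nonpositive exactly by the Lipschitz estimate for \<open>G\<close>.\<close>
 define \<psi> where "\<psi> t = F (x + t *\<^sub>R h) - t * (G x \<bullet> h) - \<beta> / 2 * (norm h)^2 * t^2" for t :: real
 have "\<psi> 1 <= \<psi> 0"
 proof (rule DERIV_nonpos_imp_nonincreasing[of 0 1])
  fix t :: real assume t: "0 <= t" "t <= 1"
  have "(\<psi> has_real_derivative (h \<bullet> G (x + t *\<^sub>R h) - G x \<bullet> h - \<beta> / 2 * (norm h)^2 * (2 * t))) (at t)"
   unfolding \<psi>_def by (auto intro!: derivative_eq_intros GDERIV_along D)
  moreover have "h \<bullet> G (x + t *\<^sub>R h) - G x \<bullet> h - \<beta> / 2 * (norm h)^2 * (2 * t) <= 0"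
  proof -
   have "h \<bullet> G (x + t *\<^sub>R h) - G x \<bullet> h = (G (x + t *\<^sub>R h) - G x) \<bullet> h"
    by (simp add: inner_diff_left inner_diff_right inner_commute)
   also have "... <= norm (G (x + t *\<^sub>R h) - G x) * norm h" by (rule norm_cauchy_schwarz)
   also have "... <= (\<beta> * norm (t *\<^sub>R h)) * norm h"
    using L[of "x + t *\<^sub>R h" x] by (intro mult_right_mono) auto
   also have "... = \<beta> / 2 * (norm h)^2 * (2 * t)" using t by (simp add: sq_eq)
   finally show ?thesis by simp
  qed
  ultimately show "\<exists>d. (\<psi> has_real_derivative d) (at t) & d <= 0" by blast
 qed simp
 thus ?thesis by (simp add: \<psi>_def h_def)
qed

section \<open>Antipodal differences on the sphere\<close>

lemma lborel_nn_integral_shift: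
 fixes g :: "'a::euclidean_space => ennreal"
 assumes "g \<in> borel_measurable borel"
 shows "(\<integral>\<^sup>+u. g (u + h) \<partial>lborel) = (\<integral>\<^sup>+u. g u \<partial>lborel)"
proof -
 have "lborel = density (distr lborel borel (%x::'a. h + 1 *\<^sub>R x)) (%_. ennreal (\<bar>1\<bar>^DIM('a)))"
  by (rule lborel_affine) simp
 hence e: "lborel = distr lborel borel (%x::'a. x + h)" by (simp add: density_1 add.commute)
 have "(\<integral>\<^sup>+u. g u \<partial>lborel) = (\<integral>\<^sup>+u. g u \<partial>distr lborel borel (%x::'a. x + h))" by (simp only: e[symmetric])
 also have "... = (\<integral>\<^sup>+u. g (u + h) \<partial>lborel)" using assms by (subst nn_integral_distr) simp_all
 finally show ?thesis by simp
qed

lemma nn_integral_prod_fst: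
 fixes g :: "'a::euclidean_space \<times> 'a => ennreal"
 assumes [measurable]: "g \<in> borel_measurable borel"
 shows "(\<integral>\<^sup>+p. g p \<partial>lborel) = (\<integral>\<^sup>+x. (\<integral>\<^sup>+y. g (x, y) \<partial>lborel) \<partial>lborel)"
 by (subst lborel_prod[symmetric], subst lborel.nn_integral_fst[symmetric]) (simp_all add: lborel_prod borel_prod)

lemma nn_integral_prod_snd:
 fixes g :: "'a::euclidean_space \<times> 'a => ennreal"
 assumes [measurable]: "g \<in> borel_measurable borel"
 shows "(\<integral>\<^sup>+p. g p \<partial>lborel) = (\<integral>\<^sup>+y. (\<integral>\<^sup>+x. g (x, y) \<partial>lborel) \<partial>lborel)"
 by (subst lborel_prod[symmetric], subst lborel_pair.nn_integral_snd[symmetric]) (simp_all add: lborel_prod borel_prod)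

lemma shear_invariance:
 fixes g :: "'a::euclidean_space \<times> 'a => ennreal"
 assumes [measurable]: "g \<in> borel_measurable borel"
 shows "(\<integral>\<^sup>+p. g (fst p + a *\<^sub>R snd p, snd p) \<partial>lborel) = (\<integral>\<^sup>+p. g p \<partial>lborel)"
  and "(\<integral>\<^sup>+p. g (fst p, snd p + a *\<^sub>R fst p) \<partial>lborel) = (\<integral>\<^sup>+p. g p \<partial>lborel)"
proof -
 have [measurable]: "(%x. g (x, y)) \<in> borel_measurable borel" "(%x. g (y, x)) \<in> borel_measurable borel" for y
  by (intro measurable_compose[OF _ assms] borel_measurable_continuous_onI continuous_intros)+
 have [measurable]: "(%p. g (fst p + a *\<^sub>R snd p, snd p)) \<in> borel_measurable borel"
   "(%p. g (fst p, snd p + a *\<^sub>R fst p)) \<in> borel_measurable borel"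
  by (intro measurable_compose[OF _ assms] borel_measurable_continuous_onI continuous_intros)+
 show "(\<integral>\<^sup>+p. g (fst p + a *\<^sub>R snd p, snd p) \<partial>lborel) = (\<integral>\<^sup>+p. g p \<partial>lborel)"
  by (subst (1 2) nn_integral_prod_snd) (simp_all add: lborel_nn_integral_shift[where g="%x. g (x, _)"])
 show "(\<integral>\<^sup>+p. g (fst p, snd p + a *\<^sub>R fst p) \<partial>lborel) = (\<integral>\<^sup>+p. g p \<partial>lborel)"
  by (subst (1 2) nn_integral_prod_fst) (simp_all add: lborel_nn_integral_shift[where g="%x. g (_, x)"])
qed

text \<open>A rotation that mixes the two vectors of a pair. The second component is the
  t-derivative of the first, and at t = pi the pair is negated.\<close>

definition rotate_pair :: "real => 'a::real_vector \<times> 'a => 'a \<times> 'a" where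
 "rotate_pair t p = (cos t *\<^sub>R fst p + sin t *\<^sub>R snd p, cos t *\<^sub>R snd p - sin t *\<^sub>R fst p)"

text \<open>A rotation with nonzero sine is a product of three shears, and a shear preserves
  Lebesgue measure because for one vector fixed it translates the other.\<close>

lemma rotation_invariance:
 fixes g :: "'a::euclidean_space \<times> 'a => ennreal"
 assumes [measurable]: "g \<in> borel_measurable borel" and t: "sin t ~= 0"
 shows "(\<integral>\<^sup>+p. g (rotate_pair t p) \<partial>lborel) = (\<integral>\<^sup>+p. g p \<partial>lborel)"
proof -
 define b where "b = - sin t"
 \<comment> \<open>This is tan (t/2), the outer shear coefficient in the factorisation of a
   rotation; the middle coefficient is - sin t.\<close>
 define a where "a = (1 - cos t) / sin t"
 have ab: "1 + a * b = cos t" using t by (simp add: a_def b_def)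
 have ab2: "a + a * (1 + b * a) = sin t"
 proof -
  have "a + a * (1 + b * a) = a * (1 + cos t)" using ab by (simp add: algebra_simps)
  also have "... = (1 - (cos t)^2) / sin t" by (simp add: a_def sq_eq algebra_simps)
  also have "... = (sin t)^2 / sin t" by (simp only: sin_squared_eq)
  also have "... = sin t" using t by (simp add: sq_eq)
  finally show ?thesis .
 qed
 define g1 where "g1 p = g (fst p + a *\<^sub>R snd p, snd p)" for p
 define g2 where "g2 p = g1 (fst p, snd p + b *\<^sub>R fst p)" for p
 have [measurable]: "g1 \<in> borel_measurable borel"
  unfolding g1_def [abs_def]
  by (intro measurable_compose[OF _ assms(1)] borel_measurable_continuous_onI continuous_intros)
 have [measurable]: "g2 \<in> borel_measurable borel"
  unfolding g2_def [abs_def]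
  by (rule measurable_compose[where g=g1 and N=borel]) (intro borel_measurable_continuous_onI continuous_intros, simp)
 have e: "g2 (fst p + a *\<^sub>R snd p, snd p) = g (rotate_pair t p)" for p
 proof -
  have 1: "(fst p + a *\<^sub>R snd p) + a *\<^sub>R (snd p + b *\<^sub>R (fst p + a *\<^sub>R snd p))
    = (1 + a * b) *\<^sub>R fst p + (a + a * (1 + b * a)) *\<^sub>R snd p"
   by (simp only: scaleR_add_left scaleR_add_right scaleR_scaleR scaleR_one distrib_left mult_1_right mult_1_left ac_simps)
  have 2: "snd p + b *\<^sub>R (fst p + a *\<^sub>R snd p) = (1 + a * b) *\<^sub>R snd p + b *\<^sub>R fst p"
   by (simp add: algebra_simps)
  show ?thesis unfolding g2_def g1_def fst_conv snd_conv 1 unfolding 2 ab ab2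
   by (simp add: rotate_pair_def b_def)
 qed
 have "(\<integral>\<^sup>+p. g (rotate_pair t p) \<partial>lborel) = (\<integral>\<^sup>+p. g2 p \<partial>lborel)"
  by (subst shear_invariance(1)[where a=a, symmetric]) (simp_all add: e)
 also have "... = (\<integral>\<^sup>+p. g1 p \<partial>lborel)" unfolding g2_def by (rule shear_invariance) simp
 also have "... = (\<integral>\<^sup>+p. g p \<partial>lborel)" unfolding g1_def by (rule shear_invariance) simp
 finally show ?thesis .
qed

lemma norm_rotate_pair: "norm (rotate_pair t p) = norm (p :: 'a::real_inner \<times> 'a)"
proof -
 have n: "(norm (a, b))^2 = a \<bullet> a + b \<bullet> b" for a b :: 'a
  by (simp add: norm_Pair power2_norm_eq_inner[symmetric])
 have "(norm (rotate_pair t p))^2 = (sin t)^2 * (fst p \<bullet> fst p + snd p \<bullet> snd p) + (cos t)^2 * (fst p \<bullet> fst p + snd p \<bullet> snd p)"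
  unfolding rotate_pair_def n
  by (simp add: inner_add inner_diff inner_commute sq_eq algebra_simps)
 also have "... = (norm (fst p))^2 + (norm (snd p))^2"
  unfolding distrib_right[symmetric] by (simp add: power2_norm_eq_inner)
 also have "... = (norm p)^2" by (simp add: norm_prod_def)
 finally show ?thesis by simp
qed

text \<open>Cauchy-Schwarz for the integral of u', in the form that the variance of u' around its
  mean slope is nonnegative.\<close>

lemma path_energy:
 fixes u u' :: "real => real"
 assumes ab: "a < b" and D: "!!t. (u has_real_derivative u' t) (at t)" and c: "!!t. isCont u' t"
 shows "ennreal ((u b - u a)^2) <= ennreal (b - a) * (\<integral>\<^sup>+t. ennreal ((u' t)^2) * indicator {a..b} t \<partial>lborel)"
proof -
 have i1: "(\<integral>t. u' t * indicator {a..b} t \<partial>lborel) = u b - u a"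
  using ab D c by (intro integral_FTC_Icc_real) auto
 have int1: "integrable lborel (%t. u' t * indicator {a..b} t)"
  using c by (intro borel_integrable_atLeastAtMost) auto
 have int2: "integrable lborel (%t. (u' t)^2 * indicator {a..b} t)"
  using c by (intro borel_integrable_atLeastAtMost) (auto intro!: continuous_intros)
 have int0: "integrable lborel (indicator {a..b} :: real => real)"
  using ab by (intro integrable_real_indicator) simp_all
 have i0: "(\<integral>t. indicator {a..b} t \<partial>lborel) = b - a" using ab by simp
 define m where "m = (u b - u a) / (b - a)"
 have "0 <= (\<integral>t. (u' t - m)^2 * indicator {a..b} t \<partial>lborel)"
  by (rule integral_nonneg_AE) (simp add: indicator_def)
 also have "... = (\<integral>t. (u' t)^2 * indicator {a..b} t - 2 * m * (u' t * indicator {a..b} t) + m^2 * indicator {a..b} t \<partial>lborel)"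
  by (intro bintegral_cong) (simp_all add: power2_diff algebra_simps)
 also have "... = (\<integral>t. (u' t)^2 * indicator {a..b} t \<partial>lborel) - 2 * m * (u b - u a) + m^2 * (b - a)"
  using int0 int1 int2 ab by (simp add: i1)
 also have "... = (\<integral>t. (u' t)^2 * indicator {a..b} t \<partial>lborel) - (u b - u a)^2 / (b - a)"
 proof -
  have "m * (b - a) = u b - u a" using ab by (simp add: m_def)
  hence "m^2 * (b - a) = m * (u b - u a)" by (simp add: sq_eq mult.assoc)
  moreover have "m * (u b - u a) = (u b - u a)^2 / (b - a)" by (simp add: m_def sq_eq)
  ultimately show ?thesis by (simp add: mult.assoc)
 qed
 finally have "(u b - u a)^2 <= (b - a) * (\<integral>t. (u' t)^2 * indicator {a..b} t \<partial>lborel)"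
  using ab by (simp add: field_simps)
 also have "ennreal ... = ennreal (b - a) * (\<integral>\<^sup>+t. ennreal ((u' t)^2 * indicator {a..b} t) \<partial>lborel)"
  using ab by (subst nn_integral_eq_integral[OF int2]) (auto simp: ennreal_mult' integral_nonneg_AE)
 also have "(\<integral>\<^sup>+t. ennreal ((u' t)^2 * indicator {a..b} t) \<partial>lborel) = (\<integral>\<^sup>+t. ennreal ((u' t)^2) * indicator {a..b} t \<partial>lborel)"
  by (intro nn_integral_cong) (simp add: indicator_def)
 finally show ?thesis using ab by (simp add: ennreal_leI)
qed

text \<open>The half turn t to cos t x + sin t y leads from x to -x, and its velocity is the second
  vector of the rotated pair. The energy bound on [0, pi] gives one factor pi. After exchanging
  integrals all time slices agree by rotation invariance, and the length of the interval gives the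
  second.\<close>

lemma half_turn_inequality:
 fixes H :: "'a::euclidean_space => real"
 assumes D: "!!x. GDERIV H x :> G x" and cont: "continuous_on UNIV G"
 shows "(\<integral>\<^sup>+p. ennreal ((H (- fst p) - H (fst p))^2) * ball1 (p :: 'a \<times> 'a) \<partial>lborel)
  <= ennreal (pi^2) * (\<integral>\<^sup>+p. ennreal ((G (fst p) \<bullet> snd p)^2) * ball1 p \<partial>lborel)"
proof -
 have cG: "isCont G x" for x using cont by (simp add: continuous_on_eq_continuous_at)
 have [measurable]: "G \<in> borel_measurable borel" using cont by (rule borel_measurable_continuous_onI)
 have cH: "isCont H x" for x using D[of x] unfolding gderiv_def by (rule has_derivative_continuous)
 hence [measurable]: "H \<in> borel_measurable borel"
  by (intro borel_measurable_continuous_onI) (simp add: continuous_on_eq_continuous_at)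
 define e where "e p = ennreal ((G (fst p) \<bullet> snd p)^2) * ball1 p" for p :: "'a \<times> 'a"
 have me: "e \<in> borel_measurable (borel \<Otimes>\<^sub>M borel)"
  unfolding e_def [abs_def] by (intro borel_measurable_times_ennreal, measurable) (simp add: borel_prod)
 have [measurable]: "e \<in> borel_measurable borel" using me by (simp add: borel_prod)
 have pt: "ennreal ((H (- fst p) - H (fst p))^2) * ball1 p
   <= ennreal pi * (\<integral>\<^sup>+t. e (rotate_pair t p) * indicator {0..pi} t \<partial>lborel)" for p
 proof -
  define c where "c t = cos t *\<^sub>R fst p + sin t *\<^sub>R snd p" for t
  define c' where "c' t = cos t *\<^sub>R snd p - sin t *\<^sub>R fst p" for t
  have dc: "(c has_derivative (%s. s *\<^sub>R c' t)) (at t)" for t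
   unfolding c_def c'_def by (auto intro!: derivative_eq_intros simp: algebra_simps)
  have d: "((%t. H (c t)) has_real_derivative (G (c t) \<bullet> c' t)) (at t)" for t
  proof -
   have "((%t. H (c t)) has_derivative (%s. (s *\<^sub>R c' t) \<bullet> G (c t))) (at t)"
    using D[of "c t"] unfolding gderiv_def by (rule has_derivative_compose[OF dc])
   moreover have "(%s. (s *\<^sub>R c' t) \<bullet> G (c t)) = (*) (G (c t) \<bullet> c' t)" by (simp add: fun_eq_iff inner_commute)
   ultimately show ?thesis by (simp only: has_field_derivative_def)
  qed
  have cc: "isCont (%t. G (c t) \<bullet> c' t) t" for t
   unfolding c_def c'_def by (intro continuous_intros isCont_o2[OF _ cG])
  have [measurable]: "(%t. G (c t) \<bullet> c' t) \<in> borel_measurable borel"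
   using cc by (intro borel_measurable_continuous_onI) (simp add: continuous_on_eq_continuous_at)
  have "ennreal ((H (c pi) - H (c 0))^2) <= ennreal (pi - 0) * (\<integral>\<^sup>+t. ennreal ((G (c t) \<bullet> c' t)^2) * indicator {0..pi} t \<partial>lborel)"
   using d cc by (intro path_energy) auto
  hence "ennreal ((H (- fst p) - H (fst p))^2) * ball1 p
   <= ennreal pi * (\<integral>\<^sup>+t. ennreal ((G (c t) \<bullet> c' t)^2) * indicator {0..pi} t \<partial>lborel) * ball1 p"
   by (intro mult_right_mono) (simp_all add: c_def)
  also have "... = ennreal pi * (\<integral>\<^sup>+t. ennreal ((G (c t) \<bullet> c' t)^2) * indicator {0..pi} t * ball1 p \<partial>lborel)"
   by (subst mult.assoc, subst nn_integral_multc[symmetric]) simp_all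
  also have "(\<integral>\<^sup>+t. ennreal ((G (c t) \<bullet> c' t)^2) * indicator {0..pi} t * ball1 (p :: 'a \<times> 'a) \<partial>lborel)
    = (\<integral>\<^sup>+t. e (rotate_pair t p) * indicator {0..pi} t \<partial>lborel)"
  proof (rule nn_integral_cong)
   fix t
   have "e (rotate_pair t p) = ennreal ((G (c t) \<bullet> c' t)^2) * ball1 p"
    unfolding e_def using norm_rotate_pair[of t p] by (simp add: indicator_def) (simp add: rotate_pair_def c_def c'_def)
   thus "ennreal ((G (c t) \<bullet> c' t)^2) * indicator {0..pi} t * ball1 p = e (rotate_pair t p) * indicator {0..pi} t"
    by (simp add: mult_ac)
  qed
  finally show ?thesis .
 qed
 have mrot: "(%x. e (rotate_pair (snd x) (fst x)) * indicator {0..pi} (snd x)) \<in> borel_measurable (borel \<Otimes>\<^sub>M borel)"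
 proof -
  have "(%x :: ('a \<times> 'a) \<times> real. rotate_pair (snd x) (fst x)) \<in> (borel \<Otimes>\<^sub>M borel) \<rightarrow>\<^sub>M borel"
   unfolding rotate_pair_def by (subst (1 2) borel_prod[symmetric]) measurable
  hence "(%x :: ('a \<times> 'a) \<times> real. e (rotate_pair (snd x) (fst x))) \<in> borel_measurable (borel \<Otimes>\<^sub>M borel)"
   by (rule measurable_compose) simp
  thus ?thesis by (intro borel_measurable_times_ennreal) (auto intro!: borel_measurable_indicator')
 qed
 have "(\<integral>\<^sup>+p. ennreal ((H (- fst p) - H (fst p))^2) * ball1 (p :: 'a \<times> 'a) \<partial>lborel)
   <= (\<integral>\<^sup>+p. ennreal pi * (\<integral>\<^sup>+t. e (rotate_pair t p) * indicator {0..pi} t \<partial>lborel) \<partial>lborel)"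
  by (rule nn_integral_mono) (rule pt)
 also have "... = ennreal pi * (\<integral>\<^sup>+p. (\<integral>\<^sup>+t. e (rotate_pair t p) * indicator {0..pi} t \<partial>lborel) \<partial>lborel)"
  by (rule nn_integral_cmult) (use lborel.borel_measurable_nn_integral[of "%p t. e (rotate_pair t p) * indicator {0..pi} t" lborel] mrot in \<open>simp add: split_beta\<close>)
 also have "(\<integral>\<^sup>+p. (\<integral>\<^sup>+t. e (rotate_pair t p) * indicator {0..pi} t \<partial>lborel) \<partial>lborel)
   = (\<integral>\<^sup>+t. (\<integral>\<^sup>+p. e (rotate_pair t p) * indicator {0..pi} t \<partial>lborel) \<partial>lborel)"
  using mrot by (intro lborel_pair.Fubini'[symmetric]) (simp add: split_beta)
 also have "... = (\<integral>\<^sup>+t. (\<integral>\<^sup>+p. e p \<partial>lborel) * indicator {0..pi} t \<partial>lborel)"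
 proof (rule nn_integral_cong_AE)
  have "AE t in (lborel::real measure). t ~= 0" "AE t in lborel. t ~= pi" by (rule AE_lborel_singleton)+
  thus "AE t in lborel. (\<integral>\<^sup>+p. e (rotate_pair t p) * indicator {0..pi} t \<partial>lborel) = (\<integral>\<^sup>+p. e p \<partial>lborel) * indicator {0..pi} t"
  proof eventually_elim
   fix t :: real assume t: "t ~= 0" "t ~= pi"
   show "(\<integral>\<^sup>+p. e (rotate_pair t p) * indicator {0..pi} t \<partial>lborel) = (\<integral>\<^sup>+p. e p \<partial>lborel) * indicator {0..pi} t"
   proof (cases "t \<in> {0..pi}")
    case True
    with t have "sin t ~= 0" using sin_gt_zero[of t] by auto
    hence "(\<integral>\<^sup>+p. e (rotate_pair t p) \<partial>lborel) = (\<integral>\<^sup>+p. e p \<partial>lborel)" by (intro rotation_invariance) simp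
    with True show ?thesis by simp
   qed simp
  qed
 qed
 also have "... = (\<integral>\<^sup>+p. e p \<partial>lborel) * ennreal pi" by (subst nn_integral_cmult) simp_all
 also have "ennreal pi * ((\<integral>\<^sup>+p. e p \<partial>lborel) * ennreal pi) = ennreal (pi^2) * (\<integral>\<^sup>+p. e p \<partial>lborel)"
  by (simp add: sq_eq ennreal_mult mult_ac)
 finally show ?thesis unfolding e_def .
qed

section \<open>Second moments over the unit ball of pairs of vectors\<close>

lemma indicator_prod_ball:
 "ball1 (x, y) = (indicator {r. r^2 <= 1 - (norm x)^2} (norm y) :: 'c::zero_neq_one)"
proof -
 have "norm (x, y) <= 1 \<longleftrightarrow> (norm y)^2 <= 1 - (norm x)^2"
  unfolding power2_le_1_norm[of "(x, y)"] by (simp add: norm_Pair algebra_simps)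
 thus ?thesis by (simp add: indicator_def)
qed

lemma indicator_prod_ball':
 "ball1 (x, y) = (indicator {r. r^2 <= 1 - (norm y)^2} (norm x) :: 'c::zero_neq_one)"
proof -
 have "norm (x, y) <= 1 \<longleftrightarrow> (norm x)^2 <= 1 - (norm y)^2"
  unfolding power2_le_1_norm[of "(x, y)"] by (simp add: norm_Pair algebra_simps)
 thus ?thesis by (simp add: indicator_def)
qed

lemma sets_sq_le [measurable]: "{r::real. r^2 <= c} \<in> sets borel"
 by measurable

lemma cball_prod_measurable [measurable]:
 "(ball1 :: 'a::euclidean_space \<times> 'a => ennreal) \<in> borel_measurable borel"
 by (rule indicator_cball_measurable)

text \<open>For a fixed first vector the slice of the ball is radial in the second one, so
  \<open>radial_moment\<close> applies with the constant vector \<open>G x\<close>. A directional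
  derivative in a random direction is thus smaller than the gradient by the factor 1/n in mean
  square.\<close>

lemma ball_pair_conditional_moment:
 fixes G :: "'a::euclidean_space => 'a"
 assumes G: "continuous_on UNIV G" and b: "!!x. norm (G x) <= B"
 shows "(\<integral>\<^sup>+p. ennreal ((G (fst p) \<bullet> snd p)^2) * ball1 (p :: 'a \<times> 'a) \<partial>lborel)
  <= ennreal (B^2 / real DIM('a)) * (\<integral>\<^sup>+p. ennreal ((norm (snd p))^2) * ball1 (p :: 'a \<times> 'a) \<partial>lborel)"
proof -
 have B: "0 <= B" using b[of 0] norm_ge_zero[of "G 0"] by linarith
 let ?n = "real DIM('a)"
 have m1: "(%p::'a \<times> 'a. (G (fst p) \<bullet> snd p)^2) \<in> borel_measurable borel"
  by (intro borel_measurable_continuous_onI continuous_intros continuous_on_compose2[OF G]) auto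
 have m2: "(%p::'a \<times> 'a. (norm (snd p))^2) \<in> borel_measurable borel"
  by (intro borel_measurable_continuous_onI continuous_intros)
 note [measurable] = m1 m2
 have inner: "(\<integral>\<^sup>+y. ennreal ((a \<bullet> y)^2) * ball1 (x :: 'a, y :: 'a) \<partial>lborel)
   = ennreal ((norm a)^2 / ?n) * (\<integral>\<^sup>+y. ennreal ((norm y)^2) * ball1 (x :: 'a, y :: 'a) \<partial>lborel)" for x a :: 'a
 proof -
  define k where "k r = (indicator {r. r^2 <= 1 - (norm x)^2} r :: real)" for r :: real
  have [measurable]: "k \<in> borel_measurable borel" unfolding k_def by measurable
  have k: "integrable lborel (%y::'a. k (norm y) * (norm y)^2)"
  proof (rule bintegrable_bound)
   show "integrable lborel (indicator (cball (0::'a) 1) :: 'a => real)"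
    by (intro integrable_real_indicator) simp_all
   show "AE y in lborel. norm (k (norm y) * (norm y)^2) <= norm (indicator (cball (0::'a) 1) y :: real)"
   proof (rule AE_I2)
    fix y :: 'a
    have "(norm y)^2 <= 1 & norm y <= 1" if "(norm y)^2 <= 1 - (norm x)^2"
    proof -
     have "(norm y)^2 <= 1" using that zero_le_power2[of "norm x"] by linarith
     thus ?thesis using power2_le_1_norm[of y] by simp
    qed
    thus "norm (k (norm y) * (norm y)^2) <= norm (indicator (cball (0::'a) 1) y :: real)"
     by (auto simp: k_def indicator_def)
   qed
  qed simp
  have e: "ennreal ((a \<bullet> y)^2) * ball1 (x :: 'a, y :: 'a) = ennreal (k (norm y) * (a \<bullet> y)^2)"
   "ennreal ((norm y)^2) * ball1 (x :: 'a, y :: 'a) = ennreal (k (norm y) * (norm y)^2)" for y :: 'a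
   unfolding indicator_prod_ball by (simp_all add: k_def indicator_def)
  have nn: "0 <= k r" for r by (simp add: k_def)
  note rm = radial_moment[OF _ k nn, of a]
  have "(\<integral>\<^sup>+y. ennreal ((a \<bullet> y)^2) * ball1 (x :: 'a, y :: 'a) \<partial>lborel) = ennreal (\<integral>y. k (norm y) * (a \<bullet> y)^2 \<partial>lborel)"
   unfolding e by (rule nn_integral_eq_integral) (use rm(1) nn in auto)
  also have "... = ennreal ((norm a)^2 / ?n) * ennreal (\<integral>y. k (norm y) * (norm y)^2 \<partial>(lborel::'a measure))"
   using rm(2) by (simp add: ennreal_mult' [symmetric])
  also have "ennreal (\<integral>y. k (norm y) * (norm y)^2 \<partial>(lborel::'a measure)) = (\<integral>\<^sup>+y. ennreal ((norm y)^2) * ball1 (x :: 'a, y :: 'a) \<partial>lborel)"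
   unfolding e by (rule nn_integral_eq_integral[symmetric]) (use k nn in auto)
  finally show ?thesis .
 qed
 have "(\<integral>\<^sup>+p. ennreal ((G (fst p) \<bullet> snd p)^2) * ball1 (p :: 'a \<times> 'a) \<partial>lborel)
   = (\<integral>\<^sup>+x. (\<integral>\<^sup>+y. ennreal ((G x \<bullet> y)^2) * ball1 (x :: 'a, y :: 'a) \<partial>lborel) \<partial>lborel)"
  by (subst nn_integral_prod_fst) simp_all
 also have "... <= (\<integral>\<^sup>+x. ennreal (B^2 / ?n) * (\<integral>\<^sup>+y. ennreal ((norm y)^2) * ball1 (x :: 'a, y :: 'a) \<partial>lborel) \<partial>(lborel::'a measure))"
  unfolding inner using b B by (intro nn_integral_mono mult_right_mono ennreal_leI divide_right_mono power_mono) auto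
 also have "... = ennreal (B^2 / ?n) * (\<integral>\<^sup>+x. (\<integral>\<^sup>+y. ennreal ((norm y)^2) * ball1 (x :: 'a, y :: 'a) \<partial>lborel) \<partial>(lborel::'a measure))"
 proof (rule nn_integral_cmult)
  have "(%p::'a \<times> 'a. ennreal ((norm (snd p))^2) * ball1 p) \<in> borel_measurable (lborel \<Otimes>\<^sub>M lborel)"
   by (simp add: lborel_prod)
  from lborel.borel_measurable_nn_integral_fst[OF this]
  show "(%x::'a. \<integral>\<^sup>+y. ennreal ((norm y)^2) * ball1 (x, y :: 'a) \<partial>lborel) \<in> borel_measurable lborel"
   by simp
 qed
 also have "(\<integral>\<^sup>+x. (\<integral>\<^sup>+y. ennreal ((norm y)^2) * ball1 (x :: 'a, y :: 'a) \<partial>lborel) \<partial>(lborel::'a measure))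
   = (\<integral>\<^sup>+p. ennreal ((norm (snd p))^2) * ball1 (p :: 'a \<times> 'a) \<partial>lborel)"
  by (subst nn_integral_prod_fst) simp_all
 finally show ?thesis .
qed

text \<open>A quarter turn of the pair carries the second vector into the first.\<close>

lemma ball_pair_symmetric:
 "(\<integral>\<^sup>+p. ennreal ((norm (snd p))^2) * ball1 (p :: 'a::euclidean_space \<times> 'a) \<partial>lborel)
  = (\<integral>\<^sup>+p. ennreal ((norm (fst p))^2) * ball1 (p :: 'a \<times> 'a) \<partial>lborel)"
proof -
 have [measurable]: "(%p::'a \<times> 'a. (norm (fst p))^2) \<in> borel_measurable borel"
  by (intro borel_measurable_continuous_onI continuous_intros)
 define g where "g p = ennreal ((norm (fst p))^2) * ball1 p" for p :: "'a \<times> 'a"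
 have "(\<integral>\<^sup>+p. g (rotate_pair (pi/2) p) \<partial>lborel) = (\<integral>\<^sup>+p. g p \<partial>lborel)"
  by (rule rotation_invariance) (simp_all add: g_def [abs_def])
 moreover have "g (rotate_pair (pi/2) p) = ennreal ((norm (snd p))^2) * ball1 p" for p
  unfolding g_def using norm_rotate_pair[of "pi/2" p] by (simp add: indicator_def) (simp add: rotate_pair_def)
 ultimately show ?thesis by (simp add: g_def)
qed

text \<open>Polar coordinates in the first vector, for each fixed second vector. The weight
  \<open>(norm (fst p))^2\<close> is what the square of a function homogeneous of degree one
  contributes besides its values on the sphere.\<close>

lemma ball_pair_polar:
 fixes q :: "'a::euclidean_space => ennreal"
 assumes q: "q \<in> borel_measurable borel"
 shows "(\<integral>\<^sup>+p. ennreal ((norm (fst p))^2) * q (sgn (fst p)) * ball1 (p :: 'a \<times> 'a) \<partial>lborel)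
  = (\<integral>\<^sup>+v. q v \<partial>sph) * (\<integral>\<^sup>+p. ennreal ((norm (fst p))^2) * ball1 (p :: 'a \<times> 'a) \<partial>lborel)"
proof -
 note [measurable] = q
 have m1: "(%p::'a \<times> 'a. (norm (fst p))^2) \<in> borel_measurable borel"
  by (intro borel_measurable_continuous_onI continuous_intros)
 have m3: "(%p::'a \<times> 'a. q (sgn (fst p))) \<in> borel_measurable borel"
  by (rule measurable_compose[of fst borel borel]) (auto intro!: borel_measurable_continuous_onI continuous_intros)
 note [measurable] = m1 m3
 have inner: "(\<integral>\<^sup>+x. ennreal ((norm x)^2) * q (sgn x) * ball1 (x :: 'a, y :: 'a) \<partial>lborel)
   = (\<integral>\<^sup>+v. q v \<partial>sph) * (\<integral>\<^sup>+x. ennreal ((norm x)^2) * ball1 (x :: 'a, y :: 'a) \<partial>lborel)" for y :: 'a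
 proof -
  let ?I = "{r. r^2 <= 1 - (norm y)^2}"
  have in1: "norm x <= 1" if "(norm x)^2 <= 1 - (norm y)^2" for x :: 'a
  proof -
   have "(norm x)^2 <= 1" using that zero_le_power2[of "norm y"] by linarith
   thus ?thesis using power2_le_1_norm[of x] by simp
  qed
  have e: "indicator ?I (norm x) = (indicator ?I (norm x) * ball1 x :: ennreal)" for x :: 'a
   using in1[of x] by (auto simp: indicator_def)
  have "(\<integral>\<^sup>+x. ennreal ((norm x)^2) * q (sgn x) * ball1 (x :: 'a, y :: 'a) \<partial>lborel)
    = (\<integral>\<^sup>+x. (%v r. q v * (ennreal (r^2) * indicator ?I r)) (sgn x) (norm x) * ball1 x \<partial>lborel)"
   unfolding indicator_prod_ball' by (intro nn_integral_cong, subst e) (simp add: mult_ac)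
  also have "... = (\<integral>\<^sup>+v. (\<integral>\<^sup>+u. q v * (ennreal ((norm u)^2) * indicator ?I (norm u)) * indicator (cball (0::'a) 1) u \<partial>lborel) \<partial>sph)"
   by (rule polar_nn_integral) simp_all
  also have "... = (\<integral>\<^sup>+v. q v * (\<integral>\<^sup>+u. ennreal ((norm u)^2) * indicator ?I (norm u) * indicator (cball (0::'a) 1) u \<partial>lborel) \<partial>sph)"
   by (intro nn_integral_cong, subst nn_integral_cmult[symmetric]) (simp_all add: mult.assoc)
  also have "... = (\<integral>\<^sup>+v. q v \<partial>sph) * (\<integral>\<^sup>+u. ennreal ((norm u)^2) * indicator ?I (norm u) * indicator (cball (0::'a) 1) u \<partial>lborel)"
   by (rule nn_integral_multc) simp
  also have "(\<integral>\<^sup>+u. ennreal ((norm u)^2) * indicator ?I (norm u) * indicator (cball (0::'a) 1) u \<partial>lborel)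
    = (\<integral>\<^sup>+x. ennreal ((norm x)^2) * ball1 (x :: 'a, y :: 'a) \<partial>lborel)"
   unfolding indicator_prod_ball'
  proof (rule nn_integral_cong)
   fix u :: 'a
   show "ennreal ((norm u)^2) * indicator ?I (norm u) * indicator (cball (0::'a) 1) u = ennreal ((norm u)^2) * indicator ?I (norm u)"
    using e[of u] by (metis mult.assoc)
  qed
  finally show ?thesis .
 qed
 have "(\<integral>\<^sup>+p. ennreal ((norm (fst p))^2) * q (sgn (fst p)) * ball1 (p :: 'a \<times> 'a) \<partial>lborel)
   = (\<integral>\<^sup>+y. (\<integral>\<^sup>+x. ennreal ((norm x)^2) * q (sgn x) * ball1 (x :: 'a, y :: 'a) \<partial>lborel) \<partial>lborel)"
  by (subst nn_integral_prod_snd) simp_all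
 also have "... = (\<integral>\<^sup>+v. q v \<partial>sph) * (\<integral>\<^sup>+y. (\<integral>\<^sup>+x. ennreal ((norm x)^2) * ball1 (x :: 'a, y :: 'a) \<partial>lborel) \<partial>(lborel::'a measure))"
  unfolding inner
 proof (rule nn_integral_cmult)
  have "(%p::'a \<times> 'a. ennreal ((norm (fst p))^2) * ball1 p) \<in> borel_measurable (lborel \<Otimes>\<^sub>M lborel)"
   by (simp add: lborel_prod)
  from lborel.borel_measurable_nn_integral_fst[OF measurable_pair_swap[OF this]]
  show "(%y::'a. \<integral>\<^sup>+x. ennreal ((norm x)^2) * ball1 (x :: 'a, y) \<partial>lborel) \<in> borel_measurable lborel"
   by simp
 qed
 also have "(\<integral>\<^sup>+y. (\<integral>\<^sup>+x. ennreal ((norm x)^2) * ball1 (x :: 'a, y :: 'a) \<partial>lborel) \<partial>(lborel::'a measure))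
   = (\<integral>\<^sup>+p. ennreal ((norm (fst p))^2) * ball1 (p :: 'a \<times> 'a) \<partial>lborel)"
  by (subst nn_integral_prod_snd) simp_all
 finally show ?thesis .
qed

text \<open>This mass is a common factor of both sides of the sphere inequality; it is cancelled at
  the end and so has to be positive and finite.\<close>

lemma ball_pair_mass:
 "(\<integral>\<^sup>+p. ennreal ((norm (fst p))^2) * ball1 (p :: 'a::euclidean_space \<times> 'a) \<partial>lborel) ~= 0"
 "(\<integral>\<^sup>+p. ennreal ((norm (fst p))^2) * ball1 (p :: 'a::euclidean_space \<times> 'a) \<partial>lborel) ~= top"
proof -
 have m1[measurable]: "(%p::'a \<times> 'a. (norm (fst p))^2) \<in> borel_measurable borel"
  by (intro borel_measurable_continuous_onI continuous_intros)
 let ?I = "\<integral>\<^sup>+p. ennreal ((norm (fst p))^2) * ball1 (p :: 'a \<times> 'a) \<partial>lborel"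
 have le: "norm (fst p) <= norm p" for p :: "'a \<times> 'a" by (cases p) (simp add: norm_fst_le)
 have "?I <= (\<integral>\<^sup>+p. ball1 (p :: 'a \<times> 'a) \<partial>lborel)"
 proof (rule nn_integral_mono)
  fix p :: "'a \<times> 'a"
  show "ennreal ((norm (fst p))^2) * ball1 p <= ball1 p"
   using le[of p] by (cases "norm p <= 1") (auto simp: indicator_def intro!: power_le_one)
 qed
 also have "... < top" by simp
 finally show "?I ~= top" by simp
 show "?I ~= 0"
 proof
  assume "?I = 0"
  hence z: "AE p in lborel. ennreal ((norm (fst p))^2) * ball1 (p :: 'a \<times> 'a) = 0"
   by (subst (asm) nn_integral_0_iff_AE) simp_all
  have null: "AE p in lborel. (p::'a \<times> 'a) \<in> cball 0 1 \<longrightarrow> fst p = 0"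
   using z by eventually_elim (auto simp: indicator_def split: if_splits)
  obtain e :: 'a where e: "e \<in> Basis" using nonempty_Basis by blast
  \<comment> \<open>A ball of radius 1/4 around this point stays in the unit ball and avoids pairs
    with vanishing first vector, so the mass cannot be zero.\<close>
  define c where "c = ((1/2) *\<^sub>R e, 0 :: 'a)"
  have "\<exists>p\<in>ball c (1/4). \<not> (p \<in> cball 0 1 \<longrightarrow> fst p = 0)"
   using e by (intro bexI[of _ c]) (auto simp: c_def norm_Pair)
  have sub: "\<not> (p \<in> cball 0 1 \<longrightarrow> fst p = 0)" if "p \<in> ball c (1/4)" for p
  proof -
   have nc: "norm c = 1/2" using e by (simp add: c_def norm_Pair)
   have "norm (p - c) < 1/4" using that by (simp add: dist_norm norm_minus_commute)
   hence "norm p <= 1" "norm (fst (p - c)) < 1/4" using norm_triangle_sub[of p c] nc le[of "p - c"] by linarith+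
   moreover have "fst p = 0 ==> norm (fst (p - c)) = 1/2" using e by (simp add: c_def)
   ultimately show ?thesis by auto
  qed
  have "AE p in lborel. p \<notin> ball c (1/4)" using null by eventually_elim (use sub in blast)
  hence "emeasure lborel (ball c (1/4)) = 0"
   by (subst (asm) AE_iff_null_sets[symmetric]) (auto simp: null_sets_def)
  moreover have "0 < measure lborel (ball c (1/4))" using content_ball_pos[of "1/4" c] by (simp add: measure_completion)
  ultimately show False by (simp add: measure_def)
 qed
qed

text \<open>The odd part \<open>h\<close> of a smooth function is extended to \<open>r x * h (x / r x)\<close>, which is almost
 homogeneous of degree one and odd, so that a half turn of a pair of vectors reverses its sign.\<close>

lemma homogeneous_extension_gderiv:
 fixes h :: "'a::euclidean_space => real"
 assumes D: "!!x. GDERIV h x :> g x" and s: "0 < s"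
 defines "r \<equiv> %x::'a. sqrt (x \<bullet> x + s^2)"
 defines "p \<equiv> %x. x /\<^sub>R r x"
 shows "GDERIV (%x. r x * h (p x)) x :> h (p x) *\<^sub>R p x + g (p x) - (g (p x) \<bullet> p x) *\<^sub>R p x"
proof -
 have r0: "0 < r y" for y unfolding r_def using s by (simp add: add_nonneg_pos)
 have r2: "r y * r y = y \<bullet> y + s^2" for y unfolding r_def by (simp add: real_sqrt_mult[symmetric])
 have d1: "((%x. x \<bullet> x + s^2) has_derivative (%d. 2 * (x \<bullet> d))) (at x)"
  by (rule has_derivative_eq_rhs, (rule derivative_intros)+) (simp add: fun_eq_iff inner_commute[of _ x])
 have pos: "0 < x \<bullet> x + s^2" using s by (simp add: add_nonneg_pos)
 have dr: "(r has_derivative (%d. (x \<bullet> d) / r x)) (at x)"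
 proof -
  have "((%x. sqrt (x \<bullet> x + s^2)) has_derivative (%d. (x \<bullet> d) / sqrt (x \<bullet> x + s^2))) (at x)"
   by (rule has_derivative_eq_rhs[OF DERIV_compose_FDERIV[where f=sqrt and g="%x. x \<bullet> x + s^2", OF DERIV_real_sqrt[OF pos] d1]])
     (simp add: fun_eq_iff field_simps)
  thus ?thesis by (simp only: r_def)
 qed
 have rn: "r x ~= 0" using r0[of x] by simp
 have dp: "(p has_derivative (%d. d /\<^sub>R r x - ((x \<bullet> d) / r x ^ 3) *\<^sub>R x)) (at x)"
  unfolding p_def
 proof -
  have "((%x. inverse (r x)) has_derivative (%d. - (inverse (r x) * ((x \<bullet> d) / r x) * inverse (r x)))) (at x)"
   by (rule Deriv.has_derivative_inverse[OF rn dr])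
  from has_derivative_scaleR[OF this has_derivative_ident]
  show "((%x. x /\<^sub>R r x) has_derivative (%d. d /\<^sub>R r x - ((x \<bullet> d) / r x ^ 3) *\<^sub>R x)) (at x)"
   by (rule has_derivative_eq_rhs) (use rn in \<open>simp add: fun_eq_iff power3_eq_cube field_simps\<close>)
 qed
 have dh: "((%x. h (p x)) has_derivative (%d. (d /\<^sub>R r x - ((x \<bullet> d) / r x ^ 3) *\<^sub>R x) \<bullet> g (p x))) (at x)"
  using D[of "p x"] unfolding gderiv_def by (rule has_derivative_compose[OF dp])
 have dH: "((%x. r x * h (p x)) has_derivative
  (%d. r x * ((d /\<^sub>R r x - ((x \<bullet> d) / r x ^ 3) *\<^sub>R x) \<bullet> g (p x)) + (x \<bullet> d) / r x * h (p x))) (at x)"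
  by (rule has_derivative_mult[OF dr dh])
 have "(%d. r x * ((d /\<^sub>R r x - ((x \<bullet> d) / r x ^ 3) *\<^sub>R x) \<bullet> g (p x)) + (x \<bullet> d) / r x * h (p x))
   = (%d. d \<bullet> (h (p x) *\<^sub>R p x + g (p x) - (g (p x) \<bullet> p x) *\<^sub>R p x))"
 proof
  fix d
  have e1: "r x * ((d /\<^sub>R r x - ((x \<bullet> d) / r x ^ 3) *\<^sub>R x) \<bullet> g (p x)) = d \<bullet> g (p x) - (x \<bullet> d) * (x \<bullet> g (p x)) / (r x * r x)"
   using rn by (simp add: inner_diff_left power3_eq_cube field_simps)
  show "r x * ((d /\<^sub>R r x - ((x \<bullet> d) / r x ^ 3) *\<^sub>R x) \<bullet> g (p x)) + (x \<bullet> d) / r x * h (p x)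
   = d \<bullet> (h (p x) *\<^sub>R p x + g (p x) - (g (p x) \<bullet> p x) *\<^sub>R p x)"
   unfolding e1 using rn
   by (simp add: inner_diff_right inner_add_right, simp only: p_def inner_scaleR_right,
     simp add: inner_commute field_simps)
 qed
 with dH show ?thesis unfolding gderiv_def by simp
qed

text \<open>Removing the component along \<open>p\<close> does not lengthen \<open>g\<close> when
  \<open>norm p <= 1\<close>, and the radial term \<open>c *\<^sub>R p\<close> is at most
  \<open>K\<close>; each part contributes one \<open>K\<close>.\<close>

lemma homogeneous_gradient_bound:
 fixes p g :: "'a::real_inner"
 assumes p: "norm p <= 1" and g: "norm g <= K" and h: "\<bar>c\<bar> <= K * norm p"
 shows "norm (c *\<^sub>R p + g - (g \<bullet> p) *\<^sub>R p) <= 2 * K"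
proof -
 have K: "0 <= K" using g norm_ge_zero[of g] by linarith
 have "(norm (g - (g \<bullet> p) *\<^sub>R p))^2 = (norm g)^2 - 2 * (g \<bullet> p)^2 + (g \<bullet> p)^2 * (norm p)^2"
  unfolding power2_norm_eq_inner by (simp add: inner_diff inner_commute sq_eq algebra_simps)
 also have "(g \<bullet> p)^2 * (norm p)^2 <= (g \<bullet> p)^2 * 1"
  using p by (intro mult_left_mono) (auto simp: power_le_one)
 finally have "(norm (g - (g \<bullet> p) *\<^sub>R p))^2 <= (norm g)^2" using zero_le_power2[of "g \<bullet> p"] by linarith
 hence 1: "norm (g - (g \<bullet> p) *\<^sub>R p) <= norm g" by (rule power2_le_imp_le) simp
 have "norm (c *\<^sub>R p) <= (K * norm p) * norm p" using h by (simp add: mult_right_mono)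
 also have "... <= (K * 1) * 1" using p K by (intro mult_mono) auto
 finally have 2: "norm (c *\<^sub>R p) <= K" by simp
 show ?thesis unfolding add_diff_eq[symmetric]
  using norm_triangle_ineq[of "c *\<^sub>R p" "g - (g \<bullet> p) *\<^sub>R p"] 1 2 g by linarith
qed

text \<open>For an odd extension H the difference over a half turn is -2H, so 4 times its second
  moment is at most pi^2 (2 K)^2 / n times the mass \<open>M\<close>, and the fours cancel. As the
  regularisation s tends to 0, Fatou's lemma passes to \<open>norm x * h (sgn x)\<close>, where
  polar coordinates split off the same mass \<open>M\<close>.\<close>

lemma odd_sphere_poincare_smooth:
 fixes h :: "'a::euclidean_space => real"
 assumes D: "!!x. GDERIV h x :> g x" and g: "continuous_on UNIV g" and gK: "!!x. norm (g x) <= K"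
  and lip: "K-lipschitz_on UNIV h" and odd: "!!x. h (- x) = - h x"
 shows "(\<integral>\<^sup>+v. ennreal ((h v)^2) \<partial>sph) <= ennreal (pi^2 * K^2 / real DIM('a))"
proof -
 let ?n = "real DIM('a)"
 have K: "0 <= K" by (rule lipschitz_on_nonneg[OF lip])
 have h0: "h 0 = 0" using odd[of 0] by simp
 have hb: "\<bar>h x\<bar> <= K * norm x" for x using lipschitz_diff[OF lip, of x 0] h0 by simp
 have ch: "continuous_on UNIV h" by (rule lipschitz_on_continuous_on[OF lip])
 note [measurable] = lipschitz_measurable[OF lip]
 define M where "M = (\<integral>\<^sup>+p. ennreal ((norm (fst p))^2) * ball1 (p :: 'a \<times> 'a) \<partial>lborel)"
 define r where "r s x = sqrt (x \<bullet> x + s^2)" for s :: real and x :: 'a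
 define H where "H s x = r s x * h (x /\<^sub>R r s x)" for s x
 have mfst: "fst \<in> (borel :: ('a \<times> 'a) measure) \<rightarrow>\<^sub>M borel"
  by (intro borel_measurable_continuous_onI continuous_intros)
 have cr: "continuous_on UNIV (r s)" for s unfolding r_def [abs_def] by (intro continuous_intros)
 have [measurable]: "r s \<in> borel_measurable borel" for s by (rule borel_measurable_continuous_onI[OF cr])
 have [measurable]: "H s \<in> borel_measurable borel" for s unfolding H_def [abs_def] by measurable
 have mHf[measurable]: "(%p::'a \<times> 'a. H s (fst p)) \<in> borel_measurable borel" for s
  by (rule measurable_compose[OF mfst]) simp
 have bound: "(\<integral>\<^sup>+p. ennreal ((H s (fst p))^2) * ball1 (p :: 'a \<times> 'a) \<partial>lborel)
   <= ennreal (pi^2 * K^2 / ?n) * M" if s: "0 < s" for s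
 proof -
  have r0: "0 < r s y" for y unfolding r_def using s by (simp add: add_nonneg_pos)
  define p where "p x = x /\<^sub>R r s x" for x
  define G where "G x = h (p x) *\<^sub>R p x + g (p x) - (g (p x) \<bullet> p x) *\<^sub>R p x" for x
  have DH: "GDERIV (H s) x :> G x" for x
   using homogeneous_extension_gderiv[OF D s, of x] unfolding H_def [abs_def] G_def p_def r_def by simp
  have np: "norm (p x) <= 1" for x
  proof -
   have "norm x <= r s x" unfolding r_def by (simp add: norm_eq_sqrt_inner)
   thus ?thesis using r0[of x] by (simp add: p_def field_simps)
  qed
  have cp: "continuous_on UNIV p" unfolding p_def [abs_def] using r0
   by (intro continuous_intros cr) (auto simp: less_imp_neq[symmetric])
  have cG: "continuous_on UNIV G" unfolding G_def [abs_def]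
   by (intro continuous_intros cp continuous_on_compose2[OF ch cp] continuous_on_compose2[OF g cp]) auto
  have bG: "norm (G x) <= 2 * K" for x unfolding G_def
   by (rule homogeneous_gradient_bound[OF np gK hb])
  have odH: "H s (- x) = - H s x" for x by (simp add: H_def r_def odd)
  have "(\<integral>\<^sup>+p. ennreal ((H s (- fst p) - H s (fst p))^2) * ball1 (p :: 'a \<times> 'a) \<partial>lborel)
   = (\<integral>\<^sup>+p. 4 * (ennreal ((H s (fst p))^2) * ball1 (p :: 'a \<times> 'a)) \<partial>lborel)"
  proof (rule nn_integral_cong)
   fix q :: "'a \<times> 'a"
   have "(H s (- fst q) - H s (fst q))^2 = 4 * (H s (fst q))^2" by (simp add: odH sq_eq algebra_simps)
   thus "ennreal ((H s (- fst q) - H s (fst q))^2) * ball1 q = 4 * (ennreal ((H s (fst q))^2) * ball1 q)"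
    by (simp add: ennreal_mult mult.assoc)
  qed
  also have "... = 4 * (\<integral>\<^sup>+p. ennreal ((H s (fst p))^2) * ball1 (p :: 'a \<times> 'a) \<partial>lborel)"
   by (rule nn_integral_cmult) simp
  finally have "4 * (\<integral>\<^sup>+p. ennreal ((H s (fst p))^2) * ball1 (p :: 'a \<times> 'a) \<partial>lborel)
   <= ennreal (pi^2) * (\<integral>\<^sup>+p. ennreal ((G (fst p) \<bullet> snd p)^2) * ball1 (p :: 'a \<times> 'a) \<partial>lborel)"
   using half_turn_inequality[of "H s" G, OF DH cG] by simp
  also have "... <= ennreal (pi^2) * (ennreal ((2 * K)^2 / ?n) * M)"
   using ball_pair_conditional_moment[OF cG bG] unfolding M_def ball_pair_symmetric by (intro mult_left_mono) auto
  also have "... = 4 * (ennreal (pi^2 * K^2 / ?n) * M)"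
  proof -
   have "ennreal (pi^2) * ennreal ((2 * K)^2 / ?n) = ennreal (4 * (pi^2 * K^2 / ?n))"
    by (subst ennreal_mult[symmetric]) (auto simp: power_mult_distrib)
   also have "... = 4 * ennreal (pi^2 * K^2 / ?n)" by (subst ennreal_mult) auto
   finally show ?thesis by (simp add: mult.assoc[symmetric])
  qed
  finally show ?thesis by (subst (asm) ennreal_mult_le_mult_iff) auto
 qed
 \<comment> \<open>Positive parameters keep the extension differentiable at the origin; they are
   sent to 0.\<close>
 define sj where "sj j = 1 / real (Suc j)" for j
 have sj: "sj \<longlonglongrightarrow> 0" unfolding sj_def [abs_def] by (rule LIMSEQ_inverse_real_of_nat[unfolded inverse_eq_divide])
 have lim: "(%j. H (sj j) x) \<longlonglongrightarrow> norm x * h (sgn x)" for x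
 proof -
  have "(%j. sqrt (x \<bullet> x + (sj j)^2)) \<longlonglongrightarrow> sqrt (x \<bullet> x + 0^2)"
   by (intro tendsto_intros sj)
  hence rl: "(%j. r (sj j) x) \<longlonglongrightarrow> norm x" by (simp add: r_def norm_eq_sqrt_inner)
  show ?thesis
  proof (cases "x = 0")
   case True thus ?thesis by (simp add: H_def h0)
  next
   case False
   have "(%j. x /\<^sub>R r (sj j) x) \<longlonglongrightarrow> x /\<^sub>R norm x"
    using False by (intro tendsto_intros rl) simp
   moreover have "isCont h (x /\<^sub>R norm x)" using ch by (simp add: continuous_on_eq_continuous_at)
   ultimately have "(%j. h (x /\<^sub>R r (sj j) x)) \<longlonglongrightarrow> h (x /\<^sub>R norm x)"
    by (rule isCont_tendsto_compose[rotated])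
   thus ?thesis unfolding H_def sgn_div_norm by (intro tendsto_mult rl)
  qed
 qed
 have "(\<integral>\<^sup>+v. ennreal ((h v)^2) \<partial>sph) * M
   = (\<integral>\<^sup>+p. ennreal ((norm (fst p))^2) * ennreal ((h (sgn (fst p)))^2) * ball1 (p :: 'a \<times> 'a) \<partial>lborel)"
  unfolding M_def by (rule ball_pair_polar[symmetric]) simp
 also have "... = (\<integral>\<^sup>+p. liminf (%j. ennreal ((H (sj j) (fst p))^2) * ball1 (p :: 'a \<times> 'a)) \<partial>lborel)"
 proof (rule nn_integral_cong)
  fix q :: "'a \<times> 'a"
  have "(%j. ennreal ((H (sj j) (fst q))^2 * ball1 q)) \<longlonglongrightarrow> ennreal ((norm (fst q) * h (sgn (fst q)))^2 * ball1 q)"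
   by (intro tendsto_ennrealI tendsto_intros lim)
  hence "liminf (%j. ennreal ((H (sj j) (fst q))^2 * ball1 q)) = ennreal ((norm (fst q) * h (sgn (fst q)))^2 * ball1 q)"
   by (rule lim_imp_Liminf[rotated]) simp
  thus "ennreal ((norm (fst q))^2) * ennreal ((h (sgn (fst q)))^2) * ball1 q
   = liminf (%j. ennreal ((H (sj j) (fst q))^2) * ball1 q)"
   by (simp add: ennreal_mult power_mult_distrib ennreal_indicator)
 qed
 also have "... <= liminf (%j. \<integral>\<^sup>+p. ennreal ((H (sj j) (fst p))^2) * ball1 (p :: 'a \<times> 'a) \<partial>lborel)"
  by (rule nn_integral_liminf) simp
 also have "... <= liminf (%j::nat. ennreal (pi^2 * K^2 / ?n) * M)"
  by (intro Liminf_mono always_eventually allI bound) (simp add: sj_def)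
 also have "... = ennreal (pi^2 * K^2 / ?n) * M" by (simp add: Liminf_const)
 finally have "M * (\<integral>\<^sup>+v. ennreal ((h v)^2) \<partial>sph) <= M * ennreal (pi^2 * K^2 / ?n)"
  by (simp add: mult.commute)
 thus ?thesis
  by (subst (asm) ennreal_mult_le_mult_iff) (auto simp: M_def ball_pair_mass)
qed

lemma antipodal_difference_integrable:
 fixes f :: "'a::euclidean_space => real"
 assumes lip: "K-lipschitz_on UNIV f"
 shows "integrable sph (%v. (f v - f (- v))^2)"
  and "norm v = 1 ==> \<bar>f v - f (- v)\<bar> <= 2 * K"
proof -
 note [measurable] = lipschitz_measurable[OF lip]
 have *: "\<bar>f v - f (- v)\<bar> <= 2 * K" if "norm v = 1" for v
 proof -
  have "v - - v = 2 *\<^sub>R v" by (simp add: scaleR_2)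
  hence "norm (v - - v) = 2" using that by simp
  with lipschitz_diff[OF lip, of v "- v"] show ?thesis by (simp add: mult.commute)
 qed
 show "norm v = 1 ==> \<bar>f v - f (- v)\<bar> <= 2 * K" by (rule *)
 have "(f v - f (- v))^2 <= (2 * K)^2" if "norm v = 1" for v
  using power_mono[OF *[OF that], of 2] by simp
 thus "integrable sph (%v. (f v - f (- v))^2)"
  by (intro integrable_sphere_bounded[where C="(2 * K)^2"]) simp_all
qed

text \<open>The odd part of a smoothing of \<open>f\<close> satisfies the smooth inequality with the
  same Lipschitz constant, and half the antipodal difference is exactly this odd part. The smoothing
  radius is then sent to 0.\<close>

theorem antipodal_poincare:
 fixes f :: "'a::euclidean_space => real"
 assumes lip: "K-lipschitz_on UNIV f"
 shows "(\<integral>v. (f v - f (- v))^2 \<partial>sph) <= 4 * pi^2 * K^2 / real DIM('a)"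
proof (rule field_le_epsilon)
 fix e :: real assume e: "0 < e"
 interpret S: prob_space "sph :: 'a measure" by (rule prob_space_uniform_sphere)
 have K: "0 <= K" by (rule lipschitz_on_nonneg[OF lip])
 \<comment> \<open>Going back from \<phi> to \<open>f\<close> costs
   \<open>8 * K^2 * \<delta>\<close> in the square, hence this choice; the summand 1 in the
   denominator covers \<open>K = 0\<close>.\<close>
 define \<delta> where "\<delta> = min 1 (e / (16 * K^2 + 1))"
 have \<delta>: "0 < \<delta>" "\<delta> <= 1" "16 * K^2 * \<delta> <= e"
 proof -
  show "0 < \<delta>" "\<delta> <= 1" using e by (auto simp: \<delta>_def add_nonneg_pos)
  have "16 * K^2 * \<delta> <= 16 * K^2 * (e / (16 * K^2 + 1))" by (intro mult_left_mono) (auto simp: \<delta>_def)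
  also have "... = e * (16 * K^2 / (16 * K^2 + 1))" by simp
  also have "... <= e * 1" using e by (intro mult_left_mono) (auto simp: divide_le_eq_1 add_nonneg_pos)
  also have "... = e" by simp
  finally show "16 * K^2 * \<delta> <= e" .
 qed
 define \<phi> where "\<phi> = smoothed \<delta> f"
 have lip\<phi>: "K-lipschitz_on UNIV \<phi>" unfolding \<phi>_def using \<delta> by (intro smoothed_lipschitz[OF lip]) auto
 have cl: "\<bar>\<phi> x - f x\<bar> <= K * \<delta>" for x unfolding \<phi>_def using \<delta> by (intro smoothed_close[OF lip]) auto
 define G where "G = sphere_gradient \<delta> f"
 have DG: "GDERIV \<phi> x :> G x" for x unfolding \<phi>_def G_def by (rule smoothed_gderiv[OF lip \<delta>(1)])
 have cG: "continuous_on UNIV G"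
 proof -
  have "(K * sqrt (real DIM('a)) / \<delta>)-lipschitz_on UNIV G"
   unfolding G_def using sphere_gradient_lipschitz[OF lip \<delta>(1)] K \<delta>
   by (intro lipschitz_onI) (auto simp: dist_norm)
  thus ?thesis by (rule lipschitz_on_continuous_on)
 qed
 define h where "h x = (\<phi> x - \<phi> (- x)) / 2" for x
 have Dh: "GDERIV h x :> (G x + G (- x)) /\<^sub>R 2" for x
 proof -
  have "((%x. \<phi> (- x)) has_derivative (%d. (- d) \<bullet> G (- x))) (at x)"
   using DG[of "- x"] unfolding gderiv_def
   by (rule has_derivative_compose[rotated]) (auto intro!: derivative_eq_intros)
  with DG[of x] have "(h has_derivative (%d. (d \<bullet> G x - (- d) \<bullet> G (- x)) / 2)) (at x)"
   unfolding h_def [abs_def] gderiv_def by (auto intro!: derivative_eq_intros)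
  thus ?thesis unfolding gderiv_def by (simp add: inner_add_right)
 qed
 have lh: "K-lipschitz_on UNIV h"
 proof (rule lipschitz_onI)
  fix x y
  have "h x - h y = ((\<phi> x - \<phi> y) - (\<phi> (- x) - \<phi> (- y))) / 2" by (simp add: h_def field_simps)
  hence "\<bar>h x - h y\<bar> = \<bar>(\<phi> x - \<phi> y) - (\<phi> (- x) - \<phi> (- y))\<bar> / 2" by (metis abs_divide abs_numeral)
  also have "... <= (\<bar>\<phi> x - \<phi> y\<bar> + \<bar>\<phi> (- x) - \<phi> (- y)\<bar>) / 2"
   by (intro divide_right_mono abs_triangle_ineq4) simp
  also have "... <= K * norm (x - y)"
   using lipschitz_diff[OF lip\<phi>, of x y] lipschitz_diff[OF lip\<phi>, of "- x" "- y"] by (simp add: norm_minus_commute)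
  finally show "dist (h x) (h y) <= K * dist x y" by (simp add: dist_norm)
 qed (rule K)
 have "(\<integral>\<^sup>+v. ennreal ((h v)^2) \<partial>sph) <= ennreal (pi^2 * K^2 / real DIM('a))"
 proof (rule odd_sphere_poincare_smooth[OF Dh])
  show "continuous_on UNIV (%x. (G x + G (- x)) /\<^sub>R 2)"
   by (intro continuous_intros cG continuous_on_compose2[OF cG]) auto
  show "norm ((G x + G (- x)) /\<^sub>R 2) <= K" for x
   using gradient_norm_le[OF lip\<phi> DG, of x] gradient_norm_le[OF lip\<phi> DG, of "- x"] norm_triangle_ineq[of "G x" "G (- x)"]
   by simp
 qed (rule lh, simp add: h_def field_simps)
 moreover have hi: "integrable sph (%v. (h v)^2)"
  unfolding h_def power_divide using antipodal_difference_integrable(1)[OF lip\<phi>] by simp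
 ultimately have "(\<integral>v. (h v)^2 \<partial>sph) <= pi^2 * K^2 / real DIM('a)"
  by (subst (asm) nn_integral_eq_integral) (auto simp: ennreal_le_iff)
 hence 1: "(\<integral>v. (\<phi> v - \<phi> (- v))^2 \<partial>sph) <= 4 * pi^2 * K^2 / real DIM('a)"
  unfolding h_def power_divide by (simp add: mult_ac)
 have "(\<integral>v. (f v - f (- v))^2 \<partial>sph) <= (\<integral>v. (\<phi> v - \<phi> (- v))^2 + 8 * K^2 * \<delta> \<partial>sph)"
 proof (rule integral_mono_AE)
  show "AE v in sph. (f v - f (- v))^2 <= (\<phi> v - \<phi> (- v))^2 + 8 * K^2 * \<delta>"
   using AE_uniform_sphere_norm
  proof eventually_elim
   fix v :: 'a assume v: "norm v = 1"
   let ?a = "f v - f (- v)" and ?b = "\<phi> v - \<phi> (- v)"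
   have a: "\<bar>?a\<bar> <= 2 * K" "\<bar>?b\<bar> <= 2 * K"
    using antipodal_difference_integrable(2)[OF lip v] antipodal_difference_integrable(2)[OF lip\<phi> v] by auto
   have ab: "\<bar>?a - ?b\<bar> <= 2 * (K * \<delta>)" using cl[of v] cl[of "- v"] by linarith
   have "?a^2 - ?b^2 = (?a - ?b) * (?a + ?b)" by (simp add: sq_eq algebra_simps)
   also have "... <= \<bar>?a - ?b\<bar> * \<bar>?a + ?b\<bar>" by (metis abs_ge_self abs_mult)
   also have "... <= (2 * (K * \<delta>)) * (4 * K)" using a ab by (intro mult_mono) linarith+
   finally show "?a^2 <= ?b^2 + 8 * K^2 * \<delta>" by (simp add: sq_eq algebra_simps)
  qed
 qed (use antipodal_difference_integrable(1)[OF lip] antipodal_difference_integrable(1)[OF lip\<phi>] in auto)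
 also have "... = (\<integral>v. (\<phi> v - \<phi> (- v))^2 \<partial>sph) + 8 * K^2 * \<delta>"
  using antipodal_difference_integrable(1)[OF lip\<phi>] S.prob_space by simp
 finally show "(\<integral>v. (f v - f (- v))^2 \<partial>sph) <= 4 * pi^2 * K^2 / real DIM('a) + e"
  using 1 \<delta> mult_nonneg_nonneg[OF zero_le_power2[of K] less_imp_le[OF \<delta>(1)]] by linarith
qed

section \<open>The Clarke gradient\<close>

lemma quotient_bound:
 fixes f :: "'a::real_normed_vector => real"
 assumes lip: "K-lipschitz_on UNIV f" and t: "0 < t"
 shows "\<bar>(f (y + t *\<^sub>R d) - f y) / t\<bar> <= K * norm d"
 using lipschitz_diff[OF lip, of "y + t *\<^sub>R d" y] t by (simp add: divide_simps mult_ac)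

lemma clarke_dirderiv_bounds:
 fixes f :: "'a::real_normed_vector => real"
 assumes lip: "K-lipschitz_on UNIV f"
 shows "clarke_dirderiv f x d <= ereal (K * norm d)" "ereal (- (K * norm d)) <= clarke_dirderiv f x d"
proof -
 have ev: "\<forall>\<^sub>F p in nhds x \<times>\<^sub>F at_right (0::real). 0 < snd p"
  unfolding eventually_prod_filter
  by (rule exI[of _ "%_. True"], rule exI[of _ "%t. 0 < t"]) (auto simp: eventually_at_right_less)
 show "clarke_dirderiv f x d <= ereal (K * norm d)"
  unfolding clarke_dirderiv_def
 proof (rule Limsup_bounded)
  show "\<forall>\<^sub>F p in nhds x \<times>\<^sub>F at_right 0. (case p of (y, t) => ereal ((f (y + t *\<^sub>R d) - f y) / t)) <= ereal (K * norm d)"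
   using ev
  proof eventually_elim
   case (elim p)
   thus ?case using quotient_bound[OF lip, of "snd p" "fst p" d, unfolded abs_le_iff] by (cases p) auto
  qed
 qed
 show "ereal (- (K * norm d)) <= clarke_dirderiv f x d"
  unfolding clarke_dirderiv_def
 proof (rule le_Limsup)
  show "\<forall>\<^sub>F p in nhds x \<times>\<^sub>F at_right 0. ereal (- (K * norm d)) <= (case p of (y, t) => ereal ((f (y + t *\<^sub>R d) - f y) / t))"
   using ev
  proof eventually_elim
   case (elim p)
   thus ?case using quotient_bound[OF lip, of "snd p" "fst p" d, unfolded abs_le_iff] by (cases p) auto
  qed
 qed (simp add: prod_filter_eq_bot)
qed

lemma clarke_dirderiv_lessD:
 assumes "clarke_dirderiv f x d < ereal c"
 obtains r where "0 < r" "!!y t. dist y x < r ==> 0 < t ==> t < r ==> (f (y + t *\<^sub>R d) - f y) / t < c"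
proof -
 have "\<forall>\<^sub>F p in nhds x \<times>\<^sub>F at_right 0. (case p of (y, t) => ereal ((f (y + t *\<^sub>R d) - f y) / t)) < ereal c"
  using assms unfolding clarke_dirderiv_def by (rule Limsup_lessD)
 then obtain P Q where P: "eventually P (nhds x)" and Q: "eventually Q (at_right (0::real))"
  and PQ: "!!y t. P y ==> Q t ==> (f (y + t *\<^sub>R d) - f y) / t < c"
  unfolding eventually_prod_filter by auto
 obtain r1 where r1: "0 < r1" "!!y. dist y x < r1 ==> P y" using P unfolding eventually_nhds_metric by blast
 obtain r2 where r2: "0 < r2" "!!t. 0 < t ==> t < r2 ==> Q t" using Q unfolding eventually_at_right_field by blast
 show ?thesis by (rule that[of "min r1 r2"]) (use r1 r2 PQ in auto)
qed

lemma clarke_dirderiv_approach: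
 assumes "ereal c < clarke_dirderiv f x d" "0 < e"
 obtains y t where "dist y x < e" "0 < t" "t < e" "c < (f (y + t *\<^sub>R d) - f y) / t"
proof (rule ccontr)
 assume neg: "\<not> thesis"
 have "\<forall>\<^sub>F p in nhds x \<times>\<^sub>F at_right (0::real). dist (fst p) x < e & 0 < snd p & snd p < e"
  unfolding eventually_prod_filter
  by (rule exI[of _ "%y. dist y x < e"], rule exI[of _ "%t. 0 < t & t < e"])
    (use assms(2) in \<open>auto simp: eventually_nhds_metric eventually_at_right_field\<close>)
 hence "\<forall>\<^sub>F p in nhds x \<times>\<^sub>F at_right 0. (case p of (y, t) => ereal ((f (y + t *\<^sub>R d) - f y) / t)) <= ereal c"
 proof eventually_elim
  case (elim p)
  thus ?case using neg that by (cases p) (auto simp: not_less[symmetric])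
 qed
 hence "clarke_dirderiv f x d <= ereal c" unfolding clarke_dirderiv_def by (rule Limsup_bounded)
 with assms show False by simp
qed

text \<open>Difference quotients of the smoothed function are averages of difference quotients of
  \<open>f\<close> over the ball, so a uniform bound on the latter survives the limit.\<close>

lemma sphere_gradient_le_quotient:
 fixes f :: "'a::euclidean_space => real"
 assumes lip: "K-lipschitz_on UNIV f" and eta: "0 < \<eta>" and r: "0 < r"
  and q: "!!y t. y \<in> cball x \<eta> ==> 0 < t ==> t < r ==> (f (y + t *\<^sub>R d) - f y) / t <= c"
 shows "sphere_gradient \<eta> f x \<bullet> d <= c"
proof -
 have D: "((%t. smoothed \<eta> f (x + t *\<^sub>R d)) has_real_derivative (d \<bullet> sphere_gradient \<eta> f x)) (at 0)"
  by (rule GDERIV_along) (use smoothed_gderiv[OF lip eta, of x] in simp)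
 hence "((%t. (smoothed \<eta> f (x + t *\<^sub>R d) - smoothed \<eta> f x) / t) \<longlongrightarrow> d \<bullet> sphere_gradient \<eta> f x) (at 0)"
  by (simp add: has_field_derivative_iff)
 hence "((%t. (smoothed \<eta> f (x + t *\<^sub>R d) - smoothed \<eta> f x) / t) \<longlongrightarrow> d \<bullet> sphere_gradient \<eta> f x) (at_right 0)"
  by (rule tendsto_mono[rotated]) (rule at_le, simp)
 moreover have "\<forall>\<^sub>F t in at_right 0. (smoothed \<eta> f (x + t *\<^sub>R d) - smoothed \<eta> f x) / t <= c"
  unfolding eventually_at_right_field
 proof (intro exI[of _ r] conjI allI impI r)
  fix t :: real assume t: "0 < t" "t < r"
  have "smoothed \<eta> f (x + t *\<^sub>R d) <= smoothed \<eta> f x + c * t"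
  proof (rule smoothed_mono[OF lip lip])
   fix u :: 'a assume u: "norm u <= 1"
   have "x + \<eta> *\<^sub>R u \<in> cball x \<eta>" using u eta by (simp add: dist_norm mult_left_le)
   from q[OF this t] t show "f (x + t *\<^sub>R d + \<eta> *\<^sub>R u) <= f (x + \<eta> *\<^sub>R u) + c * t"
    by (simp add: field_simps)
  qed (use eta in simp)
  thus "(smoothed \<eta> f (x + t *\<^sub>R d) - smoothed \<eta> f x) / t <= c" using t by (simp add: field_simps)
 qed
 ultimately have "d \<bullet> sphere_gradient \<eta> f x <= c" by (rule tendsto_upperbound) simp
 thus ?thesis by (simp add: inner_commute)
qed

text \<open>Near-optimal difference quotients are turned, by smoothing at a tiny scale and the mean
  value theorem, into smoothed gradients at points close to \<open>x\<close>. These are bounded by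
  \<open>K\<close>, so a subsequence converges. The limit is a Clarke gradient because an upper
  bound on all quotients near \<open>x\<close> in some direction also bounds the smoothed gradients
  there.\<close>

lemma clarke_gradient_attains:
 fixes f :: "'a::euclidean_space => real"
 assumes lip: "K-lipschitz_on UNIV f"
 shows "\<exists>g\<in>clarke_gradient f x. clarke_dirderiv f x d <= ereal (g \<bullet> d)"
proof -
 have K: "0 <= K" by (rule lipschitz_on_nonneg[OF lip])
 obtain c where c: "clarke_dirderiv f x d = ereal c"
  using clarke_dirderiv_bounds(1)[OF lip, of x d] clarke_dirderiv_bounds(2)[OF lip, of d x] by (cases "clarke_dirderiv f x d") auto
 define e where "e j = 1 / real (Suc j)" for j
 have e0: "0 < e j" for j by (simp add: e_def)
 have elim: "e \<longlonglongrightarrow> 0" unfolding e_def [abs_def] by (rule LIMSEQ_inverse_real_of_nat[unfolded inverse_eq_divide])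
 have "\<exists>\<delta> z. 0 < \<delta> & \<delta> < e j & dist z x <= e j * (1 + norm d) & c - 2 * e j <= sphere_gradient \<delta> f z \<bullet> d" for j
 proof -
  have "ereal (c - e j) < clarke_dirderiv f x d" using e0[of j] by (simp add: c)
  then obtain y t where y: "dist y x < e j" and t: "0 < t" "t < e j" and q: "c - e j < (f (y + t *\<^sub>R d) - f y) / t"
   using e0[of j] by (rule clarke_dirderiv_approach)
  \<comment> \<open>Smoothing errs by at most \<open>K * \<delta>\<close> at either end of the
    segment; the second entry keeps their sum below \<open>t * e j\<close>, which after division by
    \<open>t\<close> is the second \<open>e j\<close> in the claim. The first entry makes the
    smoothing balls shrink to \<open>x\<close>.\<close>
  define \<delta> where "\<delta> = min (e j / 2) (t * e j / (2 * K + 1))"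
  have \<delta>: "0 < \<delta>" "\<delta> < e j" using e0[of j] t K by (auto simp: \<delta>_def)
  have K\<delta>: "2 * (K * \<delta>) <= t * e j"
  proof -
   have "2 * (K * \<delta>) <= (2 * K + 1) * \<delta>" using \<delta> by (simp add: algebra_simps)
   also have "... <= (2 * K + 1) * (t * e j / (2 * K + 1))" using K by (intro mult_left_mono) (auto simp: \<delta>_def)
   also have "... = t * e j" using K by simp
   finally show ?thesis .
  qed
  have "\<exists>s>0. s < t & smoothed \<delta> f (y + t *\<^sub>R d) - smoothed \<delta> f (y + 0 *\<^sub>R d) = (t - 0) * (d \<bullet> sphere_gradient \<delta> f (y + s *\<^sub>R d))"
   using t by (intro MVT2) (auto intro!: GDERIV_along smoothed_gderiv[OF lip \<delta>(1)])
  then obtain s where s: "0 < s" "s < t"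
   and mv: "smoothed \<delta> f (y + t *\<^sub>R d) - smoothed \<delta> f y = t * (d \<bullet> sphere_gradient \<delta> f (y + s *\<^sub>R d))" by auto
  have "(c - e j) * t < f (y + t *\<^sub>R d) - f y" using q t by (simp add: field_simps)
  also have "... <= smoothed \<delta> f (y + t *\<^sub>R d) - smoothed \<delta> f y + t * e j"
   using smoothed_close[OF lip, of \<delta> "y + t *\<^sub>R d"] smoothed_close[OF lip, of \<delta> y] \<delta> K\<delta> by linarith
  finally have "t * (c - 2 * e j) < t * (d \<bullet> sphere_gradient \<delta> f (y + s *\<^sub>R d))" unfolding mv by (simp add: algebra_simps)
  hence "c - 2 * e j <= sphere_gradient \<delta> f (y + s *\<^sub>R d) \<bullet> d" using t by (simp add: inner_commute)
  moreover have "dist (y + s *\<^sub>R d) x <= e j * (1 + norm d)"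
  proof -
   have "dist (y + s *\<^sub>R d) x <= dist y x + norm (s *\<^sub>R d)"
    unfolding dist_norm using norm_triangle_ineq[of "y - x" "s *\<^sub>R d"] by (simp add: algebra_simps)
   also have "... <= e j + e j * norm d"
    using y s t by (intro add_mono) (auto intro!: mult_right_mono)
   finally show ?thesis by (simp add: algebra_simps)
  qed
  ultimately show ?thesis using \<delta> by blast
 qed
 then obtain \<delta> z where \<delta>: "!!j. 0 < \<delta> j" "!!j. \<delta> j < e j" and z: "!!j. dist (z j) x <= e j * (1 + norm d)"
  and g: "!!j. c - 2 * e j <= sphere_gradient (\<delta> j) f (z j) \<bullet> d" by metis
 define G where "G j = sphere_gradient (\<delta> j) f (z j)" for j
 have "\<forall>j. G j \<in> cball 0 K"
 proof
  fix j
  have "K-lipschitz_on UNIV (smoothed (\<delta> j) f)" using \<delta>(1)[of j] by (intro smoothed_lipschitz[OF lip]) simp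
  from gradient_norm_le[OF this smoothed_gderiv[OF lip \<delta>(1)]] show "G j \<in> cball 0 K" by (simp add: G_def)
 qed
 then obtain g0 \<sigma> where \<sigma>: "strict_mono (\<sigma> :: nat => nat)" and lim: "(G \<circ> \<sigma>) \<longlonglongrightarrow> g0"
  using compact_cball[of "0::'a" K] unfolding compact_def by blast
 have el: "(e \<circ> \<sigma>) \<longlonglongrightarrow> 0" using elim \<sigma> by (rule LIMSEQ_subseq_LIMSEQ)
 have "c <= g0 \<bullet> d"
 proof (rule LIMSEQ_le)
  show "(%j. c - 2 * (e \<circ> \<sigma>) j) \<longlonglongrightarrow> c" using tendsto_diff[OF tendsto_const tendsto_mult[OF tendsto_const el]] by simp
  show "(%j. (G \<circ> \<sigma>) j \<bullet> d) \<longlonglongrightarrow> g0 \<bullet> d" by (intro tendsto_intros lim)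
  show "\<exists>N. \<forall>n\<ge>N. c - 2 * (e \<circ> \<sigma>) n <= (G \<circ> \<sigma>) n \<bullet> d" using g by (auto simp: G_def)
 qed
 moreover have "g0 \<in> clarke_gradient f x"
  unfolding clarke_gradient_def mem_Collect_eq
 proof (intro allI)
  fix d' :: 'a
  show "ereal (g0 \<bullet> d') <= clarke_dirderiv f x d'"
  proof (rule ccontr)
   assume "\<not> ereal (g0 \<bullet> d') <= clarke_dirderiv f x d'"
   then obtain b where b: "clarke_dirderiv f x d' < ereal b" "ereal b < ereal (g0 \<bullet> d')"
    using ereal_dense2[of "clarke_dirderiv f x d'" "ereal (g0 \<bullet> d')"] by (auto simp: not_le)
   obtain r where r: "0 < r" and rq: "!!y t. dist y x < r ==> 0 < t ==> t < r ==> (f (y + t *\<^sub>R d') - f y) / t < b"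
    using clarke_dirderiv_lessD[OF b(1)] by blast
   have "(%j. (e \<circ> \<sigma>) j * (1 + norm d) + (e \<circ> \<sigma>) j) \<longlonglongrightarrow> 0 * (1 + norm d) + 0"
    by (intro tendsto_intros el)
   hence "\<forall>\<^sub>F j in sequentially. (e \<circ> \<sigma>) j * (1 + norm d) + (e \<circ> \<sigma>) j < r"
    using r by (intro order_tendstoD(2)) auto
   hence "\<forall>\<^sub>F j in sequentially. (G \<circ> \<sigma>) j \<bullet> d' <= b"
   proof eventually_elim
    fix j assume j: "(e \<circ> \<sigma>) j * (1 + norm d) + (e \<circ> \<sigma>) j < r"
    show "(G \<circ> \<sigma>) j \<bullet> d' <= b"
     unfolding G_def o_def
    proof (rule sphere_gradient_le_quotient[OF lip \<delta>(1) r])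
     fix y t assume y: "y \<in> cball (z (\<sigma> j)) (\<delta> (\<sigma> j))" and t: "0 < t" "t < r"
     have "dist y x < r" using dist_triangle[of y x "z (\<sigma> j)"] y z[of "\<sigma> j"] \<delta>(2)[of "\<sigma> j"] j
      by (simp add: dist_commute)
     from rq[OF this t] show "(f (y + t *\<^sub>R d') - f y) / t <= b" by simp
    qed
   qed
   moreover have "(%j. (G \<circ> \<sigma>) j \<bullet> d') \<longlonglongrightarrow> g0 \<bullet> d'" by (intro tendsto_intros lim)
   ultimately have "g0 \<bullet> d' <= b" by (intro tendsto_upperbound[OF _ _ sequentially_bot])
   with b(2) show False by simp
  qed
 qed
 ultimately show ?thesis unfolding c by (intro bexI[of _ g0]) auto
qed

text \<open>A distance to a set is a distance to its closure, so it suffices that the closure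
  contains the smoothed gradient. Otherwise a hyperplane separates them strictly: in one direction
  all Clarke derivatives over the ball stay below a constant, compactness of the ball makes this
  uniform for difference quotients, and averaging contradicts the separation.\<close>

theorem clarke_eta_gradient_infdist:
 fixes f :: "'a::euclidean_space => real"
 assumes lip: "K-lipschitz_on UNIV f" and eta: "0 < \<eta>"
 shows "infdist 0 (clarke_eta_gradient \<eta> f x) <= norm (sphere_gradient \<eta> f x)"
proof -
 define U where "U = clarke_eta_gradient \<eta> f x"
 define G where "G = sphere_gradient \<eta> f x"
 have "G \<in> closure U"
 proof (rule ccontr)
  assume "G \<notin> closure U"
  moreover have "convex (closure U)" unfolding U_def clarke_eta_gradient_def by (intro convex_closure convex_convex_hull)
  ultimately obtain a b where ab: "a \<bullet> G < b" "!!z. z \<in> closure U ==> b < a \<bullet> z"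
   using separating_hyperplane_closed_point[of "closure U" G] by auto
  define d where "d = - a"
  have lt: "clarke_dirderiv f y d < ereal (- b)" if y: "y \<in> cball x \<eta>" for y
  proof -
   obtain g where g: "g \<in> clarke_gradient f y" "clarke_dirderiv f y d <= ereal (g \<bullet> d)"
    using clarke_gradient_attains[OF lip, of y d] by blast
   have "g \<in> U" unfolding U_def clarke_eta_gradient_def using g y by (intro hull_inc) blast
   hence "b < a \<bullet> g" using ab(2) closure_subset by blast
   hence "ereal (g \<bullet> d) < ereal (- b)" by (simp add: d_def inner_commute)
   with g(2) show ?thesis by (rule le_less_trans)
  qed
  have "\<forall>y\<in>cball x \<eta>. \<exists>r>0. \<forall>y' t. dist y' y < r \<longrightarrow> 0 < t \<longrightarrow> t < r \<longrightarrow> (f (y' + t *\<^sub>R d) - f y') / t < - b"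
   using clarke_dirderiv_lessD[OF lt] by metis
  then obtain \<rho> where \<rho>: "!!y. y \<in> cball x \<eta> ==> 0 < \<rho> y"
   and \<rho>q: "!!y y' t. y \<in> cball x \<eta> ==> dist y' y < \<rho> y ==> 0 < t ==> t < \<rho> y ==> (f (y' + t *\<^sub>R d) - f y') / t < - b"
   unfolding bchoice_iff by blast
  have "cball x \<eta> <= (\<Union>y\<in>cball x \<eta>. ball y (\<rho> y))"
   using \<rho> by (auto intro!: bexI)
  then obtain Y where Y: "Y <= cball x \<eta>" "finite Y" "cball x \<eta> <= (\<Union>y\<in>Y. ball y (\<rho> y))"
   using compactE_image[OF compact_cball, of "cball x \<eta>" "%y. ball y (\<rho> y)" x \<eta>] by auto
  have Yne: "Y ~= {}" using Y(3) eta centre_in_cball[of x \<eta>] by auto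
  define r where "r = Min (\<rho> ` Y)"
  have r: "0 < r" unfolding r_def using Y(1,2) Yne \<rho> by (subst Min_gr_iff) auto
  have "G \<bullet> d <= - b" unfolding G_def
  proof (rule sphere_gradient_le_quotient[OF lip eta r])
   fix y t assume y: "y \<in> cball x \<eta>" and t: "0 < t" "t < r"
   then obtain y0 where y0: "y0 \<in> Y" "dist y0 y < \<rho> y0" using Y(3) by auto
   have "r <= \<rho> y0" unfolding r_def using Y(2) y0(1) by (intro Min_le) auto
   with \<rho>q[of y0 y t] y0 Y(1) t show "(f (y + t *\<^sub>R d) - f y) / t <= - b" by (force simp: dist_commute)
  qed
  with ab(1) show False by (simp add: d_def inner_commute)
 qed
 show ?thesis unfolding U_def[symmetric] G_def[symmetric]
 proof (rule field_le_epsilon)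
  fix e :: real assume "0 < e"
  with \<open>G \<in> closure U\<close> obtain h where h: "h \<in> U" "dist h G < e" unfolding closure_approachable by blast
  have "infdist 0 U <= dist 0 h" using h(1) by (rule infdist_le)
  also have "... <= norm G + e" using h(2) norm_triangle_sub[of h G] by (simp add: dist_norm)
  finally show "infdist 0 U <= norm G + e" .
 qed
qed

section \<open>The mixing matrix\<close>

lemma norm_matrix_sq: "(norm (X :: real^'n^'m))^2 = (\<Sum>i\<in>UNIV. \<Sum>j\<in>UNIV. (X $ i $ j)^2)"
 unfolding power2_norm_eq_inner by (simp add: inner_vec_def sq_eq)

lemma norm_vector_sq: "(norm (e :: real^'m))^2 = (\<Sum>i\<in>UNIV. (e $ i)^2)"
 unfolding power2_norm_eq_inner by (simp add: inner_vec_def sq_eq)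

lemma norm_rows_sq: "(norm (X :: real^'n^'m))^2 = (\<Sum>i\<in>UNIV. (norm (X $ i))^2)"
 by (simp add: power2_norm_eq_inner inner_vec_def)

text \<open>The squared Frobenius norm is a sum over columns, and the operator norm bounds each
  column.\<close>

lemma norm_matrix_mult_le:
 fixes A :: "real^'m^'m" and X :: "real^'n^'m"
 shows "norm (A ** X) <= onorm ((*v) A) * norm X"
proof (rule power2_le_imp_le)
 have bl: "bounded_linear ((*v) A)" by (rule matrix_vector_mul_bounded_linear)
 have "(norm (A ** X))^2 = (\<Sum>j\<in>UNIV. \<Sum>i\<in>UNIV. ((A ** X) $ i $ j)^2)"
  unfolding norm_matrix_sq by (rule sum.swap)
 also have "... = (\<Sum>j\<in>UNIV. (norm (A *v column j X))^2)"
  by (intro sum.cong refl) (simp add: norm_vector_sq matrix_matrix_mult_def matrix_vector_mult_def column_def)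
 also have "... <= (\<Sum>j\<in>UNIV. (onorm ((*v) A))^2 * (norm (column j X))^2)"
  unfolding power_mult_distrib[symmetric] by (intro sum_mono power_mono onorm[OF bl]) simp
 also have "... = (onorm ((*v) A))^2 * (\<Sum>j\<in>UNIV. \<Sum>i\<in>UNIV. (X $ i $ j)^2)"
  by (simp add: sum_distrib_left norm_vector_sq column_def)
 also have "(\<Sum>j\<in>UNIV. \<Sum>i\<in>UNIV. (X $ i $ j)^2) = (norm X)^2"
  unfolding norm_matrix_sq by (rule sum.swap)
 finally show "(norm (A ** X))^2 <= (onorm ((*v) A) * norm X)^2" by (simp add: power_mult_distrib)
 show "0 <= onorm ((*v) A) * norm X" using onorm_pos_le[OF bl] by simp
qed

definition mixing :: "real^'m^'m => real^'m^'m" where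
 "mixing W = W - (\<chi> i j. 1 / real CARD('m))"

lemma lambda_W_mixing: "lambda_W W = onorm ((*v) (mixing W))"
 by (simp add: lambda_W_def mixing_def)

lemma lambda_W_nonneg: "0 <= lambda_W W"
 unfolding lambda_W_mixing by (rule onorm_pos_le) (rule matrix_vector_mul_bounded_linear)

lemma mixing_norm_le: "norm (mixing W ** X) <= lambda_W W * norm X"
 unfolding lambda_W_mixing by (rule norm_matrix_mult_le)

lemma average_component: "average (X :: real^'n^'m) $ j = (\<Sum>i\<in>UNIV. X $ i $ j) / real CARD('m)"
 by (simp add: average_def)

lemma average_add: "average (X + Y) = average X + average Y"
 by (simp add: average_def sum.distrib scaleR_add_right)

lemma average_diff: "average (X - Y) = average X - average Y"
 by (simp add: average_def sum_subtractf scaleR_diff_right)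

lemma average_scaleR: "average (c *\<^sub>R X) = c *\<^sub>R average X"
 by (simp add: average_def scaleR_sum_right mult.commute)

lemma average_0 [simp]: "average 0 = 0"
 by (simp add: average_def)

lemma deviation_diff: "deviation (X - Y) = deviation X - deviation Y"
 by (simp add: deviation_def vec_eq_iff average_diff)

lemma deviation_0 [simp]: "deviation 0 = 0"
 by (simp add: deviation_def vec_eq_iff)

lemma average_deviation [simp]: "average (deviation (X :: real^'n^'m)) = 0"
 by (simp add: vec_eq_iff average_component deviation_def sum_subtractf)

lemma norm_split_average:
 fixes X :: "real^'n^'m"
 shows "(norm X)^2 = (norm (deviation X))^2 + real CARD('m) * (norm (average X))^2"
proof -
 have z: "(\<Sum>i\<in>UNIV. deviation X $ i) = 0"
  using average_deviation[of X] unfolding average_def by simp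
 have "(norm X)^2 = (\<Sum>i\<in>UNIV. (norm (deviation X $ i + average X))^2)"
  unfolding norm_rows_sq by (simp add: deviation_def)
 also have "... = (\<Sum>i\<in>UNIV. (norm (deviation X $ i))^2 + 2 * (deviation X $ i \<bullet> average X) + (norm (average X))^2)"
  by (simp add: power2_norm_eq_inner inner_add inner_commute algebra_simps)
 also have "... = (norm (deviation X))^2 + 2 * ((\<Sum>i\<in>UNIV. deviation X $ i) \<bullet> average X) + real CARD('m) * (norm (average X))^2"
  by (simp add: sum.distrib sum_distrib_left[symmetric] inner_sum_left norm_rows_sq)
 finally show ?thesis by (simp add: z)
qed

lemma norm_average_sq_le:
 fixes X :: "real^'n^'m"
 shows "(norm (average X))^2 <= (norm X)^2 / real CARD('m)"
 using norm_split_average[of X] by (simp add: field_simps)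

lemma ds_rows: "doubly_stochastic W ==> (\<Sum>j\<in>UNIV. W $ i $ j) = 1"
 and ds_cols: "doubly_stochastic W ==> (\<Sum>i\<in>UNIV. W $ i $ j) = 1"
 and ds_nonneg: "doubly_stochastic W ==> 0 <= W $ i $ j"
 by (simp_all add: doubly_stochastic_def)

lemma average_mult:
 fixes W :: "real^'m^'m" and X :: "real^'n^'m"
 assumes ds: "doubly_stochastic W"
 shows "average (W ** X) = average X"
proof -
 have "(\<Sum>i\<in>UNIV. \<Sum>k\<in>UNIV. W $ i $ k * X $ k $ j) = (\<Sum>k\<in>UNIV. X $ k $ j)" for j
  by (subst sum.swap) (simp add: sum_distrib_right[symmetric] ds_cols[OF ds])
 thus ?thesis by (simp add: vec_eq_iff average_component matrix_matrix_mult_def)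
qed

lemma mixing_mult_component:
 fixes W :: "real^'m^'m" and X :: "real^'n^'m"
 shows "(mixing W ** X) $ i $ j = (W ** X) $ i $ j - average X $ j"
 by (simp add: mixing_def matrix_matrix_mult_def left_diff_distrib sum_subtractf average_component sum_divide_distrib)

lemma deviation_mult:
 fixes W :: "real^'m^'m" and X :: "real^'n^'m"
 assumes ds: "doubly_stochastic W"
 shows "deviation (W ** X) = mixing W ** X"
 by (simp add: vec_eq_iff mixing_mult_component deviation_def average_mult[OF ds])

lemma mixing_deviation:
 fixes W :: "real^'m^'m" and X :: "real^'n^'m"
 assumes ds: "doubly_stochastic W"
 shows "mixing W ** deviation X = mixing W ** X"
proof -
 have "(W ** deviation X) $ i $ j = (W ** X) $ i $ j - average X $ j" for i j
  by (simp add: matrix_matrix_mult_def deviation_def right_diff_distrib sum_subtractf sum_distrib_right[symmetric] ds_rows[OF ds])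
 thus ?thesis by (simp add: vec_eq_iff mixing_mult_component)
qed

text \<open>By Cauchy-Schwarz each row, having sum one, has squared norm at least 1/m. The bound
  lets numerical constants be absorbed into terms that carry w^2.\<close>

lemma frobenius_ge_one:
 fixes W :: "real^'m^'m"
 assumes ds: "doubly_stochastic W"
 shows "1 <= norm W"
proof -
 have "1 / real CARD('m) <= (\<Sum>j\<in>UNIV. (W $ i $ j)^2)" for i
  using sum_squared_le_sum_of_squares[of "%j. W $ i $ j" "UNIV :: 'm set"] ds_rows[OF ds, of i]
  by (simp add: field_simps)
 hence "(\<Sum>i\<in>(UNIV :: 'm set). 1 / real CARD('m)) <= (norm W)^2" unfolding norm_matrix_sq by (intro sum_mono)
 hence "1^2 <= (norm W)^2" by simp
 thus ?thesis by (rule power2_le_imp_le) simp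
qed

text \<open>Row by row this is the variance identity for the weights of that row; the column sums
  turn the weighted squares back into the norm of \<open>d\<close>. It is the defect in Jensen's
  inequality.\<close>

lemma stochastic_energy_gap:
 fixes W :: "real^'m^'m" and d :: "real^'m"
 assumes ds: "doubly_stochastic W"
 shows "(norm d)^2 - (norm (W *v d))^2 = (\<Sum>i\<in>UNIV. \<Sum>j\<in>UNIV. W $ i $ j * (d $ j - (W *v d) $ i)^2)"
proof -
 note nv = norm_vector_sq
 have "(\<Sum>j\<in>UNIV. W $ i $ j * (d $ j - (W *v d) $ i)^2) = (\<Sum>j\<in>UNIV. W $ i $ j * (d $ j)^2) - ((W *v d) $ i)^2" for i
 proof -
  have "(\<Sum>j\<in>UNIV. W $ i $ j * (d $ j - (W *v d) $ i)^2)
   = (\<Sum>j\<in>UNIV. W $ i $ j * (d $ j)^2 - 2 * (W *v d) $ i * (W $ i $ j * d $ j) + ((W *v d) $ i)^2 * W $ i $ j)"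
   by (simp add: power2_diff algebra_simps)
  also have "... = (\<Sum>j\<in>UNIV. W $ i $ j * (d $ j)^2) - 2 * (W *v d) $ i * (\<Sum>j\<in>UNIV. W $ i $ j * d $ j) + ((W *v d) $ i)^2 * (\<Sum>j\<in>UNIV. W $ i $ j)"
   by (simp add: sum.distrib sum_subtractf sum_distrib_left)
  also have "(\<Sum>j\<in>UNIV. W $ i $ j * d $ j) = (W *v d) $ i" by (simp add: matrix_vector_mult_def)
  finally show ?thesis by (simp add: ds_rows[OF ds] sq_eq)
 qed
 hence "(\<Sum>i\<in>UNIV. \<Sum>j\<in>UNIV. W $ i $ j * (d $ j - (W *v d) $ i)^2)
   = (\<Sum>i\<in>UNIV. \<Sum>j\<in>UNIV. W $ i $ j * (d $ j)^2) - (\<Sum>i\<in>UNIV. ((W *v d) $ i)^2)"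
  by (simp add: sum_subtractf)
 also have "(\<Sum>i\<in>UNIV. \<Sum>j\<in>UNIV. W $ i $ j * (d $ j)^2) = (\<Sum>j\<in>UNIV. (d $ j)^2)"
  by (subst sum.swap) (simp add: sum_distrib_right[symmetric] ds_cols[OF ds])
 finally show ?thesis by (simp add: nv)
qed

text \<open>Equality in Jensen's inequality forces a vector to be constant along walks of even length; the
 self-loop makes every walk even.\<close>

lemma network_strict_contraction:
 fixes W :: "real^'m^'m" and x :: "real^'m"
 assumes net: "network E W" and x: "x ~= 0"
 shows "norm (mixing W *v x) < norm x"
proof -
 have ds: "doubly_stochastic W" using net by (simp add: network_def)
 define c where "c = (\<Sum>i\<in>UNIV. x $ i) / real CARD('m)"
 define d where "d = x - (\<chi> i. c)"
 have Ax: "mixing W *v x = W *v d"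
  by (simp add: vec_eq_iff mixing_def matrix_vector_mult_def d_def c_def left_diff_distrib right_diff_distrib
    sum_subtractf sum_distrib_right[symmetric] ds_rows[OF ds] sum_divide_distrib)
 note nv = norm_vector_sq
 have sd: "(\<Sum>i\<in>UNIV. d $ i) = 0" by (simp add: d_def c_def sum_subtractf)
 have "(norm x)^2 = (\<Sum>i\<in>UNIV. (d $ i)^2 + 2 * c * d $ i + c^2)"
  unfolding nv by (simp add: d_def power2_diff algebra_simps sq_eq)
 also have "... = (norm d)^2 + 2 * c * (\<Sum>i\<in>UNIV. d $ i) + real CARD('m) * c^2"
  unfolding nv by (simp add: sum.distrib sum_distrib_left)
 finally have nx: "(norm x)^2 = (norm d)^2 + real CARD('m) * c^2" by (simp add: sd)
 have gap: "0 <= (norm d)^2 - (norm (W *v d))^2"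
  unfolding stochastic_energy_gap[OF ds] by (intro sum_nonneg mult_nonneg_nonneg ds_nonneg[OF ds]) simp
 have "(norm (W *v d))^2 < (norm x)^2"
 proof (rule ccontr)
  assume "\<not> ?thesis"
  moreover have "0 <= real CARD('m) * c^2" by simp
  ultimately have eq: "(norm d)^2 - (norm (W *v d))^2 = 0" and c0: "real CARD('m) * c^2 = 0"
   using gap nx by linarith+
  from eq have "(\<Sum>i\<in>UNIV. \<Sum>j\<in>UNIV. W $ i $ j * (d $ j - (W *v d) $ i)^2) = 0"
   unfolding stochastic_energy_gap[OF ds] .
  hence "W $ i $ j * (d $ j - (W *v d) $ i)^2 = 0" for i j
   by (subst (asm) sum_nonneg_eq_0_iff, simp, intro sum_nonneg mult_nonneg_nonneg ds_nonneg[OF ds], simp)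
     (metis (no_types, lifting) UNIV_I ds ds_nonneg finite mult_nonneg_nonneg sum_nonneg_eq_0_iff zero_le_power2)
  hence lk: "0 < W $ i $ j ==> d $ j = (W *v d) $ i" for i j by (metis less_irrefl mult_eq_0_iff power_eq_0_iff right_minus_eq)
  obtain i0 where i0: "0 < W $ i0 $ i0" using net by (auto simp: network_def)
  \<comment> \<open>Both \<open>d\<close> and \<open>W *v d\<close> are carried along the walk: an
    edge transfers the value from \<open>W *v d\<close> at one end to \<open>d\<close> at the other,
    and by symmetry back. The self-loop links the two vectors at the start.\<close>
  have "d $ j = d $ i0 & (W *v d) $ j = d $ i0" for j
  proof -
   have "(i0, j) \<in> E\<^sup>*" using net by (simp add: network_def)
   thus ?thesis
   proof (induction rule: rtrancl_induct)
    case base thus ?case using lk[OF i0] by simp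
   next
    case (step j k)
    have "(k, j) \<in> E" "j ~= k" using step.hyps net by (auto simp: network_def sym_def irrefl_def)
    with step.hyps(2) have "0 < W $ j $ k" "0 < W $ k $ j" using net by (auto simp: network_def)
    with lk step.IH show ?case by metis
   qed
  qed
  hence "!!j. d $ j = d $ i0" by blast
  hence "real CARD('m) * d $ i0 = 0" using sd by (metis (no_types, lifting) sum.cong sum_constant)
  hence "d = 0" using \<open>!!j. d $ j = d $ i0\<close> by (simp add: vec_eq_iff)
  with nx c0 x show False by simp
 qed
 thus ?thesis unfolding Ax by (rule power2_less_imp_less) simp
qed

text \<open>Pointwise strict contraction becomes uniform because the norm of the image attains its
  maximum on the compact unit sphere.\<close>

theorem lambda_W_less_one:
 fixes W :: "real^'m^'m"
 assumes net: "network E W"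
 shows "lambda_W W < 1"
proof -
 have "continuous_on (sphere (0 :: real^'m) 1) (%x. norm (mixing W *v x))"
  by (intro continuous_intros linear_continuous_on matrix_vector_mul_bounded_linear)
 moreover have "sphere (0 :: real^'m) 1 ~= {}" by simp
 ultimately obtain x0 where x0: "norm x0 = 1" and mx: "!!x. norm x = 1 ==> norm (mixing W *v x) <= norm (mixing W *v x0)"
  using continuous_attains_sup[of "sphere (0 :: real^'m) 1" "%x. norm (mixing W *v x)"] by auto
 have "onorm ((*v) (mixing W)) <= norm (mixing W *v x0)"
 proof (rule onorm_bound)
  fix x :: "real^'m"
  show "norm (mixing W *v x) <= norm (mixing W *v x0) * norm x"
  proof (cases "x = 0")
   case False
   have "mixing W *v x = norm x *\<^sub>R (mixing W *v (x /\<^sub>R norm x))"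
    using False by (simp add: matrix_vector_mult_scaleR)
   hence "norm (mixing W *v x) = norm x * norm (mixing W *v (x /\<^sub>R norm x))" by (metis abs_norm_cancel norm_scaleR)
   also have "... <= norm x * norm (mixing W *v x0)" using False by (intro mult_left_mono mx) auto
   finally show ?thesis by (simp add: mult.commute)
  qed simp
 qed simp
 also have "... < 1" using network_strict_contraction[OF net, of x0] x0 by (cases "x0 = 0") auto
 finally show ?thesis by (simp add: lambda_W_mixing)
qed

section \<open>The lower-level variational inequality\<close>

lemma projected_step_contraction:
 fixes F :: "'a::euclidean_space => 'a"
 assumes sm: "(F z - F z') \<bullet> (z - z') \<ge> \<mu> * (norm (z - z'))^2"
  and lip: "norm (F z - F z') <= L * norm (z - z')" and L: "0 <= L" and a: "0 <= \<alpha>"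
 shows "(norm ((z - \<alpha> *\<^sub>R F z) - (z' - \<alpha> *\<^sub>R F z')))^2 <= (1 - 2 * \<alpha> * \<mu> + \<alpha>^2 * L^2) * (norm (z - z'))^2"
proof -
 have e: "(z - \<alpha> *\<^sub>R F z) - (z' - \<alpha> *\<^sub>R F z') = (z - z') - \<alpha> *\<^sub>R (F z - F z')" by (simp add: algebra_simps)
 have "(norm ((z - \<alpha> *\<^sub>R F z) - (z' - \<alpha> *\<^sub>R F z')))^2 = (norm (z - z'))^2 - 2 * \<alpha> * ((F z - F z') \<bullet> (z - z')) + \<alpha>^2 * (norm (F z - F z'))^2"
  unfolding e power2_norm_eq_inner by (simp add: inner_diff inner_commute sq_eq algebra_simps)
 also have "... <= (norm (z - z'))^2 - 2 * \<alpha> * (\<mu> * (norm (z - z'))^2) + \<alpha>^2 * (L * norm (z - z'))^2"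
  using sm lip a by (intro add_mono diff_mono mult_left_mono power_mono) auto
 finally show ?thesis by (simp add: algebra_simps power_mult_distrib)
qed

text \<open>A point is the projection of \<open>z - \<alpha> *\<^sub>R F z\<close> iff the
  displacement makes no acute angle with any feasible direction, and the displacement from
  \<open>z\<close> is a negative multiple of \<open>F z\<close>.\<close>

lemma solves_VI_fixed_point:
 fixes C :: "'a::euclidean_space set"
 assumes C: "convex C" "closed C" "C ~= {}" and a: "0 < \<alpha>"
 shows "solves_VI C F z \<longleftrightarrow> closest_point C (z - \<alpha> *\<^sub>R F z) = z"
proof
 assume s: "solves_VI C F z"
 have "z = closest_point C (z - \<alpha> *\<^sub>R F z)"
 proof (rule closest_point_unique[OF C(1,2)])
  show "z \<in> C" using s by (simp add: solves_VI_def)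
  show "\<forall>z'\<in>C. dist (z - \<alpha> *\<^sub>R F z) z <= dist (z - \<alpha> *\<^sub>R F z) z'"
  proof
   fix z' assume "z' \<in> C"
   hence "0 <= F z \<bullet> (z' - z)" using s by (simp add: solves_VI_def)
   hence "0 <= 2 * \<alpha> * (F z \<bullet> (z' - z)) + (norm (z' - z))^2" using a by simp
   hence "(norm (\<alpha> *\<^sub>R F z))^2 <= (norm (\<alpha> *\<^sub>R F z + (z' - z)))^2"
    unfolding power2_norm_eq_inner by (simp add: inner_add inner_diff inner_commute sq_eq algebra_simps)
   hence "norm (\<alpha> *\<^sub>R F z) <= norm (\<alpha> *\<^sub>R F z + (z' - z))" by (rule power2_le_imp_le) simp
   moreover have "dist (z - \<alpha> *\<^sub>R F z) z' = norm (\<alpha> *\<^sub>R F z + (z' - z))"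
    unfolding dist_norm by (subst norm_minus_cancel[symmetric]) (simp add: algebra_simps)
   ultimately show "dist (z - \<alpha> *\<^sub>R F z) z <= dist (z - \<alpha> *\<^sub>R F z) z'" by (simp add: dist_norm)
  qed
 qed
 thus "closest_point C (z - \<alpha> *\<^sub>R F z) = z" by simp
next
 assume e: "closest_point C (z - \<alpha> *\<^sub>R F z) = z"
 have "0 <= F z \<bullet> (z' - z)" if "z' \<in> C" for z'
  using closest_point_dot[OF C(1,2) that, of "z - \<alpha> *\<^sub>R F z"] a unfolding e by (simp add: zero_le_mult_iff)
 moreover have "z \<in> C" using closest_point_in_set[OF C(2,3), of "z - \<alpha> *\<^sub>R F z"] unfolding e .
 ultimately show "solves_VI C F z" by (simp add: solves_VI_def)
qed

context
 fixes P :: "('n::finite, 'm::finite, 'p::finite, 'd::finite) mpec" and \<mu> L D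
 assumes lower: "lower_level P \<mu> L D"
begin

lemma lower_facts:
 shows "0 < \<mu>"
  and "(mean_vmap P i x z - mean_vmap P i x z') \<bullet> (z - z') \<ge> \<mu> * (norm (z - z'))^2"
  and "norm (mean_vmap P i x z - mean_vmap P i x z') <= L * norm (z - z')"
  and "feas P i x ~= {}" "closed (feas P i x)" "convex (feas P i x)"
  and "z \<in> feas P i x ==> z' \<in> feas P i x ==> (norm (z - z'))^2 <= D i"
proof -
 have lip: "L-lipschitz_on UNIV (mean_vmap P i x)" using lower by (simp add: lower_level_def)
 show "norm (mean_vmap P i x z - mean_vmap P i x z') <= L * norm (z - z')"
  using lipschitz_onD[OF lip, of z z'] by (simp add: dist_norm)
qed (use lower in \<open>simp_all add: lower_level_def\<close>)

text \<open>Both moduli are compared on one unit vector. It follows that \<open>L\<close> is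
  positive and that the condition number is at least 1.\<close>

lemma mu_le_L: "\<mu> <= L"
proof -
 define z :: "real^'p" where "z = axis undefined 1"
 have n: "norm z = 1" by (simp add: z_def)
 have "\<mu> * (norm (z - 0))^2 <= (mean_vmap P undefined 0 z - mean_vmap P undefined 0 0) \<bullet> (z - 0)"
  by (rule lower_facts(2))
 also have "... <= norm (mean_vmap P undefined 0 z - mean_vmap P undefined 0 0) * norm (z - 0)" by (rule norm_cauchy_schwarz)
 also have "... <= (L * norm (z - 0)) * norm (z - 0)" by (intro mult_right_mono lower_facts(3)) simp
 finally show ?thesis by (simp add: n)
qed

lemma L_pos: "0 < L"
 using mu_le_L lower_facts(1) by linarith

lemma VI_unique:
 assumes "solves_VI (feas P i x) (mean_vmap P i x) z" "solves_VI (feas P i x) (mean_vmap P i x) z'"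
 shows "z = z'"
proof -
 have "0 <= mean_vmap P i x z \<bullet> (z' - z)" "0 <= mean_vmap P i x z' \<bullet> (z - z')"
  using assms by (auto simp: solves_VI_def)
 hence "(mean_vmap P i x z - mean_vmap P i x z') \<bullet> (z - z') <= 0" by (simp add: inner_diff algebra_simps)
 with lower_facts(2)[of z z' i x] have "\<mu> * (norm (z - z'))^2 <= 0" by linarith
 thus ?thesis using lower_facts(1) by (simp add: mult_le_0_iff)
qed

text \<open>The step length \<mu> / L^2 minimises the factor 1 - 2 \<alpha> \<mu> + \<alpha>^2 L^2
  of \<open>projected_step_contraction\<close>.\<close>

definition proj_step :: "'m => real^'n => real^'p => real^'p" where
 "proj_step i x z = closest_point (feas P i x) (z - (\<mu> / L^2) *\<^sub>R mean_vmap P i x z)"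

lemma proj_step_contraction:
 "dist (proj_step i x z) (proj_step i x z') <= sqrt (1 - \<mu>^2 / L^2) * dist z z'"
proof -
 have L: "0 < L" by (rule L_pos)
 have "dist (proj_step i x z) (proj_step i x z')
   <= dist (z - (\<mu> / L^2) *\<^sub>R mean_vmap P i x z) (z' - (\<mu> / L^2) *\<^sub>R mean_vmap P i x z')"
  unfolding proj_step_def using lower_facts by (intro closest_point_lipschitz) auto
 also have "... <= sqrt ((1 - \<mu>^2 / L^2) * (norm (z - z'))^2)"
 proof (rule real_le_rsqrt)
  have e: "1 - 2 * (\<mu> / L^2) * \<mu> + (\<mu> / L^2)^2 * L^2 = 1 - \<mu>^2 / L^2"
   using L by (simp add: field_simps sq_eq)
  show "(dist (z - (\<mu> / L^2) *\<^sub>R mean_vmap P i x z) (z' - (\<mu> / L^2) *\<^sub>R mean_vmap P i x z'))^2 <= (1 - \<mu>^2 / L^2) * (norm (z - z'))^2"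
   unfolding dist_norm e[symmetric]
   by (rule projected_step_contraction[OF lower_facts(2,3)]) (use L lower_facts(1) in auto)
 qed
 also have "... = sqrt (1 - \<mu>^2 / L^2) * dist z z'" by (simp add: real_sqrt_mult dist_norm)
 finally show ?thesis .
qed

lemma contraction_factor: "0 <= sqrt (1 - \<mu>^2 / L^2)" "sqrt (1 - \<mu>^2 / L^2) < 1"
proof -
 have "\<mu>^2 <= L^2" using mu_le_L lower_facts(1) by (intro power_mono) auto
 thus "0 <= sqrt (1 - \<mu>^2 / L^2)" using L_pos by (simp add: field_simps)
 show "sqrt (1 - \<mu>^2 / L^2) < 1" using lower_facts(1) L_pos by simp
qed

lemma zsol_solves: "solves_VI (feas P i x) (mean_vmap P i x) (zsol P i x)"
proof -
 have "\<exists>!z. proj_step i x z = z"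
  using banach_fix_type[OF contraction_factor, of "proj_step i x"] proj_step_contraction by blast
 then obtain z where z: "proj_step i x z = z" by blast
 have "solves_VI (feas P i x) (mean_vmap P i x) z"
  using z lower_facts(1,4,5,6) L_pos unfolding proj_step_def
  by (subst solves_VI_fixed_point[where \<alpha>="\<mu> / L^2"]) auto
 thus ?thesis unfolding zsol_def by (rule theI[where a=z]) (use VI_unique \<open>solves_VI _ _ z\<close> in blast)
qed

lemma zsol_fixed_point:
 assumes "0 < \<alpha>"
 shows "closest_point (feas P i x) (zsol P i x - \<alpha> *\<^sub>R mean_vmap P i x (zsol P i x)) = zsol P i x"
 using zsol_solves assms lower_facts(4,5,6) by (subst (asm) solves_VI_fixed_point[where \<alpha>=\<alpha>]) auto

lemma zsol_in_feas: "zsol P i x \<in> feas P i x"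
 using zsol_solves by (simp add: solves_VI_def)

text \<open>Serves the measurability of \<open>zsol\<close>, which becomes a pointwise limit of
  measurable maps. The constant start 0 avoids a measurable choice of feasible points; already the
  first projection is feasible.\<close>

primrec proj_iter :: "'m => nat => real^'n => real^'p" where
 "proj_iter i 0 x = 0"
| "proj_iter i (Suc k) x = proj_step i x (proj_iter i k x)"

lemma proj_iter_tendsto: "(%k. proj_iter i k x) \<longlonglongrightarrow> zsol P i x"
proof -
 let ?c = "sqrt (1 - \<mu>^2 / L^2)"
 have "dist (proj_iter i k x) (zsol P i x) <= ?c ^ k * dist 0 (zsol P i x)" for k
 proof (induction k)
  case (Suc k)
  have fx: "proj_step i x (zsol P i x) = zsol P i x"
   unfolding proj_step_def using lower_facts(1) L_pos by (intro zsol_fixed_point) simp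
  have "dist (proj_iter i (Suc k) x) (zsol P i x) <= ?c * dist (proj_iter i k x) (zsol P i x)"
   using proj_step_contraction[of i x "proj_iter i k x" "zsol P i x"] by (simp add: fx)
  also have "... <= ?c * (?c ^ k * dist 0 (zsol P i x))" by (rule mult_left_mono[OF Suc contraction_factor(1)])
  finally show ?case by (simp add: mult.assoc)
 qed simp
 moreover have "(%k. ?c ^ k * dist 0 (zsol P i x)) \<longlonglongrightarrow> 0 * dist 0 (zsol P i x)"
  using contraction_factor by (intro tendsto_mult LIMSEQ_power_zero tendsto_const) auto
 ultimately show ?thesis
  by (subst tendsto_dist_iff) (rule tendsto_sandwich[OF _ _ tendsto_const], auto)
qed

context
 assumes wp: "well_posed P"
begin

lemma law_facts: "prob_space (law P i)" "sets (law P i) = sets borel"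
 using wp by (simp_all add: well_posed_def)

lemma cost_measurable: "(%(x, z, \<xi>). cost P i x z \<xi>) \<in> borel_measurable borel"
 and vmap_measurable: "(%(x, z, \<xi>). vmap P i x z \<xi>) \<in> borel_measurable borel"
 and proj_measurable: "(%(x, w). closest_point (feas P i x) w) \<in> borel_measurable borel"
 using wp by (simp_all add: well_posed_def)

lemma mean_vmap_measurable: "(%p. mean_vmap P i (fst p) (snd p)) \<in> borel_measurable borel"
proof -
 interpret prob_space "law P i" by (rule law_facts)
 have [measurable_cong]: "sets (law P i) = sets borel" by (rule law_facts)
 have m: "(%p. vmap P i (fst (fst p)) (snd (fst p)) (snd p)) \<in> borel_measurable ((borel :: ((real^'n) \<times> (real^'p)) measure) \<Otimes>\<^sub>M law P i)"
 proof -
  have "(%p. (fst (fst p), snd (fst p), snd p)) \<in> (borel :: (((real^'n) \<times> (real^'p)) \<times> (real^'d)) measure) \<rightarrow>\<^sub>M borel"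
   by (intro borel_measurable_continuous_onI continuous_intros)
  from measurable_compose[OF this vmap_measurable]
  have "(%p. vmap P i (fst (fst p)) (snd (fst p)) (snd p)) \<in> borel_measurable (borel :: (((real^'n) \<times> (real^'p)) \<times> (real^'d)) measure)"
   by simp
  thus ?thesis
   by (simp add: borel_prod[symmetric] cong: measurable_cong_sets sets_pair_measure_cong)
 qed
 show ?thesis unfolding mean_vmap_def
  by (rule borel_measurable_lebesgue_integral) (use m in \<open>simp add: split_beta\<close>)
qed

lemma proj_iter_measurable: "proj_iter i k \<in> borel_measurable borel"
proof (induction k)
 case 0
 have "proj_iter i 0 = (%x. 0)" by (simp add: fun_eq_iff)
 thus ?case by simp
next
 case (Suc k)
 note [measurable] = Suc.IH
 have pr: "(%x. (f x, g x)) \<in> borel \<rightarrow>\<^sub>M borel" if "f \<in> borel \<rightarrow>\<^sub>M borel" "g \<in> borel \<rightarrow>\<^sub>M borel"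
  for f :: "real^'n => real^'n" and g :: "real^'n => real^'p"
  using that by (simp add: borel_prod[symmetric])
 have "(%x. mean_vmap P i x (proj_iter i k x)) \<in> borel_measurable borel"
  using measurable_compose[OF pr[of "%x. x" "proj_iter i k"] mean_vmap_measurable[of i]] Suc.IH by simp
 hence "(%x. proj_iter i k x - (\<mu> / L^2) *\<^sub>R mean_vmap P i x (proj_iter i k x)) \<in> borel_measurable borel"
  by measurable
 from measurable_compose[OF pr[OF measurable_ident this] proj_measurable[of i]]
 have "(%x. proj_step i x (proj_iter i k x)) \<in> borel_measurable borel"
  by (simp add: proj_step_def)
 moreover have "proj_iter i (Suc k) = (%x. proj_step i x (proj_iter i k x))" by (simp add: fun_eq_iff)
 ultimately show ?case by simp
qed

lemma zsol_measurable: "zsol P i \<in> borel_measurable borel"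
 by (rule borel_measurable_LIMSEQ_metric[OF proj_iter_measurable proj_iter_tendsto])

end

end

section \<open>Scalar recursions\<close>

text \<open>Young's parameter is spent so that the contraction factor becomes (1 + l^2)/2, halfway
  between l^2 and 1. Summation then moves that multiple of the sum to the left, which leaves (1 -
  l^2)/2 of it.\<close>

lemma contraction_sum:
 fixes u v :: "nat => real"
 assumes l: "0 <= l" "l < 1" and u: "!!k. 0 <= u k" and v: "!!k. 0 <= v k"
  and rec: "!!k t. 0 < t ==> u (Suc k) <= l^2 * ((1 + t) * u k + (1 + 1 / t) * v k)"
 shows "(\<Sum>k<Suc N. u k) <= 2 * u 0 / (1 - l^2) + 4 * l^2 / (1 - l^2)^2 * (\<Sum>k<N. v k)"
proof -
 define w where "w = 1 - l^2"
 have l2: "l^2 < 1" using l by (simp add: power_less_one_iff abs_square_less_1)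
 hence w: "0 < w" "w <= 1" by (auto simp: w_def)
 have step: "u (Suc k) <= (1 + l^2) / 2 * u k + 2 * l^2 / w * v k" for k
 proof (cases "l = 0")
  case True
  thus ?thesis using rec[of 1 k] u[of k] by simp
 next
  case False
  with l have l0: "0 < l" by simp
  \<comment> \<open>The solution of l^2 (1 + t) = (1 + l^2)/2.\<close>
  define t where "t = w / (2 * l^2)"
  have t: "0 < t" using w l0 by (simp add: t_def)
  have 1: "l^2 * (1 + t) = (1 + l^2) / 2" using l0 by (simp add: t_def w_def field_simps)
  have 2: "l^2 * (1 + 1 / t) = l^2 * (1 + l^2) / w" using l0 w by (simp add: t_def w_def field_simps)
  have "u (Suc k) <= l^2 * (1 + t) * u k + l^2 * (1 + 1 / t) * v k" using rec[OF t, of k] by (simp add: algebra_simps)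
  also have "... <= (1 + l^2) / 2 * u k + l^2 * 2 / w * v k"
   unfolding 1 2 using v w l2 by (intro add_mono mult_right_mono divide_right_mono mult_left_mono) auto
  finally show ?thesis by (simp add: mult.commute)
 qed
 have "(\<Sum>k<N. u (Suc k)) <= (1 + l^2) / 2 * (\<Sum>k<N. u k) + 2 * l^2 / w * (\<Sum>k<N. v k)"
  unfolding sum_distrib_left sum.distrib[symmetric] by (rule sum_mono) (rule step)
 also have "... <= (1 + l^2) / 2 * (\<Sum>k<Suc N. u k) + 2 * l^2 / w * (\<Sum>k<N. v k)"
  using u[of N] by (intro add_right_mono mult_left_mono) auto
 finally have "(\<Sum>k<Suc N. u k) - u 0 <= (1 + l^2) / 2 * (\<Sum>k<Suc N. u k) + 2 * l^2 / w * (\<Sum>k<N. v k)"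
  unfolding sum.lessThan_Suc_shift by simp
 hence "w / 2 * (\<Sum>k<Suc N. u k) <= u 0 + 2 * l^2 / w * (\<Sum>k<N. v k)" by (simp add: w_def field_simps)
 hence "(\<Sum>k<Suc N. u k) <= (u 0 + 2 * l^2 / w * (\<Sum>k<N. v k)) / (w / 2)"
  using w by (simp add: field_simps)
 also have "... = 2 * u 0 / w + 4 * l^2 / w^2 * (\<Sum>k<N. v k)"
  using w by (simp add: field_simps sq_eq)
 finally show ?thesis by (simp add: w_def)
qed

text \<open>The loop behind the consensus bound: \<open>c\<close> is the consensus error,
  \<open>y\<close> the deviation of the tracked direction with noise part \<open>n\<close> and drift
  part \<open>z\<close>; the drift is fed by gradient increments \<open>p\<close> and bias
  increments \<Delta>, and \<open>p\<close> is in turn bounded by \<open>c\<close>, \<open>y\<close>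
  and the averaged step \<open>b\<close>. Summed over the horizon, the loop closes with gains 5/16
  on the consensus sum and 5/64 on the tracking sum, both below 1 thanks to the two stepsize
  conditions.\<close>

lemma consensus_sum:
 fixes c y n z q p b \<tau> \<Delta> :: "nat => real"
 assumes l: "0 <= l" "l < 1" and g: "0 < \<gamma>" and be: "0 <= \<beta>"
  and s1: "9 * l * (\<gamma> * \<beta>) <= 1 - l^2" and s2: "20 * l^2 * (\<gamma> * \<beta>) <= (1 - l^2)^2"
  and nn: "!!k. 0 <= c k" "!!k. 0 <= y k" "!!k. 0 <= z k" "!!k. 0 <= q k" "!!k. 0 <= b k" "!!k. 0 <= \<tau> k" "0 <= \<sigma>"
  and c: "!!k t. 0 < t ==> c (Suc k) <= l^2 * ((1 + t) * c k + (1 + 1 / t) * (\<gamma>^2 * y (Suc k)))"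
  and z0: "z 0 = 0"
  and z: "!!k t. 0 < t ==> z (Suc k) <= l^2 * ((1 + t) * z k + (1 + 1 / t) * q k)"
  and q: "!!k. q k <= 5 / 4 * p k + 5 * \<Delta> k"
  and \<Delta>: "\<Delta> 0 <= \<tau> 0" "!!k. \<Delta> (Suc k) <= 2 * \<tau> (Suc k) + 2 * \<tau> k"
  and p: "p 0 <= 0" "!!k. p (Suc k) <= \<beta>^2 * (5 * c k + 5 * \<gamma>^2 * l^2 * y (Suc k) + \<gamma>^2 * b (Suc k))"
  and b: "!!k. b (Suc k) <= 2 * \<sigma> + 2 * \<tau> k"
  and y: "!!k. y k <= 5 * n k + 5 / 4 * z k"
  and n: "!!k. n (Suc k) <= 5 * l^2 * \<sigma> / (1 - l^2)"
 shows "(\<Sum>k<Suc N. c k) <= 4 * c 0 / (1 - l^2)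
   + \<gamma>^2 * l^2 / (1 - l^2)^3 * (170 * l^2 + 2) * \<sigma> * real (Suc N)
   + \<gamma>^2 * l^2 / (1 - l^2)^2 * (667 * l^2 / (1 - l^2)^2 + 2) * (\<Sum>k<Suc N. \<tau> k)"
proof -
 define w where "w = 1 - l^2"
 have l2: "l^2 < 1" using l by (simp add: power_less_one_iff abs_square_less_1)
 hence w: "0 < w" "w <= 1" by (auto simp: w_def)
 define A where "A = 4 * l^2 / w^2"
 have A0: "0 <= A" by (simp add: A_def)
 define s where "s = \<gamma> * \<beta>"
 have s0: "0 <= s" using g be by (simp add: s_def)
 define C Y T where "C = (\<Sum>k<Suc N. c k)" and "Y = (\<Sum>k<N. y (Suc k))" and "T = (\<Sum>k<Suc N. \<tau> k)"
 define K where "K = real (Suc N)"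
 have Y0: "0 <= Y" unfolding Y_def by (intro sum_nonneg nn)
 have T0: "0 <= T" unfolding T_def by (intro sum_nonneg nn)
 have C0: "0 <= C" unfolding C_def by (intro sum_nonneg nn)
 have K0: "0 <= K" "real N <= K" by (auto simp: K_def)
 have TN: "(\<Sum>k<N. \<tau> k) <= T" using nn(6)[of N] by (simp add: T_def)
 have T1: "(\<Sum>k<N. \<tau> (Suc k)) <= T" unfolding T_def sum.lessThan_Suc_shift using nn(6)[of 0] by simp
 have CN: "(\<Sum>k<N. c k) <= C" using nn(1)[of N] by (simp add: C_def)
 have hC: "C <= 2 * c 0 / w + A * (\<gamma>^2 * Y)"
  using contraction_sum[of l c "%k. \<gamma>^2 * y (Suc k)" N, OF l nn(1) _ c] nn(2)
  by (simp add: C_def Y_def A_def w_def sum_distrib_left)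
 have hZ: "(\<Sum>k<N. z (Suc k)) <= A * (\<Sum>k<N. q k)"
 proof -
  have "(\<Sum>k<Suc N. z k) = (\<Sum>k<N. z (Suc k))" unfolding sum.lessThan_Suc_shift by (simp add: z0)
  thus ?thesis using contraction_sum[of l z q N, OF l nn(3) nn(4) z] by (simp add: A_def w_def z0)
 qed
 have h\<Delta>: "(\<Sum>k<N. \<Delta> k) <= 4 * T"
 proof (cases N)
  case (Suc M)
  have "(\<Sum>k<N. \<Delta> k) = \<Delta> 0 + (\<Sum>k<M. \<Delta> (Suc k))" unfolding Suc sum.lessThan_Suc_shift by simp
  also have "... <= \<tau> 0 + (\<Sum>k<M. 2 * \<tau> (Suc k) + 2 * \<tau> k)" by (intro add_mono sum_mono \<Delta>)
  also have "... = \<tau> 0 + 2 * (\<Sum>k<M. \<tau> (Suc k)) + 2 * (\<Sum>k<M. \<tau> k)" by (simp add: sum.distrib sum_distrib_left)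
  also have "\<tau> 0 + 2 * (\<Sum>k<M. \<tau> (Suc k)) <= 2 * (\<Sum>k<N. \<tau> k)"
   unfolding Suc sum.lessThan_Suc_shift using nn(6)[of 0] by simp
  also have "(\<Sum>k<M. \<tau> k) <= (\<Sum>k<N. \<tau> k)" unfolding Suc using nn(6)[of M] by simp
  finally show ?thesis using TN by simp
 qed (use T0 in simp)
 define R where "R k = \<beta>^2 * (5 * c k + 5 * \<gamma>^2 * l^2 * y (Suc k) + \<gamma>^2 * b (Suc k))" for k
 have R0: "0 <= R k" for k unfolding R_def using nn by (intro mult_nonneg_nonneg add_nonneg_nonneg) auto
 have hp: "(\<Sum>k<N. p k) <= \<beta>^2 * (5 * C + 5 * \<gamma>^2 * l^2 * Y + \<gamma>^2 * (2 * \<sigma> * K + 2 * T))"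
 proof -
  have "(\<Sum>k<N. p k) <= (\<Sum>k<N. R k)"
  proof (cases N)
   case (Suc M)
   have "(\<Sum>k<N. p k) = p 0 + (\<Sum>k<M. p (Suc k))" unfolding Suc sum.lessThan_Suc_shift by simp
   also have "... <= 0 + (\<Sum>k<M. R k)" unfolding R_def by (intro add_mono sum_mono p)
   also have "... <= (\<Sum>k<N. R k)" unfolding Suc using R0[of M] by simp
   finally show ?thesis .
  qed simp
  also have "... = \<beta>^2 * (5 * (\<Sum>k<N. c k) + 5 * \<gamma>^2 * l^2 * Y + \<gamma>^2 * (\<Sum>k<N. b (Suc k)))"
   unfolding R_def Y_def sum_distrib_left[symmetric] sum.distrib by (simp add: sum_distrib_left)
  also have "... <= \<beta>^2 * (5 * C + 5 * \<gamma>^2 * l^2 * Y + \<gamma>^2 * (2 * \<sigma> * K + 2 * T))"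
  proof -
   have "(\<Sum>k<N. b (Suc k)) <= (\<Sum>k<N. 2 * \<sigma> + 2 * \<tau> k)" by (rule sum_mono) (rule b)
   also have "... = 2 * \<sigma> * real N + 2 * (\<Sum>k<N. \<tau> k)" by (simp add: sum.distrib sum_distrib_left)
   also have "... <= 2 * \<sigma> * K + 2 * T" using nn(7) K0 TN by (intro add_mono mult_left_mono) auto
   finally have hb: "(\<Sum>k<N. b (Suc k)) <= 2 * \<sigma> * K + 2 * T" .
   show ?thesis by (intro mult_left_mono add_mono order.refl CN hb) auto
  qed
  finally show ?thesis .
 qed
 define B where "B = \<sigma> * K + T"
 have B0: "0 <= B" using nn(7) K0 T0 by (simp add: B_def)
 have hY: "Y <= 25 * (l^2 * \<sigma> * K / w) + 5 / 4 * A * (5 / 4 * (\<beta>^2 * (5 * C + 5 * \<gamma>^2 * l^2 * Y + 2 * \<gamma>^2 * B)) + 20 * T)"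
 proof -
  have "Y <= (\<Sum>k<N. 5 * (5 * l^2 * \<sigma> / w) + 5 / 4 * z (Suc k))"
   unfolding Y_def
  proof (rule sum_mono)
   fix k show "y (Suc k) <= 5 * (5 * l^2 * \<sigma> / w) + 5 / 4 * z (Suc k)"
    using y[of "Suc k"] n[of k] by (simp add: w_def)
  qed
  also have "... = (25 * l^2 * \<sigma> / w) * real N + 5 / 4 * (\<Sum>k<N. z (Suc k))" by (simp add: sum.distrib sum_distrib_left)
  also have "... <= (25 * l^2 * \<sigma> / w) * K + 5 / 4 * (A * (\<Sum>k<N. q k))"
   using w nn(7) K0 hZ by (intro add_mono mult_left_mono) auto
  also have "... <= (25 * l^2 * \<sigma> / w) * K + 5 / 4 * (A * (5 / 4 * (\<beta>^2 * (5 * C + 5 * \<gamma>^2 * l^2 * Y + \<gamma>^2 * (2 * \<sigma> * K + 2 * T))) + 5 * (4 * T)))"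
  proof -
   have "(\<Sum>k<N. q k) <= (\<Sum>k<N. 5 / 4 * p k + 5 * \<Delta> k)" by (rule sum_mono) (rule q)
   also have "... = 5 / 4 * (\<Sum>k<N. p k) + 5 * (\<Sum>k<N. \<Delta> k)" by (simp add: sum.distrib sum_distrib_left)
   also have "... <= 5 / 4 * (\<beta>^2 * (5 * C + 5 * \<gamma>^2 * l^2 * Y + \<gamma>^2 * (2 * \<sigma> * K + 2 * T))) + 5 * (4 * T)"
    by (intro add_mono mult_left_mono hp h\<Delta>) auto
   finally show ?thesis using A0 by (intro add_left_mono mult_left_mono) auto
  qed
  finally show ?thesis by (simp add: B_def algebra_simps)
 qed
 \<comment> \<open>The three gains that follow are bounded here: the condition with constant 20
   bounds \<open>A * s\<close>, the one with constant 9 bounds \<open>A * s^2\<close>, as 4/81 <=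
   1/20.\<close>
 have As: "A * s <= 1 / 5"
 proof -
  have "4 * (l^2 * s) * 5 <= w^2" using s2 by (simp add: s_def w_def)
  thus ?thesis using w by (simp add: A_def field_simps)
 qed
 have A2: "A^2 * s^2 <= 1 / 25"
  using power_mono[OF As, of 2] A0 s0 by (simp add: power_mult_distrib power_divide)
 have As2: "A * s^2 <= 1 / 20"
 proof -
  have "(9 * l * s)^2 <= w^2" using s1 l s0 by (intro power_mono) (auto simp: s_def w_def)
  hence "81 * (l^2 * s^2) <= w^2" by (simp add: power_mult_distrib)
  moreover have "0 <= l^2 * s^2" by simp
  ultimately have "20 * (4 * l^2 * s^2) <= w^2" unfolding mult.assoc by linarith
  thus ?thesis using w by (simp add: A_def field_simps)
 qed
 have Asl: "A * s^2 * l^2 <= 1 / 100"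
 proof -
  have ls: "l^2 * s <= w^2 / 20" using s2 by (simp add: s_def w_def)
  have "A * s^2 * l^2 = (A * s) * (l^2 * s)" by (simp add: sq_eq)
  also have "... <= (1 / 5) * (w^2 / 20)" using As ls A0 s0 by (intro mult_mono) auto
  also have "... <= 1 / 100" using w power_le_one[of w 2] by simp
  finally show ?thesis .
 qed
 \<comment> \<open>The tracking sum in the units in which it enters \<open>hC\<close>, so that the
   loop is a pair of linear inequalities in \<open>C\<close> and \<open>X\<close>.\<close>
 define X where "X = A * \<gamma>^2 * Y"
 have X0: "0 <= X" using A0 Y0 by (simp add: X_def)
 have "X <= A * \<gamma>^2 * (25 * (l^2 * \<sigma> * K / w) + 5 / 4 * A * (5 / 4 * (\<beta>^2 * (5 * C + 5 * \<gamma>^2 * l^2 * Y + 2 * \<gamma>^2 * B)) + 20 * T))"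
  unfolding X_def using hY A0 by (intro mult_left_mono) auto
 also have "... = 25 * A * \<gamma>^2 * (l^2 * \<sigma> * K / w) + 25 * A^2 * \<gamma>^2 * T
   + 125 / 16 * (A^2 * s^2) * C + 125 / 16 * (A * s^2 * l^2) * X + 25 / 8 * (A * s^2) * (A * \<gamma>^2 * B)"
  by (simp add: X_def s_def power_mult_distrib sq_eq algebra_simps)
 also have "... <= 25 * A * \<gamma>^2 * (l^2 * \<sigma> * K / w) + 25 * A^2 * \<gamma>^2 * T
   + 125 / 16 * (1 / 25) * C + 125 / 16 * (1 / 100) * X + 25 / 8 * (1 / 20) * (A * \<gamma>^2 * B)"
  using A2 Asl As2 C0 X0 A0 B0 by (intro add_mono mult_right_mono mult_left_mono order.refl) auto
 finally have hX: "X <= 25 * A * \<gamma>^2 * (l^2 * \<sigma> * K / w) + 25 * A^2 * \<gamma>^2 * T + 5 / 16 * C + 5 / 64 * X + 5 / 32 * (A * \<gamma>^2 * B)"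
  by simp
 define E1 E2 E3 where "E1 = A * \<gamma>^2 * (l^2 * \<sigma> * K / w)" and "E2 = A^2 * \<gamma>^2 * T" and "E3 = A * \<gamma>^2 * B"
 have Enn: "0 <= E1" "0 <= E2" "0 <= E3"
  using A0 B0 T0 w nn(7) K0 by (auto simp: E1_def E2_def E3_def)
 have hX': "X <= 25 * E1 + 25 * E2 + 5 / 16 * C + 5 / 64 * X + 5 / 32 * E3"
  using hX by (simp add: E1_def E2_def E3_def mult.assoc)
 have hC': "C <= 2 * (c 0 / w) + X" using hC by (simp add: X_def mult.assoc)
 have c0: "0 <= c 0 / w" using nn(1) w by simp
 \<comment> \<open>Eliminating \<open>X\<close> leaves 39/59 of \<open>C\<close> on the left. The
   coefficients are rounded up, with 4 * 42.4 <= 170 and 16 * 41.6 <= 667 in view.\<close>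
 have fin: "C <= 4 * (c 0 / w) + 42.4 * E1 + 41.6 * E2 + 0.5 * E3"
  using hX' hC' Enn c0 by linarith
 have E1': "E1 = 4 * (\<gamma>^2 * l^2 / w^3) * l^2 * \<sigma> * K"
  using w by (simp add: E1_def A_def field_simps sq_eq power3_eq_cube)
 have E2': "E2 = 16 * (\<gamma>^2 * l^2 / w^2) * (l^2 / w^2) * T"
  using w by (simp add: E2_def A_def field_simps sq_eq)
 have E3': "E3 = 4 * (\<gamma>^2 * l^2 / w^2) * \<sigma> * K + 4 * (\<gamma>^2 * l^2 / w^2) * T"
  using w by (simp add: E3_def B_def A_def field_simps sq_eq)
 have w32: "\<gamma>^2 * l^2 / w^2 <= \<gamma>^2 * l^2 / w^3"
 proof (rule divide_left_mono)
  show "w ^ 3 <= w^2" using w by (intro power_decreasing) auto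
 qed (use w in auto)
 have sK: "0 <= \<sigma> * K" using nn(7) K0 by simp
 have E3'': "(\<gamma>^2 * l^2 / w^2) * (\<sigma> * K) <= (\<gamma>^2 * l^2 / w^3) * (\<sigma> * K)"
  using w32 sK by (rule mult_right_mono)
 have nnT: "0 <= (\<gamma>^2 * l^2 / w^2) * (l^2 / w^2) * T" using w T0 by simp
 have nns: "0 <= (\<gamma>^2 * l^2 / w^3) * l^2 * (\<sigma> * K)" using w sK by simp
 have "C <= 4 * (c 0 / w) + 42.4 * (4 * ((\<gamma>^2 * l^2 / w^3) * l^2 * (\<sigma> * K))) + 41.6 * (16 * ((\<gamma>^2 * l^2 / w^2) * (l^2 / w^2) * T))
   + 0.5 * (4 * ((\<gamma>^2 * l^2 / w^2) * (\<sigma> * K)) + 4 * ((\<gamma>^2 * l^2 / w^2) * T))"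
  using fin unfolding E1' E2' E3' by (simp add: mult.assoc)
 also have "... <= 4 * (c 0 / w) + 170 * ((\<gamma>^2 * l^2 / w^3) * l^2 * (\<sigma> * K)) + 667 * ((\<gamma>^2 * l^2 / w^2) * (l^2 / w^2) * T)
   + 2 * ((\<gamma>^2 * l^2 / w^3) * (\<sigma> * K)) + 2 * ((\<gamma>^2 * l^2 / w^2) * T)"
 proof -
  have gen: "a + 42.4 * (4 * x) + 41.6 * (16 * y) + 0.5 * (4 * u + 4 * v) <= a + 170 * x + 667 * y + 2 * u' + 2 * v"
   if "0 <= x" "0 <= y" "u <= u'" for a x y u u' v :: real
   using that by (simp add: field_simps)
  show ?thesis by (rule gen) (rule nns nnT E3'')+
 qed
 also have "... = 4 * c 0 / w + \<gamma>^2 * l^2 / w^3 * (170 * l^2 + 2) * \<sigma> * K + \<gamma>^2 * l^2 / w^2 * (667 * l^2 / w^2 + 2) * T"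
  by (simp add: algebra_simps)
 finally show ?thesis by (simp add: C_def w_def K_def T_def)
qed

text \<open>The bound of \<open>consensus_sum\<close> per iteration: \<open>V\<close> is the initial
  consensus error, \<open>T\<close> the sum of the bias levels over the horizon
  \<open>K\<close>.\<close>

definition consensus_rate :: "real => real => real => real => real => real => real" where
 "consensus_rate \<gamma> l \<sigma> V T K = 4 * V / ((1 - l^2) * K) + \<gamma>^2 * l^2 / (1 - l^2)^3 * (170 * l^2 + 2) * \<sigma>
   + \<gamma>^2 * l^2 / (1 - l^2)^2 * (667 * l^2 / (1 - l^2)^2 + 2) * (T / K)"

text \<open>What the summed descent inequality gives after multiplication by 4 / (\<gamma> K);
  \<beta> is the Lipschitz constant of the smoothed gradients.\<close>

definition stationarity_rate :: "real => real => real => real => real => real => real => real => real => real" where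
 "stationarity_rate m \<gamma> \<beta> l \<sigma> gap V T K = 4 * gap / (\<gamma> * K) + 2 * \<beta>^2 * consensus_rate \<gamma> l \<sigma> V T K
   + 4 * (1 + \<gamma> * \<beta>) * (T / K) + 4 * (\<gamma> * \<beta>) * \<sigma> / m"

text \<open>An intermediate shape common to both stated bounds: the factor 2 \<beta>^2 leads to
  summands of the stationarity bound, the factor \<open>H_const\<close> to summands of the consensus
  bound. The noise level is \<open>s\<close>.\<close>

definition consensus_majorant :: "real => real => real => real => real => real => real => real" where
 "consensus_majorant \<gamma> l w s V T K = (1 + 20 / (1 - l^2)) * V / K
   + (80 * \<gamma>^2 * l^2 / (1 - l^2)^3) * 2 * s * (w^2 + 11/2 * l^2)
   + (80 * \<gamma>^2 * l^2 / (1 - l^2)^3) * (2 * w^2 + 5 * l^2 * ((1 + 3 * l^2) / (1 - l^2))) * (T / K)"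

lemma consensus_rate_le_majorant:
 assumes l: "0 <= l" "l < 1" and w: "1 <= w" and V: "0 <= V" and T: "0 <= T" and K: "0 < K"
  and s: "0 <= \<sigma>" "\<sigma> <= s"
 shows "consensus_rate \<gamma> l \<sigma> V T K <= consensus_majorant \<gamma> l w s V T K"
 unfolding consensus_rate_def consensus_majorant_def
proof (intro add_mono)
 define u where "u = 1 - l^2"
 have l2: "l^2 < 1" using l by (simp add: power_less_one_iff abs_square_less_1)
 hence u: "0 < u" "u <= 1" by (auto simp: u_def)
 have w2: "1 <= w^2" using w by (simp add: one_le_power)
 have "4 * V / (u * K) <= 20 / u * V / K" using u V K by (simp add: field_simps)
 also have "... <= (1 + 20 / u) * V / K" using V K by (intro divide_right_mono mult_right_mono) auto
 finally show "4 * V / ((1 - l^2) * K) <= (1 + 20 / (1 - l^2)) * V / K" by (simp add: u_def)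
 have "(170 * l^2 + 2) * \<sigma> <= (160 * (w^2 + 11/2 * l^2)) * s"
 proof (rule mult_mono)
  show "170 * l^2 + 2 <= 160 * (w^2 + 11/2 * l^2)" unfolding distrib_left using w2 zero_le_power2[of l] by linarith
 qed (use s in auto)
 hence "\<gamma>^2 * l^2 / u^3 * ((170 * l^2 + 2) * \<sigma>) <= \<gamma>^2 * l^2 / u^3 * ((160 * (w^2 + 11/2 * l^2)) * s)"
  using u by (intro mult_left_mono) auto
 thus "\<gamma>^2 * l^2 / (1 - l^2)^3 * (170 * l^2 + 2) * \<sigma> <= (80 * \<gamma>^2 * l^2 / (1 - l^2)^3) * 2 * s * (w^2 + 11/2 * l^2)"
  unfolding u_def by (simp add: mult_ac)
 \<comment> \<open>With denominators cleared, the difference is 1198 t^2 - 423 t + 158 in t = l^2,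
   which is positive by completing the square.\<close>
 have poly: "667 * l^2 + 2 * u^2 <= 160 * u + 400 * l^2 * (1 + 3 * l^2)"
 proof -
  define t where "t = l^2"
  have "0 <= 1198 * (t - 423 / 2396)^2 + (158 - 423^2 / 4792)" by (intro add_nonneg_nonneg) auto
  also have "... = 160 * (1 - t) + 400 * t * (1 + 3 * t) - (667 * t + 2 * (1 - t)^2)"
   by (simp add: sq_eq algebra_simps)
  finally show ?thesis by (simp add: t_def u_def)
 qed
 have "667 * l^2 / u^2 + 2 = (667 * l^2 + 2 * u^2) / u^2" using u by (simp add: field_simps)
 also have "... <= (160 * u + 400 * l^2 * (1 + 3 * l^2)) / u^2" using poly by (rule divide_right_mono) simp
 also have "... = 80 / u * (2 + 5 * l^2 * ((1 + 3 * l^2) / u))" using u by (simp add: field_simps sq_eq)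
 also have "... <= 80 / u * (2 * w^2 + 5 * l^2 * ((1 + 3 * l^2) / u))" using u w2 by (intro mult_left_mono) auto
 finally have "\<gamma>^2 * l^2 / u^2 * (667 * l^2 / u^2 + 2) <= \<gamma>^2 * l^2 / u^2 * (80 / u * (2 * w^2 + 5 * l^2 * ((1 + 3 * l^2) / u)))"
  by (rule mult_left_mono) (use u in simp)
 hence "\<gamma>^2 * l^2 / u^2 * (667 * l^2 / u^2 + 2) * (T / K) <= (80 * \<gamma>^2 * l^2 / u^3) * (2 * w^2 + 5 * l^2 * ((1 + 3 * l^2) / u)) * (T / K)"
  using T K by (intro mult_right_mono) (auto simp: sq_eq power3_eq_cube mult_ac)
 thus "\<gamma>^2 * l^2 / (1 - l^2)^2 * (667 * l^2 / (1 - l^2)^2 + 2) * (T / K)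
   <= (80 * \<gamma>^2 * l^2 / (1 - l^2)^3) * (2 * w^2 + 5 * l^2 * ((1 + 3 * l^2) / (1 - l^2))) * (T / K)"
  by (simp add: u_def)
qed

context
 fixes n m \<eta> \<gamma> l w L Lt gap G V :: real and \<epsilon> :: "nat => real" and K :: nat
 assumes l: "0 <= l" "l < 1" and w: "1 <= w" and V: "0 <= V" and G: "0 <= G" and gap: "0 <= gap"
  and K: "1 <= K" and eps: "!!k. 0 <= \<epsilon> k" and L: "0 < L" and n: "1 <= n" and m: "1 <= m"
  and eta: "0 < \<eta>" and gam: "0 < \<gamma>"
begin

lemma majorants:
 fixes \<sigma> \<beta> T :: real
 defines "\<sigma> \<equiv> pi^2 * n * L^2" and "\<beta> \<equiv> L * sqrt n / \<eta>" and "T \<equiv> (\<Sum>k<K. n^2 * Lt^2 * \<epsilon> k / \<eta>^2)"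
 shows "stationarity_rate m \<gamma> \<beta> l \<sigma> gap V T K <= stationarity_bound n m \<eta> \<gamma> l w L Lt gap G V \<epsilon> K"
  and "consensus_rate \<gamma> l \<sigma> V T K <= consensus_bound n m \<eta> \<gamma> l w L Lt gap G V \<epsilon> K"
proof -
 define s where "s = 16 * sqrt (2 * pi) * L^2 * n"
 have K0: "0 < real K" using K by simp
 have l2: "l^2 < 1" using l by (simp add: power_less_one_iff abs_square_less_1)
 have s0: "0 <= \<sigma>" using n by (simp add: \<sigma>_def)
 \<comment> \<open>The half-turn constant pi^2 is compared with the constant 16 sqrt (2 pi) of the
   stated bounds.\<close>
 have ss: "\<sigma> <= s"
 proof -
  have "1 <= sqrt (2 * pi)" using pi_gt3 by simp
  moreover have "pi * pi <= 4 * 4" using pi_less_4 pi_gt3 by (intro mult_mono) auto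
  ultimately have "pi^2 <= 16 * sqrt (2 * pi)" unfolding sq_eq by linarith
  hence "pi^2 * (n * L^2) <= 16 * sqrt (2 * pi) * (n * L^2)" using n by (intro mult_right_mono) auto
  thus ?thesis by (simp add: \<sigma>_def s_def mult_ac)
 qed
 have T0: "0 <= T" unfolding T_def using eps by (intro sum_nonneg) auto
 have cm: "consensus_rate \<gamma> l \<sigma> V T K <= consensus_majorant \<gamma> l w s V T K"
  by (rule consensus_rate_le_majorant[OF l w V T0 K0 s0 ss])
 have Te: "T = n^2 * Lt^2 / \<eta>^2 * (\<Sum>k<K. \<epsilon> k)" unfolding T_def by (simp add: sum_distrib_left)
 define u where "u = 1 - l^2"
 have u: "0 < u" "u <= 1" using l2 by (auto simp: u_def)
 have se: "0 <= (\<Sum>k<K. \<epsilon> k)" "0 <= (\<Sum>k<K. \<epsilon> (Suc k))" using eps by (auto intro: sum_nonneg)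
 have b2: "\<beta>^2 = L^2 * n / \<eta>^2" using n by (simp add: \<beta>_def power_mult_distrib power_divide)
 have n32: "n powr (3/2) = n * sqrt n"
  using n powr_add[of n 1 "1/2"] by (simp add: powr_half_sqrt)
 \<comment> \<open>The constant 96 is 6 * 16, so there is room for the factor 4 together with the
   passage from \<sigma> to \<open>s\<close>.\<close>
 have sm: "4 * (\<gamma> * \<beta>) * \<sigma> / m <= 96 * sqrt (2 * pi) * L^3 * n powr (3/2) * \<gamma> / (m * \<eta>)"
 proof -
  have "4 * (\<gamma> * \<beta>) * \<sigma> / m <= 6 * (\<gamma> * \<beta>) * s / m"
   using ss s0 gam L n eta m by (intro divide_right_mono mult_mono) (auto simp: \<beta>_def)
  also have "... = 96 * sqrt (2 * pi) * L^3 * n powr (3/2) * \<gamma> / (m * \<eta>)"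
   unfolding n32 by (simp add: \<beta>_def s_def sq_eq power3_eq_cube mult_ac)
  finally show ?thesis .
 qed
 \<comment> \<open>Naming the summands keeps them opaque, and the comparison becomes linear
   arithmetic.\<close>
 define T4 where "T4 = 320 * \<gamma>^2 * l^4 * L^2 * n / ((1 - l^2)^3 * \<eta>^2 * K) * (G + 16 * sqrt (2 * pi) * L^2 * n + Lt^2 * n^2 * \<epsilon> 0 / \<eta>^2)"
 define T5 where "T5 = 25600 * sqrt (2 * pi) * n^3 * L^6 * \<gamma>^4 * l^4 * (3 + l^2) / (m * \<eta>^4 * (1 - l^2)^2)"
 define T7 where "T7 = (160 * \<gamma>^2 * l^2 * L^4 * n^3 / (\<eta>^4 * (1 - l^2)^3)) * (5 * l^2 * Lt^2 / L^2) * ((1 + 3 * l^2) / (1 - l^2)) * ((\<Sum>k<K. \<epsilon> (Suc k)) / K)"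
 define T8 where "T8 = (160 * \<gamma>^2 * l^2 * L^4 * n^3 / (\<eta>^4 * (1 - l^2)^3)) * (300 * l^4 * \<gamma>^2 * Lt^2 * n / (\<eta>^2 * (1 - l^2)^2)) * ((\<Sum>k<K. \<epsilon> k) / K)"
 have nonneg: "0 <= T4" "0 <= T5" "0 <= T7" "0 <= T8"
  using u G n m se eps[of 0] unfolding T4_def T5_def T7_def T8_def u_def[symmetric] by auto
 have A6: "2 * \<beta>^2 * ((80 * \<gamma>^2 * l^2 / u^3) * 2 * s * (w^2 + 11/2 * l^2))
   = (160 * \<gamma>^2 * l^2 * L^4 * n^2 / (\<eta>^2 * u^3)) * 32 * sqrt (2 * pi) * (w^2 + 11/2 * l^2)"
  unfolding b2 s_def using u eta by (simp add: field_simps sq_eq power4_eq_xxxx)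
 have A8: "2 * \<beta>^2 * ((80 * \<gamma>^2 * l^2 / u^3) * (2 * w^2 + 5 * l^2 * ((1 + 3 * l^2) / u)) * (T / K))
   = (160 * \<gamma>^2 * l^2 * L^4 * n^3 / (\<eta>^4 * u^3)) * (2 * w^2 * Lt^2 / L^2 + (5 * l^2 * Lt^2 / L^2) * ((1 + 3 * l^2) / u)) * ((\<Sum>k<K. \<epsilon> k) / K)"
 proof -
  define X where "X = 2 * w^2 + 5 * l^2 * ((1 + 3 * l^2) / u)"
  have "2 * w^2 * Lt^2 / L^2 + (5 * l^2 * Lt^2 / L^2) * r = (2 * w^2 + 5 * l^2 * r) * (Lt^2 / L^2)" for r
   by (simp add: algebra_simps add_divide_distrib)
  hence Xe: "2 * w^2 * Lt^2 / L^2 + (5 * l^2 * Lt^2 / L^2) * ((1 + 3 * l^2) / u) = X * (Lt^2 / L^2)"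
   unfolding X_def .
  show ?thesis unfolding Xe unfolding X_def[symmetric] b2 Te using u eta L K0
   by (simp add: field_simps sq_eq power3_eq_cube power4_eq_xxxx)
 qed
 have A3: "2 * \<beta>^2 * ((1 + 20 / u) * V / K) = 2 * L^2 * n / (\<eta>^2 * K) * (1 + 20 / u) * V"
  unfolding b2 by simp
 have A9: "4 * (1 + \<gamma> * \<beta>) * (T / K) <= (1 + 3 * \<gamma> * L * sqrt n / (2 * \<eta>)) * (4 * Lt^2 * n^2 / \<eta>^2) * ((\<Sum>k<K. \<epsilon> k) / K)"
 proof -
  have "4 * (1 + \<gamma> * \<beta>) * (T / K) <= 4 * (1 + 3/2 * (\<gamma> * \<beta>)) * (T / K)"
  proof (rule mult_right_mono)
   have "0 <= \<gamma> * \<beta>" using gam L n eta by (simp add: \<beta>_def)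
   thus "4 * (1 + \<gamma> * \<beta>) <= 4 * (1 + 3/2 * (\<gamma> * \<beta>))" by (simp add: mult.commute)
  qed (use T0 K0 in simp)
  also have "... = (1 + 3 * \<gamma> * L * sqrt n / (2 * \<eta>)) * (4 * Lt^2 * n^2 / \<eta>^2) * ((\<Sum>k<K. \<epsilon> k) / K)"
   unfolding Te by (simp add: \<beta>_def mult_ac)
  finally show ?thesis .
 qed
 have "2 * \<beta>^2 * consensus_rate \<gamma> l \<sigma> V T K <= 2 * \<beta>^2 * consensus_majorant \<gamma> l w s V T K"
  using cm by (rule mult_left_mono) simp
 also have "... = 2 * L^2 * n / (\<eta>^2 * K) * (1 + 20 / u) * V
   + (160 * \<gamma>^2 * l^2 * L^4 * n^2 / (\<eta>^2 * u^3)) * 32 * sqrt (2 * pi) * (w^2 + 11/2 * l^2)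
   + (160 * \<gamma>^2 * l^2 * L^4 * n^3 / (\<eta>^4 * u^3)) * (2 * w^2 * Lt^2 / L^2 + (5 * l^2 * Lt^2 / L^2) * ((1 + 3 * l^2) / u)) * ((\<Sum>k<K. \<epsilon> k) / K)"
  unfolding consensus_majorant_def u_def[symmetric] A3[symmetric] A6[symmetric] A8[symmetric] by (simp only: distrib_left)
 finally have main: "2 * \<beta>^2 * consensus_rate \<gamma> l \<sigma> V T K <= ..." .
 show "stationarity_rate m \<gamma> \<beta> l \<sigma> gap V T K <= stationarity_bound n m \<eta> \<gamma> l w L Lt gap G V \<epsilon> K"
  using main sm A9 nonneg unfolding stationarity_rate_def stationarity_bound_def T4_def[symmetric] T5_def[symmetric] T7_def[symmetric]
  unfolding distrib_left[of "160 * \<gamma>^2 * l^2 * L^4 * n^3 / (\<eta>^4 * (1 - l^2)^3)"] distrib_right[of _ _ "(\<Sum>k<K. \<epsilon> k) / K"] T8_def[symmetric] u_def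
  by linarith
 define H where "H = H_const n \<eta> \<gamma> l L"
 have H: "1 <= H" unfolding H_def H_const_def u_def[symmetric] using u n by auto
 define C1 where "C1 = 160 * H * \<gamma>^2 * l^4 / ((1 - l^2)^3 * K) * (G + 16 * sqrt (2 * pi) * L^2 * n + Lt^2 * n^2 * \<epsilon> 0 / \<eta>^2)"
 define C3 where "C3 = 12800 * H * sqrt (2 * pi) * n^2 * L^4 * \<gamma>^4 * l^4 * (3 + l^2) / (m * \<eta>^2 * (1 - l^2)^2)"
 define C5 where "C5 = H * (80 * \<gamma>^2 * l^2 * L^2 * n^2 / (\<eta>^2 * (1 - l^2)^3)) * (5 * l^2 * Lt^2 / L^2) * ((1 + 3 * l^2) / (1 - l^2)) * ((\<Sum>k<K. \<epsilon> (Suc k)) / K)"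
 define C6 where "C6 = H * (1 + 3 * \<gamma> * L * sqrt n / (2 * \<eta>)) * (16 * Lt^2 * n^2 / \<eta>^2) * ((\<Sum>k<K. \<epsilon> k) / K)"
 define C8 where "C8 = 16 * H * gap / (\<gamma> * K)"
 define C9 where "C9 = H * (384 * sqrt (2 * pi) * L^3 * n powr (3/2) * \<gamma> / (m * \<eta>))"
 define C4 where "C4 = H * (80 * \<gamma>^2 * l^2 * L^2 * n^2 / (\<eta>^2 * (1 - l^2)^3)) * (300 * l^4 * \<gamma>^2 * Lt^2 * n / (\<eta>^2 * (1 - l^2)^2)) * ((\<Sum>k<K. \<epsilon> k) / K)"
 have nonneg2: "0 <= C1" "0 <= C3" "0 <= C4" "0 <= C5" "0 <= C6" "0 <= C8" "0 <= C9"
  using u G n m se eps[of 0] H gap gam L eta unfolding C1_def C3_def C4_def C5_def C6_def C8_def C9_def u_def[symmetric] by auto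
 have mj0: "0 <= consensus_majorant \<gamma> l w s V T K"
 proof -
  have "0 <= consensus_rate \<gamma> l \<sigma> V T K"
   unfolding consensus_rate_def u_def[symmetric] using u V T0 s0 K0 by auto
  with cm show ?thesis by linarith
 qed
 have "consensus_rate \<gamma> l \<sigma> V T K <= 1 * consensus_majorant \<gamma> l w s V T K" using cm by simp
 also have "... <= H * consensus_majorant \<gamma> l w s V T K" using H mj0 by (rule mult_right_mono)
 also have "... = H / K * (1 + 20 / u) * V + (80 * \<gamma>^2 * l^2 * L^2 * n / u^3) * 32 * H * sqrt (2 * pi) * (w^2 + 11/2 * l^2)
   + H * (80 * \<gamma>^2 * l^2 * L^2 * n^2 / (\<eta>^2 * u^3)) * (2 * w^2 * Lt^2 / L^2 + (5 * l^2 * Lt^2 / L^2) * ((1 + 3 * l^2) / u)) * ((\<Sum>k<K. \<epsilon> k) / K)"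
 proof -
  define X where "X = 2 * w^2 + 5 * l^2 * ((1 + 3 * l^2) / u)"
  have "2 * w^2 * Lt^2 / L^2 + (5 * l^2 * Lt^2 / L^2) * r = (2 * w^2 + 5 * l^2 * r) * (Lt^2 / L^2)" for r
   by (simp add: algebra_simps add_divide_distrib)
  hence X: "2 * w^2 * Lt^2 / L^2 + (5 * l^2 * Lt^2 / L^2) * ((1 + 3 * l^2) / u) = X * (Lt^2 / L^2)"
   unfolding X_def .
  have 1: "H * ((80 * \<gamma>^2 * l^2 / u^3) * 2 * s * (w^2 + 11/2 * l^2)) = (80 * \<gamma>^2 * l^2 * L^2 * n / u^3) * 32 * H * sqrt (2 * pi) * (w^2 + 11/2 * l^2)"
   unfolding s_def by (simp add: mult_ac)
  have 2: "H * ((80 * \<gamma>^2 * l^2 / u^3) * X * (T / K)) = H * (80 * \<gamma>^2 * l^2 * L^2 * n^2 / (\<eta>^2 * u^3)) * (X * (Lt^2 / L^2)) * ((\<Sum>k<K. \<epsilon> k) / K)"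
   unfolding Te using u eta L K0 by (simp add: field_simps)
  show ?thesis unfolding consensus_majorant_def u_def[symmetric] X_def[symmetric] X distrib_left[of H] 1 2
   by (simp add: mult_ac)
 qed
 finally have main2: "consensus_rate \<gamma> l \<sigma> V T K <= ..." .
 show "consensus_rate \<gamma> l \<sigma> V T K <= consensus_bound n m \<eta> \<gamma> l w L Lt gap G V \<epsilon> K"
  using main2 nonneg2 unfolding consensus_bound_def Let_def H_def[symmetric] C1_def[symmetric] C3_def[symmetric] C5_def[symmetric] C6_def[symmetric] C8_def[symmetric] C9_def[symmetric]
  unfolding distrib_left[of "H * (80 * \<gamma>^2 * l^2 * L^2 * n^2 / (\<eta>^2 * (1 - l^2)^3))"] distrib_right[of _ _ "(\<Sum>k<K. \<epsilon> k) / K"] C4_def[symmetric] u_def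
  by linarith
qed

end

section \<open>Independence and square-integrable vectors\<close>

lemma (in prob_space) indep_set_mono:
 "indep_set A B ==> A' <= A ==> B' <= B ==> indep_set A' B'"
 unfolding indep_sets2_eq by blast

lemma (in prob_space)
 assumes ind: "indep_set (sets A) (sets B)" and sp: "space A = space M" "space B = space M"
  and X: "X \<in> A \<rightarrow>\<^sub>M S" and Y: "Y \<in> B \<rightarrow>\<^sub>M T"
 shows indep_random_variables: "random_variable S X" "random_variable T Y"
  and indep_joint_distr: "distr M S X \<Otimes>\<^sub>M distr M T Y = distr M (S \<Otimes>\<^sub>M T) (%x. (X x, Y x))"
proof -
 have "sets A <= events" "sets B <= events" using ind by (simp_all add: indep_sets2_eq)
 hence "subalgebra M A" "subalgebra M B" using sp by (simp_all add: subalgebra_def)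
 thus rv[measurable]: "random_variable S X" "random_variable T Y" using X Y by (auto intro: measurable_from_subalg)
 interpret DX: prob_space "distr M S X" by (rule prob_space_distr) simp
 interpret DY: prob_space "distr M T Y" by (rule prob_space_distr) simp
 show "distr M S X \<Otimes>\<^sub>M distr M T Y = distr M (S \<Otimes>\<^sub>M T) (%x. (X x, Y x))"
 proof (rule pair_measure_eqI)
  show "sigma_finite_measure (distr M S X)" "sigma_finite_measure (distr M T Y)" ..
  show "sets (distr M S X \<Otimes>\<^sub>M distr M T Y) = sets (distr M (S \<Otimes>\<^sub>M T) (%x. (X x, Y x)))"
   by (simp cong: sets_pair_measure_cong)
  fix U V assume U: "U \<in> sets (distr M S X)" and V: "V \<in> sets (distr M T Y)"
  hence [measurable]: "U \<in> sets S" "V \<in> sets T" by simp_all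
  have "X -` U \<inter> space M \<in> sets A" "Y -` V \<inter> space M \<in> sets B"
   using measurable_sets[OF X, of U] measurable_sets[OF Y, of V] sp by auto
  hence "prob ((X -` U \<inter> space M) \<inter> (Y -` V \<inter> space M)) = prob (X -` U \<inter> space M) * prob (Y -` V \<inter> space M)"
   by (rule indep_setD[OF ind])
  moreover have "(X -` U \<inter> space M) \<inter> (Y -` V \<inter> space M) = (%x. (X x, Y x)) -` (U \<times> V) \<inter> space M" by auto
  ultimately have "prob ((%x. (X x, Y x)) -` (U \<times> V) \<inter> space M) = prob (X -` U \<inter> space M) * prob (Y -` V \<inter> space M)" by simp
  thus "emeasure (distr M S X) U * emeasure (distr M T Y) V = emeasure (distr M (S \<Otimes>\<^sub>M T) (%x. (X x, Y x))) (U \<times> V)"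
   by (simp add: emeasure_distr emeasure_eq_measure ennreal_mult)
 qed
qed

text \<open>The joint law is a product, so \<open>Y\<close> may be integrated out with
  \<open>X\<close> frozen. This and its real-valued companion take the place of conditional
  expectations in the analysis of the scheme.\<close>

lemma (in prob_space) nn_integral_indep:
 assumes ind: "indep_set (sets A) (sets B)" and sp: "space A = space M" "space B = space M"
  and X: "X \<in> A \<rightarrow>\<^sub>M S" and Y: "Y \<in> B \<rightarrow>\<^sub>M T"
  and h: "case_prod h \<in> borel_measurable (S \<Otimes>\<^sub>M T)"
 shows "(\<integral>\<^sup>+w. h (X w) (Y w) \<partial>M) = (\<integral>\<^sup>+w. (\<integral>\<^sup>+y. h (X w) y \<partial>distr M T Y) \<partial>M)"
proof -
 note [measurable] = indep_random_variables[OF ind sp X Y] h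
 note eq = indep_joint_distr[OF ind sp X Y]
 interpret D: prob_space "distr M T Y" by (rule prob_space_distr) simp
 have "(\<integral>\<^sup>+w. h (X w) (Y w) \<partial>M) = (\<integral>\<^sup>+p. case_prod h p \<partial>distr M (S \<Otimes>\<^sub>M T) (%x. (X x, Y x)))"
  by (subst nn_integral_distr) simp_all
 also have "... = (\<integral>\<^sup>+x. (\<integral>\<^sup>+y. h x y \<partial>distr M T Y) \<partial>distr M S X)"
  unfolding eq[symmetric] by (subst D.nn_integral_fst[symmetric]) simp_all
 also have "... = (\<integral>\<^sup>+w. (\<integral>\<^sup>+y. h (X w) y \<partial>distr M T Y) \<partial>M)"
  by (subst nn_integral_distr) simp_all
 finally show ?thesis .
qed

lemma (in prob_space) integral_indep:
 fixes h :: "'b => 'c => real"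
 assumes ind: "indep_set (sets A) (sets B)" and sp: "space A = space M" "space B = space M"
  and X: "X \<in> A \<rightarrow>\<^sub>M S" and Y: "Y \<in> B \<rightarrow>\<^sub>M T"
  and h: "case_prod h \<in> borel_measurable (S \<Otimes>\<^sub>M T)"
  and int: "integrable M (%w. h (X w) (Y w))"
 shows "(\<integral>w. h (X w) (Y w) \<partial>M) = (\<integral>w. (\<integral>y. h (X w) y \<partial>distr M T Y) \<partial>M)"
proof -
 note [measurable] = indep_random_variables[OF ind sp X Y] h
 note eq = indep_joint_distr[OF ind sp X Y]
 interpret D: prob_space "distr M T Y" by (rule prob_space_distr) simp
 interpret D': prob_space "distr M S X" by (rule prob_space_distr) simp
 interpret DD: pair_sigma_finite "distr M S X" "distr M T Y" ..
 have int': "integrable (distr M S X \<Otimes>\<^sub>M distr M T Y) (case_prod h)"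
  unfolding eq by (subst integrable_distr_eq) (use int in \<open>simp_all\<close>)
 have "(\<integral>w. h (X w) (Y w) \<partial>M) = (\<integral>p. case_prod h p \<partial>distr M (S \<Otimes>\<^sub>M T) (%x. (X x, Y x)))"
  by (subst integral_distr) simp_all
 also have "... = (\<integral>x. (\<integral>y. h x y \<partial>distr M T Y) \<partial>distr M S X)"
  unfolding eq[symmetric] using DD.integral_fst'[OF int'] by simp
 also have "... = (\<integral>w. (\<integral>y. h (X w) y \<partial>distr M T Y) \<partial>M)"
  by (subst integral_distr) simp_all
 finally show ?thesis .
qed

definition L2 :: "'w measure => ('w => 'a::euclidean_space) => bool" where
 "L2 M Z \<longleftrightarrow> Z \<in> borel_measurable M & integrable M (%w. (norm (Z w))^2)"

definition moment2 :: "'w measure => ('w => 'a::euclidean_space) => real" where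
 "moment2 M Z = (\<integral>w. (norm (Z w))^2 \<partial>M)"

lemma moment2_nonneg [simp]: "0 <= moment2 M Z"
 by (simp add: moment2_def)

lemma L2D:
 "L2 M Z ==> Z \<in> borel_measurable M"
 "L2 M Z ==> integrable M (%w. (norm (Z w))^2)"
 by (simp_all add: L2_def)

lemma L2_bound:
 assumes "L2 M Z" "Y \<in> borel_measurable M" "!!w. w \<in> space M ==> norm (Y w) <= c * norm (Z w)"
 shows "L2 M Y"
 unfolding L2_def
proof
 show "integrable M (%w. (norm (Y w))^2)"
 proof (rule bintegrable_bound)
  show "integrable M (%w. c^2 * (norm (Z w))^2)" using assms(1) by (simp add: L2_def)
  show "AE w in M. norm ((norm (Y w))^2) <= norm (c^2 * (norm (Z w))^2)"
   using power_mono[OF assms(3) norm_ge_zero, of _ 2] by (intro AE_I2) (simp add: power_mult_distrib)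
 qed (use assms in simp)
qed (rule assms)

lemma norm_add_sq_le:
 fixes a b :: "'a::real_inner"
 assumes t: "0 < t"
 shows "(norm (a + b))^2 <= (1 + t) * (norm a)^2 + (1 + 1 / t) * (norm b)^2"
proof -
 have "0 <= (norm (t *\<^sub>R a - b))^2 / t" using t by simp
 also have "... = t * (norm a)^2 - 2 * (a \<bullet> b) + (norm b)^2 / t"
  using t unfolding power2_norm_eq_inner by (simp add: inner_diff inner_commute field_simps)
 finally show ?thesis unfolding power2_norm_eq_inner by (simp add: inner_add inner_commute algebra_simps)
qed

lemma L2_add:
 fixes Y Z :: "'w => 'a::euclidean_space"
 assumes "L2 M Y" "L2 M Z"
 shows "L2 M (%w. Y w + Z w)"
 unfolding L2_def
proof
 note [measurable] = L2D(1)[OF assms(1)] L2D(1)[OF assms(2)]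
 show "(%w. Y w + Z w) \<in> borel_measurable M" by simp
 show "integrable M (%w. (norm (Y w + Z w))^2)"
 proof (rule bintegrable_bound)
  show "integrable M (%w. 2 * (norm (Y w))^2 + 2 * (norm (Z w))^2)"
   using assms by (simp add: L2_def)
  show "AE w in M. norm ((norm (Y w + Z w))^2) <= norm (2 * (norm (Y w))^2 + 2 * (norm (Z w))^2)"
   using norm_add_sq_le[of 1 "Y _" "Z _"] by (intro AE_I2) simp
 qed simp
qed

lemma L2_scaleR:
 "L2 M Z ==> L2 M (%w. c *\<^sub>R Z w)"
 by (rule L2_bound[where c="\<bar>c\<bar>"]) (auto simp: L2_def)

lemma L2_minus:
 "L2 M Z ==> L2 M (%w. - Z w)"
 by (rule L2_bound[where c=1]) (auto simp: L2_def)

lemma L2_diff: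
 assumes "L2 M Y" "L2 M Z"
 shows "L2 M (%w. Y w - Z w)"
 using L2_add[OF assms(1) L2_minus[OF assms(2)]] by simp

lemma L2_inner:
 fixes Y Z :: "'w => 'a::euclidean_space"
 assumes "L2 M Y" "L2 M Z"
 shows "integrable M (%w. Y w \<bullet> Z w)"
proof (rule bintegrable_bound)
 note [measurable] = L2D(1)[OF assms(1)] L2D(1)[OF assms(2)]
 show "(%w. Y w \<bullet> Z w) \<in> borel_measurable M" by simp
 show "integrable M (%w. (norm (Y w))^2 + (norm (Z w))^2)"
  using assms by (simp add: L2_def)
 show "AE w in M. norm (Y w \<bullet> Z w) <= norm ((norm (Y w))^2 + (norm (Z w))^2)"
 proof (rule AE_I2)
  fix w
  have "\<bar>Y w \<bullet> Z w\<bar> <= norm (Y w) * norm (Z w)" by (rule Cauchy_Schwarz_ineq2)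
  also have "... <= (norm (Y w))^2 + (norm (Z w))^2"
  proof -
   have "0 <= norm (Y w) * norm (Z w)" by simp
   with zero_le_power2[of "norm (Y w) - norm (Z w)"] show ?thesis unfolding power2_diff by linarith
  qed
  finally show "norm (Y w \<bullet> Z w) <= norm ((norm (Y w))^2 + (norm (Z w))^2)" by simp
 qed
qed

lemma moment2_add_le:
 fixes Y Z :: "'w => 'a::euclidean_space"
 assumes Y: "L2 M Y" and Z: "L2 M Z" and t: "0 < t"
 shows "moment2 M (%w. Y w + Z w) <= (1 + t) * moment2 M Y + (1 + 1 / t) * moment2 M Z"
proof -
 have "moment2 M (%w. Y w + Z w) <= (\<integral>w. (1 + t) * (norm (Y w))^2 + (1 + 1 / t) * (norm (Z w))^2 \<partial>M)"
  unfolding moment2_def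
  using L2_add[OF Y Z] Y Z by (intro integral_mono norm_add_sq_le t) (auto simp: L2_def)
 also have "... = (1 + t) * moment2 M Y + (1 + 1 / t) * moment2 M Z"
  unfolding moment2_def using Y Z by (subst bintegral_add) (auto simp: L2_def)
 finally show ?thesis .
qed

lemma moment2_minus [simp]: "moment2 M (%w. - Z w) = moment2 M Z"
 by (simp add: moment2_def)

lemma moment2_orthogonal:
 fixes Y Z :: "'w => 'a::euclidean_space"
 assumes Y: "L2 M Y" and Z: "L2 M Z" and o: "(\<integral>w. Y w \<bullet> Z w \<partial>M) = 0"
 shows "moment2 M (%w. Y w + Z w) = moment2 M Y + moment2 M Z"
proof -
 have "moment2 M (%w. Y w + Z w) = (\<integral>w. (norm (Y w))^2 + 2 * (Y w \<bullet> Z w) + (norm (Z w))^2 \<partial>M)"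
  unfolding moment2_def power2_norm_eq_inner by (simp add: inner_add inner_commute algebra_simps)
 also have "... = moment2 M Y + 2 * (\<integral>w. Y w \<bullet> Z w \<partial>M) + moment2 M Z"
  unfolding moment2_def using L2_inner[OF Y Z] Y Z by (simp add: L2_def)
 finally show ?thesis by (simp add: o)
qed

lemma moment2_mono:
 fixes Y :: "'w => 'a::euclidean_space" and Z :: "'w => 'b::euclidean_space"
 assumes Y: "L2 M Y" and Z: "L2 M Z"
  and le: "!!w. w \<in> space M ==> norm (Y w) <= c * norm (Z w)"
 shows "moment2 M Y <= c^2 * moment2 M Z"
proof -
 have "moment2 M Y <= (\<integral>w. c^2 * (norm (Z w))^2 \<partial>M)"
  unfolding moment2_def
  using Y Z power_mono[OF le norm_ge_zero, of _ 2] by (intro integral_mono) (auto simp: L2_def power_mult_distrib)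
 thus ?thesis by (simp add: moment2_def)
qed

lemma moment2_scaleR: "moment2 M (%w. c *\<^sub>R Z w) = c^2 * moment2 M Z"
 by (simp add: moment2_def power_mult_distrib)

text \<open>Extended integrals exist beforehand, so a moment estimate in them proves integrability
  and the real-valued bound at once.\<close>

lemma L2_from_nn:
 fixes Z :: "'w => 'a::euclidean_space"
 assumes [measurable]: "Z \<in> borel_measurable M" and b: "(\<integral>\<^sup>+w. ennreal ((norm (Z w))^2) \<partial>M) <= ennreal c" and c: "0 <= c"
 shows "L2 M Z" "moment2 M Z <= c"
proof -
 show "L2 M Z" unfolding L2_def
  using b by (auto intro!: integrableI_nonneg simp: le_less_trans[OF _ ennreal_less_top])
 hence "integrable M (%w. (norm (Z w))^2)" by (simp add: L2_def)
 hence "ennreal (moment2 M Z) <= ennreal c"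
  unfolding moment2_def using b by (subst nn_integral_eq_integral[symmetric]) auto
 thus "moment2 M Z <= c" using c by (simp add: ennreal_le_iff)
qed

lemma moment2_nn:
 assumes "L2 M Z"
 shows "(\<integral>\<^sup>+w. ennreal ((norm (Z w))^2) \<partial>M) = ennreal (moment2 M Z)"
 unfolding moment2_def by (rule nn_integral_eq_integral) (use assms in \<open>auto simp: L2_def\<close>)

lemma (in prob_space) L2_bounded:
 fixes Z :: "'a => 'b::euclidean_space"
 assumes [measurable]: "Z \<in> borel_measurable M" and b: "!!w. w \<in> space M ==> norm (Z w) <= c"
 shows "L2 M Z"
 unfolding L2_def
proof
 show "integrable M (%w. (norm (Z w))^2)"
  by (rule integrable_const_bound[where B="c^2"]) (use power_mono[OF b norm_ge_zero, of _ 2] in \<open>auto intro!: AE_I2\<close>)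
qed (rule assms)

lemma (in prob_space) L2_integrable_norm:
 fixes Z :: "'a => 'b::euclidean_space"
 assumes Z: "L2 M Z"
 shows "integrable M (%w. norm (Z w))"
proof (rule bintegrable_bound)
 show "integrable M (%w. 1 + (norm (Z w))^2)" using Z by (simp add: L2_def)
 have "norm z <= 1 + (norm z)^2" for z :: 'b
  using zero_le_power2[of "norm z - 1"] by (simp add: power2_diff)
   (smt (verit) norm_ge_zero)
 thus "AE w in M. norm (norm (Z w)) <= norm (1 + (norm (Z w))^2)" by (intro AE_I2) simp
qed (rule measurable_compose[OF L2D(1)[OF Z] borel_measurable_norm])

lemma matrix_mult_measurable:
 fixes X :: "'w => real^'n^'m" and A :: "real^'m^'k"
 assumes "X \<in> borel_measurable M"
 shows "(%w. A ** X w) \<in> borel_measurable M"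
proof -
 have "linear (%X :: real^'n^'m. A ** X)"
  by (rule linearI) (simp_all add: matrix_add_ldistrib matrix_scalar_ac scalar_matrix_assoc)
 hence "continuous_on UNIV (%X :: real^'n^'m. A ** X)" by (rule linear_continuous_on[OF linear_conv_bounded_linear[THEN iffD1]])
 thus ?thesis using measurable_compose[OF assms borel_measurable_continuous_onI] by simp
qed

lemma vec_nth_measurable:
 fixes X :: "'w => 'b::euclidean_space^'m"
 assumes "X \<in> borel_measurable M"
 shows "(%w. X w $ i) \<in> borel_measurable M"
 by (rule measurable_compose[OF assms]) (intro borel_measurable_continuous_onI continuous_intros)

lemma vec_lambda_measurable:
 fixes X :: "'m::finite => 'w => real^'n::finite"
 assumes "!!i. X i \<in> borel_measurable M"
 shows "(%w. \<chi> i. X i w) \<in> borel_measurable M"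
proof (subst borel_measurable_euclidean_space, intro ballI)
 fix b :: "real^'n^'m" assume "b \<in> Basis"
 note [measurable] = assms
 have "(%w. \<Sum>i\<in>UNIV. X i w \<bullet> b $ i) \<in> borel_measurable M" by measurable
 thus "(%w. (\<chi> i. X i w) \<bullet> b) \<in> borel_measurable M" by (simp add: inner_vec_def)
qed

lemma average_measurable:
 fixes X :: "'w => real^'n^'m"
 assumes "X \<in> borel_measurable M"
 shows "(%w. average (X w)) \<in> borel_measurable M"
 unfolding average_def using vec_nth_measurable[OF assms] by measurable

lemma inner_matrix_mult:
 fixes A :: "real^'m^'k" and X :: "real^'n^'m" and Y :: "real^'n^'k"
 shows "(A ** X) \<bullet> Y = X \<bullet> (transpose A ** Y)"
proof -
 have "(A ** X) \<bullet> Y = (\<Sum>i\<in>UNIV. \<Sum>j\<in>UNIV. \<Sum>k\<in>UNIV. A $ i $ k * X $ k $ j * Y $ i $ j)"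
  by (simp add: inner_vec_def matrix_matrix_mult_def sum_distrib_right)
 also have "... = (\<Sum>k\<in>UNIV. \<Sum>j\<in>UNIV. \<Sum>i\<in>UNIV. A $ i $ k * X $ k $ j * Y $ i $ j)"
  by (subst (2) sum.swap, subst sum.swap, subst (2) sum.swap) (rule refl)
 also have "... = X \<bullet> (transpose A ** Y)"
  by (simp add: inner_vec_def matrix_matrix_mult_def transpose_def sum_distrib_left mult_ac)
 finally show ?thesis .
qed

section \<open>Sampling and the gradient estimator\<close>

lemma Pair_borel_measurable:
 fixes f :: "'w => 'a::second_countable_topology" and g :: "'w => 'b::second_countable_topology"
 shows "f \<in> borel_measurable A ==> g \<in> borel_measurable A ==> (%w. (f w, g w)) \<in> borel_measurable A"
 by (simp add: borel_prod[symmetric])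

lemma shifted_scaled_lipschitz:
 fixes f :: "'a::real_normed_vector => real"
 assumes lip: "K-lipschitz_on UNIV f" and eta: "0 <= \<eta>"
 shows "(K * \<eta>)-lipschitz_on UNIV (%u. f (x + \<eta> *\<^sub>R u))"
proof (rule lipschitz_onI)
 fix u w
 show "dist (f (x + \<eta> *\<^sub>R u)) (f (x + \<eta> *\<^sub>R w)) <= K * \<eta> * dist u w"
  using lipschitz_diff[OF lip, of "x + \<eta> *\<^sub>R u" "x + \<eta> *\<^sub>R w"] eta
  by (simp add: dist_norm scaleR_diff_right[symmetric] mult.assoc)
qed (use lipschitz_on_nonneg[OF lip] eta in simp)

context
 fixes P :: "('n::finite, 'm::finite, 'p::finite, 'd::finite) mpec" and \<mu> L :: real and D :: "'m => real"
 assumes lower: "lower_level P \<mu> L D" and wp: "well_posed P" and lipd: "lipschitz_data P"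
begin

definition implicit_cost :: "'m => real^'n => real^'d => real" where
 "implicit_cost i x \<xi> = cost P i x (zsol P i x) \<xi>"

lemma cost_comp_measurable:
 "f \<in> borel_measurable A ==> g \<in> borel_measurable A ==> h \<in> borel_measurable A ==>
  (%w. cost P i (f w) (g w) (h w)) \<in> borel_measurable A"
 using measurable_compose[OF Pair_borel_measurable[OF _ Pair_borel_measurable] cost_measurable[OF lower wp, of i], of f A g h] by simp

lemma vmap_comp_measurable:
 "f \<in> borel_measurable A ==> g \<in> borel_measurable A ==> h \<in> borel_measurable A ==>
  (%w. vmap P i (f w) (g w) (h w)) \<in> borel_measurable A"
 using measurable_compose[OF Pair_borel_measurable[OF _ Pair_borel_measurable] vmap_measurable[OF lower wp, of i], of f A g h] by simp

lemma zsol_comp_measurable: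
 "f \<in> borel_measurable A ==> (%w. zsol P i (f w)) \<in> borel_measurable A"
 by (rule measurable_compose[OF _ zsol_measurable[OF lower wp]])

lemma implicit_cost_measurable:
 "f \<in> borel_measurable A ==> h \<in> borel_measurable A ==> (%w. implicit_cost i (f w) (h w)) \<in> borel_measurable A"
 unfolding implicit_cost_def by (intro cost_comp_measurable zsol_comp_measurable)

lemma lip_facts:
 shows lipx_measurable: "lipx P i \<in> borel_measurable borel" and lipz_measurable: "lipz P i \<in> borel_measurable borel"
  and lipx_sq: "integrable (law P i) (%\<xi>. (lipx P i \<xi>)^2)" and lipz_sq: "integrable (law P i) (%\<xi>. (lipz P i \<xi>)^2)"
  and lipz_lip: "(lipz P i \<xi>)-lipschitz_on UNIV (%z. cost P i x z \<xi>)"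
  and lipx_lip: "(lipx P i \<xi>)-lipschitz_on UNIV (%x. implicit_cost i x \<xi>)"
 using lipd by (simp_all add: lipschitz_data_def implicit_cost_def)

lemma lipx_nonneg: "0 <= lipx P i \<xi>" and lipz_nonneg: "0 <= lipz P i \<xi>"
 using lipx_lip[of i \<xi>] lipz_lip[of i \<xi>] by (auto intro: lipschitz_on_nonneg)

lemma L0_sq: "(\<integral>\<xi>. (lipx P i \<xi>)^2 \<partial>law P i) <= (L0 P)^2" and L0_nonneg: "0 <= L0 P"
proof -
 have *: "sqrt (\<integral>\<xi>. (lipx P i \<xi>)^2 \<partial>law P i) <= L0 P" for i unfolding L0_def by (rule Max_ge) auto
 have "0 <= sqrt (\<integral>\<xi>. (lipx P i \<xi>)^2 \<partial>law P i)" for i by simp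
 with * show "0 <= L0 P" by (meson order_trans)
 with *[of i] show "(\<integral>\<xi>. (lipx P i \<xi>)^2 \<partial>law P i) <= (L0 P)^2" by (simp add: sqrt_le_D)
qed

lemma Lt0_sq: "(\<integral>\<xi>. (lipz P i \<xi>)^2 \<partial>law P i) <= (Lt0 P)^2"
proof -
 have *: "sqrt (\<integral>\<xi>. (lipz P i \<xi>)^2 \<partial>law P i) <= Lt0 P" for i unfolding Lt0_def by (rule Max_ge) auto
 thus ?thesis by (simp add: sqrt_le_D)
qed

lemma lipx_integrable: "integrable (law P i) (lipx P i)" and lipx_mean: "(\<integral>\<xi>. lipx P i \<xi> \<partial>law P i) <= L0 P"
proof -
 interpret prob_space "law P i" by (rule law_facts[OF lower wp])
 have [measurable_cong]: "sets (law P i) = sets borel" by (rule law_facts[OF lower wp])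
 note [measurable] = lipx_measurable
 show i: "integrable (law P i) (lipx P i)"
 proof (rule bintegrable_bound)
  show "integrable (law P i) (%\<xi>. 1 + (lipx P i \<xi>)^2)" using lipx_sq by simp
  have "z <= 1 + z^2" if "0 <= z" for z :: real using zero_le_power2[of "z - 1"] that by (simp add: power2_diff)
  thus "AE \<xi> in law P i. norm (lipx P i \<xi>) <= norm (1 + (lipx P i \<xi>)^2)" using lipx_nonneg by (intro AE_I2) simp
 qed simp
 let ?e = "expectation (lipx P i)"
 have "0 <= (\<integral>\<xi>. (lipx P i \<xi> - ?e)^2 \<partial>law P i)" by simp
 also have "... = (\<integral>\<xi>. (lipx P i \<xi>)^2 - 2 * ?e * lipx P i \<xi> + ?e^2 \<partial>law P i)"
  by (simp add: power2_diff algebra_simps)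
 also have "... = (\<integral>\<xi>. (lipx P i \<xi>)^2 \<partial>law P i) - 2 * ?e * ?e + ?e^2" using i lipx_sq prob_space by simp
 finally have "?e^2 <= (L0 P)^2" using L0_sq[of i] by (simp add: sq_eq)
 thus "?e <= L0 P" using L0_nonneg by (rule power2_le_imp_le)
qed

lemma implicit_cost_integrable: "integrable (law P i) (implicit_cost i x)"
 unfolding implicit_cost_def [abs_def] using wp by (simp add: well_posed_def)

lemma agent_obj_eq: "agent_obj P i x = (\<integral>\<xi>. implicit_cost i x \<xi> \<partial>law P i)"
 by (simp add: agent_obj_def implicit_cost_def)

lemma agent_obj_lipschitz: "(L0 P)-lipschitz_on UNIV (agent_obj P i)"
proof (rule lipschitz_onI)
 fix x y
 have e: "agent_obj P i x - agent_obj P i y = (\<integral>\<xi>. implicit_cost i x \<xi> - implicit_cost i y \<xi> \<partial>law P i)"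
  unfolding agent_obj_eq by (simp add: implicit_cost_integrable)
 have "\<bar>agent_obj P i x - agent_obj P i y\<bar> <= (\<integral>\<xi>. lipx P i \<xi> * norm (x - y) \<partial>law P i)"
  unfolding e
 proof (rule order_trans[OF integral_abs_bound integral_mono])
  show "\<bar>implicit_cost i x \<xi> - implicit_cost i y \<xi>\<bar> <= lipx P i \<xi> * norm (x - y)" for \<xi>
   by (rule lipschitz_diff[OF lipx_lip])
 qed (use implicit_cost_integrable lipx_integrable in auto)
 also have "... <= L0 P * norm (x - y)" using lipx_mean by (simp add: mult_right_mono)
 finally show "dist (agent_obj P i x) (agent_obj P i y) <= L0 P * dist x y" by (simp add: dist_norm)
qed (rule L0_nonneg)

text \<open>The two-point estimator with exact lower-level solutions. It separates the sampling
  noise from the error of the solver.\<close>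

definition estimate :: "real => 'm => real^'n => real^'d => real^'n => real^'n" where
 "estimate \<eta> i x z u = (real CARD('n) / (2 * \<eta>) * (implicit_cost i (x + \<eta> *\<^sub>R u) z - implicit_cost i (x - \<eta> *\<^sub>R u) z)) *\<^sub>R u"

lemma estimate_measurable:
 "f \<in> borel_measurable A ==> g \<in> borel_measurable A ==> h \<in> borel_measurable A ==>
  (%w. estimate \<eta> i (f w) (g w) (h w)) \<in> borel_measurable A"
 unfolding estimate_def
 by (intro borel_measurable_scaleR borel_measurable_times borel_measurable_diff implicit_cost_measurable borel_measurable_add) auto

text \<open>For a fixed sample the function u to implicit cost at
  \<open>x + \<eta> *\<^sub>R u\<close> has Lipschitz constant \<open>lipx P i z * \<eta>\<close>,
  and \<open>antipodal_poincare\<close> gives (n / (2 \<eta>))^2 * 4 pi^2 lipx^2 \<eta>^2 / n = pi^2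
  n lipx^2.\<close>

lemma estimate_sphere_moment:
 assumes eta: "0 < \<eta>"
 shows "(\<integral>\<^sup>+u. ennreal ((norm (estimate \<eta> i x z u))^2) \<partial>sph) <= ennreal (pi^2 * real CARD('n) * (lipx P i z)^2)"
proof -
 let ?n = "real CARD('n)" and ?f = "%u. implicit_cost i (x + \<eta> *\<^sub>R u) z"
 have lip: "(lipx P i z * \<eta>)-lipschitz_on UNIV ?f"
  using eta by (intro shifted_scaled_lipschitz[OF lipx_lip]) simp
 have n: "0 < ?n" by simp
 have "(\<integral>\<^sup>+u. ennreal ((norm (estimate \<eta> i x z u))^2) \<partial>sph)
   = (\<integral>\<^sup>+u. ennreal ((?n / (2 * \<eta>))^2 * (?f u - ?f (- u))^2) \<partial>sph)"
 proof (rule nn_integral_cong_AE)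
  show "AE u in sph. ennreal ((norm (estimate \<eta> i x z u))^2) = ennreal ((?n / (2 * \<eta>))^2 * (?f u - ?f (- u))^2)"
   using AE_uniform_sphere_norm by eventually_elim (simp only: estimate_def norm_scaleR power_mult_distrib power2_abs, simp)
 qed
 also have "... = ennreal (\<integral>u. (?n / (2 * \<eta>))^2 * (?f u - ?f (- u))^2 \<partial>sph)"
  by (rule nn_integral_eq_integral) (use antipodal_difference_integrable(1)[OF lip] in auto)
 also have "... <= ennreal (pi^2 * ?n * (lipx P i z)^2)"
 proof (rule ennreal_leI)
  have "(\<integral>u. (?n / (2 * \<eta>))^2 * (?f u - ?f (- u))^2 \<partial>sph) <= (?n / (2 * \<eta>))^2 * (4 * pi^2 * (lipx P i z * \<eta>)^2 / ?n)"
   unfolding integral_mult_right_zero using antipodal_poincare[OF lip] by (intro mult_left_mono) simp_all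
  also have "... = pi^2 * ?n * (lipx P i z)^2" using eta n by (simp add: field_simps sq_eq)
  finally show "(\<integral>u. (?n / (2 * \<eta>))^2 * (?f u - ?f (- u))^2 \<partial>sph) <= pi^2 * ?n * (lipx P i z)^2" .
 qed
 finally show ?thesis .
qed

lemma estimate_moment2:
 assumes eta: "0 < \<eta>"
 shows "(\<integral>\<^sup>+p. ennreal ((norm (estimate \<eta> i x (fst p) (snd p)))^2) \<partial>(law P i \<Otimes>\<^sub>M sph)) <= ennreal (pi^2 * real CARD('n) * (L0 P)^2)"
proof -
 interpret S: prob_space "sph :: (real^'n) measure" by (rule prob_space_uniform_sphere)
 have [measurable_cong]: "sets (law P i) = sets borel" by (rule law_facts[OF lower wp])
 have [measurable]: "(%p. estimate \<eta> i x (fst p) (snd p)) \<in> borel_measurable (law P i \<Otimes>\<^sub>M sph)"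
  by (intro estimate_measurable) simp_all
 have "(\<integral>\<^sup>+p. ennreal ((norm (estimate \<eta> i x (fst p) (snd p)))^2) \<partial>(law P i \<Otimes>\<^sub>M sph))
   = (\<integral>\<^sup>+z. (\<integral>\<^sup>+u. ennreal ((norm (estimate \<eta> i x z u))^2) \<partial>sph) \<partial>law P i)"
  by (subst S.nn_integral_fst[symmetric]) simp_all
 also have "... <= (\<integral>\<^sup>+z. ennreal (pi^2 * real CARD('n) * (lipx P i z)^2) \<partial>law P i)"
  by (rule nn_integral_mono) (rule estimate_sphere_moment[OF eta])
 also have "... = ennreal (pi^2 * real CARD('n) * (\<integral>z. (lipx P i z)^2 \<partial>law P i))"
  by (subst nn_integral_eq_integral) (use lipx_sq in auto)
 also have "... <= ennreal (pi^2 * real CARD('n) * (L0 P)^2)"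
  by (intro ennreal_leI mult_left_mono L0_sq) simp
 finally show ?thesis .
qed

text \<open>Integrating over the sample first turns sampled costs into the agent's objective; the
  sphere integral that remains is the symmetric form of the smoothed gradient.\<close>

lemma estimate_mean:
 assumes eta: "0 < \<eta>"
 shows "(\<integral>p. estimate \<eta> i x (fst p) (snd p) \<bullet> t \<partial>(law P i \<Otimes>\<^sub>M sph)) = sphere_gradient \<eta> (agent_obj P i) x \<bullet> t"
proof -
 let ?c = "real CARD('n) / (2 * \<eta>)"
 interpret S: prob_space "sph :: (real^'n) measure" by (rule prob_space_uniform_sphere)
 interpret Lw: prob_space "law P i" by (rule law_facts[OF lower wp])
 interpret LS: pair_prob_space "law P i" "sph :: (real^'n) measure" ..
 have [measurable_cong]: "sets (law P i) = sets borel" by (rule law_facts[OF lower wp])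
 have [measurable]: "(%p. estimate \<eta> i x (fst p) (snd p)) \<in> borel_measurable (law P i \<Otimes>\<^sub>M sph)"
  by (intro estimate_measurable) simp_all
 have "L2 (law P i \<Otimes>\<^sub>M sph) (%p. estimate \<eta> i x (fst p) (snd p))"
  by (rule L2_from_nn(1)[OF _ estimate_moment2[OF eta]]) auto
 moreover have "L2 (law P i \<Otimes>\<^sub>M sph) (%p :: (real^'d) \<times> (real^'n). t)"
  by (rule LS.P.L2_bounded[where c="norm t"]) auto
 ultimately have int: "integrable (law P i \<Otimes>\<^sub>M sph) (%p. estimate \<eta> i x (fst p) (snd p) \<bullet> t)"
  by (rule L2_inner)
 hence int': "integrable (law P i \<Otimes>\<^sub>M sph) (%(z, u). estimate \<eta> i x z u \<bullet> t)"
  by (simp only: case_prod_unfold)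
 have "(\<integral>p. estimate \<eta> i x (fst p) (snd p) \<bullet> t \<partial>(law P i \<Otimes>\<^sub>M sph))
   = (\<integral>u. (\<integral>z. estimate \<eta> i x z u \<bullet> t \<partial>law P i) \<partial>sph)"
  using LS.integral_snd[OF int'] by (simp only: case_prod_unfold)
 also have "... = (\<integral>u. ?c * (agent_obj P i (x + \<eta> *\<^sub>R u) - agent_obj P i (x - \<eta> *\<^sub>R u)) * (u \<bullet> t) \<partial>sph)"
 proof (intro bintegral_cong refl)
  fix u :: "real^'n"
  have "(\<integral>z. estimate \<eta> i x z u \<bullet> t \<partial>law P i)
    = (\<integral>z. (implicit_cost i (x + \<eta> *\<^sub>R u) z - implicit_cost i (x - \<eta> *\<^sub>R u) z) * (?c * (u \<bullet> t)) \<partial>law P i)"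
   by (simp add: estimate_def mult_ac)
  also have "... = (\<integral>z. implicit_cost i (x + \<eta> *\<^sub>R u) z - implicit_cost i (x - \<eta> *\<^sub>R u) z \<partial>law P i) * (?c * (u \<bullet> t))"
   by (rule integral_mult_left_zero)
  also have "(\<integral>z. implicit_cost i (x + \<eta> *\<^sub>R u) z - implicit_cost i (x - \<eta> *\<^sub>R u) z \<partial>law P i)
    = agent_obj P i (x + \<eta> *\<^sub>R u) - agent_obj P i (x - \<eta> *\<^sub>R u)"
   unfolding agent_obj_eq
   by (rule bintegral_diff) (rule implicit_cost_integrable)+
  finally show "(\<integral>z. estimate \<eta> i x z u \<bullet> t \<partial>law P i) = ?c * (agent_obj P i (x + \<eta> *\<^sub>R u) - agent_obj P i (x - \<eta> *\<^sub>R u)) * (u \<bullet> t)"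
   by (simp add: mult_ac)
 qed
 also have "... = sphere_gradient \<eta> (agent_obj P i) x \<bullet> t"
  using sphere_gradient_inner_sym[OF agent_obj_lipschitz, of \<eta> i x t] eta by simp
 finally show ?thesis .
qed

end

section \<open>Sigma-algebras generated by sources of randomness\<close>

lemma sets_events_of:
 assumes "X \<in> borel_measurable M"
 shows "events_of M X <= sets M"
 using assms unfolding events_of_def by (auto intro: measurable_sets)

lemma Int_stable_events_of:
 fixes X :: "'w => 'c::topological_space"
 shows "Int_stable (events_of M X)"
 unfolding events_of_def
proof (rule Int_stableI, clarify)
 fix A B :: "'c set" assume "A \<in> sets borel" "B \<in> sets borel"
 thus "\<exists>C. X -` A \<inter> space M \<inter> (X -` B \<inter> space M) = X -` C \<inter> space M & C \<in> sets borel"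
  by (intro exI[of _ "A \<inter> B"]) auto
qed

locale sampled = prob_space M
 for M :: "'w measure" and P :: "('n::finite, 'm::finite, 'p::finite, 'd::finite) mpec"
  and S :: "'w measure" and \<xi> :: "'m => nat => 'w => real^'d" and v :: "'m => nat => 'w => real^'n" +
 assumes samp: "sampling P M S \<xi> v"
begin

lemma samp_facts:
 shows "subalgebra M S" "\<xi> i k \<in> borel_measurable M" "distr M borel (\<xi> i k) = law P i"
  "v i k \<in> borel_measurable M" "distr M borel (v i k) = sph"
  "indep_sets (source_events M S \<xi> v) UNIV"
 using samp by (auto simp: sampling_def)

lemma source_events_sets: "source_events M S \<xi> v c <= sets M"
 using samp_facts(1) sets_events_of[OF samp_facts(2)] sets_events_of[OF samp_facts(4)]
 by (cases c) (auto simp: subalgebra_def)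

text \<open>One family of sigma-algebras for all purposes: histories, single draws and complements
  of single draws are all of this form, and disjoint index sets give independence by
  \<open>info_indep\<close>.\<close>

definition info :: "'m source set => 'w measure" where
 "info I = sigma (space M) (\<Union>c\<in>I. source_events M S \<xi> v c)"

lemma info_generators: "(\<Union>c\<in>I. source_events M S \<xi> v c) <= Pow (space M)"
 using source_events_sets sets.space_closed by blast

lemma space_info [simp]: "space (info I) = space M"
 by (simp add: info_def space_measure_of_conv)

lemma sets_info: "sets (info I) = sigma_sets (space M) (\<Union>c\<in>I. source_events M S \<xi> v c)"
 unfolding info_def by (rule sets_measure_of[OF info_generators])

lemma info_subalgebra: "subalgebra M (info I)"
 unfolding subalgebra_def sets_info using source_events_sets
 by (auto intro!: sets.sigma_sets_subset)

lemma info_mono: "I <= J ==> subalgebra (info J) (info I)"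
 unfolding subalgebra_def sets_info by (auto intro!: sigma_sets_mono')

lemma info_le:
 assumes "A <= sets (info I)"
 shows "subalgebra (info I) (sigma (space M) A)"
proof -
 have "A <= Pow (space M)" using assms sets.space_closed[of "info I"] by auto
 thus ?thesis unfolding subalgebra_def using assms
  by (auto simp: sets_measure_of) (metis assms sets.sigma_sets_subset space_info subsetD)
qed

lemma source_in_info: "c \<in> I ==> source_events M S \<xi> v c <= sets (info I)"
 unfolding sets_info by auto

lemma info_measurable_M: "f \<in> info I \<rightarrow>\<^sub>M N ==> f \<in> M \<rightarrow>\<^sub>M N"
 by (rule measurable_from_subalg[OF info_subalgebra])

lemma info_measurable_mono: "f \<in> info I \<rightarrow>\<^sub>M N ==> I <= J ==> f \<in> info J \<rightarrow>\<^sub>M N"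
 by (rule measurable_from_subalg[OF info_mono])

lemma events_of_measurable:
 assumes "events_of M X <= sets F" "space F = space M"
 shows "X \<in> borel_measurable F"
 using assms unfolding events_of_def by (intro measurableI) auto

lemma sample_measurable: "Sample i k \<in> I ==> \<xi> i k \<in> borel_measurable (info I)"
 using source_in_info[of "Sample i k" I] by (intro events_of_measurable) auto

lemma direction_measurable: "Direction i k \<in> I ==> v i k \<in> borel_measurable (info I)"
 using source_in_info[of "Direction i k" I] by (intro events_of_measurable) auto

lemma solver_measurable: "Solver \<in> I ==> f \<in> S \<rightarrow>\<^sub>M N ==> f \<in> info I \<rightarrow>\<^sub>M N"
 using source_in_info[of Solver I] samp_facts(1)
 by (intro measurable_from_subalg[of "info I" S]) (auto simp: subalgebra_def)

lemma source_Int_stable: "Int_stable (source_events M S \<xi> v c)"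
 by (cases c) (simp_all add: sets.Int_stable Int_stable_events_of)

lemma info_indep:
 assumes "I \<inter> J = {}"
 shows "indep_set (sets (info I)) (sets (info J))"
proof -
 have "indep_sets (%b. sigma_sets (space M) (\<Union>c\<in>case_bool I J b. source_events M S \<xi> v c)) (UNIV :: bool set)"
 proof (rule indep_sets_collect_sigma)
  show "indep_sets (source_events M S \<xi> v) (\<Union>b\<in>UNIV. case_bool I J b)"
   by (rule indep_sets_mono_index[OF _ samp_facts(6)]) simp
  show "disjoint_family_on (case_bool I J) UNIV"
   using assms by (auto simp: disjoint_family_on_def split: bool.splits)
 qed (rule source_Int_stable)
 moreover have "(%b. sigma_sets (space M) (\<Union>c\<in>case_bool I J b. source_events M S \<xi> v c)) = case_bool (sets (info I)) (sets (info J))"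
  by (auto simp: fun_eq_iff sets_info split: bool.splits)
 ultimately show ?thesis unfolding indep_set_def by simp
qed

lemma sample_direction_distr:
 "distr M (borel \<Otimes>\<^sub>M borel) (%w. (\<xi> i k w, v i k w)) = law P i \<Otimes>\<^sub>M sph"
proof -
 have "indep_set (sets (info {Sample i k})) (sets (info {Direction i k}))" by (rule info_indep) simp
 from indep_joint_distr[OF this space_info space_info sample_measurable direction_measurable]
 show ?thesis using samp_facts(3,5) by simp
qed

lemma AE_direction_norm: "AE w in M. norm (v i k w) = 1"
proof -
 have "AE u in distr M borel (v i k). norm u = 1" unfolding samp_facts(5) by (rule AE_uniform_sphere_norm)
 thus ?thesis by (subst (asm) AE_distr_iff) (use samp_facts(4) in auto)
qed

text \<open>\<open>Solver\<close> belongs to every history: the initial point and the solver's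
  randomness count as known from the start, which is harmless because they are independent of all
  samples and directions.\<close>

definition past_sources :: "nat => 'm source set" where
 "past_sources k = insert Solver {c. \<exists>j l. l < k & (c = Sample j l \<or> c = Direction j l)}"

abbreviation "hist k \<equiv> info (past_sources k)"

lemma past_sources_mono: "k <= l ==> past_sources k <= past_sources l"
 unfolding past_sources_def by fastforce

lemma available_subalgebra:
 assumes "past_sources k <= I" "Direction i k \<in> I"
 shows "subalgebra (info I) (available M S \<xi> v k i)"
 unfolding available_def
proof (rule info_le, intro Un_least UN_least)
 show "sets S <= sets (info I)" using source_in_info[of Solver I] assms(1) by (auto simp: past_sources_def)
 show "events_of M (v i k) <= sets (info I)" using source_in_info[of "Direction i k" I] assms(2) by simp
 fix j l assume "l \<in> {..<k}"
 hence "Sample j l \<in> I" "Direction j l \<in> I" using assms(1) by (auto simp: past_sources_def)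
 thus "events_of M (\<xi> j l) <= sets (info I)" "events_of M (v j l) <= sets (info I)"
  using source_in_info[of "Sample j l" I] source_in_info[of "Direction j l" I] by auto
qed

end

lemma L2_rows:
 fixes Z :: "'w => real^'n^'m"
 assumes "!!i. L2 M (%w. Z w $ i)"
 shows "L2 M Z" "moment2 M Z = (\<Sum>i\<in>UNIV. moment2 M (%w. Z w $ i))"
proof -
 have "(%w. \<chi> i. Z w $ i) \<in> borel_measurable M" by (rule vec_lambda_measurable) (rule L2D(1)[OF assms])
 hence "Z \<in> borel_measurable M" by simp
 moreover have "integrable M (%w. (norm (Z w $ i))^2)" for i by (rule L2D(2)[OF assms])
 ultimately show "L2 M Z" unfolding L2_def norm_rows_sq by simp
 show "moment2 M Z = (\<Sum>i\<in>UNIV. moment2 M (%w. Z w $ i))"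
  unfolding moment2_def norm_rows_sq using L2D(2)[OF assms] by (intro bintegral_sum) auto
qed

lemma L2_row:
 fixes Z :: "'w => real^'n^'m"
 assumes "L2 M Z"
 shows "L2 M (%w. Z w $ i)"
 by (rule L2_bound[OF assms vec_nth_measurable, where c=1])
   (use assms Finite_Cartesian_Product.norm_nth_le[of _ i] in \<open>auto simp: L2_def\<close>)

lemma L2_matrix_mult:
 fixes Z :: "'w => real^'n^'m" and A :: "real^'m^'m"
 assumes "L2 M Z"
 shows "L2 M (%w. A ** Z w)"
 by (rule L2_bound[OF assms matrix_mult_measurable, where c="onorm ((*v) A)"])
   (use assms norm_matrix_mult_le in \<open>auto simp: L2_def\<close>)

lemma norm_comp_measurable:
 fixes f :: "'w => 'a::real_normed_vector"
 shows "f \<in> borel_measurable A ==> (%w. norm (f w)) \<in> borel_measurable A"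
 by (rule measurable_compose[OF _ borel_measurable_norm])

lemma inner_rows: "X \<bullet> Y = (\<Sum>i\<in>UNIV. (X $ i) \<bullet> (Y $ i))" for X Y :: "real^'n^'m"
 by (rule inner_vec_def)

text \<open>The recursion before anything is known about the measurability of the solver outputs.
  For the stochastic approximation method that measurability is itself proved along the
  recursion.\<close>

locale zo_recursion = sampled M P S \<xi> v
 for M :: "'w measure" and P :: "('n::finite, 'm::finite, 'p::finite, 'd::finite) mpec"
  and S :: "'w measure" and \<xi> :: "'m => nat => 'w => real^'d" and v :: "'m => nat => 'w => real^'n" +
 fixes E :: "('m \<times> 'm) set" and W :: "real^'m^'m" and x0 :: "'w => real^'n^'m" and \<eta> \<gamma> \<mu> L :: real and D :: "'m => real"
  and za :: "bool => nat => 'm => 'w => real^'p" and x y :: "nat => 'w => real^'n^'m"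
 assumes network: "network E W" and wp: "well_posed P" and lipd: "lipschitz_data P" and lower: "lower_level P \<mu> L D"
  and eta: "0 < \<eta>" and gam: "0 < \<gamma>"
  and x0m: "x0 \<in> borel_measurable S" and run: "dizs_gt P W \<eta> \<gamma> M \<xi> v za x0 x y"
begin

lemma ds: "doubly_stochastic W"
 using network by (simp add: network_def)

definition "g k w = zo_gradient P \<eta> \<xi> v za x k w"
definition "gp k w = (case k of 0 => 0 | Suc l => g l w)"

lemma run_facts:
 assumes "w \<in> space M"
 shows "x 0 w = x0 w" "y 0 w = 0" "y (Suc k) w = W ** (y k w + g k w - gp k w)"
  "x (Suc k) w = W ** (x k w - \<gamma> *\<^sub>R y (Suc k) w)"
 using run assms unfolding dizs_gt_def g_def gp_def by auto

lemma query_measurable: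
 "f \<in> borel_measurable A ==> h \<in> borel_measurable A ==> (%w. query \<eta> s (f w) (h w)) \<in> borel_measurable A"
 unfolding query_def by (cases s) simp_all

lemma g_measurable_info:
 assumes za: "!!s i. za s k i \<in> borel_measurable (available M S \<xi> v k i)"
  and xm: "x k \<in> borel_measurable (info I)" and I: "past_sources (Suc k) <= I"
 shows "g k \<in> borel_measurable (info I)"
proof -
 have s: "past_sources k <= I" "!!i. Direction i k \<in> I" "!!i. Sample i k \<in> I"
  using I past_sources_mono[of k "Suc k"] by (auto simp: past_sources_def)
 note [measurable] = vec_nth_measurable[OF xm] direction_measurable[OF s(2)] sample_measurable[OF s(3)]
  measurable_from_subalg[OF available_subalgebra[OF s(1,2)] za]
 show ?thesis
  unfolding g_def [abs_def] zo_gradient_def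
  by (intro vec_lambda_measurable borel_measurable_scaleR borel_measurable_times borel_measurable_diff
    cost_comp_measurable[OF lower wp lipd] query_measurable) simp_all
qed

text \<open>Measurability of solver outputs is assumed only before \<open>k\<close>, so that the
  lemma can serve inside an induction that establishes it.\<close>

lemma iterates_measurable_upto:
 assumes "!!s l i. l < k ==> za s l i \<in> borel_measurable (available M S \<xi> v l i)"
 shows "x k \<in> borel_measurable (hist k) & y k \<in> borel_measurable (hist k) & gp k \<in> borel_measurable (hist k)"
 using assms
proof (induction k)
 case 0
 have "x0 \<in> borel_measurable (hist 0)" using x0m by (intro solver_measurable) (auto simp: past_sources_def)
 hence "x 0 \<in> borel_measurable (hist 0)"
  by (subst measurable_cong[of _ _ x0]) (auto simp: run_facts)
 moreover have "y 0 \<in> borel_measurable (hist 0)"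
  by (subst measurable_cong[of _ _ "%_. 0"]) (auto simp: run_facts)
 moreover have "gp 0 \<in> borel_measurable (hist 0)" by (simp add: gp_def [abs_def])
 ultimately show ?case by blast
next
 case (Suc k)
 have s: "past_sources k <= past_sources (Suc k)" by (rule past_sources_mono) simp
 have m: "x k \<in> borel_measurable (hist (Suc k))" "y k \<in> borel_measurable (hist (Suc k))" "gp k \<in> borel_measurable (hist (Suc k))"
  using Suc.IH[OF Suc.prems] info_measurable_mono[OF _ s] by (blast intro: less_SucI)+
 have gm: "g k \<in> borel_measurable (hist (Suc k))" by (rule g_measurable_info[OF Suc.prems[OF lessI] m(1)]) simp
 have gpm: "gp (Suc k) \<in> borel_measurable (hist (Suc k))" using gm by (simp add: gp_def [abs_def])
 note [measurable] = m gm
 have "(%w. W ** (y k w + g k w - gp k w)) \<in> borel_measurable (hist (Suc k))"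
  by (rule matrix_mult_measurable) simp
 hence ym: "y (Suc k) \<in> borel_measurable (hist (Suc k))"
  by (subst measurable_cong[where g="%w. W ** (y k w + g k w - gp k w)"]) (auto simp: run_facts)
 note [measurable] = ym
 have "(%w. W ** (x k w - \<gamma> *\<^sub>R y (Suc k) w)) \<in> borel_measurable (hist (Suc k))"
  by (rule matrix_mult_measurable) simp
 hence "x (Suc k) \<in> borel_measurable (hist (Suc k))"
  by (subst measurable_cong[where g="%w. W ** (x k w - \<gamma> *\<^sub>R y (Suc k) w)"]) (auto simp: run_facts)
 with ym gpm show ?case by blast
qed

end

locale zo_scheme = zo_recursion M P S \<xi> v E W x0 \<eta> \<gamma> \<mu> L D za x y
 for M :: "'w measure" and P :: "('n::finite, 'm::finite, 'p::finite, 'd::finite) mpec"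
  and S \<xi> v E W x0 \<eta> \<gamma> \<mu> L D za x y +
 assumes zam: "!!s k i. za s k i \<in> borel_measurable (available M S \<xi> v k i)"
begin

lemma za_measurable:
 assumes "past_sources k <= I" "Direction i k \<in> I"
 shows "za s k i \<in> borel_measurable (info I)"
 by (rule measurable_from_subalg[OF available_subalgebra[OF assms] zam])

lemma iterates_measurable: "x k \<in> borel_measurable (hist k) & y k \<in> borel_measurable (hist k) & gp k \<in> borel_measurable (hist k)"
 by (rule iterates_measurable_upto) (rule zam)

lemma x_measurable: "past_sources k <= I ==> x k \<in> borel_measurable (info I)"
 using iterates_measurable info_measurable_mono by blast

lemma x_meas_M: "x k \<in> borel_measurable M" and y_meas_M: "y k \<in> borel_measurable M"
 using iterates_measurable info_measurable_M by blast+

lemma g_measurable: "past_sources (Suc k) <= I ==> g k \<in> borel_measurable (info I)"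
 using g_measurable_info[OF zam] x_measurable past_sources_mono[of k "Suc k"] by (meson le_SucI order_refl subset_trans)

end

text \<open>The solver enters through unconditional second moments at the query points, which is the
  common ground of the inexactness condition and the stochastic approximation method.\<close>

locale zo_run = zo_scheme M P S \<xi> v E W x0 \<eta> \<gamma> \<mu> L D za x y
 for M :: "'w measure" and P :: "('n::finite, 'm::finite, 'p::finite, 'd::finite) mpec"
  and S \<xi> v E W x0 \<eta> \<gamma> \<mu> L D za x y +
 fixes \<epsilon> :: "nat => real"
 assumes eps: "!!k. 0 <= \<epsilon> k"
  and zerr: "!!s k i. (\<integral>\<^sup>+w. ennreal ((norm (za s k i w - zsol P i (query \<eta> s (x k w $ i) (v i k w))))^2) \<partial>M) <= ennreal (\<epsilon> k)"
begin

definition "ghat k w = (\<chi> i. estimate P \<eta> i (x k w $ i) (\<xi> i k w) (v i k w))"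
definition "smooth_gradients X = (\<chi> i. sphere_gradient \<eta> (agent_obj P i) (X $ i))" for X :: "real^'n^'m"
definition "grad k w = smooth_gradients (x k w)"
definition "noise k w = ghat k w - grad k w"
definition "bias k w = g k w - ghat k w"
text \<open>Bound for the second moment of one agent's estimate, from
  \<open>estimate_moment2\<close>.\<close>

definition "\<sigma> = pi^2 * (real CARD('n)) * (L0 P)^2"
text \<open>Bound for the second moment of one agent's bias: (n / (2 \<eta>))^2 from the estimator,
  times 2 + 2 for the two query points.\<close>

definition "\<tau> k = (real CARD('n))^2 * (Lt0 P)^2 * \<epsilon> k / \<eta>^2"

lemma sigma_nonneg: "0 <= \<sigma>" and tau_nonneg: "0 <= \<tau> k"
 using eps by (simp_all add: \<sigma>_def \<tau>_def)

lemma ghat_row_measurable: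
 assumes "past_sources k <= I" "Sample i k \<in> I" "Direction i k \<in> I"
 shows "(%w. ghat k w $ i) \<in> borel_measurable (info I)"
 unfolding ghat_def vec_lambda_beta
 by (intro estimate_measurable[OF lower wp lipd] vec_nth_measurable x_measurable sample_measurable direction_measurable assms)

lemma smooth_gradients_component_continuous: "continuous_on UNIV (sphere_gradient \<eta> (agent_obj P i))"
proof -
 have "(L0 P * sqrt (real DIM(real^'n)) / \<eta>)-lipschitz_on UNIV (sphere_gradient \<eta> (agent_obj P i))"
  using sphere_gradient_lipschitz[OF agent_obj_lipschitz[OF lower wp lipd] eta] L0_nonneg[OF lower wp lipd] eta
  by (intro lipschitz_onI) (auto simp: dist_norm)
 thus ?thesis by (rule lipschitz_on_continuous_on)
qed

lemma grad_row_measurable: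
 assumes "past_sources k <= I"
 shows "(%w. grad k w $ i) \<in> borel_measurable (info I)"
 unfolding grad_def smooth_gradients_def vec_lambda_beta
 by (rule measurable_compose[OF vec_nth_measurable[OF x_measurable[OF assms]] borel_measurable_continuous_onI])
   (rule smooth_gradients_component_continuous)

lemma noise_row_measurable:
 assumes "past_sources k <= I" "Sample i k \<in> I" "Direction i k \<in> I"
 shows "(%w. noise k w $ i) \<in> borel_measurable (info I)"
 unfolding noise_def vector_minus_component
 by (intro borel_measurable_diff ghat_row_measurable grad_row_measurable assms)

text \<open>Besides the past this contains the simultaneous draws of the other agents; noises of
  different agents are therefore orthogonal.\<close>

definition "others i k = - {Sample i k, Direction i k}" for i :: 'm and k :: nat

lemma past_others: "past_sources k <= others i k"
 by (auto simp: past_sources_def others_def)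

lemma others_indep: "indep_set (sets (info (others i k))) (sets (info {Sample i k, Direction i k}))"
 by (rule info_indep) (auto simp: others_def)

lemma sample_pair_measurable: "(%w. (\<xi> i k w, v i k w)) \<in> info {Sample i k, Direction i k} \<rightarrow>\<^sub>M borel \<Otimes>\<^sub>M borel"
 by (intro measurable_Pair sample_measurable direction_measurable) auto

lemma ghat_row_moment: "(\<integral>\<^sup>+w. ennreal ((norm (ghat k w $ i))^2) \<partial>M) <= ennreal \<sigma>"
proof -
 have xm: "(%w. x k w $ i) \<in> borel_measurable (info (others i k))"
  by (rule vec_nth_measurable[OF x_measurable[OF past_others]])
 let ?h = "%x p. ennreal ((norm (estimate P \<eta> i x (fst p) (snd p)))^2)"
 have hm: "case_prod ?h \<in> borel_measurable (borel \<Otimes>\<^sub>M (borel \<Otimes>\<^sub>M borel))"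
  unfolding case_prod_unfold
  by (intro measurable_compose[OF _ measurable_ennreal] borel_measurable_power norm_comp_measurable
    estimate_measurable[OF lower wp lipd]) measurable
 have "(\<integral>\<^sup>+w. ennreal ((norm (ghat k w $ i))^2) \<partial>M) = (\<integral>\<^sup>+w. ?h (x k w $ i) (\<xi> i k w, v i k w) \<partial>M)"
  by (simp add: ghat_def)
 also have "... = (\<integral>\<^sup>+w. (\<integral>\<^sup>+p. ?h (x k w $ i) p \<partial>(law P i \<Otimes>\<^sub>M sph)) \<partial>M)"
  unfolding sample_direction_distr[of i k, symmetric]
  by (rule nn_integral_indep[OF others_indep space_info space_info xm sample_pair_measurable hm])
 also have "... <= (\<integral>\<^sup>+w. ennreal \<sigma> \<partial>M)"
  unfolding \<sigma>_def by (intro nn_integral_mono estimate_moment2[OF lower wp lipd eta])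
 also have "... = ennreal \<sigma>" by (simp add: emeasure_space_1)
 finally show ?thesis .
qed

lemma ghat_row: "L2 M (%w. ghat k w $ i)" "moment2 M (%w. ghat k w $ i) <= \<sigma>"
proof -
 have "(%w. ghat k w $ i) \<in> borel_measurable M"
  by (rule info_measurable_M[OF ghat_row_measurable[of k UNIV]]) auto
 from L2_from_nn[OF this ghat_row_moment sigma_nonneg]
 show "L2 M (%w. ghat k w $ i)" "moment2 M (%w. ghat k w $ i) <= \<sigma>" by auto
qed

lemma sphere_gradient_agent_bound: "norm (sphere_gradient \<eta> (agent_obj P i) z) <= L0 P"
 by (rule gradient_norm_le[OF smoothed_lipschitz[OF agent_obj_lipschitz[OF lower wp lipd]] smoothed_gderiv[OF agent_obj_lipschitz[OF lower wp lipd] eta]])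
   (use eta in simp)

lemma grad_row: "L2 M (%w. grad k w $ i)"
 by (rule L2_bounded[where c="L0 P"])
   (rule info_measurable_M[OF grad_row_measurable[of k UNIV]], simp, simp add: grad_def smooth_gradients_def sphere_gradient_agent_bound)

text \<open>The local copy and the test vector are frozen together, being independent of the agent's
  own current draw. Integrating over that draw replaces the estimate by its mean, the smoothed
  gradient.\<close>

lemma noise_row_orthogonal:
 assumes T: "T \<in> borel_measurable (info (others i k))" and Ti: "L2 M T"
 shows "(\<integral>w. (noise k w $ i) \<bullet> T w \<partial>M) = 0"
proof -
 have xm: "(%w. x k w $ i) \<in> borel_measurable (info (others i k))"
  by (rule vec_nth_measurable[OF x_measurable[OF past_others]])
 let ?h = "%q p. estimate P \<eta> i (fst q) (fst p) (snd p) \<bullet> snd q"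
 have Xm: "(%w. (x k w $ i, T w)) \<in> info (others i k) \<rightarrow>\<^sub>M borel \<Otimes>\<^sub>M borel"
  by (intro measurable_Pair xm T)
 have hm: "case_prod ?h \<in> borel_measurable ((borel \<Otimes>\<^sub>M borel) \<Otimes>\<^sub>M (borel \<Otimes>\<^sub>M borel))"
  unfolding case_prod_unfold
  by (intro borel_measurable_inner estimate_measurable[OF lower wp lipd]) measurable
 have int: "integrable M (%w. ?h (x k w $ i, T w) (\<xi> i k w, v i k w))"
  using L2_inner[OF ghat_row(1)[of k i] Ti] by (simp add: ghat_def)
 have "(\<integral>w. (ghat k w $ i) \<bullet> T w \<partial>M) = (\<integral>w. ?h (x k w $ i, T w) (\<xi> i k w, v i k w) \<partial>M)"
  by (simp add: ghat_def)
 also have "... = (\<integral>w. (\<integral>p. ?h (x k w $ i, T w) p \<partial>(law P i \<Otimes>\<^sub>M sph)) \<partial>M)"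
  unfolding sample_direction_distr[of i k, symmetric]
  using integral_indep[OF others_indep space_info space_info Xm sample_pair_measurable hm int] by simp
 also have "... = (\<integral>w. (grad k w $ i) \<bullet> T w \<partial>M)"
  by (simp add: estimate_mean[OF lower wp lipd eta] grad_def smooth_gradients_def)
 finally have "(\<integral>w. (ghat k w $ i) \<bullet> T w \<partial>M) = (\<integral>w. (grad k w $ i) \<bullet> T w \<partial>M)" .
 thus ?thesis
  unfolding noise_def vector_minus_component inner_diff_left
  using L2_inner[OF ghat_row(1)[of k i] Ti] L2_inner[OF grad_row[of k i] Ti] by simp
qed

lemma noise_row: "L2 M (%w. noise k w $ i)"
 unfolding noise_def vector_minus_component by (rule L2_diff[OF ghat_row(1) grad_row])

text \<open>Noise and smoothed gradient are orthogonal and sum to the estimate, so both moments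
  together are at most \<sigma>.\<close>

lemma noise_row_moment:
 "moment2 M (%w. noise k w $ i) <= \<sigma>" "moment2 M (%w. grad k w $ i) <= \<sigma>"
proof -
 have "moment2 M (%w. noise k w $ i + grad k w $ i) = moment2 M (%w. noise k w $ i) + moment2 M (%w. grad k w $ i)"
  by (rule moment2_orthogonal[OF noise_row grad_row noise_row_orthogonal[OF grad_row_measurable[OF past_others] grad_row]])
 hence "moment2 M (%w. noise k w $ i) + moment2 M (%w. grad k w $ i) <= \<sigma>"
  using ghat_row(2)[of k i] by (simp add: noise_def)
 thus "moment2 M (%w. noise k w $ i) <= \<sigma>" "moment2 M (%w. grad k w $ i) <= \<sigma>"
  using moment2_nonneg[of M "%w. noise k w $ i"] moment2_nonneg[of M "%w. grad k w $ i"] by linarith+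
qed

definition "zgap s k i w = norm (za s k i w - zsol P i (query \<eta> s (x k w $ i) (v i k w)))"

text \<open>The solver's error may depend on the current direction but not on the current
  upper-level sample. Removing that one source makes the random Lipschitz constant independent of
  the error, and the expectation factorises.\<close>

lemma weighted_gap_moment:
 "(\<integral>\<^sup>+w. ennreal ((lipz P i (\<xi> i k w))^2 * (zgap s k i w)^2) \<partial>M) <= ennreal ((Lt0 P)^2 * \<epsilon> k)"
proof -
 let ?I = "- {Sample i k}"
 have sub: "past_sources k <= ?I" "Direction i k \<in> ?I" by (auto simp: past_sources_def)
 have zm: "zgap s k i \<in> borel_measurable (info ?I)"
  unfolding zgap_def [abs_def]
  by (intro norm_comp_measurable borel_measurable_diff za_measurable[OF sub] zsol_comp_measurable[OF lower wp lipd]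
    query_measurable vec_nth_measurable x_measurable direction_measurable sub)
 have ind: "indep_set (sets (info ?I)) (sets (info {Sample i k}))" by (rule info_indep) auto
 have sm: "\<xi> i k \<in> borel_measurable (info {Sample i k})" by (rule sample_measurable) simp
 note [measurable] = lipz_measurable[OF lower wp lipd] info_measurable_M[OF zm]
 let ?h = "%d z. ennreal ((lipz P i z)^2 * d^2)"
 have "(\<integral>\<^sup>+w. ennreal ((lipz P i (\<xi> i k w))^2 * (zgap s k i w)^2) \<partial>M) = (\<integral>\<^sup>+w. (\<integral>\<^sup>+z. ?h (zgap s k i w) z \<partial>law P i) \<partial>M)"
  unfolding samp_facts(3)[of i k, symmetric]
  by (rule nn_integral_indep[OF ind space_info space_info zm sm]) measurable
 also have "... = (\<integral>\<^sup>+w. ennreal (\<integral>z. (lipz P i z)^2 \<partial>law P i) * ennreal ((zgap s k i w)^2) \<partial>M)"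
 proof (rule nn_integral_cong)
  fix w
  have "(\<integral>\<^sup>+z. ?h (zgap s k i w) z \<partial>law P i) = ennreal (\<integral>z. (lipz P i z)^2 * (zgap s k i w)^2 \<partial>law P i)"
   by (rule nn_integral_eq_integral) (use lipz_sq[OF lower wp lipd] in auto)
  thus "(\<integral>\<^sup>+z. ?h (zgap s k i w) z \<partial>law P i) = ennreal (\<integral>z. (lipz P i z)^2 \<partial>law P i) * ennreal ((zgap s k i w)^2)"
   by (simp add: ennreal_mult)
 qed
 also have "... = ennreal (\<integral>z. (lipz P i z)^2 \<partial>law P i) * (\<integral>\<^sup>+w. ennreal ((zgap s k i w)^2) \<partial>M)"
  by (rule nn_integral_cmult) simp
 also have "... <= ennreal ((Lt0 P)^2) * ennreal (\<epsilon> k)"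
  using zerr[of s k i] unfolding zgap_def by (intro mult_mono ennreal_leI Lt0_sq[OF lower wp lipd]) auto
 also have "... = ennreal ((Lt0 P)^2 * \<epsilon> k)" using eps[of k] by (simp add: ennreal_mult)
 finally show ?thesis .
qed

lemma bias_row_moment: "(\<integral>\<^sup>+w. ennreal ((norm (bias k w $ i))^2) \<partial>M) <= ennreal (\<tau> k)"
proof -
 let ?c = "(real CARD('n)) / (2 * \<eta>)"
 let ?l = "%w. lipz P i (\<xi> i k w)"
 have pt: "(norm (bias k w $ i))^2 <= 2 * ?c^2 * (?l w)^2 * (zgap True k i w)^2 + 2 * ?c^2 * (?l w)^2 * (zgap False k i w)^2"
  if v1: "norm (v i k w) = 1" for w
 proof -
  define q where "q s = query \<eta> s (x k w $ i) (v i k w)" for s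
  define d where "d s = cost P i (q s) (za s k i w) (\<xi> i k w) - cost P i (q s) (zsol P i (q s)) (\<xi> i k w)" for s
  have d: "\<bar>d s\<bar> <= ?l w * zgap s k i w" for s
   unfolding d_def zgap_def q_def by (rule lipschitz_diff[OF lipz_lip[OF lower wp lipd]])
  have "bias k w $ i = (?c * (d True - d False)) *\<^sub>R v i k w"
   unfolding bias_def g_def zo_gradient_def ghat_def estimate_def[OF lower wp lipd] implicit_cost_def[OF lower wp lipd]
   by (simp add: d_def q_def query_def algebra_simps)
  hence "(norm (bias k w $ i))^2 = ?c^2 * (d True - d False)^2"
   using v1 by (simp only: norm_scaleR power_mult_distrib power2_abs) simp
  moreover have "?c^2 * (d True - d False)^2 <= ?c^2 * (2 * (?l w * zgap True k i w)^2 + 2 * (?l w * zgap False k i w)^2)"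
  proof (rule mult_left_mono)
   have "(d True - d False)^2 <= 2 * (d True)^2 + 2 * (d False)^2"
    using zero_le_power2[of "d True + d False"] by (simp add: sq_eq algebra_simps)
   also have "... <= 2 * (?l w * zgap True k i w)^2 + 2 * (?l w * zgap False k i w)^2"
    using power_mono[OF d[of True] abs_ge_zero, of 2] power_mono[OF d[of False] abs_ge_zero, of 2] by simp
   finally show "(d True - d False)^2 <= 2 * (?l w * zgap True k i w)^2 + 2 * (?l w * zgap False k i w)^2" .
  qed simp
  ultimately show ?thesis by (simp add: power_mult_distrib algebra_simps)
 qed
 note [measurable] = lipz_measurable[OF lower wp lipd] samp_facts(2)[of i k]
 have zm[measurable]: "zgap s k i \<in> borel_measurable M" for s
  unfolding zgap_def [abs_def]
  by (rule info_measurable_M[of _ UNIV], intro norm_comp_measurable borel_measurable_diff za_measurable zsol_comp_measurable[OF lower wp lipd]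
    query_measurable vec_nth_measurable x_measurable direction_measurable) auto
 have "(\<integral>\<^sup>+w. ennreal ((norm (bias k w $ i))^2) \<partial>M)
  <= (\<integral>\<^sup>+w. ennreal (2 * ?c^2) * ennreal ((?l w)^2 * (zgap True k i w)^2) + ennreal (2 * ?c^2) * ennreal ((?l w)^2 * (zgap False k i w)^2) \<partial>M)"
 proof (rule nn_integral_mono_AE)
  show "AE w in M. ennreal ((norm (bias k w $ i))^2)
   <= ennreal (2 * ?c^2) * ennreal ((?l w)^2 * (zgap True k i w)^2) + ennreal (2 * ?c^2) * ennreal ((?l w)^2 * (zgap False k i w)^2)"
   using AE_direction_norm[of i k]
  proof eventually_elim
   case (elim w)
   have "ennreal ((norm (bias k w $ i))^2) <= ennreal (2 * ?c^2 * ((?l w)^2 * (zgap True k i w)^2) + 2 * ?c^2 * ((?l w)^2 * (zgap False k i w)^2))"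
    using pt[OF elim] by (intro ennreal_leI) (simp add: mult.assoc)
   also have "... = ennreal (2 * ?c^2) * ennreal ((?l w)^2 * (zgap True k i w)^2) + ennreal (2 * ?c^2) * ennreal ((?l w)^2 * (zgap False k i w)^2)"
    by (subst ennreal_plus) (auto simp: ennreal_mult[symmetric] simp del: ennreal_plus)
   finally show ?case .
  qed
 qed
 also have "... = ennreal (2 * ?c^2) * (\<integral>\<^sup>+w. ennreal ((?l w)^2 * (zgap True k i w)^2) \<partial>M)
   + ennreal (2 * ?c^2) * (\<integral>\<^sup>+w. ennreal ((?l w)^2 * (zgap False k i w)^2) \<partial>M)"
  by (subst nn_integral_add) (auto simp: nn_integral_cmult)
 also have "... <= ennreal (2 * ?c^2) * ennreal ((Lt0 P)^2 * \<epsilon> k) + ennreal (2 * ?c^2) * ennreal ((Lt0 P)^2 * \<epsilon> k)"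
  by (intro add_mono mult_left_mono weighted_gap_moment) auto
 also have "... = ennreal (\<tau> k)"
 proof -
  have "2 * ?c^2 * ((Lt0 P)^2 * \<epsilon> k) + 2 * ?c^2 * ((Lt0 P)^2 * \<epsilon> k) = \<tau> k"
   using eta by (simp add: \<tau>_def field_simps sq_eq)
  thus ?thesis using eps[of k] by (subst (1 2) ennreal_mult[symmetric]) (auto simp: ennreal_plus[symmetric] simp del: ennreal_plus)
 qed
 finally show ?thesis .
qed

lemma bias_measurable: "bias k \<in> borel_measurable M"
proof -
 have "(%w. \<chi> i. ghat k w $ i) \<in> borel_measurable M"
  by (rule vec_lambda_measurable) (rule L2D(1)[OF ghat_row(1)])
 hence "ghat k \<in> borel_measurable M" by simp
 moreover have "g k \<in> borel_measurable M" by (rule info_measurable_M[OF g_measurable[of k UNIV]]) simp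
 ultimately show ?thesis unfolding bias_def [abs_def] by simp
qed

lemma bias_row: "L2 M (%w. bias k w $ i)" "moment2 M (%w. bias k w $ i) <= \<tau> k"
 using L2_from_nn[OF vec_nth_measurable[OF bias_measurable] bias_row_moment tau_nonneg] by auto

lemma matrix_moments:
 shows noise_si: "L2 M (noise k)" and "moment2 M (noise k) <= (real CARD('m)) * \<sigma>"
  and grad_si: "L2 M (grad k)" and "moment2 M (grad k) <= (real CARD('m)) * \<sigma>"
  and bias_si: "L2 M (bias k)" and "moment2 M (bias k) <= (real CARD('m)) * \<tau> k"
  and ghat_si: "L2 M (ghat k)" and "moment2 M (ghat k) <= (real CARD('m)) * \<sigma>"
 using L2_rows[of M "noise k", OF noise_row] L2_rows[of M "grad k", OF grad_row]
  L2_rows[of M "bias k", OF bias_row(1)] L2_rows[of M "ghat k", OF ghat_row(1)]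
  sum_bounded_above[of "UNIV :: 'm set" "%i. moment2 M (%w. noise k w $ i)" \<sigma>, OF noise_row_moment(1)]
  sum_bounded_above[of "UNIV :: 'm set" "%i. moment2 M (%w. grad k w $ i)" \<sigma>, OF noise_row_moment(2)]
  sum_bounded_above[of "UNIV :: 'm set" "%i. moment2 M (%w. bias k w $ i)" "\<tau> k", OF bias_row(2)]
  sum_bounded_above[of "UNIV :: 'm set" "%i. moment2 M (%w. ghat k w $ i)" \<sigma>, OF ghat_row(2)]
 by auto

lemma noise_orthogonal:
 fixes T :: "'w => real^'n^'m"
 assumes T: "T \<in> borel_measurable (hist k)" and Ti: "L2 M T"
 shows "(\<integral>w. noise k w \<bullet> T w \<partial>M) = 0"
proof -
 have "(\<integral>w. noise k w \<bullet> T w \<partial>M) = (\<Sum>i\<in>UNIV. \<integral>w. (noise k w $ i) \<bullet> (T w $ i) \<partial>M)"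
  unfolding inner_rows
  by (intro bintegral_sum L2_inner[OF noise_row L2_row[OF Ti]])
 also have "... = 0"
 proof (rule sum.neutral, intro ballI)
  fix i
  show "(\<integral>w. (noise k w $ i) \<bullet> (T w $ i) \<partial>M) = 0"
   by (rule noise_row_orthogonal[OF vec_nth_measurable[OF info_measurable_mono[OF T past_others]] L2_row[OF Ti]])
 qed
 finally show ?thesis .
qed

text \<open>A constant matrix moves to the test vector as its transpose and preserves measurability
  in the history.\<close>

lemma mixed_noise_orthogonal:
 fixes T :: "'w => real^'n^'m" and A :: "real^'m^'m"
 assumes T: "T \<in> borel_measurable (hist k)" and Ti: "L2 M T"
 shows "(\<integral>w. (A ** noise k w) \<bullet> T w \<partial>M) = 0"
 unfolding inner_matrix_mult
 by (rule noise_orthogonal[OF matrix_mult_measurable[OF T] L2_matrix_mult[OF Ti]])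

text \<open>Rows are added one at a time, each orthogonal to the sum of the others. The average of m
  noises thus has variance \<sigma> / m, the source of the factor 1/m in the rates.\<close>

lemma average_noise_moment:
 shows "L2 M (%w. average (noise k w))" "moment2 M (%w. average (noise k w)) <= \<sigma> / (real CARD('m))"
proof -
 have s: "L2 M (%w. \<Sum>i\<in>F. noise k w $ i) &
   moment2 M (%w. \<Sum>i\<in>F. noise k w $ i) <= real (card F) * \<sigma>" if "finite F" for F
  using that
 proof (induction F rule: finite_induct)
  case empty
  show ?case by (simp add: L2_def moment2_def)
 next
  case (insert i F)
  have m: "(%w. \<Sum>j\<in>F. noise k w $ j) \<in> borel_measurable (info (others i k))"
   using insert.hyps by (intro borel_measurable_sum noise_row_measurable past_others) (auto simp: others_def)
  have "moment2 M (%w. noise k w $ i + (\<Sum>j\<in>F. noise k w $ j)) = moment2 M (%w. noise k w $ i) + moment2 M (%w. \<Sum>j\<in>F. noise k w $ j)"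
   using insert.IH by (intro moment2_orthogonal noise_row noise_row_orthogonal[OF m]) auto
  also have "... <= \<sigma> + real (card F) * \<sigma>" using insert.IH noise_row_moment(1)[of k i] by linarith
  finally show ?case using insert L2_add[OF noise_row[of k i], of "%w. \<Sum>j\<in>F. noise k w $ j"]
   by (simp add: algebra_simps)
 qed
 from s[of UNIV] have s1: "L2 M (%w. \<Sum>i\<in>UNIV. noise k w $ i)"
  and s2: "moment2 M (%w. \<Sum>i\<in>UNIV. noise k w $ i) <= (real CARD('m)) * \<sigma>" by auto
 show "L2 M (%w. average (noise k w))"
  unfolding average_def by (rule L2_scaleR[OF s1])
 have "moment2 M (%w. average (noise k w)) <= (1 / (real CARD('m)))^2 * ((real CARD('m)) * \<sigma>)"
  unfolding average_def moment2_scaleR using s2 by (rule mult_left_mono) simp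
 thus "moment2 M (%w. average (noise k w)) <= \<sigma> / (real CARD('m))"
  by (simp add: sq_eq)
qed

end

section \<open>Consensus\<close>

lemma matrix_mult_diff:
 fixes A :: "real^'m^'k" and X Y :: "real^'n^'m"
 shows "A ** (X - Y) = A ** X - A ** Y"
 using matrix_add_ldistrib[of A "X - Y" Y] by simp

lemma matrix_mult_scale:
 fixes A :: "real^'m^'k" and X :: "real^'n^'m"
 shows "A ** (c *\<^sub>R X) = c *\<^sub>R (A ** X)"
 by (simp add: matrix_scalar_ac scalar_matrix_assoc)

lemma deviation_measurable:
 fixes X :: "'w => real^'n^'m"
 assumes "X \<in> borel_measurable M"
 shows "(%w. deviation (X w)) \<in> borel_measurable M"
 unfolding deviation_def
 by (intro vec_lambda_measurable borel_measurable_diff vec_nth_measurable average_measurable assms)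

lemma moment2_cong:
 "(!!w. w \<in> space M ==> Y w = Z w) ==> moment2 M Y = moment2 M Z"
 unfolding moment2_def by (rule bintegral_cong) auto

lemma L2_cong:
 assumes "L2 M Z" "!!w. w \<in> space M ==> Y w = Z w"
 shows "L2 M Y"
 using assms(1) measurable_cong[of M Y Z] bintegrable_cong[OF refl, of M "%w. (norm (Y w))^2" "%w. (norm (Z w))^2"] assms(2)
 unfolding L2_def by auto

lemma L2_average:
 fixes Z :: "'w => real^'n^'m"
 assumes "L2 M Z"
 shows "L2 M (%w. average (Z w))" "moment2 M (%w. average (Z w)) <= moment2 M Z / real CARD('m)"
proof -
 have b: "norm (average (Z w)) <= sqrt (1 / real CARD('m)) * norm (Z w)" for w
  by (rule power2_le_imp_le) (use norm_average_sq_le[of "Z w"] in \<open>simp_all add: power_mult_distrib\<close>)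
 show si: "L2 M (%w. average (Z w))"
  by (rule L2_bound[OF assms average_measurable b]) (use assms in \<open>simp add: L2_def\<close>)
 show "moment2 M (%w. average (Z w)) <= moment2 M Z / real CARD('m)"
  using moment2_mono[OF si assms b] by simp
qed

locale zo_rate = zo_run M P S \<xi> v E W x0 \<eta> \<gamma> \<mu> L D za x y \<epsilon>
 for M :: "'w measure" and P :: "('n::finite, 'm::finite, 'p::finite, 'd::finite) mpec"
  and S \<xi> v E W x0 \<eta> \<gamma> \<mu> L D za x y \<epsilon> +
 assumes step1: "9 * lambda_W W * (\<gamma> * (L0 P * sqrt (real CARD('n)) / \<eta>)) <= 1 - (lambda_W W)^2"
  and step2: "20 * (lambda_W W)^2 * (\<gamma> * (L0 P * sqrt (real CARD('n)) / \<eta>)) <= (1 - (lambda_W W)^2)^2"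
  and step3: "\<gamma> * (L0 P * sqrt (real CARD('n)) / \<eta>) <= 1 / 6"
  and finite_V: "integrable M (%w. consensus_error (x0 w))"
  and finite_gap: "integrable M (%w. smoothed_obj P \<eta> (average (x0 w)))"
  and bounded: "bdd_below (range (objective P))"
begin

abbreviation "l \<equiv> lambda_W W"
abbreviation "A \<equiv> mixing W"

definition "\<beta> = L0 P * sqrt (real CARD('n)) / \<eta>"

lemma beta_nonneg: "0 <= \<beta>"
 using L0_nonneg[OF lower wp lipd] eta by (simp add: \<beta>_def)

lemma l_facts: "0 <= l" "l < 1" "0 < 1 - l^2" "l^2 <= 1"
proof -
 show "0 <= l" "l < 1" using lambda_W_nonneg lambda_W_less_one[OF network] by auto
 thus "0 < 1 - l^2" by (simp add: power_less_one_iff abs_square_less_1)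
 thus "l^2 <= 1" by simp
qed

definition "mean_sq Z = moment2 M Z / real CARD('m)" for Z :: "'w => real^'n^'m"

lemma mean_sq_nonneg [simp]: "0 <= mean_sq Z"
 by (simp add: mean_sq_def)

lemma mean_sq_add_le:
 assumes "L2 M Y" "L2 M Z" "0 < t"
 shows "mean_sq (%w. Y w + Z w) <= (1 + t) * mean_sq Y + (1 + 1 / t) * mean_sq Z"
 using divide_right_mono[OF moment2_add_le[OF assms], of "real CARD('m)"] by (simp add: mean_sq_def add_divide_distrib)

lemma mean_sq_mixing:
 assumes "L2 M Z"
 shows "mean_sq (%w. A ** Z w) <= l^2 * mean_sq Z"
 using divide_right_mono[OF moment2_mono[OF L2_matrix_mult[OF assms] assms mixing_norm_le], of "real CARD('m)"]
 by (simp add: mean_sq_def)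

lemma mean_sq_scaleR: "mean_sq (%w. c *\<^sub>R Z w) = c^2 * mean_sq Z"
 by (simp add: mean_sq_def moment2_scaleR)

lemma mean_sq_mono:
 assumes "L2 M Y" "L2 M Z" "!!w. w \<in> space M ==> norm (Y w) <= c * norm (Z w)"
 shows "mean_sq Y <= c^2 * mean_sq Z"
 using divide_right_mono[OF moment2_mono[OF assms], of "real CARD('m)"] by (simp add: mean_sq_def)

lemma mean_sq_cong: "(!!w. w \<in> space M ==> Y w = Z w) ==> mean_sq Y = mean_sq Z"
 unfolding mean_sq_def using moment2_cong[of M Y Z] by simp

lemma mean_sq_noise: "mean_sq (noise k) <= \<sigma>" and mean_sq_grad: "mean_sq (grad k) <= \<sigma>"
 and mean_sq_bias: "mean_sq (bias k) <= \<tau> k" and mean_sq_ghat: "mean_sq (ghat k) <= \<sigma>"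
 using matrix_moments[of k] by (simp_all add: mean_sq_def divide_le_eq mult.commute)

lemma mean_sq_orthogonal:
 assumes "L2 M Y" "L2 M Z" "(\<integral>w. Y w \<bullet> Z w \<partial>M) = 0"
 shows "mean_sq (%w. Y w + Z w) = mean_sq Y + mean_sq Z"
 by (simp add: mean_sq_def moment2_orthogonal[OF assms] add_divide_distrib)

lemma grad_measurable: "past_sources k <= I ==> grad k \<in> borel_measurable (info I)"
 using vec_lambda_measurable[of "%i w. grad k w $ i" "info I"] grad_row_measurable by simp

lemma noise_measurable:
 assumes "past_sources (Suc k) <= I"
 shows "noise k \<in> borel_measurable (info I)"
proof -
 have "past_sources k <= I" "Sample i k \<in> I" "Direction i k \<in> I" for i
  using assms past_sources_mono[of k "Suc k"] by (auto simp: past_sources_def)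
 thus ?thesis
  using vec_lambda_measurable[of "%i w. noise k w $ i" "info I"] noise_row_measurable by simp
qed

text \<open>The tracked direction is split into a part driven by the martingale noise, whose moment is
 bounded uniformly in \<open>k\<close> through orthogonality, and a part driven by the increments of the
 smoothed gradients and by the solver bias.\<close>

primrec tail :: "nat => 'w => real^'n^'m" where
 "tail 0 = (%w. A ** grad 0 w)"
| "tail (Suc k) = (%w. A ** tail k w + A ** (A ** noise k w - noise k w))"

text \<open>The newest noise is kept outside \<open>tail\<close>, which is measurable in the history
  before it; the two summands are then orthogonal. Substituting the recursion of the tracker
  produces the term \<open>A ** noise j w - noise j w\<close> of the next tail.\<close>

definition "noise_part k w = (case k of 0 => 0 | Suc j => A ** noise j w + tail j w)"
text \<open>At k = 0 the increment is 0: the initial gradient sits in \<open>tail 0\<close>, where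
  it is controlled by \<sigma>, and the drift starts from zero.\<close>

definition "grad_step k w = (case k of 0 => 0 | Suc j => grad (Suc j) w - grad j w)"
definition "bias_step k w = (case k of 0 => bias 0 w | Suc j => bias (Suc j) w - bias j w)"

primrec drift_part :: "nat => 'w => real^'n^'m" where
 "drift_part 0 = (%w. 0)"
| "drift_part (Suc k) = (%w. A ** (drift_part k w + (grad_step k w + bias_step k w)))"

lemma g_split: "g k w = noise k w + grad k w + bias k w"
 by (simp add: noise_def bias_def)

lemma deviation_y_Suc:
 assumes "w \<in> space M"
 shows "deviation (y (Suc k) w) = A ** (deviation (y k w) + g k w - gp k w)"
 unfolding run_facts(3)[OF assms] deviation_mult[OF ds]
 by (simp add: matrix_add_ldistrib matrix_mult_diff mixing_deviation[OF ds])

lemma deviation_y_split: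
 assumes "w \<in> space M"
 shows "deviation (y k w) = noise_part k w + drift_part k w"
proof (induction k)
 case 0
 thus ?case by (simp add: run_facts[OF assms] noise_part_def)
next
 case (Suc k)
 show ?case
 proof (cases k)
  case 0
  have "deviation (y (Suc 0) w) = A ** (g 0 w)"
   unfolding deviation_y_Suc[OF assms] by (simp add: run_facts[OF assms] gp_def)
  thus ?thesis unfolding 0 g_split
   by (simp add: noise_part_def grad_step_def bias_step_def matrix_add_ldistrib)
 next
  case (Suc j)
  have "deviation (y (Suc k) w) = A ** ((A ** noise j w + tail j w) + drift_part k w + g k w - g j w)"
   unfolding deviation_y_Suc[OF assms] Suc.IH by (simp add: noise_part_def gp_def Suc)
  thus ?thesis unfolding Suc g_split
   by (simp add: noise_part_def grad_step_def bias_step_def matrix_add_ldistrib matrix_mult_diff)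
 qed
qed

lemma tail_measurable: "tail k \<in> borel_measurable (hist k)"
proof (induction k)
 case 0 thus ?case by (simp add: matrix_mult_measurable grad_measurable)
next
 case (Suc k)
 have "past_sources k <= past_sources (Suc k)" by (rule past_sources_mono) simp
 from info_measurable_mono[OF Suc this] have t: "tail k \<in> borel_measurable (hist (Suc k))" .
 have n: "noise k \<in> borel_measurable (hist (Suc k))" by (rule noise_measurable) simp
 show ?case unfolding tail.simps by (intro borel_measurable_add borel_measurable_diff matrix_mult_measurable t n)
qed

text \<open>By orthogonality the squares add without loss, so the moments obey a <= l^2 a + 4 l^2
  \<sigma>, whose fixed point is the stated bound. Only one factor 1 - l^2 is lost this way.\<close>

lemma tail_moment: "L2 M (tail k)" "mean_sq (tail k) <= 4 * l^2 * \<sigma> / (1 - l^2)"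
proof (induction k)
 case 0
 { case 1 show ?case by (simp add: L2_matrix_mult grad_si) }
 { case 2
  have "mean_sq (tail 0) <= l^2 * mean_sq (grad 0)" using mean_sq_mixing[OF grad_si[of 0]] by simp
  also have "... <= l^2 * \<sigma>" by (intro mult_left_mono mean_sq_grad) simp
  also have "... <= 4 * l^2 * \<sigma> / (1 - l^2)"
  proof -
   have "l^2 * \<sigma> * (1 - l^2) <= l^2 * \<sigma> * 4" using sigma_nonneg zero_le_power2[of l] by (intro mult_left_mono) (linarith, simp)
   thus ?thesis using l_facts by (simp add: pos_le_divide_eq)
  qed
  finally show ?case . }
next
 case (Suc k)
 let ?u = "%w. A ** noise k w - noise k w"
 note An = L2_matrix_mult[OF noise_si[of k], of A]
 have u: "L2 M ?u" by (rule L2_diff[OF An noise_si])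
 note At = L2_matrix_mult[OF Suc.IH(1), of A]
 note Au = L2_matrix_mult[OF u, of A]
 { case 1 show ?case unfolding tail.simps by (rule L2_add[OF At Au]) }
 { case 2
  have Atm: "(%w. A ** tail k w) \<in> borel_measurable (hist k)" by (rule matrix_mult_measurable[OF tail_measurable])
  have o1: "(\<integral>w. (B ** noise k w) \<bullet> (A ** tail k w) \<partial>M) = 0" for B
   by (rule mixed_noise_orthogonal[OF Atm At])
  have ui: "integrable M (%w. (B ** noise k w) \<bullet> (A ** tail k w))" for B
   by (rule L2_inner[OF L2_matrix_mult[OF noise_si] At])
  have "(\<integral>w. (A ** tail k w) \<bullet> (A ** ?u w) \<partial>M) = (\<integral>w. ((A ** A) ** noise k w) \<bullet> (A ** tail k w) - (A ** noise k w) \<bullet> (A ** tail k w) \<partial>M)"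
   by (simp add: matrix_mult_diff matrix_mul_assoc inner_diff_left inner_diff_right inner_commute)
  also have "... = 0" using ui[of "A ** A"] ui[of A] by (simp add: o1)
  finally have "mean_sq (tail (Suc k)) = mean_sq (%w. A ** tail k w) + mean_sq (%w. A ** ?u w)"
   unfolding tail.simps by (rule mean_sq_orthogonal[OF At Au])
  also have "... <= l^2 * mean_sq (tail k) + l^2 * mean_sq ?u" by (intro add_mono mean_sq_mixing Suc.IH(1) u)
  also have "... <= l^2 * (4 * l^2 * \<sigma> / (1 - l^2)) + l^2 * (4 * \<sigma>)"
  proof (intro add_mono mult_left_mono Suc.IH(2))
   have "norm (?u w) <= 2 * norm (noise k w)" for w
    using norm_triangle_ineq4[of "A ** noise k w" "noise k w"] mixing_norm_le[of W "noise k w"]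
     mult_right_mono[of l 1 "norm (noise k w)"] l_facts(2) by simp
   from mean_sq_mono[OF u noise_si this] show "mean_sq ?u <= 4 * \<sigma>"
    using mean_sq_noise[of k] by simp
  qed auto
  also have "... = 4 * l^2 * \<sigma> / (1 - l^2)" using l_facts by (simp add: field_simps)
  finally show ?case . }
qed

lemma noise_part_si: "L2 M (noise_part k)"
proof (cases k)
 case 0
 have "noise_part 0 = (%w. 0)" by (simp add: noise_part_def fun_eq_iff)
 thus ?thesis unfolding 0 by (simp add: L2_def)
next
 case (Suc j)
 have "noise_part (Suc j) = (%w. A ** noise j w + tail j w)" by (simp add: noise_part_def fun_eq_iff)
 thus ?thesis unfolding Suc by (simp add: L2_add L2_matrix_mult noise_si tail_moment)
qed

lemma noise_part_moment: "mean_sq (noise_part (Suc k)) <= 5 * l^2 * \<sigma> / (1 - l^2)"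
proof -
 have e: "noise_part (Suc k) = (%w. A ** noise k w + tail k w)" by (simp add: noise_part_def fun_eq_iff)
 have "mean_sq (noise_part (Suc k)) = mean_sq (%w. A ** noise k w) + mean_sq (tail k)"
  unfolding e
  by (rule mean_sq_orthogonal[OF L2_matrix_mult[OF noise_si] tail_moment(1) mixed_noise_orthogonal[OF tail_measurable tail_moment(1)]])
 also have "... <= l^2 * \<sigma> + 4 * l^2 * \<sigma> / (1 - l^2)"
  using mean_sq_mixing[OF noise_si[of k]] mult_left_mono[OF mean_sq_noise[of k], of "l^2"]
  by (intro add_mono tail_moment(2)) auto
 also have "... <= 5 * l^2 * \<sigma> / (1 - l^2)"
 proof -
  have "l^2 * \<sigma> * (1 - l^2) <= l^2 * \<sigma> * 1" using sigma_nonneg l_facts by (intro mult_left_mono) auto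
  hence "l^2 * \<sigma> <= l^2 * \<sigma> / (1 - l^2)" using l_facts by (simp add: pos_le_divide_eq)
  thus ?thesis by simp
 qed
 finally show ?thesis .
qed

lemma grad_step_si: "L2 M (grad_step k)" and bias_step_si: "L2 M (bias_step k)"
proof -
 have "grad_step 0 = (%w. 0)" "bias_step 0 = bias 0" "!!j. grad_step (Suc j) = (%w. grad (Suc j) w - grad j w)"
  "!!j. bias_step (Suc j) = (%w. bias (Suc j) w - bias j w)"
  by (simp_all add: grad_step_def bias_step_def fun_eq_iff)
 thus "L2 M (grad_step k)" "L2 M (bias_step k)"
  by (cases k; simp add: L2_diff grad_si bias_si; simp add: L2_def)+
qed

lemma bias_step_moment: "mean_sq (bias_step 0) <= \<tau> 0" "mean_sq (bias_step (Suc k)) <= 2 * \<tau> (Suc k) + 2 * \<tau> k"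
proof -
 have e: "bias_step 0 = bias 0" "bias_step (Suc k) = (%w. bias (Suc k) w + - bias k w)"
  by (simp_all add: bias_step_def fun_eq_iff)
 show "mean_sq (bias_step 0) <= \<tau> 0" unfolding e by (rule mean_sq_bias)
 have "mean_sq (bias_step (Suc k)) <= (1 + 1) * mean_sq (bias (Suc k)) + (1 + 1 / 1) * mean_sq (%w. - bias k w)"
  unfolding e by (rule mean_sq_add_le[OF bias_si L2_minus[OF bias_si]]) simp
 thus "mean_sq (bias_step (Suc k)) <= 2 * \<tau> (Suc k) + 2 * \<tau> k"
  using mean_sq_bias[of k] mean_sq_bias[of "Suc k"] by (simp add: mean_sq_def)
qed

lemma drift_part_si: "L2 M (drift_part k)"
proof (induction k)
 case 0 show ?case by (simp add: L2_def)
qed (simp add: L2_matrix_mult L2_add grad_step_si bias_step_si)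

definition "dev_y k w = deviation (y k w)"
definition "dev_x k w = deviation (x k w)"

lemma dev_y_si: "L2 M (dev_y k)"
 by (rule L2_cong[OF L2_add[OF noise_part_si drift_part_si]])
   (simp add: dev_y_def deviation_y_split)

text \<open>Young's inequality with parameter 4: the heavy weight goes to the noise, which stays
  outside the feedback loop, and the light one to the drift, which feeds it.\<close>

lemma dev_y_moment: "mean_sq (dev_y k) <= 5 * mean_sq (noise_part k) + 5 / 4 * mean_sq (drift_part k)"
proof -
 have "mean_sq (dev_y k) = mean_sq (%w. noise_part k w + drift_part k w)"
  by (rule mean_sq_cong) (simp add: dev_y_def deviation_y_split)
 thus ?thesis using mean_sq_add_le[OF noise_part_si drift_part_si, of 4] by simp
qed

lemma dev_x_Suc: "w \<in> space M ==> dev_x (Suc k) w = A ** (dev_x k w + (- \<gamma>) *\<^sub>R dev_y (Suc k) w)"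
 by (simp only: dev_x_def dev_y_def run_facts(4) deviation_mult[OF ds]) (simp add: matrix_mult_diff matrix_add_ldistrib
   matrix_mult_scale mixing_deviation[OF ds])

lemma dev_x0: "L2 M (dev_x 0)" "mean_sq (dev_x 0) = (\<integral>w. consensus_error (x0 w) \<partial>M)"
proof -
 have e: "(norm (dev_x 0 w))^2 = real CARD('m) * consensus_error (x0 w)" if "w \<in> space M" for w
  by (simp add: dev_x_def run_facts(1)[OF that] consensus_error_def)
 have "integrable M (%w. (norm (dev_x 0 w))^2)"
  by (subst bintegrable_cong[OF refl e]) (simp_all add: finite_V)
 moreover have "dev_x 0 \<in> borel_measurable M"
  unfolding dev_x_def [abs_def] by (rule deviation_measurable[OF x_meas_M])
 ultimately show "L2 M (dev_x 0)" by (simp add: L2_def)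
 have "moment2 M (dev_x 0) = (\<integral>w. real CARD('m) * consensus_error (x0 w) \<partial>M)"
  unfolding moment2_def by (rule bintegral_cong) (auto simp: e)
 thus "mean_sq (dev_x 0) = (\<integral>w. consensus_error (x0 w) \<partial>M)" by (simp add: mean_sq_def)
qed

lemma dev_x_si: "L2 M (dev_x k)"
proof (induction k)
 case (Suc k)
 show ?case
  by (rule L2_cong[OF L2_matrix_mult[OF L2_add[OF Suc L2_scaleR[OF dev_y_si]]]])
    (rule dev_x_Suc)
qed (rule dev_x0)

lemma dev_x_moment:
 assumes t: "0 < t"
 shows "mean_sq (dev_x (Suc k)) <= l^2 * ((1 + t) * mean_sq (dev_x k) + (1 + 1 / t) * (\<gamma>^2 * mean_sq (dev_y (Suc k))))"
proof -
 note s = L2_scaleR[OF dev_y_si, of "- \<gamma>" "Suc k"]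
 have "mean_sq (dev_x (Suc k)) = mean_sq (%w. A ** (dev_x k w + (- \<gamma>) *\<^sub>R dev_y (Suc k) w))"
  by (rule mean_sq_cong) (rule dev_x_Suc)
 also have "... <= l^2 * mean_sq (%w. dev_x k w + (- \<gamma>) *\<^sub>R dev_y (Suc k) w)"
  by (rule mean_sq_mixing[OF L2_add[OF dev_x_si s]])
 also have "... <= l^2 * ((1 + t) * mean_sq (dev_x k) + (1 + 1 / t) * (\<gamma>^2 * mean_sq (dev_y (Suc k))))"
  using mean_sq_add_le[OF dev_x_si s t, of k] unfolding mean_sq_scaleR by (intro mult_left_mono) auto
 finally show ?thesis .
qed

lemma drift_part_moment:
 assumes t: "0 < t"
 shows "mean_sq (drift_part (Suc k)) <= l^2 * ((1 + t) * mean_sq (drift_part k) + (1 + 1 / t) * mean_sq (%w. grad_step k w + bias_step k w))"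
proof -
 note s = L2_add[OF grad_step_si bias_step_si, of k k]
 have "mean_sq (drift_part (Suc k)) <= l^2 * mean_sq (%w. drift_part k w + (grad_step k w + bias_step k w))"
  unfolding drift_part.simps by (rule mean_sq_mixing[OF L2_add[OF drift_part_si s]])
 also have "... <= l^2 * ((1 + t) * mean_sq (drift_part k) + (1 + 1 / t) * mean_sq (%w. grad_step k w + bias_step k w))"
  using mean_sq_add_le[OF drift_part_si s t, of k] by (intro mult_left_mono) auto
 finally show ?thesis .
qed

text \<open>Averages are invariant under mixing and the gradient increments telescope, so the
  averaged tracker equals the averaged latest estimate.\<close>

lemma average_y: "w \<in> space M ==> average (y k w) = average (gp k w)"
proof (induction k)
 case (Suc k)
 thus ?case by (simp add: run_facts(3) average_mult[OF ds] average_diff average_add gp_def)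
qed (simp add: run_facts gp_def)

lemma average_y_Suc: "w \<in> space M ==> average (y (Suc k) w) = average (g k w)"
 by (simp add: average_y gp_def)

lemma average_x_Suc: "w \<in> space M ==> average (x (Suc k) w) = average (x k w) - \<gamma> *\<^sub>R average (g k w)"
 by (simp add: run_facts(4) average_mult[OF ds] average_diff average_scaleR average_y_Suc)

lemma g_eq: "g k = (%w. ghat k w + bias k w)"
 by (simp add: bias_def fun_eq_iff)

lemma g_si: "L2 M (g k)"
 unfolding g_eq by (rule L2_add[OF ghat_si bias_si])

lemma average_g_moment: "moment2 M (%w. average (g k w)) <= 2 * \<sigma> + 2 * \<tau> k"
proof -
 have "moment2 M (%w. average (g k w)) <= mean_sq (g k)" unfolding mean_sq_def by (rule L2_average[OF g_si])
 also have "... <= (1 + 1) * mean_sq (ghat k) + (1 + 1 / 1) * mean_sq (bias k)"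
  unfolding g_eq by (rule mean_sq_add_le[OF ghat_si bias_si]) simp
 finally show ?thesis using mean_sq_ghat[of k] mean_sq_bias[of k] by simp
qed

lemma smooth_gradients_lipschitz: "norm (smooth_gradients X - smooth_gradients Y) <= \<beta> * norm (X - Y)"
proof -
 have "(norm (smooth_gradients X - smooth_gradients Y))^2 <= (\<Sum>i\<in>UNIV. (\<beta> * norm ((X - Y) $ i))^2)"
  unfolding norm_rows_sq
 proof (intro sum_mono power_mono)
  show "norm ((smooth_gradients X - smooth_gradients Y) $ i) <= \<beta> * norm ((X - Y) $ i)" for i
   using sphere_gradient_lipschitz[OF agent_obj_lipschitz[OF lower wp lipd] eta, of i "X $ i" "Y $ i"]
   by (simp add: smooth_gradients_def \<beta>_def)
 qed simp
 also have "... = (\<beta> * norm (X - Y))^2"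
  unfolding power_mult_distrib norm_rows_sq[of "X - Y"] by (simp add: sum_distrib_left)
 finally show ?thesis by (rule power2_le_imp_le) (simp add: beta_nonneg)
qed

lemma dev_x_increment:
 "moment2 M (%w. dev_x (Suc k) w - dev_x k w) <= 5 * moment2 M (dev_x k) + 5 * \<gamma>^2 * l^2 * moment2 M (dev_y (Suc k))"
proof -
 let ?u = "%w. A ** dev_x k w - dev_x k w" and ?w = "%w. (- \<gamma>) *\<^sub>R (A ** dev_y (Suc k) w)"
 note ui = L2_diff[OF L2_matrix_mult[OF dev_x_si, of A k] dev_x_si[of k]]
 note wi = L2_scaleR[OF L2_matrix_mult[OF dev_y_si, of A "Suc k"], of "- \<gamma>"]
 have "moment2 M (%w. dev_x (Suc k) w - dev_x k w) = moment2 M (%w. ?u w + ?w w)"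
  by (rule moment2_cong) (simp add: dev_x_Suc matrix_add_ldistrib matrix_mult_diff matrix_mult_scale)
 \<comment> \<open>Parameter 1/4 gives the weights 5/4 and 5; since \<open>A - 1\<close> at most
   doubles a norm, both terms end up with factor 5.\<close>
 also have "... <= (1 + 1/4) * moment2 M ?u + (1 + 1 / (1/4)) * moment2 M ?w"
  by (rule moment2_add_le[OF ui wi]) simp
 also have "... <= (1 + 1/4) * (2^2 * moment2 M (dev_x k)) + (1 + 1 / (1/4)) * ((\<gamma> * l)^2 * moment2 M (dev_y (Suc k)))"
 proof (intro add_mono mult_left_mono)
  show "moment2 M ?u <= 2^2 * moment2 M (dev_x k)"
  proof (rule moment2_mono[OF ui dev_x_si])
   fix w
   show "norm (?u w) <= 2 * norm (dev_x k w)"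
    using norm_triangle_ineq4[of "A ** dev_x k w" "dev_x k w"] mixing_norm_le[of W "dev_x k w"]
     mult_right_mono[of l 1 "norm (dev_x k w)"] l_facts(2) by simp
  qed
  show "moment2 M ?w <= (\<gamma> * l)^2 * moment2 M (dev_y (Suc k))"
   by (rule moment2_mono[OF wi dev_y_si]) (use mixing_norm_le[of W] gam in \<open>simp add: mult.assoc\<close>)
 qed auto
 finally show ?thesis by (simp add: power_mult_distrib)
qed

text \<open>A step splits orthogonally into its deviation and its average, and the average moves by
  \<gamma> times the averaged estimate. Gradient increments are thereby bounded by consensus error,
  tracking deviation and averaged step, which closes the loop.\<close>

lemma grad_step_moment:
 "mean_sq (grad_step 0) <= 0"
 "mean_sq (grad_step (Suc k)) <= \<beta>^2 * (5 * mean_sq (dev_x k) + 5 * \<gamma>^2 * l^2 * mean_sq (dev_y (Suc k))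
   + \<gamma>^2 * moment2 M (%w. average (g k w)))"
proof -
 have "grad_step 0 = (%w. 0)" by (simp add: grad_step_def fun_eq_iff)
 thus "mean_sq (grad_step 0) <= 0" by (simp add: mean_sq_def moment2_def)
 let ?m = "real CARD('m)"
 note di = L2_diff[OF dev_x_si[of "Suc k"] dev_x_si[of k]]
 note ai = L2_average(1)[OF g_si[of k]]
 have pt: "(norm (grad_step (Suc k) w))^2 <= \<beta>^2 * ((norm (dev_x (Suc k) w - dev_x k w))^2 + ?m * \<gamma>^2 * (norm (average (g k w)))^2)"
  if w: "w \<in> space M" for w
 proof -
  have "(norm (grad_step (Suc k) w))^2 <= (\<beta> * norm (x (Suc k) w - x k w))^2"
   by (rule power_mono) (simp_all add: grad_step_def grad_def smooth_gradients_lipschitz)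
  also have "... = \<beta>^2 * ((norm (dev_x (Suc k) w - dev_x k w))^2 + ?m * (norm (average (x (Suc k) w - x k w)))^2)"
   by (simp add: power_mult_distrib norm_split_average[of "x (Suc k) w - x k w"] deviation_diff dev_x_def)
  also have "average (x (Suc k) w - x k w) = (- \<gamma>) *\<^sub>R average (g k w)" by (simp add: average_diff average_x_Suc[OF w])
  finally show ?thesis by (simp add: power_mult_distrib mult.assoc)
 qed
 have "moment2 M (grad_step (Suc k)) <= (\<integral>w. \<beta>^2 * ((norm (dev_x (Suc k) w - dev_x k w))^2 + ?m * \<gamma>^2 * (norm (average (g k w)))^2) \<partial>M)"
  unfolding moment2_def
  by (rule integral_mono) (use grad_step_si di ai pt in \<open>auto simp: L2_def\<close>)
 also have "... = \<beta>^2 * (moment2 M (%w. dev_x (Suc k) w - dev_x k w) + ?m * \<gamma>^2 * moment2 M (%w. average (g k w)))"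
  unfolding moment2_def using di ai by (simp add: L2_def)
 also have "... <= \<beta>^2 * ((5 * moment2 M (dev_x k) + 5 * \<gamma>^2 * l^2 * moment2 M (dev_y (Suc k))) + ?m * \<gamma>^2 * moment2 M (%w. average (g k w)))"
  by (intro mult_left_mono add_right_mono dev_x_increment) simp
 finally have "moment2 M (grad_step (Suc k)) / ?m <= ... / ?m" by (rule divide_right_mono) simp
 thus "mean_sq (grad_step (Suc k)) <= \<beta>^2 * (5 * mean_sq (dev_x k) + 5 * \<gamma>^2 * l^2 * mean_sq (dev_y (Suc k))
   + \<gamma>^2 * moment2 M (%w. average (g k w)))"
  unfolding mean_sq_def by (simp add: add_divide_distrib distrib_left)
qed

lemma consensus_total:
 assumes "1 <= K"
 shows "(\<Sum>k<K. mean_sq (dev_x k)) <= real K * consensus_rate \<gamma> l \<sigma> (\<integral>w. consensus_error (x0 w) \<partial>M) (\<Sum>k<K. \<tau> k) (real K)"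
proof -
 obtain N where K: "K = Suc N" using assms by (cases K) auto
 have s: "9 * l * (\<gamma> * \<beta>) <= 1 - l^2" "20 * l^2 * (\<gamma> * \<beta>) <= (1 - l^2)^2"
  using step1 step2 by (simp_all add: \<beta>_def)
 have q: "mean_sq (%w. grad_step k w + bias_step k w) <= 5 / 4 * mean_sq (grad_step k) + 5 * mean_sq (bias_step k)" for k
  using mean_sq_add_le[OF grad_step_si bias_step_si, of "1/4" k k] by simp
 have z0: "mean_sq (drift_part 0) = 0" by (simp add: mean_sq_def moment2_def)
 \<comment> \<open>Indexing by \<open>gp\<close> shifts by one, so that \<open>b (Suc k)\<close> is
   the moment of the estimate of iteration \<open>k\<close>, as \<open>consensus_sum\<close>
   expects.\<close>
 define b where "b k = moment2 M (%w. average (gp k w))" for k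
 have b: "b (Suc k) = moment2 M (%w. average (g k w))" for k by (simp add: b_def gp_def)
 have b0: "0 <= b k" for k by (simp add: b_def)
 note main = consensus_sum[OF l_facts(1,2) gam beta_nonneg s mean_sq_nonneg[of "dev_x _"] mean_sq_nonneg[of "dev_y _"]
   mean_sq_nonneg[of "drift_part _"] mean_sq_nonneg[of "%w. grad_step _ w + bias_step _ w"] b0 tau_nonneg sigma_nonneg
   dev_x_moment z0 drift_part_moment q bias_step_moment grad_step_moment[folded b] average_g_moment[folded b]
   dev_y_moment noise_part_moment, of N]
 have gen: "a / w + b * \<sigma> * r + c * t = r * (a / (w * r) + b * \<sigma> + c * (t / r))" if "0 < r" for a b c r t w :: real
  using that by (simp add: distrib_left)
 show ?thesis unfolding K consensus_rate_def
  using main[unfolded dev_x0(2)]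
  by (subst gen[symmetric]) simp_all
qed

end

section \<open>Descent\<close>

context
 fixes P :: "('n::finite, 'm::finite, 'p::finite, 'd::finite) mpec" and \<mu> L :: real and D :: "'m => real"
 assumes lower: "lower_level P \<mu> L D" and wp: "well_posed P" and lipd: "lipschitz_data P"
begin

lemma objective_lipschitz: "(L0 P)-lipschitz_on UNIV (objective P)"
proof (rule lipschitz_onI)
 fix x y
 have "\<bar>objective P x - objective P y\<bar> = (1 / real CARD('m)) * \<bar>\<Sum>i\<in>UNIV. agent_obj P i x - agent_obj P i y\<bar>"
  unfolding objective_def right_diff_distrib[symmetric] sum_subtractf[symmetric] by (simp add: abs_mult)
 also have "... <= (1 / real CARD('m)) * (\<Sum>i\<in>(UNIV :: 'm set). L0 P * norm (x - y))"
  by (intro mult_left_mono order_trans[OF sum_abs] sum_mono lipschitz_diff[OF agent_obj_lipschitz[OF lower wp lipd]]) simp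
 also have "... = L0 P * norm (x - y)" by simp
 finally show "dist (objective P x) (objective P y) <= L0 P * dist x y" by (simp add: dist_norm)
qed (rule L0_nonneg[OF lower wp lipd])

lemma smoothed_obj_eq:
 assumes "0 <= \<eta>"
 shows "smoothed_obj P \<eta> x = smoothed \<eta> (objective P) x"
 unfolding smoothed_obj_def smoothed_def objective_def
 using integrable_uniform_ball_lipschitz[OF agent_obj_lipschitz[OF lower wp lipd] assms] by simp

lemma sphere_gradient_objective:
 assumes "0 <= \<eta>"
 shows "sphere_gradient \<eta> (objective P) x = average (\<chi> i. sphere_gradient \<eta> (agent_obj P i) x)"
proof -
 note i = sphere_gradient_integrable[OF agent_obj_lipschitz[OF lower wp lipd] assms]
 have "(\<integral>v. objective P (x + \<eta> *\<^sub>R v) *\<^sub>R v \<partial>sph)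
   = (\<integral>v. (1 / real CARD('m)) *\<^sub>R (\<Sum>i\<in>UNIV. agent_obj P i (x + \<eta> *\<^sub>R v) *\<^sub>R v) \<partial>sph)"
  by (simp add: objective_def scaleR_sum_left[symmetric])
 also have "... = (1 / real CARD('m)) *\<^sub>R (\<Sum>i\<in>UNIV. \<integral>v. agent_obj P i (x + \<eta> *\<^sub>R v) *\<^sub>R v \<partial>sph)"
  using i by simp
 finally show ?thesis
  unfolding sphere_gradient_def average_def by (simp add: scaleR_sum_right mult.commute)
qed

lemma smoothed_obj_bdd_below:
 assumes "0 <= \<eta>" "bdd_below (range (objective P))"
 shows "bdd_below (range (smoothed_obj P \<eta>))"
proof -
 obtain c where c: "!!x. c <= objective P x" using assms(2) unfolding bdd_below_def by auto
 have "c - L0 P * \<eta> <= smoothed_obj P \<eta> x" for x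
  using smoothed_close[OF objective_lipschitz assms(1), of x] c[of x] unfolding smoothed_obj_eq[OF assms(1)] by linarith
 thus ?thesis unfolding bdd_below_def by blast
qed

lemma initial_gap_nonneg:
 fixes M :: "'w measure" and x0 :: "'w => real^'n^'m"
 assumes eta: "0 <= \<eta>" and bdd: "bdd_below (range (objective P))" and pr: "prob_space M"
  and int: "integrable M (%w. smoothed_obj P \<eta> (average (x0 w)))"
 shows "0 <= (\<integral>w. smoothed_obj P \<eta> (average (x0 w)) \<partial>M) - (INF z. smoothed_obj P \<eta> z)"
proof -
 interpret prob_space M by (rule pr)
 have "(\<integral>w. (INF z. smoothed_obj P \<eta> z) \<partial>M) <= (\<integral>w. smoothed_obj P \<eta> (average (x0 w)) \<partial>M)"
  by (rule integral_mono[OF _ int]) (use smoothed_obj_bdd_below[OF eta bdd] in \<open>auto intro: cINF_lower\<close>)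
 thus ?thesis by (simp add: prob_space)
qed

end

text \<open>The integrand is split along the events Ks = k. Each has probability 1/K and is
  independent of the algorithm, so the expectation is the average over the horizon.\<close>

lemma (in sampled) nn_integral_horizon:
 fixes h :: "nat => 'w => ennreal"
 assumes K: "1 <= K" and H: "random_horizon M S \<xi> v K Ks" and h: "!!k. h k \<in> borel_measurable (info UNIV)"
  and c: "!!k. (\<integral>\<^sup>+w. h k w \<partial>M) <= ennreal (c k)" "!!k. 0 <= c k" and r: "(\<Sum>k<K. c k) <= real K * r"
 shows "(\<integral>\<^sup>+w. h (Ks w) w \<partial>M) <= ennreal r"
proof -
 have Ks[measurable]: "Ks \<in> M \<rightarrow>\<^sub>M count_space UNIV" and dist: "distr M (count_space UNIV) Ks = measure_pmf (pmf_of_set {..<K})"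
  and ind: "indep_set (sets (info UNIV)) {Ks -` A \<inter> space M | A. True}"
  using H unfolding random_horizon_def sets_info by auto
 define B where "B = vimage_algebra (space M) Ks (count_space UNIV)"
 have spB: "space B = space M" by (simp add: B_def)
 have sB: "sets B = {Ks -` A \<inter> space M | A. True}" unfolding B_def by (subst sets_vimage_algebra2) auto
 have KB: "Ks \<in> B \<rightarrow>\<^sub>M count_space UNIV" unfolding B_def by (rule measurable_vimage_algebra1) simp
 have indB: "indep_set (sets (info UNIV)) (sets B)" using ind by (simp add: sB)
 have hM[measurable]: "h k \<in> borel_measurable M" for k by (rule info_measurable_M[OF h])
 have ne: "{..<K} ~= {}" using K by (simp add: lessThan_empty_iff)
 have "AE j in distr M (count_space UNIV) Ks. j < K"
  unfolding dist by (rule AE_pmfI) (use ne in auto)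
 hence lt: "AE w in M. Ks w < K" by (subst (asm) AE_distr_iff) auto
 have "(\<integral>\<^sup>+w. h (Ks w) w \<partial>M) = (\<integral>\<^sup>+w. (\<Sum>k<K. h k w * indicator {k} (Ks w)) \<partial>M)"
 proof (rule nn_integral_cong_AE)
  show "AE w in M. h (Ks w) w = (\<Sum>k<K. h k w * indicator {k} (Ks w))"
   using lt
  proof eventually_elim
   case (elim w)
   have "(\<Sum>k<K. h k w * indicator {k} (Ks w)) = (\<Sum>k<K. if Ks w = k then h k w else 0)"
    by (rule sum.cong) (auto simp: indicator_def)
   thus ?case using elim by simp
  qed
 qed
 also have "... = (\<Sum>k<K. \<integral>\<^sup>+w. h k w * indicator {k} (Ks w) \<partial>M)"
  by (rule nn_integral_sum) (intro borel_measurable_times_ennreal hM measurable_compose[OF Ks], simp)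
 also have "... <= (\<Sum>k<K. ennreal (c k / real K))"
 proof (rule sum_mono)
  fix k assume k: "k \<in> {..<K}"
  have "(\<integral>\<^sup>+w. h k w * indicator {k} (Ks w) \<partial>M) = (\<integral>\<^sup>+w. (\<integral>\<^sup>+j. h k w * indicator {k} j \<partial>distr M (count_space UNIV) Ks) \<partial>M)"
   by (rule nn_integral_indep[where h="%u j. u * indicator {k} j", OF indB space_info spB h KB], unfold case_prod_unfold,
     intro borel_measurable_times_ennreal measurable_fst measurable_compose[OF measurable_snd]) simp
  also have "... = (\<integral>\<^sup>+w. h k w * ennreal (1 / real K) \<partial>M)"
   unfolding dist using k ne
   by (subst nn_integral_cmult_indicator) (auto simp: emeasure_pmf_single pmf_of_set divide_ennreal)
  also have "... = (\<integral>\<^sup>+w. h k w \<partial>M) * ennreal (1 / real K)" by (rule nn_integral_multc) simp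
  also have "... <= ennreal (c k) * ennreal (1 / real K)" by (intro mult_right_mono c(1)) simp
  also have "... = ennreal (c k / real K)" using c(2)[of k] by (simp add: ennreal_mult[symmetric])
  finally show "(\<integral>\<^sup>+w. h k w * indicator {k} (Ks w) \<partial>M) <= ennreal (c k / real K)" .
 qed
 also have "... = ennreal ((\<Sum>k<K. c k) / real K)" using c(2) by (simp add: sum_ennreal sum_divide_distrib)
 also have "... <= ennreal r" using r K by (intro ennreal_leI) (simp add: divide_le_eq mult.commute)
 finally show ?thesis .
qed

text \<open>Here \<open>a\<close> is the smoothed gradient at the average, \<open>b\<close> the
  average of the local ones, \<nu> the averaged noise and \<open>e\<close> the averaged bias.
  Everything linear in \<nu> is collected in one inner product, whose expectation will
  vanish.\<close>

lemma descent_algebra: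
 fixes a b e \<nu> :: "'a::real_inner" and \<beta> \<gamma> :: real
 assumes g: "0 < \<gamma>" and be: "0 <= \<beta>" and s: "\<gamma> * \<beta> <= 1 / 6"
 shows "a \<bullet> (- (\<gamma> *\<^sub>R (\<nu> + b + e))) + \<beta> / 2 * (norm (\<gamma> *\<^sub>R (\<nu> + b + e)))^2
  <= \<nu> \<bullet> ((2 * \<beta> * \<gamma>^2) *\<^sub>R b - \<gamma> *\<^sub>R a) - \<gamma> / 4 * (norm a)^2 + \<gamma> / 2 * (norm (a - b))^2 + \<gamma> * (norm e)^2
   + \<beta> * \<gamma>^2 * ((norm \<nu>)^2 + (norm e)^2)"
proof -
 have 1: "(norm (\<nu> + b + e))^2 <= 2 * (norm (\<nu> + b))^2 + 2 * (norm e)^2"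
  using norm_add_sq_le[of 1 "\<nu> + b" e] by simp
 have 2: "(norm (\<nu> + b))^2 = (norm \<nu>)^2 + 2 * (\<nu> \<bullet> b) + (norm b)^2"
  unfolding power2_norm_eq_inner by (simp add: inner_add inner_commute)
 \<comment> \<open>The polarisation of a . b is exact; for a . e the slack is the square of a/2 +
   e.\<close>
 have 3: "- (a \<bullet> (b + e)) <= - (1/4) * (norm a)^2 - 1/2 * (norm b)^2 + 1/2 * (norm (a - b))^2 + (norm e)^2"
 proof -
  have "0 <= (norm ((1/2) *\<^sub>R a + e))^2" by simp
  thus ?thesis unfolding power2_norm_eq_inner by (simp add: inner_add inner_diff inner_commute algebra_simps)
 qed
 \<comment> \<open>The second-order term in \<open>b\<close> is absorbed by the negative term that
   \<open>3\<close> provides; this is where the stepsize bound enters.\<close>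
 have 4: "\<beta> * \<gamma>^2 * (norm b)^2 <= \<gamma> / 2 * (norm b)^2"
 proof (rule mult_right_mono)
  have "\<gamma> * (\<gamma> * \<beta>) <= \<gamma> * (1 / 6)" using s g by (intro mult_left_mono) auto
  thus "\<beta> * \<gamma>^2 <= \<gamma> / 2" using g by (simp add: sq_eq mult_ac)
 qed simp
 have "\<beta> / 2 * (norm (\<gamma> *\<^sub>R (\<nu> + b + e)))^2 = \<beta> * \<gamma>^2 / 2 * (norm (\<nu> + b + e))^2" by (simp add: power_mult_distrib)
 also have "... <= \<beta> * \<gamma>^2 / 2 * (2 * ((norm \<nu>)^2 + 2 * (\<nu> \<bullet> b) + (norm b)^2) + 2 * (norm e)^2)"
  using 1 be unfolding 2 by (intro mult_left_mono) auto
 also have "... = \<beta> * \<gamma>^2 * ((norm \<nu>)^2 + (norm e)^2) + 2 * \<beta> * \<gamma>^2 * (\<nu> \<bullet> b) + \<beta> * \<gamma>^2 * (norm b)^2"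
  by (simp add: algebra_simps)
 finally have 5: "\<beta> / 2 * (norm (\<gamma> *\<^sub>R (\<nu> + b + e)))^2 <= \<beta> * \<gamma>^2 * ((norm \<nu>)^2 + (norm e)^2) + 2 * \<beta> * \<gamma>^2 * (\<nu> \<bullet> b) + \<gamma> / 2 * (norm b)^2"
  using 4 by linarith
 have 6: "a \<bullet> (- (\<gamma> *\<^sub>R (\<nu> + b + e))) = - \<gamma> * (\<nu> \<bullet> a) + \<gamma> * (- (a \<bullet> (b + e)))"
  by (simp add: inner_add inner_commute algebra_simps)
 have "\<gamma> * (- (a \<bullet> (b + e))) <= \<gamma> * (- (1/4) * (norm a)^2 - 1/2 * (norm b)^2 + 1/2 * (norm (a - b))^2 + (norm e)^2)"
  using 3 g by (intro mult_left_mono) auto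
 also have "... = - (\<gamma> / 4 * (norm a)^2) - \<gamma> / 2 * (norm b)^2 + \<gamma> / 2 * (norm (a - b))^2 + \<gamma> * (norm e)^2"
  by (simp add: algebra_simps)
 finally have 7: "a \<bullet> (- (\<gamma> *\<^sub>R (\<nu> + b + e))) <= - \<gamma> * (\<nu> \<bullet> a) + (- (\<gamma> / 4 * (norm a)^2) - \<gamma> / 2 * (norm b)^2 + \<gamma> / 2 * (norm (a - b))^2 + \<gamma> * (norm e)^2)"
  unfolding 6 by simp
 have 8: "\<nu> \<bullet> ((2 * \<beta> * \<gamma>^2) *\<^sub>R b - \<gamma> *\<^sub>R a) = 2 * \<beta> * \<gamma>^2 * (\<nu> \<bullet> b) - \<gamma> * (\<nu> \<bullet> a)"
  by (simp add: inner_diff_right)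
 show ?thesis unfolding 8 using 5 7 by linarith
qed

context zo_rate
begin

definition "\<Phi> k w = smoothed_obj P \<eta> (average (x k w))"
definition "mean_grad k w = sphere_gradient \<eta> (objective P) (average (x k w))"

lemma mean_grad_measurable:
 assumes "past_sources k <= I"
 shows "mean_grad k \<in> borel_measurable (info I)"
proof -
 have "\<beta>-lipschitz_on UNIV (sphere_gradient \<eta> (objective P))"
  using sphere_gradient_lipschitz[OF objective_lipschitz[OF lower wp lipd] eta] beta_nonneg
  by (intro lipschitz_onI) (auto simp: dist_norm \<beta>_def)
 hence "continuous_on UNIV (sphere_gradient \<eta> (objective P))" by (rule lipschitz_on_continuous_on)
 thus ?thesis unfolding mean_grad_def [abs_def]
  using measurable_compose[OF average_measurable[OF x_measurable[OF assms]] borel_measurable_continuous_onI] by simp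
qed

lemma mean_grad_si: "L2 M (mean_grad k)"
proof (rule L2_bounded[where c="L0 P"])
 show "mean_grad k \<in> borel_measurable M" by (rule info_measurable_M[OF mean_grad_measurable[of k UNIV]]) simp
 show "norm (mean_grad k w) <= L0 P" for w
  unfolding mean_grad_def
  by (rule gradient_norm_le[OF smoothed_lipschitz[OF objective_lipschitz[OF lower wp lipd]] smoothed_gderiv[OF objective_lipschitz[OF lower wp lipd] eta]])
    (use eta in simp)
qed

text \<open>The smoothed gradient of the objective at the average is the average of the agents'
  smoothed gradients at that common point, so the gap compares the same Lipschitz maps at the
  average and at the local copies.\<close>

lemma mean_grad_gap:
 "L2 M (%w. mean_grad k w - average (grad k w))"
 "moment2 M (%w. mean_grad k w - average (grad k w)) <= \<beta>^2 * mean_sq (dev_x k)"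
proof -
 show si: "L2 M (%w. mean_grad k w - average (grad k w))"
  by (rule L2_diff[OF mean_grad_si L2_average(1)[OF grad_si]])
 have b: "norm (mean_grad k w - average (grad k w)) <= (\<beta> / sqrt (real CARD('m))) * norm (dev_x k w)" for w
 proof (rule power2_le_imp_le)
  let ?X = "(\<chi> i. average (x k w)) :: real^'n^'m"
  have "mean_grad k w - average (grad k w) = average (smooth_gradients ?X - smooth_gradients (x k w))"
   unfolding mean_grad_def sphere_gradient_objective[OF lower wp lipd less_imp_le[OF eta]] average_diff grad_def
   by (simp add: smooth_gradients_def)
  hence "(norm (mean_grad k w - average (grad k w)))^2 <= (norm (smooth_gradients ?X - smooth_gradients (x k w)))^2 / real CARD('m)"
   using norm_average_sq_le by metis
  also have "... <= (\<beta> * norm (?X - x k w))^2 / real CARD('m)"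
   by (intro divide_right_mono power_mono smooth_gradients_lipschitz) auto
  also have "?X - x k w = - dev_x k w" by (simp add: dev_x_def deviation_def vec_eq_iff)
  finally show "(norm (mean_grad k w - average (grad k w)))^2 <= (\<beta> / sqrt (real CARD('m)) * norm (dev_x k w))^2"
   by (simp add: power_mult_distrib power_divide)
 qed (simp add: beta_nonneg)
 show "moment2 M (%w. mean_grad k w - average (grad k w)) <= \<beta>^2 * mean_sq (dev_x k)"
  using moment2_mono[OF si dev_x_si b] by (simp add: mean_sq_def power_divide)
qed

lemma average_noise_orthogonal:
 assumes T: "T \<in> borel_measurable (hist k)" and Ti: "L2 M T"
 shows "(\<integral>w. average (noise k w) \<bullet> T w \<partial>M) = 0"
proof -
 have "(\<integral>w. average (noise k w) \<bullet> T w \<partial>M) = (\<integral>w. (1 / real CARD('m)) * (\<Sum>i\<in>UNIV. (noise k w $ i) \<bullet> T w) \<partial>M)"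
  by (simp add: average_def inner_sum_left)
 also have "... = (1 / real CARD('m)) * (\<Sum>i\<in>UNIV. \<integral>w. (noise k w $ i) \<bullet> T w \<partial>M)"
  using L2_inner[OF noise_row Ti] by simp
 also have "... = 0"
  by (simp add: noise_row_orthogonal[OF info_measurable_mono[OF T past_others] Ti])
 finally show ?thesis .
qed

lemma \<Phi>_measurable: "\<Phi> k \<in> borel_measurable M"
proof -
 have "(L0 P)-lipschitz_on UNIV (smoothed \<eta> (objective P))"
  using eta by (intro smoothed_lipschitz objective_lipschitz[OF lower wp lipd]) simp
 hence "smoothed \<eta> (objective P) \<in> borel_measurable borel" by (rule lipschitz_measurable)
 thus ?thesis unfolding \<Phi>_def [abs_def] smoothed_obj_eq[OF lower wp lipd less_imp_le[OF eta]]
  by (rule measurable_compose[OF average_measurable[OF x_meas_M]])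
qed

lemma \<Phi>_step:
 assumes w: "w \<in> space M"
 shows "\<Phi> (Suc k) w <= \<Phi> k w + average (noise k w) \<bullet> ((2 * \<beta> * \<gamma>^2) *\<^sub>R average (grad k w) - \<gamma> *\<^sub>R mean_grad k w)
   - \<gamma> / 4 * (norm (mean_grad k w))^2 + \<gamma> / 2 * (norm (mean_grad k w - average (grad k w)))^2 + \<gamma> * (norm (average (bias k w)))^2
   + \<beta> * \<gamma>^2 * ((norm (average (noise k w)))^2 + (norm (average (bias k w)))^2)"
proof -
 have e: "average (x (Suc k) w) - average (x k w) = - (\<gamma> *\<^sub>R (average (noise k w) + average (grad k w) + average (bias k w)))"
  by (simp add: average_x_Suc[OF w] g_split average_add)
 have "\<Phi> (Suc k) w <= \<Phi> k w + mean_grad k w \<bullet> (average (x (Suc k) w) - average (x k w)) + \<beta> / 2 * (norm (average (x (Suc k) w) - average (x k w)))^2"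
  unfolding \<Phi>_def mean_grad_def smoothed_obj_eq[OF lower wp lipd less_imp_le[OF eta]] \<beta>_def
  by (rule descent_lemma[OF smoothed_gderiv[OF objective_lipschitz[OF lower wp lipd] eta]])
    (use sphere_gradient_lipschitz[OF objective_lipschitz[OF lower wp lipd] eta] in simp)
 also have "... <= \<Phi> k w + (average (noise k w) \<bullet> ((2 * \<beta> * \<gamma>^2) *\<^sub>R average (grad k w) - \<gamma> *\<^sub>R mean_grad k w)
   - \<gamma> / 4 * (norm (mean_grad k w))^2 + \<gamma> / 2 * (norm (mean_grad k w - average (grad k w)))^2 + \<gamma> * (norm (average (bias k w)))^2
   + \<beta> * \<gamma>^2 * ((norm (average (noise k w)))^2 + (norm (average (bias k w)))^2))"
  using descent_algebra[OF gam beta_nonneg step3[folded \<beta>_def], of "mean_grad k w" "average (noise k w)" "average (grad k w)" "average (bias k w)"]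
  unfolding e norm_minus_cancel by linarith
 finally show ?thesis by linarith
qed

lemma \<Phi>_integrable: "integrable M (\<Phi> k)"
proof (induction k)
 case 0
 have "integrable M (\<Phi> 0) \<longleftrightarrow> integrable M (%w. smoothed_obj P \<eta> (average (x0 w)))"
  by (rule bintegrable_cong) (auto simp: \<Phi>_def run_facts)
 thus ?case using finite_gap by simp
next
 case (Suc k)
 have lip: "(L0 P)-lipschitz_on UNIV (smoothed \<eta> (objective P))"
  using eta by (intro smoothed_lipschitz objective_lipschitz[OF lower wp lipd]) simp
 show ?case
 proof (rule bintegrable_bound)
  show "integrable M (%w. \<bar>\<Phi> k w\<bar> + L0 P * \<gamma> * norm (average (g k w)))"
   using Suc L2_integrable_norm[OF L2_average(1)[OF g_si]] by simp
  show "AE w in M. norm (\<Phi> (Suc k) w) <= norm (\<bar>\<Phi> k w\<bar> + L0 P * \<gamma> * norm (average (g k w)))"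
  proof (rule AE_I2)
   fix w assume w: "w \<in> space M"
   have "\<bar>\<Phi> (Suc k) w - \<Phi> k w\<bar> <= L0 P * norm (average (x (Suc k) w) - average (x k w))"
    unfolding \<Phi>_def smoothed_obj_eq[OF lower wp lipd less_imp_le[OF eta]] by (rule lipschitz_diff[OF lip])
   hence "\<bar>\<Phi> (Suc k) w - \<Phi> k w\<bar> <= L0 P * \<gamma> * norm (average (g k w))"
    using gam by (simp add: average_x_Suc[OF w])
   thus "norm (\<Phi> (Suc k) w) <= norm (\<bar>\<Phi> k w\<bar> + L0 P * \<gamma> * norm (average (g k w)))" by simp
  qed
 qed (rule \<Phi>_measurable)
qed

text \<open>In expectation the noise pairs with a vector measurable in the history and vanishes;
  only its square remains, at the averaged level \<sigma> / m.\<close>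

lemma \<Phi>_descent:
 "\<gamma> / 4 * moment2 M (mean_grad k) <= (\<integral>w. \<Phi> k w \<partial>M) - (\<integral>w. \<Phi> (Suc k) w \<partial>M)
   + \<gamma> / 2 * (\<beta>^2 * mean_sq (dev_x k)) + \<gamma> * \<tau> k + \<beta> * \<gamma>^2 * (\<sigma> / real CARD('m) + \<tau> k)"
proof -
 let ?T = "%w. (2 * \<beta> * \<gamma>^2) *\<^sub>R average (grad k w) - \<gamma> *\<^sub>R mean_grad k w"
 have Ti: "L2 M ?T"
  by (intro L2_diff L2_scaleR L2_average grad_si mean_grad_si)
 have Tm: "?T \<in> borel_measurable (hist k)"
  using average_measurable[OF grad_measurable[of k "past_sources k"]] mean_grad_measurable[of k "past_sources k"] by simp
 note ni = average_noise_moment(1)[of k] and bi = L2_average(1)[OF bias_si[of k]]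
 note D2 = L2D(2)
 note ints = L2_inner[OF ni Ti] D2[OF mean_grad_si[of k]] D2[OF mean_grad_gap(1)[of k]] D2[OF bi] D2[OF ni] \<Phi>_integrable
 have "(\<integral>w. \<Phi> (Suc k) w \<partial>M) <= (\<integral>w. \<Phi> k w + average (noise k w) \<bullet> ?T w
   - \<gamma> / 4 * (norm (mean_grad k w))^2 + \<gamma> / 2 * (norm (mean_grad k w - average (grad k w)))^2 + \<gamma> * (norm (average (bias k w)))^2
   + \<beta> * \<gamma>^2 * ((norm (average (noise k w)))^2 + (norm (average (bias k w)))^2) \<partial>M)"
  by (rule integral_mono) (use ints \<Phi>_step in auto)
 also have "... = (\<integral>w. \<Phi> k w \<partial>M) + 0 - \<gamma> / 4 * moment2 M (mean_grad k)
   + \<gamma> / 2 * moment2 M (%w. mean_grad k w - average (grad k w)) + \<gamma> * moment2 M (%w. average (bias k w))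
   + \<beta> * \<gamma>^2 * (moment2 M (%w. average (noise k w)) + moment2 M (%w. average (bias k w)))"
  unfolding moment2_def average_noise_orthogonal[OF Tm Ti, symmetric] using ints by simp
 also have "... <= (\<integral>w. \<Phi> k w \<partial>M) + 0 - \<gamma> / 4 * moment2 M (mean_grad k)
   + \<gamma> / 2 * (\<beta>^2 * mean_sq (dev_x k)) + \<gamma> * \<tau> k + \<beta> * \<gamma>^2 * (\<sigma> / real CARD('m) + \<tau> k)"
 proof -
  have "moment2 M (%w. average (bias k w)) <= \<tau> k"
   using L2_average(2)[OF bias_si[of k]] mean_sq_bias[of k] by (simp add: mean_sq_def)
  thus ?thesis using gam beta_nonneg mean_grad_gap(2)[of k] average_noise_moment(2)[of k]
   by (intro add_mono mult_left_mono order.refl) auto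
 qed
 finally show ?thesis by linarith
qed

text \<open>The descent inequality telescopes; the last function value is bounded below by the
  infimum and the consensus sum by \<open>consensus_total\<close>. Dividing by \<gamma> / 4 gives
  the coefficients of \<open>stationarity_rate\<close>.\<close>

lemma stationarity_total:
 fixes gap :: real
 assumes K: "1 <= K" and gap: "gap = (\<integral>w. smoothed_obj P \<eta> (average (x0 w)) \<partial>M) - (INF z. smoothed_obj P \<eta> z)"
 shows "(\<Sum>k<K. moment2 M (mean_grad k))
  <= real K * stationarity_rate (real CARD('m)) \<gamma> \<beta> l \<sigma> gap (\<integral>w. consensus_error (x0 w) \<partial>M) (\<Sum>k<K. \<tau> k) (real K)"
proof -
 define V where "V = (\<integral>w. consensus_error (x0 w) \<partial>M)"
 define T where "T = (\<Sum>k<K. \<tau> k)"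
 define C where "C = (\<Sum>k<K. mean_sq (dev_x k))"
 let ?S = "\<Sum>k<K. moment2 M (mean_grad k)" and ?m = "real CARD('m)"
 have "\<gamma> / 4 * ?S <= (\<Sum>k<K. ((\<integral>w. \<Phi> k w \<partial>M) - (\<integral>w. \<Phi> (Suc k) w \<partial>M))
   + \<gamma> / 2 * (\<beta>^2 * mean_sq (dev_x k)) + \<gamma> * \<tau> k + \<beta> * \<gamma>^2 * (\<sigma> / ?m + \<tau> k))"
  unfolding sum_distrib_left by (rule sum_mono) (rule \<Phi>_descent)
 also have "... = ((\<integral>w. \<Phi> 0 w \<partial>M) - (\<integral>w. \<Phi> K w \<partial>M)) + \<gamma> / 2 * (\<beta>^2 * C) + \<gamma> * T + \<beta> * \<gamma>^2 * (real K * (\<sigma> / ?m) + T)"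
  using sum_lessThan_telescope'[of "%k. \<integral>w. \<Phi> k w \<partial>M" K]
  unfolding C_def T_def sum.distrib sum_distrib_left[symmetric] by simp
 also have "... <= gap + \<gamma> / 2 * (\<beta>^2 * C) + \<gamma> * T + \<beta> * \<gamma>^2 * (real K * (\<sigma> / ?m) + T)"
 proof -
  have "(\<integral>w. \<Phi> 0 w \<partial>M) = (\<integral>w. smoothed_obj P \<eta> (average (x0 w)) \<partial>M)"
   by (rule bintegral_cong) (auto simp: \<Phi>_def run_facts)
  moreover have "(\<integral>w. (INF z. smoothed_obj P \<eta> z) \<partial>M) <= (\<integral>w. \<Phi> K w \<partial>M)"
   by (rule integral_mono[OF _ \<Phi>_integrable])
     (use smoothed_obj_bdd_below[OF lower wp lipd less_imp_le[OF eta] bounded] in \<open>auto simp: \<Phi>_def intro: cINF_lower\<close>)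
  hence "(INF z. smoothed_obj P \<eta> z) <= (\<integral>w. \<Phi> K w \<partial>M)" by (simp add: prob_space)
  ultimately show ?thesis unfolding gap by linarith
 qed
 also have "... <= gap + \<gamma> / 2 * (\<beta>^2 * (real K * consensus_rate \<gamma> l \<sigma> V T (real K))) + \<gamma> * T + \<beta> * \<gamma>^2 * (real K * (\<sigma> / ?m) + T)"
  using consensus_total[OF K] gam unfolding C_def V_def T_def by (intro add_right_mono add_left_mono mult_left_mono) auto
 also have "... = \<gamma> / 4 * (real K * stationarity_rate ?m \<gamma> \<beta> l \<sigma> gap V T (real K))"
  using gam K unfolding stationarity_rate_def by (simp add: sq_eq field_simps)
 finally show ?thesis using gam by (simp add: V_def T_def)
qed

theorem stationarity_error_le:
 fixes gap :: real
 assumes K: "1 <= K" and H: "random_horizon M S \<xi> v K Ks"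
  and gap: "gap = (\<integral>w. smoothed_obj P \<eta> (average (x0 w)) \<partial>M) - (INF z. smoothed_obj P \<eta> z)"
 shows "stationarity_error P \<eta> M x Ks
  <= ennreal (stationarity_rate (real CARD('m)) \<gamma> \<beta> l \<sigma> gap (\<integral>w. consensus_error (x0 w) \<partial>M) (\<Sum>k<K. \<tau> k) (real K))"
proof -
 have "stationarity_error P \<eta> M x Ks <= (\<integral>\<^sup>+w. ennreal ((norm (mean_grad (Ks w) w))^2) \<partial>M)"
  unfolding stationarity_error_def mean_grad_def
  by (intro nn_integral_mono ennreal_leI power_mono clarke_eta_gradient_infdist[OF objective_lipschitz[OF lower wp lipd] eta] infdist_nonneg)
 also have "... <= ennreal (stationarity_rate (real CARD('m)) \<gamma> \<beta> l \<sigma> gap (\<integral>w. consensus_error (x0 w) \<partial>M) (\<Sum>k<K. \<tau> k) (real K))"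
 proof (rule nn_integral_horizon[OF K H _ _ moment2_nonneg stationarity_total[OF K gap]])
  show "(%w. ennreal ((norm (mean_grad k w))^2)) \<in> borel_measurable (info UNIV)" for k
   using mean_grad_measurable[of k UNIV] by simp
  show "(\<integral>\<^sup>+w. ennreal ((norm (mean_grad k w))^2) \<partial>M) <= ennreal (moment2 M (mean_grad k))" for k
   by (simp add: moment2_nn[OF mean_grad_si])
 qed
 finally show ?thesis .
qed

theorem consensus_error_le:
 assumes K: "1 <= K" and H: "random_horizon M S \<xi> v K Ks"
 shows "(\<integral>\<^sup>+w. ennreal (consensus_error (x (Ks w) w)) \<partial>M)
  <= ennreal (consensus_rate \<gamma> l \<sigma> (\<integral>w. consensus_error (x0 w) \<partial>M) (\<Sum>k<K. \<tau> k) (real K))"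
proof (rule nn_integral_horizon[OF K H _ _ mean_sq_nonneg consensus_total[OF K]])
 have e: "consensus_error (x k w) = (norm (dev_x k w))^2 / real CARD('m)" for k w
  by (simp add: consensus_error_def dev_x_def)
 show "(%w. ennreal (consensus_error (x k w))) \<in> borel_measurable (info UNIV)" for k
  unfolding e dev_x_def using deviation_measurable[OF x_measurable[of k UNIV]] by simp
 have "(\<integral>\<^sup>+w. ennreal (consensus_error (x k w)) \<partial>M) = ennreal (\<integral>w. (norm (dev_x k w))^2 / real CARD('m) \<partial>M)" for k
  unfolding e by (rule nn_integral_eq_integral) (use L2D(2)[OF dev_x_si[of k]] in auto)
 thus "(\<integral>\<^sup>+w. ennreal (consensus_error (x k w)) \<partial>M) <= ennreal (mean_sq (dev_x k))" for k
  by (simp add: mean_sq_def moment2_def)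
qed

end

lemma stepsize_conditions:
 assumes l: "0 <= l" "l < 1" and s: "s <= stepsize_factor l"
 shows "9 * l * s <= 1 - l^2" "20 * l^2 * s <= (1 - l^2)^2" "s <= 1 / 6"
proof -
 have "9 * l * s <= 1 - l^2 & 20 * l^2 * s <= (1 - l^2)^2 & s <= 1 / 6"
 proof (cases "l = 0")
  case True
  thus ?thesis using s by (simp add: stepsize_factor_def)
 next
  case False
  with l have l0: "0 < l" by simp
  have "s <= (1 - l^2)^2 / (20 * l^2)" "s <= 1 / 6" "s <= (1 - l^2) / (9 * l)"
   using s False by (simp_all add: stepsize_factor_def)
  thus ?thesis using l0 by (simp add: pos_le_divide_eq mult_ac)
 qed
 thus "9 * l * s <= 1 - l^2" "20 * l^2 * s <= (1 - l^2)^2" "s <= 1 / 6" by auto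
qed

text \<open>A conditional expectation has the same integral as the original function, so the almost
  sure bound integrates.\<close>

lemma (in zo_scheme) inexact_moment:
 assumes inx: "inexact P \<eta> \<epsilon> M S \<xi> v za x0 x"
 shows "(\<integral>\<^sup>+w. ennreal ((norm (za s k i w - zsol P i (query \<eta> s (x k w $ i) (v i k w))))^2) \<partial>M) <= ennreal (\<epsilon> k)"
proof -
 let ?F = "past M x0 \<xi> v za k i"
 let ?d = "%w. ennreal ((norm (za s k i w - zsol P i (query \<eta> s (x k w $ i) (v i k w))))^2)"
 have zaM: "za s k i \<in> borel_measurable M" for s k i
  by (rule info_measurable_M[OF za_measurable[of k UNIV]]) auto
 have "x0 \<in> borel_measurable M" by (rule measurable_from_subalg[OF samp_facts(1) x0m])
 hence gen: "events_of M x0 \<union>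
   (\<Union>j. \<Union>l\<in>{..<k}. events_of M (\<xi> j l) \<union> events_of M (v j l) \<union> (\<Union>s. events_of M (za s l j))) \<union>
   events_of M (v i k) <= sets M"
  using sets_events_of[OF samp_facts(2)] sets_events_of[OF samp_facts(4)] sets_events_of[OF zaM] sets_events_of by blast
 have sub: "subalgebra M ?F"
  unfolding past_def subalgebra_def using sets.sigma_sets_subset[OF gen] gen sets.space_closed[of M]
  by (simp add: space_measure_of_conv sets_measure_of[OF order_trans[OF gen sets.space_closed]])
 interpret F: finite_measure_subalgebra M ?F by unfold_locales (rule sub)
 have dm: "?d \<in> borel_measurable M"
  by (intro measurable_compose[OF _ measurable_ennreal] borel_measurable_power norm_comp_measurable borel_measurable_diff zaM
    zsol_comp_measurable[OF lower wp lipd] query_measurable vec_nth_measurable x_meas_M samp_facts)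
 have "(\<integral>\<^sup>+w. ?d w \<partial>M) = (\<integral>\<^sup>+w. nn_cond_exp M ?F ?d w \<partial>M)"
  using F.nn_cond_exp_intg[OF borel_measurable_const[where c=1] dm] by simp
 also have "... <= (\<integral>\<^sup>+w. ennreal (\<epsilon> k) \<partial>M)"
  using inx unfolding inexact_def by (intro nn_integral_mono_AE) blast
 finally show ?thesis by (simp add: emeasure_space_1)
qed

theorem error_bounds:
 fixes P :: "('n::finite, 'm::finite, 'p::finite, 'd::finite) mpec"
  and W :: "real^'m^'m" and M :: "'w measure" and x0 :: "'w => real^'n^'m" and D :: "'m => real" and \<eta> :: real
 defines "n \<equiv> real CARD('n)" and "m \<equiv> real CARD('m)"
  and "gap \<equiv> (\<integral>w. smoothed_obj P \<eta> (average (x0 w)) \<partial>M) - (INF x. smoothed_obj P \<eta> x)"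
  and "V \<equiv> (\<integral>w. consensus_error (x0 w) \<partial>M)"
 assumes "network E W" "well_posed P" and bdd: "bdd_below (range (objective P))" and "lipschitz_data P" "lower_level P \<mu> LF D"
  and eta: "0 < \<eta>" and "prob_space M" and fV: "integrable M (%w. consensus_error (x0 w))"
  and fgap: "integrable M (%w. smoothed_obj P \<eta> (average (x0 w)))"
  and gam_pos: "0 < \<gamma>" and step: "\<gamma> <= stepsize_factor (lambda_W W) * (\<eta> / (sqrt n * L0 P))"
  and eps: "\<forall>k. 0 <= \<epsilon> k"
  and "sampling P M S \<xi> v" "x0 \<in> borel_measurable S" "dizs_gt P W \<eta> \<gamma> M \<xi> v za x0 x y"
  and inx: "inexact P \<eta> \<epsilon> M S \<xi> v za x0 x" and K: "1 <= K" and H: "random_horizon M S \<xi> v K Ks" and G: "0 <= G"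
 shows "stationarity_error P \<eta> M x Ks
     <= ennreal (stationarity_bound n m \<eta> \<gamma> (lambda_W W) (norm W) (L0 P) (Lt0 P) gap G V \<epsilon> K)"
  and "(\<integral>\<^sup>+w. ennreal (consensus_error (x (Ks w) w)) \<partial>M)
     <= ennreal (consensus_bound n m \<eta> \<gamma> (lambda_W W) (norm W) (L0 P) (Lt0 P) gap G V \<epsilon> K)"
proof -
 interpret prob_space M by fact
 interpret zo_scheme M P S \<xi> v E W x0 \<eta> \<gamma> \<mu> LF D za x y
  using assms by unfold_locales (auto simp: inexact_def)
 let ?l = "lambda_W W" and ?\<beta> = "L0 P * sqrt n / \<eta>"
 have l: "0 <= ?l" "?l < 1" using lambda_W_nonneg lambda_W_less_one[OF network] by auto
 \<comment> \<open>Division by zero yields 0, so for \<open>L0 P = 0\<close> the stepsize condition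
   reads \<gamma> <= 0 and contradicts \<gamma> > 0. Hence \<open>L0 P\<close> is positive.\<close>
 have "\<gamma> <= 0" if "L0 P = 0" using step unfolding that by simp
 with gam_pos have "L0 P ~= 0" by auto
 hence L0: "0 < L0 P" using L0_nonneg[OF lower wp lipd] by simp
 have n: "1 <= n" "1 <= m" by (simp_all add: n_def m_def Suc_leI)
 have b: "0 < ?\<beta>" using L0 eta n by simp
 have "\<gamma> * ?\<beta> <= stepsize_factor ?l * (\<eta> / (sqrt n * L0 P)) * ?\<beta>" using step b by (intro mult_right_mono) auto
 also have "... = stepsize_factor ?l" using L0 eta n by simp
 finally have "\<gamma> * ?\<beta> <= stepsize_factor ?l" .
 note s = stepsize_conditions[OF l this]
 interpret zo_rate M P S \<xi> v E W x0 \<eta> \<gamma> \<mu> LF D za x y \<epsilon>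
  by unfold_locales (use s eps inexact_moment[OF inx] fV fgap bdd in \<open>auto simp: n_def\<close>)
 have V0: "0 <= V" unfolding V_def by (simp add: consensus_error_def)
 have gap0: "0 <= gap" unfolding gap_def
  by (rule initial_gap_nonneg[OF lower wp lipd less_imp_le[OF eta] bdd prob_space_axioms fgap])
 have eps': "0 <= \<epsilon> k" for k using eps by simp
 note maj = majorants[of ?l "norm W" V G gap K \<epsilon>, OF l frobenius_ge_one[OF ds] V0 G gap0 K eps' L0 n eta gam_pos, of "Lt0 P"]
 have r: "\<sigma> = pi^2 * n * (L0 P)^2" "\<beta> = ?\<beta>" "(\<Sum>k<K. \<tau> k) = (\<Sum>k<K. n^2 * (Lt0 P)^2 * \<epsilon> k / \<eta>^2)"
  by (simp_all add: \<sigma>_def \<beta>_def \<tau>_def n_def)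
 show "stationarity_error P \<eta> M x Ks <= ennreal (stationarity_bound n m \<eta> \<gamma> ?l (norm W) (L0 P) (Lt0 P) gap G V \<epsilon> K)"
  using order_trans[OF stationarity_error_le[OF K H gap_def[THEN meta_eq_to_obj_eq]] ennreal_leI] maj(1)
  unfolding r m_def[symmetric] V_def[symmetric] by blast
 show "(\<integral>\<^sup>+w. ennreal (consensus_error (x (Ks w) w)) \<partial>M)
   <= ennreal (consensus_bound n m \<eta> \<gamma> ?l (norm W) (L0 P) (Lt0 P) gap G V \<epsilon> K)"
  using order_trans[OF consensus_error_le[OF K H] ennreal_leI] maj(2)
  unfolding r V_def[symmetric] by blast
qed

section \<open>The stochastic approximation solver\<close>

text \<open>The induction step for errors of the form q / p with p = r + Gh and b = \<mu> gh: the
  contraction 1 - b/p and the noise leave q (p - 1) / p^2, and (p - 1)(p + 1) <= p^2.\<close>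

lemma sa_recursion:
 fixes p q b M2 :: real
 assumes p: "1 <= p" and b: "1 < b" and bp: "b <= p" and q: "M2 <= q * (b - 1)" and q0: "0 <= q" and e: "0 <= e" "e <= q / p"
 shows "(1 - b / p) * e + M2 / p^2 <= q / (p + 1)"
proof -
 have "(1 - b / p) * e + M2 / p^2 <= (1 - b / p) * (q / p) + q * (b - 1) / p^2"
  using p bp e q by (intro add_mono mult_left_mono divide_right_mono) auto
 also have "... = q * (p - 1) / p^2" using p by (simp add: field_simps sq_eq)
 also have "... <= q / (p + 1)"
 proof -
  have "q * (p - 1) * (p + 1) <= q * p^2" using q0 by (simp add: sq_eq algebra_simps)
  thus ?thesis using p by (simp add: pos_divide_le_eq pos_le_divide_eq)
 qed
 finally show ?thesis .
qed

locale sa_setup = prob_space M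
 for M :: "'w measure" and P :: "('n::finite, 'm::finite, 'p::finite, 'd::finite) mpec"
  and J :: "'w measure" and \<xi> :: "'m => nat => 'w => real^'d" and v :: "'m => nat => 'w => real^'n"
  and Q :: "'m => (real^'d) measure" and \<zeta> :: "'m => nat => bool => nat => 'w => real^'d" and \<nu> \<mu> LF :: real and D :: "'m => real" +
 assumes low: "lower_level P \<mu> LF D" and wpd: "well_posed P" and ld: "lipschitz_data P"
  and upper: "sampling P M (solver_info M J \<zeta>) \<xi> v" and inner: "lower_sampling P \<nu> M J Q \<zeta>"
begin

definition "zeta_events c = (case c of (i, k, s, r) => events_of M (\<zeta> i k s r))"

text \<open>The part of the solver's information that uses only the samples with indices in \<open>Z\<close>.\<close>

definition "part_info Z = sigma (space M) (sets J \<union> (\<Union>c\<in>Z. zeta_events c))"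

lemma inner_facts:
 shows "subalgebra M J" "\<zeta> i k s r \<in> borel_measurable M" "distr M borel (\<zeta> i k s r) = Q i"
  "indep_sets (%c. case c of None => sets J | Some (i, k, s, r) => events_of M (\<zeta> i k s r)) UNIV"
  "integrable (Q i) (vmap P i x z)" "(\<integral>\<xi>. vmap P i x z \<xi> \<partial>Q i) = mean_vmap P i x z"
  "(\<integral>\<^sup>+\<xi>. ennreal ((norm (vmap P i x z \<xi> - mean_vmap P i x z))^2) \<partial>Q i) <= ennreal (\<nu>^2)"
 using inner unfolding lower_sampling_def by auto

lemma zeta_events_sets: "zeta_events c <= sets M"
 using sets_events_of[OF inner_facts(2)] by (auto simp: zeta_events_def split: prod.splits)

lemma part_generators: "sets J \<union> (\<Union>c\<in>Z. zeta_events c) <= sets M"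
 using inner_facts(1) zeta_events_sets unfolding subalgebra_def by blast

lemma space_part [simp]: "space (part_info Z) = space M"
 by (simp add: part_info_def space_measure_of_conv)

lemma sets_part: "sets (part_info Z) = sigma_sets (space M) (sets J \<union> (\<Union>c\<in>Z. zeta_events c))"
 unfolding part_info_def by (rule sets_measure_of[OF order_trans[OF part_generators sets.space_closed]])

lemma part_subalgebra: "subalgebra M (part_info Z)"
 unfolding subalgebra_def sets_part using sets.sigma_sets_subset[OF part_generators] by simp

lemma part_mono: "Z <= Z' ==> sets (part_info Z) <= sets (part_info Z')"
 unfolding sets_part by (rule sigma_sets_mono') auto

lemma part_UNIV: "part_info UNIV = solver_info M J \<zeta>"
proof -
 have "(\<Union>c. zeta_events c) = (\<Union>i k s r. events_of M (\<zeta> i k s r))"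
  by (auto simp: zeta_events_def split: prod.splits) blast+
 thus ?thesis by (simp add: part_info_def solver_info_def)
qed

lemma J_part: "f \<in> J \<rightarrow>\<^sub>M N ==> f \<in> part_info Z \<rightarrow>\<^sub>M N"
 using inner_facts(1) by (intro measurable_from_subalg[of "part_info Z" J]) (auto simp: subalgebra_def sets_part)

text \<open>Shrinking the solver's information preserves independence, so all facts about histories
  hold with \<open>part_info Z\<close> in its place.\<close>

lemma part_sampled: "sampled M P (part_info Z) \<xi> v"
proof
 have sub: "source_events M (part_info Z) \<xi> v c <= source_events M (solver_info M J \<zeta>) \<xi> v c" for c
  using part_mono[of Z UNIV] part_UNIV by (cases c) auto
 have "indep_sets (source_events M (solver_info M J \<zeta>) \<xi> v) UNIV"
  using upper by (simp add: sampling_def)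
 from indep_sets_mono_sets[OF this sub] show "sampling P M (part_info Z) \<xi> v"
  using upper part_subalgebra by (simp add: sampling_def)
qed

abbreviation partial_info :: "('m \<times> nat \<times> bool \<times> nat) set => 'm source set => 'w measure" where
 "partial_info Z I \<equiv> sampled.info M (part_info Z) \<xi> v I"

lemma zeta_measurable: "(i, k, s, r) \<in> Z ==> \<zeta> i k s r \<in> borel_measurable (part_info Z)"
 unfolding sets_part[of Z] using sets_part[of Z]
 by (intro measurableI) (auto simp: zeta_events_def events_of_def intro!: sigma_sets.Basic)

lemma zeta_indep_part: "indep_set (sets (part_info (- {c}))) (sigma_sets (space M) (zeta_events c))"
proof -
 let ?F = "%c. case c of None => sets J | Some c => zeta_events c"
 let ?I = "case_bool (- {Some c}) {Some c}"
 have F: "?F = (%c. case c of None => sets J | Some (i, k, s, r) => events_of M (\<zeta> i k s r))"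
  by (auto simp: fun_eq_iff zeta_events_def split: option.splits)
 have "indep_sets (%b. sigma_sets (space M) (\<Union>c\<in>?I b. ?F c)) (UNIV :: bool set)"
 proof (rule indep_sets_collect_sigma)
  show "indep_sets ?F (\<Union>b\<in>UNIV. ?I b)"
   unfolding F by (rule indep_sets_mono_index[OF _ inner_facts(4)]) simp
  show "disjoint_family_on ?I UNIV" by (auto simp: disjoint_family_on_def split: bool.splits)
  show "Int_stable (?F d)" for d
   by (auto simp: zeta_events_def sets.Int_stable Int_stable_events_of split: option.splits prod.splits)
 qed
 moreover have "(\<Union>d\<in>- {Some c}. ?F d) = sets J \<union> (\<Union>d\<in>- {c}. zeta_events d)"
  by (auto split: option.splits)
 hence "(%b. sigma_sets (space M) (\<Union>c\<in>?I b. ?F c)) = case_bool (sets (part_info (- {c}))) (sigma_sets (space M) (zeta_events c))"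
  by (auto simp: fun_eq_iff sets_part split: bool.splits)
 ultimately show ?thesis unfolding indep_set_def by simp
qed

text \<open>An inner sample has to be independent of the upper level and of the rest of the solver
  jointly. The probability of an intersection factorises in two steps: the upper level splits from
  the complete solver information, then the sample splits from the remaining solver information.
  Such intersections form a generator stable under intersection.\<close>

lemma zeta_indep: "indep_set (sets (partial_info (- {c}) UNIV)) (sets (sigma (space M) (zeta_events c)))"
proof -
 interpret U: sampled M P "part_info UNIV" \<xi> v by (rule part_sampled)
 interpret Z: sampled M P "part_info (- {c})" \<xi> v by (rule part_sampled)
 let ?C = "sigma_sets (space M) (zeta_events c)"
 define R where "R = sets (U.info (- {Solver}))"
 define A where "A = {a \<inter> b | a b. a \<in> sets (part_info (- {c})) & b \<in> R}"
 have indR: "indep_set (sets (part_info UNIV)) R"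
  unfolding R_def by (rule indep_set_mono[OF U.info_indep[of "{Solver}" "- {Solver}"]])
   (use U.source_in_info[of Solver "{Solver}"] in auto)
 note indC = zeta_indep_part[of c]
 have CS: "?C <= sets (part_info UNIV)" unfolding sets_part by (rule sigma_sets_mono') auto
 have PS: "sets (part_info (- {c})) <= sets (part_info UNIV)" by (rule part_mono) simp
 have ev: "sets (part_info UNIV) <= events" "R <= events" using indR by (simp_all add: indep_sets2_eq)
 have sp: "space M \<in> R" unfolding R_def using sets.top[of "U.info (- {Solver})"] by simp
 have spP: "space M \<in> sets (part_info (- {c}))" using sets.top[of "part_info (- {c})"] by simp
 have "indep_set A ?C" unfolding indep_sets2_eq
 proof (intro conjI ballI)
  show "A <= events" unfolding A_def using PS ev by (blast intro: sets.Int)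
  show "?C <= events" using CS ev by blast
  fix a C assume "a \<in> A" and C: "C \<in> ?C"
  then obtain p b where a: "a = p \<inter> b" and p: "p \<in> sets (part_info (- {c}))" and b: "b \<in> R" unfolding A_def by auto
  have "prob (a \<inter> C) = prob ((p \<inter> C) \<inter> b)" unfolding a by (rule arg_cong[where f=prob]) auto
  also have "... = prob (p \<inter> C) * prob b"
   by (rule indep_setD[OF indR _ b]) (use p C PS CS in \<open>auto intro: sets.Int\<close>)
  also have "prob (p \<inter> C) = prob p * prob C" by (rule indep_setD[OF indC p C])
  also have "prob p * prob C * prob b = prob (p \<inter> b) * prob C"
   using indep_setD[OF indR _ b, of p] p PS by auto
  finally show "prob (a \<inter> C) = prob a * prob C" by (simp add: a)
 qed
 moreover have "Int_stable A"
 proof (rule Int_stableI)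
  fix a a' assume "a \<in> A" "a' \<in> A"
  then obtain p b p' b' where e: "a = p \<inter> b" "a' = p' \<inter> b'"
   and "p \<in> sets (part_info (- {c}))" "p' \<in> sets (part_info (- {c}))" "b \<in> R" "b' \<in> R" unfolding A_def by auto
  hence "p \<inter> p' \<in> sets (part_info (- {c}))" "b \<inter> b' \<in> R" unfolding R_def by auto
  thus "a \<inter> a' \<in> A" unfolding A_def e by (intro CollectI exI[of _ "p \<inter> p'"] exI[of _ "b \<inter> b'"]) auto
 qed
 moreover have "Int_stable ?C"
  using sets.Int_stable[of "sigma (space M) (zeta_events c)"] zeta_events_sets[of c] sets.space_closed[of M]
  by (simp add: sets_measure_of subset_trans)
 ultimately have "indep_set (sigma_sets (space M) A) (sigma_sets (space M) ?C)" by (rule indep_set_sigma_sets)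
 moreover have "sets (Z.info UNIV) <= sigma_sets (space M) A"
  unfolding Z.sets_info
 proof (rule sigma_sets_mono, rule UN_least)
  fix d :: "'m source"
  show "source_events M (part_info (- {c})) \<xi> v d <= sigma_sets (space M) A"
  proof (cases "d = Solver")
   case True
   have "p \<in> A" if "p \<in> sets (part_info (- {c}))" for p
    unfolding A_def using that sp sets.sets_into_space[OF that] by (intro CollectI exI[of _ p] exI[of _ "space M"]) auto
   thus ?thesis unfolding True by auto
  next
   case False
   hence "source_events M (part_info (- {c})) \<xi> v d <= R"
    using U.source_in_info[of d "- {Solver}"] unfolding R_def by (cases d) auto
   moreover have "b \<in> A" if "b \<in> R" for b
    unfolding A_def using that spP ev sets.sets_into_space[of b M] by (intro CollectI exI[of _ "space M"] exI[of _ b]) auto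
   ultimately show ?thesis by auto
  qed
 qed
 moreover have "sets (sigma (space M) (zeta_events c)) <= sigma_sets (space M) ?C"
  using zeta_events_sets[of c] sets.space_closed[of M] by (subst sets_measure_of) auto
 ultimately show ?thesis by (rule indep_set_mono)
qed

lemma zeta_sigma_measurable: "\<zeta> i k s r \<in> borel_measurable (sigma (space M) (zeta_events (i, k, s, r)))"
 using zeta_events_sets[of "(i, k, s, r)"] sets.space_closed[of M]
 by (intro measurableI) (auto simp: zeta_events_def events_of_def space_measure_of_conv sets_measure_of intro!: sigma_sets.Basic)

text \<open>The solution is a fixed point of the projected exact step for every step length, so
  nonexpansiveness reduces the error to the unprojected difference. There the centred noise is
  orthogonal, and \<alpha> LF^2 <= \<mu> weakens the contraction factor to 1 - \<alpha>
  \<mu>.\<close>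

lemma sa_step:
 fixes \<alpha> :: real
 assumes a: "0 < \<alpha>" "\<alpha> * LF^2 <= \<mu>"
 shows "(\<integral>\<^sup>+u. ennreal ((norm (closest_point (feas P i x) (z - \<alpha> *\<^sub>R vmap P i x z u) - zsol P i x))^2) \<partial>Q i)
  <= ennreal ((1 - \<alpha> * \<mu>) * (norm (z - zsol P i x))^2 + \<alpha>^2 * \<nu>^2)"
proof -
 let ?F = "mean_vmap P i x" and ?s = "zsol P i x" and ?C = "feas P i x"
 have "prob_space (Q i)" using inner_facts(3)[of i 0 True 0] prob_space_distr[OF inner_facts(2)[of i 0 True 0]] by simp
 then interpret Q: prob_space "Q i" .
 have [measurable_cong]: "sets (Q i) = sets borel" using inner_facts(3)[of i 0 True 0, symmetric] by simp
 define W where "W u = vmap P i x z u - ?F z" for u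
 define U where "U = (z - \<alpha> *\<^sub>R ?F z) - (?s - \<alpha> *\<^sub>R ?F ?s)"
 have "vmap P i x z \<in> borel_measurable (Q i)"
  by (rule vmap_comp_measurable[OF low wpd ld, of "%_. x" _ "%_. z" "%u. u"]) simp_all
 hence Wm: "W \<in> borel_measurable (Q i)" unfolding W_def [abs_def] by simp
 have Wsi: "L2 (Q i) W" and Wm2: "moment2 (Q i) W <= \<nu>^2"
  using L2_from_nn[OF Wm inner_facts(7)[of i x z, folded W_def]] by auto
 have Wint: "integrable (Q i) W" unfolding W_def [abs_def] using inner_facts(5)[of i x z] by simp
 have W0: "(\<integral>u. W u \<partial>Q i) = 0" unfolding W_def using inner_facts(5,6)[of i x z] by (simp add: Q.prob_space)
 have Usi: "L2 (Q i) (%_. U)" by (rule Q.L2_bounded[where c="norm U"]) auto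
 have o: "(\<integral>u. U \<bullet> ((- \<alpha>) *\<^sub>R W u) \<partial>Q i) = 0" using Wint by (simp add: W0)
 have si: "L2 (Q i) (%u. U + (- \<alpha>) *\<^sub>R W u)"
  by (rule L2_add[OF Usi L2_scaleR[OF Wsi]])
 have pt: "(norm (closest_point ?C (z - \<alpha> *\<^sub>R vmap P i x z u) - ?s))^2 <= (norm (U + (- \<alpha>) *\<^sub>R W u))^2" for u
 proof (rule power_mono)
  have "norm (closest_point ?C (z - \<alpha> *\<^sub>R vmap P i x z u) - ?s)
    = dist (closest_point ?C (z - \<alpha> *\<^sub>R vmap P i x z u)) (closest_point ?C (?s - \<alpha> *\<^sub>R ?F ?s))"
   using zsol_fixed_point[OF low a(1), of i x] by (simp add: dist_norm)
  also have "... <= dist (z - \<alpha> *\<^sub>R vmap P i x z u) (?s - \<alpha> *\<^sub>R ?F ?s)"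
   by (rule closest_point_lipschitz) (use lower_facts[OF low] in auto)
  also have "... = norm (U + (- \<alpha>) *\<^sub>R W u)" by (simp add: dist_norm U_def W_def algebra_simps)
  finally show "norm (closest_point ?C (z - \<alpha> *\<^sub>R vmap P i x z u) - ?s) <= norm (U + (- \<alpha>) *\<^sub>R W u)" .
 qed simp
 have "(\<integral>\<^sup>+u. ennreal ((norm (closest_point ?C (z - \<alpha> *\<^sub>R vmap P i x z u) - ?s))^2) \<partial>Q i)
  <= (\<integral>\<^sup>+u. ennreal ((norm (U + (- \<alpha>) *\<^sub>R W u))^2) \<partial>Q i)"
  by (intro nn_integral_mono ennreal_leI pt)
 also have "... = ennreal (moment2 (Q i) (%u. U + (- \<alpha>) *\<^sub>R W u))" by (rule moment2_nn[OF si])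
 also have "moment2 (Q i) (%u. U + (- \<alpha>) *\<^sub>R W u) = (norm U)^2 + \<alpha>^2 * moment2 (Q i) W"
  unfolding moment2_orthogonal[OF Usi L2_scaleR[OF Wsi] o] moment2_scaleR
  by (simp add: moment2_def Q.prob_space)
 also have "ennreal ((norm U)^2 + \<alpha>^2 * moment2 (Q i) W) <= ennreal ((1 - \<alpha> * \<mu>) * (norm (z - ?s))^2 + \<alpha>^2 * \<nu>^2)"
 proof (intro ennreal_leI add_mono mult_left_mono Wm2)
  have "(norm U)^2 <= (1 - 2 * \<alpha> * \<mu> + \<alpha>^2 * LF^2) * (norm (z - ?s))^2"
   unfolding U_def by (rule projected_step_contraction) (use lower_facts[OF low] L_pos[OF low] a in auto)
  also have "... <= (1 - \<alpha> * \<mu>) * (norm (z - ?s))^2"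
  proof (rule mult_right_mono)
   have "\<alpha> * (\<alpha> * LF^2) <= \<alpha> * \<mu>" using a by (intro mult_left_mono) auto
   thus "1 - 2 * \<alpha> * \<mu> + \<alpha>^2 * LF^2 <= 1 - \<alpha> * \<mu>" by (simp add: sq_eq mult_ac)
  qed simp
  finally show "(norm U)^2 <= (1 - \<alpha> * \<mu>) * (norm (z - ?s))^2" .
 qed auto
 finally show ?thesis .
qed

end

section \<open>The projected iteration inside the upper-level scheme\<close>

locale sa_run = sa_setup M P J \<xi> v Q \<zeta> \<nu> \<mu> LF D
 for M :: "'w measure" and P :: "('n::finite, 'm::finite, 'p::finite, 'd::finite) mpec"
  and J \<xi> v Q \<zeta> \<nu> \<mu> LF D +
 fixes E :: "('m \<times> 'm) set" and W :: "real^'m^'m" and x0 :: "'w => real^'n^'m" and \<eta> \<gamma> gh Gh :: real and t :: "nat => nat"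
  and zl :: "bool => nat => 'm => nat => 'w => real^'p"
  and za :: "bool => nat => 'm => 'w => real^'p" and x y :: "nat => 'w => real^'n^'m"
 assumes net: "network E W" and et: "0 < \<eta>" and ga: "0 < \<gamma>" and x0J: "x0 \<in> borel_measurable J"
  and scheme: "dizs_gt P W \<eta> \<gamma> M \<xi> v za x0 x y"
  and solver: "sa_solver P \<eta> gh Gh t M J \<xi> v \<zeta> x zl za"
  and gh: "1 / \<mu> < gh" and Gh: "gh * LF^2 / \<mu> < Gh"
begin

lemma recursion: "zo_recursion M P (part_info Z) \<xi> v E W x0 \<eta> \<gamma> \<mu> LF D za x y"
proof -
 interpret sampled M P "part_info Z" \<xi> v by (rule part_sampled)
 show ?thesis by unfold_locales (use net wpd ld low et ga scheme J_part[OF x0J] in auto)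
qed

definition "point s k i w = query \<eta> s (x k w $ i) (v i k w)"

lemma solver_facts:
 shows "zl s k i 0 \<in> borel_measurable (start_info M J \<xi> v \<zeta> k i)"
  and "w \<in> space M ==> zl s k i 0 w \<in> feas P i (point s k i w)"
  and "w \<in> space M ==> r < t k ==> zl s k i (Suc r) w = closest_point (feas P i (point s k i w))
      (zl s k i r w - (gh / (real r + Gh)) *\<^sub>R vmap P i (point s k i w) (zl s k i r w) (\<zeta> i k s r w))"
  and "w \<in> space M ==> za s k i w = zl s k i (t k) w"
 using solver unfolding sa_solver_def Let_def point_def by blast+

abbreviation "call_sources k i \<equiv> insert (Direction i k) (sampled.past_sources k)"

text \<open>An inner iterate uses the inner samples of earlier iterations and those already drawn in
  its own call. Any index set \<open>Z\<close> with these suffices, in particular one that omits the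
  next sample.\<close>

lemma zl_measurable:
 assumes Z: "!!j l s r. l < k ==> (j, l, s, r) \<in> Z" and Zr: "!!r'. r' < r ==> (i, k, s, r') \<in> Z" and r: "r <= t k"
  and xm: "x k \<in> borel_measurable (partial_info Z (call_sources k i))"
 shows "zl s k i r \<in> borel_measurable (partial_info Z (call_sources k i))"
 using r Zr
proof (induction r)
 interpret zo_recursion M P "part_info Z" \<xi> v E W x0 \<eta> \<gamma> \<mu> LF D za x y by (rule recursion)
 let ?I = "insert (Direction i k) (past_sources k)"
 case 0
 have "subalgebra (info ?I) (start_info M J \<xi> v \<zeta> k i)"
  unfolding start_info_def
 proof (rule info_le, intro Un_least UN_least)
  have S: "sets (part_info Z) <= sets (info ?I)" using source_in_info[of Solver ?I] by (auto simp: past_sources_def)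
  show "sets J <= sets (info ?I)" using S unfolding sets_part by auto
  show "events_of M (v i k) <= sets (info ?I)" using source_in_info[of "Direction i k" ?I] by auto
  fix j l assume l: "l \<in> {..<k}"
  hence m: "Sample j l \<in> ?I" "Direction j l \<in> ?I" by (auto simp: past_sources_def)
  show "events_of M (\<xi> j l) <= sets (info ?I)" "events_of M (v j l) <= sets (info ?I)"
   using source_in_info[OF m(1)] source_in_info[OF m(2)] by auto
  fix s r
  have "events_of M (\<zeta> j l s r) = zeta_events (j, l, s, r)" by (simp add: zeta_events_def)
  also have "... <= sets (part_info Z)" unfolding sets_part using Z[of l j s r] l by auto
  finally show "events_of M (\<zeta> j l s r) <= sets (info ?I)" using S by blast
 qed
 from measurable_from_subalg[OF this solver_facts(1)] show ?case .
next
 interpret zo_recursion M P "part_info Z" \<xi> v E W x0 \<eta> \<gamma> \<mu> LF D za x y by (rule recursion)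
 let ?I = "insert (Direction i k) (past_sources k)"
 case (Suc r)
 have zm: "zl s k i r \<in> borel_measurable (info ?I)" using Suc by simp
 have \<zeta>m: "\<zeta> i k s r \<in> borel_measurable (info ?I)"
  by (rule solver_measurable[OF _ zeta_measurable]) (use Suc.prems in \<open>auto simp: past_sources_def\<close>)
 have pm: "point s k i \<in> borel_measurable (info ?I)"
  unfolding point_def [abs_def] by (intro query_measurable vec_nth_measurable xm direction_measurable) simp
 have "(%w. closest_point (feas P i (point s k i w))
      (zl s k i r w - (gh / (real r + Gh)) *\<^sub>R vmap P i (point s k i w) (zl s k i r w) (\<zeta> i k s r w))) \<in> borel_measurable (info ?I)"
  using measurable_compose[OF Pair_borel_measurable[OF pm borel_measurable_diff[OF zm borel_measurable_scaleR[OF borel_measurable_const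
    vmap_comp_measurable[OF low wpd ld pm zm \<zeta>m]]]] proj_measurable[OF low wpd]] by simp
 thus ?case using Suc.prems by (subst measurable_cong) (auto simp: solver_facts(3))
qed

lemma za_available:
 assumes "zl s k i (t k) \<in> borel_measurable (partial_info Z (call_sources k i))"
 shows "za s k i \<in> borel_measurable (available M (part_info Z) \<xi> v k i)"
proof -
 interpret zo_recursion M P "part_info Z" \<xi> v E W x0 \<eta> \<gamma> \<mu> LF D za x y by (rule recursion)
 let ?I = "insert (Direction i k) (past_sources k)" and ?A = "available M (part_info Z) \<xi> v k i"
 let ?G = "sets (part_info Z) \<union> (\<Union>j. \<Union>l\<in>{..<k}. events_of M (\<xi> j l) \<union> events_of M (v j l)) \<union> events_of M (v i k)"
 have G: "?G <= sets M"
  using sets_events_of[OF samp_facts(2)] sets_events_of[OF samp_facts(4)] samp_facts(1) unfolding subalgebra_def by blast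
 have "sets (info ?I) <= sigma_sets (space M) ?G"
  unfolding sets_info by (rule sigma_sets_mono') (auto simp: past_sources_def)
 hence "subalgebra ?A (info ?I)"
  unfolding subalgebra_def available_def using sets_measure_of[OF order_trans[OF G sets.space_closed]]
  by (simp add: space_measure_of_conv)
 from measurable_from_subalg[OF this assms] show ?thesis
  by (subst measurable_cong) (auto simp: solver_facts(4) available_def space_measure_of_conv)
qed

text \<open>Solver outputs depend on the current iterate and iterates on earlier outputs; strong
  induction over the iteration resolves the mutual dependence.\<close>

lemma scheme_measurable:
 assumes Z: "!!j l s r. l < k ==> (j, l, s, r) \<in> Z"
 shows "l < k ==> za s l i \<in> borel_measurable (available M (part_info Z) \<xi> v l i)"
  and "x k \<in> borel_measurable (partial_info Z (call_sources k i))"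
proof -
 interpret zo_recursion M P "part_info Z" \<xi> v E W x0 \<eta> \<gamma> \<mu> LF D za x y by (rule recursion)
 have xI: "x l \<in> borel_measurable (info (insert (Direction i l) (past_sources l)))"
  if "!!s' l' i'. l' < l ==> za s' l' i' \<in> borel_measurable (available M (part_info Z) \<xi> v l' i')" for l i
  using iterates_measurable_upto[OF that] by (blast intro: info_measurable_mono)
 have za: "za s l i \<in> borel_measurable (available M (part_info Z) \<xi> v l i)" if "l < k" for s l i
  using that
 proof (induction l arbitrary: s i rule: less_induct)
  case (less l)
  show ?case
   by (rule za_available, rule zl_measurable) (use less Z xI in auto)
 qed
 thus "l < k ==> za s l i \<in> borel_measurable (available M (part_info Z) \<xi> v l i)" .
 show "x k \<in> borel_measurable (partial_info Z (call_sources k i))" by (rule xI[OF za])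
qed

lemma solver_available: "za s k i \<in> borel_measurable (available M (solver_info M J \<zeta>) \<xi> v k i)"
 using scheme_measurable(1)[of "Suc k" UNIV k] part_UNIV by auto

lemma Gh_facts: "1 < Gh" "1 < \<mu> * gh" "\<mu> * gh <= Gh" "0 < gh"
proof -
 have m: "0 < \<mu>" "\<mu> <= LF" using lower_facts(1)[OF low] mu_le_L[OF low] by auto
 show b: "1 < \<mu> * gh" using gh m by (simp add: pos_divide_less_eq mult.commute)
 thus g: "0 < gh" using m zero_less_mult_pos[of \<mu> gh] by simp
 have "\<mu> * gh = gh * \<mu>^2 / \<mu>" using m by (simp add: sq_eq)
 also have "... <= gh * LF^2 / \<mu>" using m g by (intro divide_right_mono mult_left_mono power_mono) auto
 finally show "\<mu> * gh <= Gh" using Gh by simp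
 with b show "1 < Gh" by simp
qed

text \<open>Induction over the inner counter: the current iterate and query point are independent of
  the next inner sample, so \<open>sa_step\<close> applies inside the expectation and
  \<open>sa_recursion\<close> closes the step.\<close>

theorem solver_moment:
 "(\<integral>\<^sup>+w. ennreal ((norm (za s k i w - zsol P i (query \<eta> s (x k w $ i) (v i k w))))^2) \<partial>M)
  <= ennreal (sa_constant \<mu> \<nu> gh Gh D / (real (t k) + Gh))"
proof -
 define q where "q = sa_constant \<mu> \<nu> gh Gh D"
 have m: "0 < \<mu>" using lower_facts(1)[OF low] .
 \<comment> \<open>The two entries of the maximum in \<open>sa_constant\<close> have separate tasks:
   this one covers the start through the diameter, the other one dominates the noise in each
   step.\<close>
 have qD: "D i <= q / Gh"
 proof -
  have "Gh * D i <= Gh * Max (range D)" using Gh_facts by (intro mult_left_mono Max_ge) auto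
  also have "... <= q" by (simp add: q_def sa_constant_def)
  finally show ?thesis using Gh_facts by (simp add: pos_le_divide_eq mult.commute)
 qed
 have q\<nu>: "\<nu>^2 * gh^2 <= q * (\<mu> * gh - 1)"
 proof -
  have "\<nu>^2 * gh^2 / (\<mu> * gh - 1) <= q" by (simp add: q_def sa_constant_def)
  thus ?thesis using Gh_facts by (simp add: pos_divide_le_eq)
 qed
 have q0: "0 <= q"
 proof -
  have "0 <= \<nu>^2 * gh^2 / (\<mu> * gh - 1)" using Gh_facts by simp
  also have "... <= q" by (simp add: q_def sa_constant_def)
  finally show ?thesis .
 qed
 let ?e = "%r w. ennreal ((norm (zl s k i r w - zsol P i (point s k i w)))^2)"
 have main: "(\<integral>\<^sup>+w. ?e r w \<partial>M) <= ennreal (q / (real r + Gh))" if "r <= t k" for r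
  using that
 proof (induction r)
  case 0
  have "(\<integral>\<^sup>+w. ?e 0 w \<partial>M) <= (\<integral>\<^sup>+w. ennreal (D i) \<partial>M)"
   by (intro nn_integral_mono ennreal_leI lower_facts(7)[OF low solver_facts(2) zsol_in_feas[OF low]])
  also have "... <= ennreal (q / Gh)" using qD by (simp add: emeasure_space_1 ennreal_leI)
  finally show ?case by simp
 next
  case (Suc r)
  define p where "p = real r + Gh"
  have p: "1 <= p" "\<mu> * gh <= p" using Gh_facts by (auto simp: p_def)
  define \<alpha> where "\<alpha> = gh / p"
  have a0: "0 < \<alpha>" using Gh_facts p by (simp add: \<alpha>_def)
  have aL: "\<alpha> * LF^2 <= \<mu>"
  proof -
   have "gh * LF^2 <= \<mu> * Gh" using Gh m by (simp add: pos_divide_less_eq mult.commute)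
   also have "... <= \<mu> * p" using m by (simp add: p_def)
   finally show ?thesis using p by (simp add: \<alpha>_def pos_divide_le_eq)
  qed
  have a1: "0 <= 1 - \<alpha> * \<mu>" using p by (simp add: \<alpha>_def mult.commute)
  \<comment> \<open>The sample of the step under way is removed from the information; the query
    point and the iterate \<open>r\<close> remain measurable without it.\<close>
  let ?c = "(i, k, s, r)" and ?Z = "- {(i, k, s, r)}"
  interpret zo_recursion M P "part_info ?Z" \<xi> v E W x0 \<eta> \<gamma> \<mu> LF D za x y by (rule recursion)
  have Zk: "(j, l, s', r') \<in> ?Z" if "l < k" for j l s' r' using that by auto
  have xm: "x k \<in> borel_measurable (info (insert (Direction i k) (past_sources k)))" by (rule scheme_measurable(2)[OF Zk])
  have zm: "zl s k i r \<in> borel_measurable (info UNIV)"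
   by (rule info_measurable_mono[OF zl_measurable[OF Zk _ _ xm]]) (use Suc.prems in auto)
  have pm: "point s k i \<in> borel_measurable (info UNIV)"
   unfolding point_def [abs_def]
   by (intro query_measurable vec_nth_measurable info_measurable_mono[OF xm] direction_measurable) auto
  let ?h = "%a u. ennreal ((norm (closest_point (feas P i (fst a)) (snd a - \<alpha> *\<^sub>R vmap P i (fst a) (snd a) u) - zsol P i (fst a)))^2)"
  have hm: "case_prod ?h \<in> borel_measurable ((borel \<Otimes>\<^sub>M borel) \<Otimes>\<^sub>M borel)"
  proof -
   have f: "(%w. fst (fst w)) \<in> borel_measurable ((borel \<Otimes>\<^sub>M borel) \<Otimes>\<^sub>M borel :: (((real^'n) \<times> (real^'p)) \<times> (real^'d)) measure)"
    and g: "(%w. snd (fst w)) \<in> borel_measurable ((borel \<Otimes>\<^sub>M borel) \<Otimes>\<^sub>M borel :: (((real^'n) \<times> (real^'p)) \<times> (real^'d)) measure)"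
    and h: "snd \<in> borel_measurable ((borel \<Otimes>\<^sub>M borel) \<Otimes>\<^sub>M borel :: (((real^'n) \<times> (real^'p)) \<times> (real^'d)) measure)"
    by measurable
   have "(%w. closest_point (feas P i (fst (fst w))) (snd (fst w) - \<alpha> *\<^sub>R vmap P i (fst (fst w)) (snd (fst w)) (snd w)))
    \<in> borel_measurable ((borel \<Otimes>\<^sub>M borel) \<Otimes>\<^sub>M borel :: (((real^'n) \<times> (real^'p)) \<times> (real^'d)) measure)"
    using measurable_compose[OF Pair_borel_measurable[OF f borel_measurable_diff[OF g borel_measurable_scaleR[OF borel_measurable_const
      vmap_comp_measurable[OF low wpd ld f g h]]]] proj_measurable[OF low wpd]] by simp
   thus ?thesis
    unfolding case_prod_unfold
    by (intro measurable_compose[OF _ measurable_ennreal] borel_measurable_power norm_comp_measurable borel_measurable_diff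
      zsol_comp_measurable[OF low wpd ld] f)
  qed
  have zM: "zl s k i r \<in> borel_measurable M" "point s k i \<in> borel_measurable M"
   using info_measurable_M zm pm by blast+
  have em: "(%w. (norm (zl s k i r w - zsol P i (point s k i w)))^2) \<in> borel_measurable M"
   by (intro borel_measurable_power norm_comp_measurable borel_measurable_diff zsol_comp_measurable[OF low wpd ld] zM)
  have IH: "(\<integral>\<^sup>+w. ?e r w \<partial>M) <= ennreal (q / p)" using Suc unfolding p_def by simp
  have "(\<integral>\<^sup>+w. ?e (Suc r) w \<partial>M) = (\<integral>\<^sup>+w. ?h (point s k i w, zl s k i r w) (\<zeta> i k s r w) \<partial>M)"
   using Suc.prems by (intro nn_integral_cong) (simp add: solver_facts(3) \<alpha>_def p_def)
  also have "... = (\<integral>\<^sup>+w. (\<integral>\<^sup>+u. ?h (point s k i w, zl s k i r w) u \<partial>distr M borel (\<zeta> i k s r)) \<partial>M)"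
   by (rule nn_integral_indep[OF zeta_indep[of ?c] space_info _ measurable_Pair[OF pm zm] zeta_sigma_measurable hm])
     (simp add: space_measure_of_conv)
  also have "... <= (\<integral>\<^sup>+w. ennreal (1 - \<alpha> * \<mu>) * ?e r w + ennreal (\<alpha>^2 * \<nu>^2) \<partial>M)"
  proof (rule nn_integral_mono)
   fix w
   have "(\<integral>\<^sup>+u. ?h (point s k i w, zl s k i r w) u \<partial>distr M borel (\<zeta> i k s r))
    <= ennreal ((1 - \<alpha> * \<mu>) * (norm (zl s k i r w - zsol P i (point s k i w)))^2 + \<alpha>^2 * \<nu>^2)"
    unfolding inner_facts(3) fst_conv snd_conv by (rule sa_step[OF a0 aL])
   also have "... = ennreal (1 - \<alpha> * \<mu>) * ?e r w + ennreal (\<alpha>^2 * \<nu>^2)"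
    using a1 by (simp add: ennreal_mult)
   finally show "(\<integral>\<^sup>+u. ?h (point s k i w, zl s k i r w) u \<partial>distr M borel (\<zeta> i k s r)) <= ennreal (1 - \<alpha> * \<mu>) * ?e r w + ennreal (\<alpha>^2 * \<nu>^2)" .
  qed
  also have "... = ennreal (1 - \<alpha> * \<mu>) * (\<integral>\<^sup>+w. ?e r w \<partial>M) + ennreal (\<alpha>^2 * \<nu>^2)"
   using em by (subst nn_integral_add) (simp_all add: nn_integral_cmult emeasure_space_1)
  also have "... <= ennreal (1 - \<alpha> * \<mu>) * ennreal (q / p) + ennreal (\<alpha>^2 * \<nu>^2)"
   by (intro add_right_mono mult_left_mono IH) simp
  also have "... = ennreal ((1 - \<mu> * gh / p) * (q / p) + \<nu>^2 * gh^2 / p^2)"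
   using a1 q0 p by (simp add: ennreal_mult[symmetric] ennreal_plus[symmetric] \<alpha>_def power_divide mult.commute del: ennreal_plus)
  also have "... <= ennreal (q / (p + 1))"
   by (intro ennreal_leI sa_recursion[OF p(1) Gh_facts(2) p(2) q\<nu> q0]) (use q0 p in auto)
  finally show ?case by (simp add: p_def add_ac)
 qed
 have "(\<integral>\<^sup>+w. ennreal ((norm (za s k i w - zsol P i (query \<eta> s (x k w $ i) (v i k w))))^2) \<partial>M) = (\<integral>\<^sup>+w. ?e (t k) w \<partial>M)"
  by (rule nn_integral_cong) (simp add: solver_facts(4) point_def)
 thus ?thesis using main[of "t k"] by (simp add: q_def)
qed

end

section \<open>Complexity\<close>

lemma power_powr: "0 < x ==> (x ^ k) powr r = x powr (real k * r)" for x :: real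
 by (simp add: powr_realpow[symmetric] powr_powr)

text \<open>Comparison of a summand with the integral by the mean value theorem; dividing by 1 - a
  treats exponents below and above 1 alike.\<close>

lemma powr_increment:
 fixes a x :: real
 assumes a: "0 < a" "a ~= 1" and x: "0 < x"
 shows "(x + 1) powr (- a) <= ((x + 1) powr (1 - a) - x powr (1 - a)) / (1 - a)"
proof -
 have "DERIV (%u. u powr (1 - a) / (1 - a)) u :> u powr (- a)" if "x <= u" for u
 proof -
  have "DERIV (%u. u powr (1 - a) / (1 - a)) u :> (1 - a) * u powr (1 - a - 1) / (1 - a)"
   using that x by (intro DERIV_cdivide has_real_derivative_powr) simp
  thus ?thesis using a by simp
 qed
 from MVT2[of x "x + 1", OF _ this] obtain z where z: "x < z" "z < x + 1"
  and e: "(x + 1) powr (1 - a) / (1 - a) - x powr (1 - a) / (1 - a) = (x + 1 - x) * z powr (- a)" by auto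
 have "(x + 1) powr (- a) <= z powr (- a)" using z x a by (intro powr_mono2') auto
 thus ?thesis using e by (simp add: diff_divide_distrib)
qed

lemma powr_sum_le:
 fixes a :: real
 assumes a: "0 < a" "a ~= 1"
 shows "(\<Sum>k<Suc N. (real k + 1) powr (- a)) <= 1 + (real (Suc N) powr (1 - a) - 1) / (1 - a)"
proof (induction N)
 case (Suc N)
 have "(\<Sum>k<Suc (Suc N). (real k + 1) powr (- a)) <= (1 + (real (Suc N) powr (1 - a) - 1) / (1 - a)) + (real (Suc N) + 1) powr (- a)"
  using Suc by simp
 also have "... <= (1 + (real (Suc N) powr (1 - a) - 1) / (1 - a)) + ((real (Suc N) + 1) powr (1 - a) - real (Suc N) powr (1 - a)) / (1 - a)"
  by (intro add_left_mono powr_increment a) simp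
 also have "... = 1 + (real (Suc (Suc N)) powr (1 - a) - 1) / (1 - a)"
  by (simp add: add_divide_distrib[symmetric] add_ac)
 finally show ?case .
qed simp

lemma powr_sum_bounds:
 fixes a :: real
 assumes K: "1 <= K" and a: "0 < a"
 shows "a < 1 ==> (\<Sum>k<K. (real k + 1) powr (- a)) <= real K powr (1 - a) / (1 - a)"
  and "1 < a ==> (\<Sum>k<K. (real k + 1) powr (- a)) <= a / (a - 1)"
  and "a = 1 ==> (\<Sum>k<K. (real k + 1) powr (- a)) <= 1 + ln (real K)"
proof -
 obtain N where N: "K = Suc N" using K by (cases K) auto
 show "(\<Sum>k<K. (real k + 1) powr (- a)) <= real K powr (1 - a) / (1 - a)" if "a < 1"
 proof -
  have "1 + (x - 1) / (1 - a) <= x / (1 - a)" for x using that a by (simp add: field_simps)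
  from order_trans[OF powr_sum_le[of a N] this] show ?thesis using a that unfolding N by simp
 qed
 show "(\<Sum>k<K. (real k + 1) powr (- a)) <= a / (a - 1)" if "1 < a"
 proof -
  have "1 + (x - 1) / (1 - a) <= a / (a - 1)" if "0 <= x" for x
  proof -
   have "1 + (x - 1) / (1 - a) = 1 + (1 - x) / (a - 1)" using \<open>1 < a\<close> by (simp add: field_simps)
   also have "... <= 1 + 1 / (a - 1)" using that \<open>1 < a\<close> by (intro add_left_mono divide_right_mono) auto
   also have "... = a / (a - 1)" using \<open>1 < a\<close> by (simp add: field_simps)
   finally show ?thesis .
  qed
  from order_trans[OF powr_sum_le[of a N] this[OF powr_ge_zero]] show ?thesis using a that unfolding N by simp
 qed
 have "(\<Sum>k<Suc N. (real k + 1) powr (- 1)) <= 1 + ln (real (Suc N))"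
 proof (induction N)
  case (Suc N)
  let ?x = "real (Suc N)"
  have "ln (?x / (?x + 1)) <= ?x / (?x + 1) - 1" by (rule ln_le_minus_one) simp
  hence "1 / (?x + 1) <= ln (?x + 1) - ln ?x" by (simp add: ln_div field_simps)
  thus ?case using Suc by (simp add: powr_minus_divide add_ac)
 qed simp
 thus "(\<Sum>k<K. (real k + 1) powr (- a)) <= 1 + ln (real K)" if "a = 1" unfolding N that .
qed

text \<open>Makes the implicit condition y (1 + ln K) <= K explicit: ln K is bounded by its tangent
  at 2 (1 + y), so that the linear part uses up only half of K.\<close>

lemma log_threshold:
 fixes y K :: real
 assumes y: "0 <= y" and K: "1 <= K" and h: "2 * y * (1 + ln (1 + y)) <= K"
 shows "y * (1 + ln K) <= K"
proof -
 have "ln (K / (2 * (1 + y))) <= K / (2 * (1 + y)) - 1" using y K by (intro ln_le_minus_one) simp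
 moreover have "ln (K / (2 * (1 + y))) = ln K - (ln 2 + ln (1 + y))" using y K ln_mult[of 2 "1 + y"] by (simp add: ln_div)
 ultimately have "1 + ln K <= K / (2 * (1 + y)) + (ln 2 + ln (1 + y))" by linarith
 also have "... <= K / (2 * (1 + y)) + (1 + ln (1 + y))" using ln_2_less_1 by simp
 finally have "y * (1 + ln K) <= y * (K / (2 * (1 + y)) + (1 + ln (1 + y)))" using y by (rule mult_left_mono)
 also have "... = (y / (1 + y)) * (K / 2) + (2 * y * (1 + ln (1 + y))) / 2" using y by (simp add: field_simps)
 also have "... <= 1 * (K / 2) + K / 2" using y K h by (intro add_mono mult_right_mono divide_right_mono) auto
 finally show ?thesis by simp
qed

lemma soft_threshold:
 fixes c g K C :: real
 assumes c: "0 <= c" and g: "0 <= g" and K: "1 <= K" and C: "2 * c * (1 + c) <= C" and h: "C * soft g <= K"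
 shows "c * g * (1 + ln K) <= K"
proof (rule log_threshold[OF _ K])
 have "ln (1 + c * g) <= ln ((1 + c) * (1 + g))" using c g by (subst ln_le_cancel_iff) (auto simp: algebra_simps add_pos_nonneg)
 also have "... = ln (1 + c) + ln (1 + g)" using c g by (simp add: ln_mult)
 also have "... <= c + ln (1 + g)" using ln_add_one_self_le_self[OF c] by simp
 finally have "1 + ln (1 + c * g) <= (1 + c) * (1 + ln (1 + g))"
 proof -
  assume "ln (1 + c * g) <= c + ln (1 + g)"
  moreover have "0 <= c * ln (1 + g)" using c g by simp
  ultimately show ?thesis by (simp add: algebra_simps)
 qed
 hence "2 * (c * g) * (1 + ln (1 + c * g)) <= 2 * (c * g) * ((1 + c) * (1 + ln (1 + g)))" using c g by (intro mult_left_mono) auto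
 also have "... = (2 * c * (1 + c)) * soft g" by (simp only: soft_def mult_ac)
 also have "... <= C * soft g" using C g by (intro mult_right_mono) (auto simp: soft_def)
 finally show "2 * (c * g) * (1 + ln (1 + c * g)) <= K" using h by simp
qed (use c g in simp)

text \<open>A lower bound on the horizon is raised to the power r; the numerical factor
  \<open>c\<close> is charged to the constant \<open>C\<close>.\<close>

lemma powr_threshold:
 fixes r c b e C K :: real
 assumes r: "0 < r" and c: "0 <= c" and b: "0 <= b" and e: "0 < e" and C: "c powr (1 / r) <= C"
  and h: "C * (b powr (1 / r) * e powr (- 1 / r)) <= K"
 shows "c * b <= e * K powr r"
proof -
 have "(c * b / e) powr (1 / r) = c powr (1 / r) * (b powr (1 / r) * e powr (- 1 / r))"
  using c b e by (simp add: powr_mult powr_divide powr_minus_divide)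
 also have "... <= C * (b powr (1 / r) * e powr (- 1 / r))" using C by (intro mult_right_mono) auto
 finally have "(c * b / e) powr (1 / r) <= K" using h by simp
 hence "((c * b / e) powr (1 / r)) powr r <= K powr r" using r by (intro powr_mono2) auto
 hence "c * b / e <= K powr r" using r c b e by (simp add: powr_powr)
 thus ?thesis using e by (simp add: field_simps)
qed

lemma powr_le_add_one:
 fixes c p :: real
 assumes "0 <= c" "0 <= p"
 shows "p <= 1 ==> c powr p <= 1 + c" and "p <= 2 ==> c powr p <= (1 + c)^2"
proof -
 have *: "c powr p <= (1 + c) powr p" using assms by (intro powr_mono2) auto
 have "(1 + c) powr p <= (1 + c) powr 1" if "p <= 1" using assms that by (intro powr_mono) auto
 with * show "p <= 1 ==> c powr p <= 1 + c" using assms by force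
 have "(1 + c) powr p <= (1 + c) powr 2" if "p <= 2" using assms that by (intro powr_mono) auto
 moreover have "(1 + c) powr 2 = (1 + c)^2" using assms by (simp add: powr_numeral)
 ultimately show "p <= 2 ==> c powr p <= (1 + c)^2" using * by force
qed

lemma soft_mono: "0 <= g ==> g <= g' ==> soft g <= soft g'"
 unfolding soft_def by (intro mult_mono add_left_mono) (auto simp: ln_le_cancel_iff)

context
 fixes a e q C B1 B2 :: real and K :: nat
 assumes a: "1/2 < a" and e: "0 < e" and q: "0 <= q" and C: "10^8 * (1 + q^2) <= C" and B: "0 <= B1" "0 <= B2" and K: "1 <= K"
begin

text \<open>The numbers are those of the two inexactness terms of the rate, each to be at most e/6:
  10704 = 6 * 2 * 892 with 892 from \<open>coupling_poly\<close>, and 28 = 6 * 4 * (1 + 1/6) with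
  1/6 from the stepsize. The 104 satisfies 104^2 >= 10704.\<close>

lemma C_facts: "1 + 10704 * q <= C" "(1 + 28 * q)^2 <= C" "28 * q <= C" "2 * (28 * q) * (1 + 28 * q) <= C"
 "2 * (104 * (1 + q)) * (1 + 104 * (1 + q)) <= C" "0 <= C"
proof -
 have q2: "2 * q <= 1 + q^2" using zero_le_power2[of "q - 1"] by (simp add: power2_diff)
 have q0: "0 <= q^2" by simp
 have C': "100000000 + 100000000 * q^2 <= C" using C by (simp add: distrib_left)
 show "1 + 10704 * q <= C" "28 * q <= C" "0 <= C" using C' q2 q0 by - linarith+
 have e1: "(1 + 28 * q)^2 = 1 + 56 * q + 784 * q^2" "2 * (28 * q) * (1 + 28 * q) = 56 * q + 1568 * q^2"
  "2 * (104 * (1 + q)) * (1 + 104 * (1 + q)) = 21840 + 43472 * q + 21632 * q^2"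
  by (simp_all add: sq_eq algebra_simps)
 show "(1 + 28 * q)^2 <= C" "2 * (28 * q) * (1 + 28 * q) <= C" "2 * (104 * (1 + q)) * (1 + 104 * (1 + q)) <= C"
  unfolding e1 using C' q2 q0 by - linarith+
qed

lemma inexactness_small:
 fixes X :: real
 defines "X \<equiv> (\<Sum>k<K. (real k + 1) powr (- a))"
 assumes lt: "a < 1 ==> C * ((B1 / (1 - a)) powr (1 / (1 + a)) * e powr (- 1 / (1 + a))) <= real K"
   "a < 1 ==> C * ((B2 / (1 - a)) powr (1 / a) * e powr (- 1 / a)) <= real K"
  and eq: "a = 1 ==> C * soft (B1 powr (1/2) * e powr (-1/2)) <= real K" "a = 1 ==> C * soft (B2 * e powr (-1)) <= real K"
  and gt: "1 < a ==> C * ((a * B1 / (a - 1)) powr (1/2) * e powr (-1/2)) <= real K"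
   "1 < a ==> C * ((a * B2 / (a - 1)) * e powr (-1)) <= real K"
 shows "10704 * q * B1 * X <= e * (real K)^2" "28 * q * B2 * X <= e * real K"
proof -
 let ?K = "real K"
 have K0: "0 < ?K" "1 <= ?K" using K by auto
 have a0: "0 < a" using a by simp
 have X0: "0 <= X" unfolding X_def by (intro sum_nonneg) auto
 have K2: "?K powr 2 = ?K^2" "?K powr 1 = ?K" using K0 by (auto simp: powr_numeral)
 have e1: "e powr (-1) = 1 / e" using e by (simp add: powr_minus_divide)
 consider "a < 1" | "a = 1" | "1 < a" by linarith
 hence "10704 * q * B1 * X <= e * ?K^2 & 28 * q * B2 * X <= e * ?K"
 proof cases
  case 1
  have XK: "X <= ?K powr (1 - a) / (1 - a)" unfolding X_def by (rule powr_sum_bounds(1)[OF K a0 1])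
  have "(10704 * q) powr (1 / (1 + a)) <= C"
   using powr_le_add_one(1)[of "10704 * q" "1 / (1 + a)"] q a0 C_facts(1) by simp
  from powr_threshold[OF _ _ _ e this lt(1)[OF 1]]
  have h1: "10704 * q * (B1 / (1 - a)) <= e * ?K powr (1 + a)" using q B 1 a0 by simp
  \<comment> \<open>Here a > 1/2 is used: it keeps the power of 28 q at most quadratic, as
    \<open>upper_const\<close> provides.\<close>
  have "1 / a <= 2" using a by (simp add: pos_divide_le_eq)
  hence "(28 * q) powr (1 / a) <= C"
   using powr_le_add_one(2)[of "28 * q" "1 / a"] q a0 C_facts(2) by simp
  from powr_threshold[OF a0 _ _ e this lt(2)[OF 1]]
  have h2: "28 * q * (B2 / (1 - a)) <= e * ?K powr a" using q B 1 by simp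
  have "10704 * q * B1 * X <= 10704 * q * B1 * (?K powr (1 - a) / (1 - a))" using XK q B by (intro mult_left_mono) auto
  also have "... = (10704 * q * (B1 / (1 - a))) * ?K powr (1 - a)" by simp
  also have "... <= (e * ?K powr (1 + a)) * ?K powr (1 - a)" by (rule mult_right_mono[OF h1]) simp
  also have "... = e * ?K^2" by (simp add: powr_add[symmetric] K2)
  finally have g1: "10704 * q * B1 * X <= e * ?K^2" .
  have "28 * q * B2 * X <= 28 * q * B2 * (?K powr (1 - a) / (1 - a))" using XK q B by (intro mult_left_mono) auto
  also have "... = (28 * q * (B2 / (1 - a))) * ?K powr (1 - a)" by simp
  also have "... <= (e * ?K powr a) * ?K powr (1 - a)" by (rule mult_right_mono[OF h2]) simp
  also have "... = e * ?K" using K0 by (simp add: powr_add[symmetric])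
  finally show ?thesis using g1 by simp
 next
  case 2
  have XK: "X <= 1 + ln ?K" unfolding X_def by (rule powr_sum_bounds(3)[OF K a0 2])
  have lnK: "0 <= ln ?K" using K0 by simp
  \<comment> \<open>The target is quadratic in K, so the threshold is of the order of the square
    root of B1 / e. Squaring it produces (1 + ln K)^2, which dominates the single logarithm in
    \<open>X\<close>.\<close>
  let ?g = "B1 powr (1/2) * e powr (-1/2)"
  have g2: "?g^2 = B1 / e"
   using B e by (simp add: power_divide powr_half_sqrt powr_minus_divide)
  have "104 * (1 + q) * ?g * (1 + ln ?K) <= ?K"
   by (rule soft_threshold[OF _ _ K0(2) C_facts(5) eq(1)[OF 2]]) (use q in auto)
  hence "(104 * (1 + q) * ?g * (1 + ln ?K))^2 <= ?K^2" using q lnK by (intro power_mono) auto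
  moreover have pm: "(x * y * z)^2 = x^2 * y^2 * z^2" for x y z :: real by (simp add: power_mult_distrib)
  ultimately have h: "(104 * (1 + q))^2 * (B1 / e) * (1 + ln ?K)^2 <= ?K^2" unfolding pm g2 by simp
  have "10704 * q * (B1 / e) * X <= (104 * (1 + q))^2 * (B1 / e) * (1 + ln ?K)^2"
  proof (intro mult_mono mult_right_mono)
   have "0 <= q^2" by simp
   thus "10704 * q <= (104 * (1 + q))^2" using q by (simp add: sq_eq algebra_simps)
   have "1 + ln ?K <= (1 + ln ?K)^2" using lnK by (simp add: sq_eq algebra_simps)
   thus "X <= (1 + ln ?K)^2" using XK by simp
  qed (use B e X0 in auto)
  hence g1: "10704 * q * B1 * X <= e * ?K^2" using h e by (simp add: field_simps)
  have "28 * q * (B2 * e powr (-1)) * (1 + ln ?K) <= ?K"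
   by (rule soft_threshold[OF _ _ K0(2) C_facts(4) eq(2)[OF 2]]) (use q B in auto)
  hence "28 * q * B2 * (1 + ln ?K) <= e * ?K" unfolding e1 using e by (simp add: field_simps)
  moreover have "28 * q * B2 * X <= 28 * q * B2 * (1 + ln ?K)" using XK q B by (intro mult_left_mono) auto
  ultimately show ?thesis using g1 by simp
 next
  case 3
  have XK: "X <= a / (a - 1)" unfolding X_def by (rule powr_sum_bounds(2)[OF K a0 3])
  have "(10704 * q) powr (1 / 2) <= C"
   using powr_le_add_one(1)[of "10704 * q" "1 / 2"] q C_facts(1) by simp
  from powr_threshold[OF _ _ _ e this gt(1)[OF 3]]
  have h1: "10704 * q * (a * B1 / (a - 1)) <= e * ?K^2" using q B 3 K2 by simp
  define b where "b = a * B2 / (a - 1)"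
  have b: "0 <= b" using B 3 by (simp add: b_def)
  have "28 * q * b / e <= C * b / e" using C_facts(3) b e by (intro divide_right_mono mult_right_mono) auto
  also have "... <= ?K" using gt(2)[OF 3] unfolding e1 by (simp add: b_def)
  finally have h2: "28 * q * (a * B2 / (a - 1)) <= e * ?K" using e unfolding b_def[symmetric] by (simp add: pos_divide_le_eq mult.commute)
  have "10704 * q * B1 * X <= 10704 * q * B1 * (a / (a - 1))" "28 * q * B2 * X <= 28 * q * B2 * (a / (a - 1))"
   using XK q B by (intro mult_left_mono; simp)+
  thus ?thesis using h1 h2 by (simp add: mult_ac)
 qed
 thus "10704 * q * B1 * X <= e * ?K^2" "28 * q * B2 * X <= e * ?K" by auto
qed

end

section \<open>The rate with the prescribed stepsize, compared with the target accuracy\<close>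

context
 fixes n m \<eta> l w L Lt V gap \<kappa> q a e \<epsilon>0 :: real
 assumes n: "1 <= n" and m: "1 <= m" and eta: "0 < \<eta>" and l: "0 <= l" "l < 1" and w: "1 <= w" and L: "0 < L"
  and Lt: "0 <= Lt" and V: "0 <= V" and gap: "0 <= gap" and kap: "1 <= \<kappa>" and q: "0 <= q" and a: "1/2 < a"
  and e: "0 < e" and eps0: "0 <= \<epsilon>0"
begin

lemma gap_l: "0 < 1 - l^2" "1 - l^2 <= 1"
 using l by (simp_all add: power_less_one_iff abs_square_less_1)

lemma upper_terms_split:
 defines "u1 \<equiv> n powr (3/2) * L^3 / \<eta> powr (4/3) * e powr (-2)"
  and "u2 \<equiv> L^3 * n powr (3/2) / (\<eta> powr (2/3) * m^2) * e powr (-2)"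
  and "u3 \<equiv> L^2 * n * V / (\<eta>^2 * (1 - l^2)) * e powr (-1)"
  and "u6 \<equiv> l^2 * L * n powr (1/2) * (l^2 + w^2) / (\<eta> powr (2/3) * (1 - l^2)^3) * e powr (-1)"
 shows "u1 <= upper_terms n m \<eta> l w L Lt V \<epsilon>0 e" "u2 <= upper_terms n m \<eta> l w L Lt V \<epsilon>0 e"
  "u3 <= upper_terms n m \<eta> l w L Lt V \<epsilon>0 e" "u6 <= upper_terms n m \<eta> l w L Lt V \<epsilon>0 e"
  "0 <= u1" "0 <= u2" "0 <= u3" "0 <= u6" "0 <= upper_terms n m \<eta> l w L Lt V \<epsilon>0 e"
proof -
 define u4 where "u4 = l^2 * L powr (1/2) * n powr (1/4) / (\<eta> powr (1/3) * (1 - l^2) powr (3/2)) * e powr (-1/2)"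
 define u5 where "u5 = l^2 * Lt * n powr (3/4) * sqrt \<epsilon>0 / (L powr (1/2) * \<eta> powr (4/3) * (1 - l^2) powr (3/2)) * e powr (-1/2)"
 define u7 where "u7 = l^2 * (3 + l^2) powr (1/2) / (\<eta> powr (2/3) * sqrt m * (1 - l^2)) * e powr (-1/2)"
 have s: "upper_terms n m \<eta> l w L Lt V \<epsilon>0 e = u1 + u2 + u3 + u4 + u5 + u6 + u7"
  unfolding upper_terms_def u1_def u2_def u3_def u4_def u5_def u6_def u7_def ..
 show nn: "0 <= u1" "0 <= u2" "0 <= u3" "0 <= u6"
  unfolding u1_def u2_def u3_def u6_def using n m L V gap_l l by auto
 have "0 <= u4" "0 <= u5" "0 <= u7"
  unfolding u4_def u5_def u7_def using n m L V gap_l l Lt eps0 by auto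
 with nn show "u1 <= upper_terms n m \<eta> l w L Lt V \<epsilon>0 e" "u2 <= upper_terms n m \<eta> l w L Lt V \<epsilon>0 e"
  "u3 <= upper_terms n m \<eta> l w L Lt V \<epsilon>0 e" "u6 <= upper_terms n m \<eta> l w L Lt V \<epsilon>0 e" "0 <= upper_terms n m \<eta> l w L Lt V \<epsilon>0 e"
  unfolding s by linarith+
qed

text \<open>Up to the factors 1 / (1 - a) or a / (a - 1), the bases of two summands of
  \<open>lower_terms\<close>: solver error that passes through the network, and solver error that
  enters directly.\<close>

definition "coupling = \<kappa> * l^2 * n / (L * \<eta>^2 * (1 - l^2)^3) * (w^2 * Lt^2 + l^4 * Lt^2 / (1 - l^2))"
definition "inexactness = \<kappa> * Lt^2 * n powr (3/2) / \<eta> powr (4/3)"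

lemma coupling_nonneg: "0 <= coupling" and inexactness_nonneg: "0 <= inexactness"
 unfolding coupling_def inexactness_def using kap n L gap_l by auto

lemma lower_terms_split:
 defines "T \<equiv> lower_terms a n \<eta> l w L Lt \<kappa> e"
 shows "0 <= T"
  and "a < 1 ==> (coupling / (1 - a)) powr (1 / (1 + a)) * e powr (- 1 / (1 + a)) <= T"
  and "a < 1 ==> (inexactness / (1 - a)) powr (1 / a) * e powr (- 1 / a) <= T"
  and "a = 1 ==> soft (coupling powr (1/2) * e powr (-1/2)) <= T"
  and "a = 1 ==> soft (inexactness * e powr (-1)) <= T"
  and "1 < a ==> (a * coupling / (a - 1)) powr (1/2) * e powr (-1/2) <= T"
  and "1 < a ==> (a * inexactness / (a - 1)) * e powr (-1) <= T"
proof -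
 note nn = coupling_nonneg inexactness_nonneg
 have 1: "\<kappa> * l^2 * n / (L * \<eta>^2 * (1 - l^2)^3 * (1 - a)) * (w^2 * Lt^2 + l^4 * Lt^2 / (1 - l^2)) = coupling / (1 - a)"
  "\<kappa> * Lt^2 * n powr (3/2) / (\<eta> powr (4/3) * (1 - a)) = inexactness / (1 - a)"
  "a * \<kappa> * l^2 * n / (L * \<eta>^2 * (1 - l^2)^3 * (a - 1)) * (w^2 * Lt^2 + l^4 * Lt^2 / (1 - l^2)) = a * coupling / (a - 1)"
  "a * \<kappa> * Lt^2 * n powr (3/2) / (\<eta> powr (4/3) * (a - 1)) = a * inexactness / (a - 1)"
  by (simp_all add: coupling_def inexactness_def)
 note r = 1[folded coupling_def] coupling_def[symmetric] inexactness_def[symmetric]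
 have lt: "(coupling / (1 - a)) powr (1 / (1 + a)) * e powr (- 1 / (1 + a)) <= T & (inexactness / (1 - a)) powr (1 / a) * e powr (- 1 / a) <= T" if "a < 1"
  unfolding T_def lower_terms_def using that by (simp only: if_True r) (simp add: add_increasing add_increasing2)
 have gt: "(a * coupling / (a - 1)) powr (1/2) * e powr (-1/2) <= T & (a * inexactness / (a - 1)) * e powr (-1) <= T" if "1 < a"
 proof -
  have f: "(a < 1) = False" "(a = 1) = False" using that by auto
  have i: "0 <= (a * inexactness / (a - 1)) * e powr (-1)" using nn that by simp
  show ?thesis unfolding T_def lower_terms_def f if_False r using i by (simp add: add_increasing add_increasing2)
 qed
 have eq: "soft (coupling powr (1/2) * e powr (-1/2)) <= T & soft (inexactness * e powr (-1)) <= T" if "a = 1"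
 proof -
  have f: "(a < 1) = False" "(a = 1) = True" using that by auto
  have i: "0 <= inexactness * e powr (-1)" using nn by simp
  show ?thesis unfolding T_def lower_terms_def f if_False if_True r
   by (intro conjI soft_mono) (use i in \<open>simp_all add: add_increasing add_increasing2\<close>)
 qed
 show "a < 1 ==> (coupling / (1 - a)) powr (1 / (1 + a)) * e powr (- 1 / (1 + a)) <= T"
  "a < 1 ==> (inexactness / (1 - a)) powr (1 / a) * e powr (- 1 / a) <= T"
  "a = 1 ==> soft (coupling powr (1/2) * e powr (-1/2)) <= T" "a = 1 ==> soft (inexactness * e powr (-1)) <= T"
  "1 < a ==> (a * coupling / (a - 1)) powr (1/2) * e powr (-1/2) <= T" "1 < a ==> (a * inexactness / (a - 1)) * e powr (-1) <= T"
  using lt eq gt by blast+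
 have "0 <= soft g" if "0 <= g" for g using that by (simp add: soft_def)
 from this[of "inexactness * e powr (-1)"] have s: "0 <= soft (inexactness * e powr (-1))" using nn by simp
 consider "a < 1" | "a = 1" | "1 < a" by linarith
 thus "0 <= T"
 proof cases
  case 1
  have "0 <= (inexactness / (1 - a)) powr (1 / a) * e powr (- 1 / a)" by simp
  thus ?thesis using lt[OF 1] by linarith
 next
  case 2 thus ?thesis using eq s by linarith
 next
  case 3
  have "0 <= (a * coupling / (a - 1)) powr (1/2) * e powr (-1/2)" by simp
  thus ?thesis using gt[OF 3] by linarith
 qed
qed

text \<open>All fractional powers become integral ones in the third root of \<open>\<eta>\<close>, the fourth root of \<open>n\<close>
 and the square roots of \<open>L\<close> and of the horizon.\<close>

lemma roots:
 assumes K: "1 <= (K :: nat)"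
 obtains E N B J where "0 < E" "0 < N" "0 < B" "0 < J" "\<eta> = E^3" "n = N^4" "L = B^2" "real K = J^2"
  "\<eta> powr (2/3) = E^2" "\<eta> powr (4/3) = E^4" "n powr (3/2) = N^6" "n powr (1/2) = N^2" "sqrt n = N^2"
  "horizon_stepsize n \<eta> L K = E^2 / (N^3 * J * B^3)"
proof -
 define E N B J where "E = \<eta> powr (1/3)" and "N = n powr (1/4)" and "B = sqrt L" and "J = sqrt (real K)"
 have pos: "0 < E" "0 < N" "0 < B" "0 < J" using eta n L K by (auto simp: E_def N_def B_def J_def)
 have eq: "\<eta> = E^3" "n = N^4" "L = B^2" "real K = J^2"
  using eta n L by (simp_all add: E_def N_def B_def J_def powr_power)
 have pw: "\<eta> powr (2/3) = E^2" "\<eta> powr (4/3) = E^4" "n powr (3/2) = N^6" "n powr (1/2) = N^2"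
  using pos by (simp_all add: eq(1,2) power_powr powr_numeral)
 have sq: "sqrt n = N^2" by (rule real_sqrt_unique) (use pos in \<open>simp_all add: eq(2) flip: power_mult\<close>)
 have "L powr (3/2) = B^3" using pos by (simp add: eq(3) power_powr powr_numeral)
 moreover have "sqrt (N^6 * J^2) = N^3 * J"
  by (rule real_sqrt_unique) (use pos in \<open>simp_all add: power_mult_distrib flip: power_mult\<close>)
 ultimately have "horizon_stepsize n \<eta> L K = E^2 / (N^3 * J * B^3)"
  unfolding horizon_stepsize_def pw eq(4) by simp
 thus ?thesis using that[OF pos eq pw sq] by simp
qed

text \<open>With this stepsize the product \<gamma> * \<beta> is the reciprocal of the square root
  of \<eta> powr (2/3) * L * n powr (1/2) * K, so the threshold says precisely that this product
  times the maximum is at most 1.\<close>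

lemma horizon_step:
 assumes K: "1 <= (K :: nat)" and thr: "horizon_threshold n \<eta> l L <= real K"
 defines "s \<equiv> horizon_stepsize n \<eta> L K * (L * sqrt n / \<eta>)"
 shows "0 < horizon_stepsize n \<eta> L K" "9 * l * s <= 1 - l^2" "20 * l^2 * s <= (1 - l^2)^2" "s <= 1 / 6"
proof -
 obtain E N B J where pos: "0 < E" "0 < N" "0 < B" "0 < J" and eq: "\<eta> = E^3" "n = N^4" "L = B^2" "real K = J^2"
  and pw: "\<eta> powr (2/3) = E^2" "n powr (1/2) = N^2" "sqrt n = N^2"
  and st: "horizon_stepsize n \<eta> L K = E^2 / (N^3 * J * B^3)" using roots[OF K] by metis
 show "0 < horizon_stepsize n \<eta> L K" unfolding st using pos by simp
 have s: "s = 1 / (E * N * B * J)"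
  unfolding s_def st pw(3) unfolding eq using pos by (simp add: field_simps sq_eq power3_eq_cube)
 define Mx where "Mx = Max {10 * sqrt 3 * l^2 / sqrt (1 - l^2), 20 * l^3 / (1 - l^2), 20 * l^2 / (1 - l^2)^2, 6, 9 * l / (1 - l^2)}"
 have Mx: "6 <= Mx" "9 * l / (1 - l^2) <= Mx" "20 * l^2 / (1 - l^2)^2 <= Mx" unfolding Mx_def by (auto intro: Max_ge)
 have "Mx^2 * (1 / (E^2 * B^2 * N^2)) <= J^2"
  using thr unfolding horizon_threshold_def pw eq(4) Mx_def[symmetric] unfolding eq(3) by simp
 hence "Mx^2 <= (E * N * B * J)^2" using pos by (simp add: field_simps)
 hence "Mx <= E * N * B * J" by (rule power2_le_imp_le) (use pos in simp)
 hence sM: "s * Mx <= 1" using pos by (simp add: s pos_divide_le_eq)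
 have s0: "0 <= s" using pos by (simp add: s)
 have "s * c <= 1" if "c <= Mx" for c using mult_left_mono[OF that s0] sM by linarith
 from this[OF Mx(1)] this[OF Mx(2)] this[OF Mx(3)]
 show "9 * l * s <= 1 - l^2" "20 * l^2 * s <= (1 - l^2)^2" "s <= 1 / 6"
  using gap_l by (simp_all add: pos_divide_le_eq mult_ac)
qed

text \<open>For terms that decay like the inverse square root of the horizon: \<open>J\<close> is
  that square root, while the hypotheses bound its square.\<close>

lemma square_term: "c * X <= J" if "0 <= J" "c^2 <= C" "C * X^2 <= J^2" for c X J C :: real
proof (rule power2_le_imp_le)
 have "(c * X)^2 <= C * X^2" using that(2) by (simp add: power_mult_distrib mult_right_mono)
 thus "(c * X)^2 <= J^2" using that(3) by linarith
qed (rule that(1))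

text \<open>Over the common denominator (1 - l^2)^4, and after using w >= 1, the difference reduces
  to 890 t^2 - 1555 t + 890 in t = l^2, which has negative discriminant.\<close>

lemma coupling_poly: "l^2 / (1 - l^2)^2 * (667 * l^2 / (1 - l^2)^2 + 2) <= 892 * (l^2 / (1 - l^2)^3 * (w^2 + l^4 / (1 - l^2)))"
proof -
 define t u where "t = l^2" and "u = 1 - l^2"
 have u: "0 < u" using gap_l by (simp add: u_def)
 have t: "0 <= t" by (simp add: t_def)
 have l4: "l^4 = t^2" by (simp add: t_def)
 have w2: "1 <= w^2" using w by (simp add: one_le_power)
 have "0 <= 890 * (t - 1555 / 1780)^2 + (890 - 1555^2 / 3560)" by (intro add_nonneg_nonneg) (simp_all add: sq_eq)
 also have "... = 892 * (1 - t + t^2) - (667 * t + 2 * (1 - t)^2)" by (simp add: sq_eq field_simps)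
 finally have "667 * t + 2 * u^2 <= 892 * (u * 1 + t^2)" by (simp add: u_def t_def)
 also have "... <= 892 * (u * w^2 + t^2)" using u w2 by (intro mult_left_mono add_right_mono) auto
 finally have "t * (667 * t + 2 * u^2) / u^4 <= t * (892 * (u * w^2 + t^2)) / u^4"
  using t u by (intro divide_right_mono mult_left_mono) auto
 moreover have "t / u^2 * (667 * t / u^2 + 2) = t * (667 * t + 2 * u^2) / u^4"
  using u by (simp add: field_simps sq_eq power4_eq_xxxx)
 moreover have "892 * (t / u^3 * (w^2 + t^2 / u)) = t * (892 * (u * w^2 + t^2)) / u^4"
  using u by (simp add: field_simps sq_eq power3_eq_cube power4_eq_xxxx)
 ultimately show ?thesis unfolding l4 unfolding u_def[symmetric] unfolding t_def[symmetric] by simp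
qed

text \<open>The rate has six summands once \<open>consensus_rate\<close> is expanded. Each is at
  most e/6 because one summand of the horizon bound, multiplied by \<open>upper_const\<close>, lies
  below K.\<close>

theorem rate_le_target:
 assumes K: "1 <= K"
  and Kb: "upper_const gap q * (upper_terms n m \<eta> l w L Lt V \<epsilon>0 e + lower_terms a n \<eta> l w L Lt \<kappa> e) <= real K"
  and thr: "horizon_threshold n \<eta> l L <= real K"
  and T: "0 <= T" "T <= n powr (3/2) * Lt^2 * q / \<eta> powr (4/3) * (\<Sum>k<K. (real k + 1) powr (- a))"
 shows "stationarity_rate m (horizon_stepsize n \<eta> L K) (L * sqrt n / \<eta>) l (pi^2 * n * L^2) gap V T (real K) <= e"
proof -
 define C where "C = upper_const gap q"
 define X where "X = (\<Sum>k<K. (real k + 1) powr (- a))"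
 define U where "U = upper_terms n m \<eta> l w L Lt V \<epsilon>0 e"
 define Lo where "Lo = lower_terms a n \<eta> l w L Lt \<kappa> e"
 let ?u = "1 - l^2"
 obtain E N B J where pos: "0 < E" "0 < N" "0 < B" "0 < J" and eq: "\<eta> = E^3" "n = N^4" "L = B^2" "real K = J^2"
  and pw: "\<eta> powr (2/3) = E^2" "\<eta> powr (4/3) = E^4" "n powr (3/2) = N^6" "n powr (1/2) = N^2" "sqrt n = N^2"
  and st: "horizon_stepsize n \<eta> L K = E^2 / (N^3 * J * B^3)" using roots[OF K] by metis
 define \<gamma> \<beta> where "\<gamma> = horizon_stepsize n \<eta> L K" and "\<beta> = L * sqrt n / \<eta>"
 have K0: "0 < real K" using K by simp
 have C1: "10^8 * (1 + gap^2 + q^2) <= C"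
 proof -
  have "1 + gap^2 + q^2 <= (1 + gap^2 + q^2)^2" using power_increasing[of 1 2 "1 + gap^2 + q^2"] by simp
  thus ?thesis unfolding C_def upper_const_def by (intro mult_left_mono) auto
 qed
 hence C8: "100000000 + 100000000 * gap^2 + 100000000 * q^2 <= C" by (simp add: distrib_left)
 have sq0: "0 <= gap^2" "0 <= q^2" by auto
 have "100000000 + 100000000 * q^2 <= C" using C8 sq0 by linarith
 hence Cq: "10^8 * (1 + q^2) <= C" by (simp add: distrib_left)
 have C0: "0 <= C" using C8 sq0 by linarith
 have bound: "C * v <= real K" if "v <= U \<or> v <= Lo" for v
 proof -
  have "v <= U + Lo" using that upper_terms_split(9) lower_terms_split(1) unfolding U_def Lo_def by auto
  hence "C * v <= C * (U + Lo)" using C0 by (rule mult_left_mono)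
  also have "... <= real K" using Kb by (simp add: C_def U_def Lo_def)
  finally show ?thesis .
 qed
 have ep: "e powr (-2) = 1 / e^2" "e powr (-1) = 1 / e" using e by (simp_all add: powr_minus_divide powr_numeral)
 have \<gamma>: "\<gamma> = E^2 / (N^3 * J * B^3)" and \<beta>: "\<beta> = B^2 * N^2 / E^3"
  unfolding \<gamma>_def st \<beta>_def pw(5) unfolding eq(1,3) by (rule refl)+
 have s: "\<gamma> * \<beta> = 1 / (E * N * B * J)"
  unfolding \<gamma> \<beta> using pos by (simp add: field_simps sq_eq power3_eq_cube)
 have pi2: "pi^2 <= 16"
 proof -
  have "pi * pi <= 4 * 4" using pi_less_4 pi_gt3 by (intro mult_mono) auto
  thus ?thesis by (simp add: sq_eq)
 qed
 have u: "0 < ?u" using gap_l by simp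
 \<comment> \<open>From the first summand of \<open>upper_terms\<close>, which is the square of
   \<open>Y\<close>; 24 = 6 * 4.\<close>
 have r1: "4 * gap / (\<gamma> * real K) <= e / 6"
 proof -
  define Y where "Y = N^3 * B^3 / (E^2 * e)"
  have "C * Y^2 <= J^2"
   using bound[OF disjI1, OF upper_terms_split(1)[folded U_def]] unfolding ep pw eq(3,4) Y_def
   by (simp add: power_divide power_mult_distrib flip: power_mult)
  moreover have "(24 * gap)^2 <= C"
  proof -
   have "(24 * gap)^2 = 576 * gap^2" by (simp add: power_mult_distrib)
   thus ?thesis using C8 sq0 by linarith
  qed
  ultimately have "24 * gap * Y <= J" using pos by (intro square_term[of J _ C]) auto
  hence "24 * gap * (N^3 * B^3) <= J * (E^2 * e)" unfolding Y_def using pos e by (simp add: pos_divide_le_eq)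
  moreover have "4 * gap / (\<gamma> * real K) = 4 * gap * (N^3 * B^3) / (E^2 * J)"
   unfolding \<gamma> eq(4) using pos by (simp add: field_simps sq_eq)
  ultimately show ?thesis using pos by (simp add: pos_divide_le_eq mult_ac)
 qed
 \<comment> \<open>From the second summand of \<open>upper_terms\<close>; 384 = 6 * 4 * 16, where 16
   bounds pi^2.\<close>
 have r2: "4 * (\<gamma> * \<beta>) * (pi^2 * n * L^2) / m <= e / 6"
 proof -
  define Y where "Y = N^3 * B^3 / (E * m * e)"
  have "C * Y^2 <= J^2"
   using bound[OF disjI1, OF upper_terms_split(2)[folded U_def]] unfolding ep pw eq(3,4) Y_def
   by (simp add: power_divide power_mult_distrib mult_ac flip: power_mult)
  moreover have "384^2 <= C"
  proof -
   have "384^2 = (147456 :: real)" by simp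
   thus ?thesis using C8 sq0 by linarith
  qed
  ultimately have "384 * Y <= J" using pos by (intro square_term[of J _ C]) auto
  hence h: "384 * (N^3 * B^3) <= J * (E * m * e)" unfolding Y_def using pos e m by (simp add: pos_divide_le_eq)
  have "4 * (\<gamma> * \<beta>) * (pi^2 * n * L^2) / m = pi^2 * (4 * (N^3 * B^3) / (E * J * m))"
   unfolding s eq(2,3) using pos m by (simp add: field_simps sq_eq power3_eq_cube power4_eq_xxxx)
  also have "... <= 16 * (4 * (N^3 * B^3) / (E * J * m))" using pi2 pos m by (intro mult_right_mono) auto
  also have "... <= e / 6" using h pos m by (simp add: pos_divide_le_eq mult_ac)
  finally show ?thesis .
 qed
 have b2: "\<beta>^2 = L^2 * n / \<eta>^2" using n by (simp add: \<beta>_def power_mult_distrib power_divide)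
 have r3: "2 * \<beta>^2 * (4 * V / (?u * real K)) <= e / 6"
 proof -
  define Y where "Y = L^2 * n * V / (\<eta>^2 * ?u)"
  have Y0: "0 <= Y / e" unfolding Y_def using n V u e by simp
  have "48 * (Y / e) <= C * (Y / e)" using C8 sq0 Y0 by (intro mult_right_mono) linarith
  also have "... <= real K" using bound[OF disjI1, OF upper_terms_split(3)[folded U_def]] unfolding ep Y_def by simp
  finally have "48 * Y <= e * real K" using e by (simp add: pos_divide_le_eq mult.commute)
  moreover have "2 * \<beta>^2 * (4 * V / (?u * real K)) = 8 * Y / real K" unfolding b2 Y_def by simp
  ultimately show ?thesis using K0 by (simp add: pos_divide_le_eq mult_ac)
 qed
 \<comment> \<open>The noise in the consensus error; 32640 = 6 * 16 * 2 * 170.\<close>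
 have r4: "2 * \<beta>^2 * (\<gamma>^2 * l^2 / ?u^3 * (170 * l^2 + 2) * (pi^2 * n * L^2)) <= e / 6"
 proof -
  define Y where "Y = l^2 * B^2 * N^2 / (E^2 * ?u^3)"
  have Y0: "0 <= Y" unfolding Y_def using u by simp
  have lw: "170 * l^2 + 2 <= 170 * (l^2 + w^2)" using one_le_power[OF w, of 2] by simp
  have Z0: "0 <= Y * (l^2 + w^2) / e" using Y0 e by simp
  have "32640 * (Y * (l^2 + w^2) / e) <= C * (Y * (l^2 + w^2) / e)" using C8 sq0 Z0 by (intro mult_right_mono) linarith
  also have "... <= real K"
   using bound[OF disjI1, OF upper_terms_split(4)[folded U_def]] unfolding ep pw Y_def unfolding eq(3) by (simp add: mult_ac)
  finally have h: "32640 * (Y * (l^2 + w^2)) <= e * real K" using e by (simp add: pos_divide_le_eq mult.commute)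
  have "2 * \<beta>^2 * (\<gamma>^2 * l^2 / ?u^3 * (170 * l^2 + 2) * (pi^2 * n * L^2))
   = (\<gamma> * \<beta>)^2 * (2 * (l^2 / ?u^3) * (170 * l^2 + 2) * (pi^2 * n * L^2))" by (simp add: power_mult_distrib)
  also have "... = pi^2 * (2 * Y * (170 * l^2 + 2) / real K)"
   unfolding s eq(2,3,4) Y_def using pos u by (simp add: field_simps sq_eq power4_eq_xxxx)
  also have "... <= 16 * (2 * Y * (170 * (l^2 + w^2)) / real K)"
   using pi2 lw Y0 by (intro mult_mono divide_right_mono mult_left_mono) auto
  also have "... <= e / 6" using h K0 by (simp add: pos_divide_le_eq mult_ac)
  finally show ?thesis .
 qed
 note small = inexactness_small[OF a e q Cq coupling_nonneg inexactness_nonneg K, folded X_def]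
 have low: "10704 * q * coupling * X <= e * (real K)^2" "28 * q * inexactness * X <= e * real K"
  by (rule small; rule bound[OF disjI2], unfold Lo_def, rule lower_terms_split; assumption)+
 have X0: "0 <= X" unfolding X_def by (intro sum_nonneg) auto
 \<comment> \<open>The solver error that passes through the network; \<open>coupling\<close> carries
   the condition number as an extra factor of at least 1.\<close>
 have r5: "2 * \<beta>^2 * (\<gamma>^2 * l^2 / ?u^2 * (667 * l^2 / ?u^2 + 2) * (T / real K)) <= e / 6"
 proof -
  define p where "p = l^2 / ?u^2 * (667 * l^2 / ?u^2 + 2)"
  define r where "r = l^2 / ?u^3 * (w^2 + l^4 / ?u)"
  have p0: "0 <= p" and r0: "0 <= r" using u by (auto simp: p_def r_def)
  have pr: "p <= 892 * r" unfolding p_def r_def by (rule coupling_poly)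
  have cp: "N^4 * Lt^2 / (E^6 * B^2) * r <= coupling"
  proof -
   have "coupling = \<kappa> * (N^4 * Lt^2 / (E^6 * B^2) * r)"
    unfolding coupling_def unfolding r_def eq using u pos by (simp add: field_simps flip: power_mult)
   moreover have "0 <= N^4 * Lt^2 / (E^6 * B^2) * r" using r0 by simp
   ultimately show ?thesis using kap mult_right_mono[of 1 \<kappa> "N^4 * Lt^2 / (E^6 * B^2) * r"] by simp
  qed
  have "2 * \<beta>^2 * (\<gamma>^2 * l^2 / ?u^2 * (667 * l^2 / ?u^2 + 2) * (T / real K)) = 2 * (\<gamma> * \<beta>)^2 * p * (T / real K)"
   by (simp add: p_def power_mult_distrib)
  also have "... <= 2 * (\<gamma> * \<beta>)^2 * (892 * r) * ((N^6 * Lt^2 * q / E^4 * X) / real K)"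
   using T(2) T(1) p0 r0 pr unfolding pw X_def[symmetric]
   by (intro mult_mono mult_left_mono divide_right_mono) auto
  also have "... = 1784 * q * (N^4 * Lt^2 / (E^6 * B^2) * r) * X / (real K)^2"
   unfolding s eq(4) using pos by (simp add: field_simps flip: power_add power_mult) (simp add: sq_eq power4_eq_xxxx power_numeral_reduce)
  also have "... <= 1784 * q * coupling * X / (real K)^2"
   using cp q X0 by (intro divide_right_mono mult_right_mono mult_left_mono) auto
  also have "... <= e / 6" using low(1) K0 by (simp add: pos_divide_le_eq mult_ac)
  finally show ?thesis .
 qed
 have r6: "4 * (1 + \<gamma> * \<beta>) * (T / real K) <= e / 6"
 proof -
  have "N^6 * Lt^2 / E^4 <= inexactness"
   unfolding inexactness_def pw using kap mult_right_mono[of 1 \<kappa> "N^6 * Lt^2 / E^4"] by (simp add: mult_ac)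
  hence TI: "T <= q * inexactness * X"
   using T(2) q X0 mult_right_mono[of "N^6 * Lt^2 / E^4" inexactness "q * X"] unfolding pw X_def[symmetric] by (simp add: mult_ac)
  have "4 * (1 + \<gamma> * \<beta>) * (T / real K) <= 4 * (1 + 1 / 6) * (T / real K)"
   using horizon_step(4)[OF K thr] T(1) by (intro mult_right_mono mult_left_mono) (auto simp: \<gamma>_def \<beta>_def)
  also have "... <= 4 * (1 + 1 / 6) * ((q * inexactness * X) / real K)"
   using TI by (intro mult_left_mono divide_right_mono) auto
  also have "... <= e / 6" using low(2) K0 by (simp add: pos_divide_le_eq mult_ac)
  finally show ?thesis .
 qed
 have "stationarity_rate m \<gamma> \<beta> l (pi^2 * n * L^2) gap V T (real K) =
   4 * gap / (\<gamma> * real K) + (2 * \<beta>^2 * (4 * V / (?u * real K))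
   + 2 * \<beta>^2 * (\<gamma>^2 * l^2 / ?u^3 * (170 * l^2 + 2) * (pi^2 * n * L^2))
   + 2 * \<beta>^2 * (\<gamma>^2 * l^2 / ?u^2 * (667 * l^2 / ?u^2 + 2) * (T / real K)))
   + 4 * (1 + \<gamma> * \<beta>) * (T / real K) + 4 * (\<gamma> * \<beta>) * (pi^2 * n * L^2) / m"
  unfolding stationarity_rate_def consensus_rate_def by (simp only: distrib_left)
 thus ?thesis using r1 r2 r3 r4 r5 r6 unfolding \<gamma>_def \<beta>_def by linarith
qed

text \<open>At least n powr (1/2) (k + 1)^a / \<eta> powr (2/3) inner steps are made, since Gh > 1.
  Dividing n^2 / \<eta>^2 by n powr (1/2) / \<eta> powr (2/3) gives the powers of n and \<eta> on
  the right.\<close>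

lemma solver_budget:
 assumes K: "1 <= K" and Gh: "1 < Gh"
 shows "(\<Sum>k<K. n^2 * Lt^2 * (q / (real (inner_iterations n \<eta> Gh a k) + Gh)) / \<eta>^2)
  <= n powr (3/2) * Lt^2 * q / \<eta> powr (4/3) * (\<Sum>k<K. (real k + 1) powr (- a))"
 unfolding sum_distrib_left
proof (rule sum_mono)
 fix k
 obtain E N B J where pos: "0 < E" "0 < N" "0 < B" "0 < J" and eq: "\<eta> = E^3" "n = N^4" "L = B^2" "real K = J^2"
  and pw: "\<eta> powr (2/3) = E^2" "\<eta> powr (4/3) = E^4" "n powr (3/2) = N^6" "n powr (1/2) = N^2" "sqrt n = N^2" using roots[OF K] by metis
 have kp: "0 < (real k + 1) powr a" by simp
 have "(real k + 1) powr a <= (real k + Gh) powr a" using a Gh by (intro powr_mono2) auto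
 hence "N^2 * (real k + 1) powr a / E^2 <= n powr (1/2) * (real k + Gh) powr a / \<eta> powr (2/3)"
  unfolding pw by (intro divide_right_mono mult_left_mono) auto
 also have "... <= real (inner_iterations n \<eta> Gh a k)" unfolding inner_iterations_def by (rule of_nat_ceiling)
 finally have "N^2 * (real k + 1) powr a / E^2 <= real (inner_iterations n \<eta> Gh a k) + Gh" using Gh by linarith
 moreover have "0 < real (inner_iterations n \<eta> Gh a k) + Gh" using Gh by linarith
 ultimately have "n^2 * Lt^2 * (q / (real (inner_iterations n \<eta> Gh a k) + Gh)) / \<eta>^2
  <= n^2 * Lt^2 * (q / (N^2 * (real k + 1) powr a / E^2)) / \<eta>^2"
  using pos kp q n by (intro divide_right_mono mult_left_mono divide_left_mono mult_pos_pos divide_pos_pos) auto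
 also have "... = N^6 * Lt^2 * q / E^4 * (real k + 1) powr (- a)"
  unfolding eq(1,2) powr_minus_divide using pos kp by (simp add: field_simps flip: power_mult power_add)
 finally show "n^2 * Lt^2 * (q / (real (inner_iterations n \<eta> Gh a k) + Gh)) / \<eta>^2
  <= n powr (3/2) * Lt^2 * q / \<eta> powr (4/3) * (real k + 1) powr (- a)" unfolding pw by simp
qed

end

text \<open>\<open>R\<close> is any upper bound for the horizon. The hypothesis \<open>big\<close>
  makes the bound for a single call at least 1, so that the rounding up and the upper-level samples
  are absorbed into it.\<close>

lemma overall_count:
 fixes n \<eta> Gh a R :: real and M K :: nat
 assumes n: "1 <= n" and eta: "0 < \<eta>" and Gh: "1 < Gh" and a: "0 < a" and K: "1 <= K" and R: "real K <= R"
  and big: "\<eta> powr (2/3) <= n powr (1/2) * R powr a"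
 shows "real (overall_complexity M (inner_iterations n \<eta> Gh a) K) <= real M * (3 + 2 * Gh powr a) * (n powr (1/2) * R powr (1 + a) / \<eta> powr (2/3))"
proof -
 let ?Y = "n powr (1/2) * R powr a / \<eta> powr (2/3)"
 have R1: "1 <= R" using K R by simp
 have ep: "0 < \<eta> powr (2/3)" using eta by simp
 have Y1: "1 <= ?Y" using big ep by (simp add: pos_le_divide_eq)
 have t: "real (inner_iterations n \<eta> Gh a k) <= ?Y * Gh powr a + 1" if k: "k < K" for k
 proof -
  have "real k + Gh <= R * Gh"
  proof -
   have "real k + 1 <= R" using k R by simp
   moreover have "(real k + 1) * Gh <= R * Gh" using calculation Gh by (intro mult_right_mono) auto
   moreover have "real k * 1 <= real k * Gh" using Gh by (intro mult_left_mono) auto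
   ultimately show ?thesis by (simp add: distrib_right)
  qed
  hence "(real k + Gh) powr a <= (R * Gh) powr a" using Gh a by (intro powr_mono2) auto
  also have "... = R powr a * Gh powr a" using R1 Gh by (simp add: powr_mult)
  finally have "n powr (1/2) * (real k + Gh) powr a / \<eta> powr (2/3) <= ?Y * Gh powr a"
   using divide_right_mono[OF mult_left_mono[of "(real k + Gh) powr a" "R powr a * Gh powr a" "n powr (1/2)"], of "\<eta> powr (2/3)"] by (simp add: mult_ac)
  moreover have "0 <= n powr (1/2) * (real k + Gh) powr a / \<eta> powr (2/3)" by simp
  ultimately show ?thesis unfolding inner_iterations_def using of_nat_nat[of "\<lceil>n powr (1/2) * (real k + Gh) powr a / \<eta> powr (2/3)\<rceil>"] by linarith
 qed
 have "real (overall_complexity M (inner_iterations n \<eta> Gh a) K) = (\<Sum>k<K. real M * (1 + 2 * real (inner_iterations n \<eta> Gh a k)))"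
  by (simp add: overall_complexity_def algebra_simps)
 also have "... <= (\<Sum>k<K. real M * (1 + 2 * (?Y * Gh powr a + 1)))" using t by (intro sum_mono mult_left_mono add_left_mono) auto
 also have "... = real K * (real M * (3 + 2 * (?Y * Gh powr a)))" by simp
 also have "... <= R * (real M * (?Y * (3 + 2 * Gh powr a)))"
 proof (intro mult_mono mult_left_mono R)
  show "3 + 2 * (?Y * Gh powr a) <= ?Y * (3 + 2 * Gh powr a)"
  proof -
   have "3 + 2 * (Y * g) <= Y * (3 + 2 * g)" if "1 <= Y" for Y g :: real using that by (simp add: algebra_simps)
   from this[OF Y1] show ?thesis .
  qed
 qed (use R1 Y1 in auto)
 also have "... = real M * (3 + 2 * Gh powr a) * (n powr (1/2) * R powr (1 + a) / \<eta> powr (2/3))"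
  using R1 by (simp add: powr_add mult_ac)
 finally show ?thesis .
qed

section \<open>Assembly of the complexity bounds\<close>

lemma sa_constant_nonneg: "1 < \<mu> * gh ==> 0 <= sa_constant \<mu> \<nu> gh Gh D"
 unfolding sa_constant_def by (rule order_trans[OF _ max.cobounded1]) simp

lemma sa_stationarity_rate:
 fixes P :: "('n::finite, 'm::finite, 'p::finite, 'd::finite) mpec"
  and W :: "real^'m^'m" and M :: "'w measure" and x0 :: "'w => real^'n^'m" and D :: "'m => real" and \<eta> :: real
 defines "n \<equiv> real CARD('n)" and "m \<equiv> real CARD('m)"
  and "gap \<equiv> (\<integral>w. smoothed_obj P \<eta> (average (x0 w)) \<partial>M) - (INF x. smoothed_obj P \<eta> x)"
  and "V \<equiv> (\<integral>w. consensus_error (x0 w) \<partial>M)"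
 assumes nw: "network E W" and wpo: "well_posed P" and bdd: "bdd_below (range (objective P))" and lpd: "lipschitz_data P"
  and lowl: "lower_level P \<mu> LF D"
  and et: "0 < \<eta>" and "prob_space M" and fV: "integrable M (%w. consensus_error (x0 w))"
  and fgap: "integrable M (%w. smoothed_obj P \<eta> (average (x0 w)))"
  and L0: "0 < L0 P" and ghc: "1 / \<mu> < gh" and Ghc: "gh * LF^2 / \<mu> < Gh"
  and sam: "sampling P M (solver_info M J \<zeta>) \<xi> v" and lsam: "lower_sampling P \<nu> M J Q \<zeta>" and x0J: "x0 \<in> borel_measurable J"
  and K: "1 <= K" and thr: "horizon_threshold n \<eta> (lambda_W W) (L0 P) <= real K"
  and sch: "dizs_gt P W \<eta> (horizon_stepsize n \<eta> (L0 P) K) M \<xi> v za x0 x y"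
  and sol: "sa_solver P \<eta> gh Gh t M J \<xi> v \<zeta> x zl za" and H: "random_horizon M (solver_info M J \<zeta>) \<xi> v K Ks"
 shows "stationarity_error P \<eta> M x Ks <= ennreal (stationarity_rate m (horizon_stepsize n \<eta> (L0 P) K) (L0 P * sqrt n / \<eta>) (lambda_W W)
   (pi^2 * n * (L0 P)^2) gap V (\<Sum>k<K. n^2 * (Lt0 P)^2 * (sa_constant \<mu> \<nu> gh Gh D / (real (t k) + Gh)) / \<eta>^2) (real K))"
proof -
 interpret prob_space M by fact
 have l: "0 <= lambda_W W" "lambda_W W < 1" using lambda_W_nonneg lambda_W_less_one[OF nw] by auto
 have n1: "1 <= n" by (simp add: n_def Suc_leI)
 have half: "1 / 2 < (1 :: real)" by simp
 \<comment> \<open>The other parameters of the context receive trivial admissible values.\<close>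
 note st = horizon_step[of n 1 \<eta> "lambda_W W" 1 "L0 P" 0 0 0 1 0 1 1 0 K, OF n1 order.refl et l order.refl L0 order.refl order.refl
   order.refl order.refl order.refl half zero_less_one order.refl K thr]
 note st1 = st(1)
 interpret sa_run M P J \<xi> v Q \<zeta> \<nu> \<mu> LF D E W x0 \<eta> "horizon_stepsize n \<eta> (L0 P) K" gh Gh t zl za x y
  by unfold_locales (rule lowl wpo lpd sam lsam nw et st1 x0J sch sol ghc Ghc)+
 interpret zo_recursion M P "solver_info M J \<zeta>" \<xi> v E W x0 \<eta> "horizon_stepsize n \<eta> (L0 P) K" \<mu> LF D za x y
  using recursion[of UNIV] unfolding part_UNIV .
 have st': "9 * lambda_W W * (horizon_stepsize n \<eta> (L0 P) K * (L0 P * sqrt (real CARD('n)) / \<eta>)) <= 1 - (lambda_W W)^2"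
  "20 * (lambda_W W)^2 * (horizon_stepsize n \<eta> (L0 P) K * (L0 P * sqrt (real CARD('n)) / \<eta>)) <= (1 - (lambda_W W)^2)^2"
  "horizon_stepsize n \<eta> (L0 P) K * (L0 P * sqrt (real CARD('n)) / \<eta>) <= 1 / 6"
  using st(2-4) unfolding n_def .
 have eps: "0 <= sa_constant \<mu> \<nu> gh Gh D / (real (t k) + Gh)" for k
  using sa_constant_nonneg[OF Gh_facts(2), of \<nu> Gh D] Gh_facts(1) by simp
 interpret zo_rate M P "solver_info M J \<zeta>" \<xi> v E W x0 \<eta> "horizon_stepsize n \<eta> (L0 P) K" \<mu> LF D za x y
   "%k. sa_constant \<mu> \<nu> gh Gh D / (real (t k) + Gh)"
  by unfold_locales (rule solver_available eps solver_moment st'(1) st'(2) st'(3) fV fgap bdd | assumption)+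
 have r: "\<sigma> = pi^2 * n * (L0 P)^2" "\<beta> = L0 P * sqrt n / \<eta>"
  "(\<Sum>k<K. \<tau> k) = (\<Sum>k<K. n^2 * (Lt0 P)^2 * (sa_constant \<mu> \<nu> gh Gh D / (real (t k) + Gh)) / \<eta>^2)"
  by (simp_all add: \<sigma>_def \<beta>_def \<tau>_def n_def)
 show ?thesis
  using stationarity_error_le[OF K H gap_def[THEN meta_eq_to_obj_eq]] unfolding r m_def[symmetric] V_def[symmetric] .
qed

theorem complexity_bounds:
 fixes P :: "('n::finite, 'm::finite, 'p::finite, 'd::finite) mpec"
  and W :: "real^'m^'m" and M :: "'w measure" and x0 :: "'w => real^'n^'m" and D :: "'m => real" and \<eta> :: real
  and gh Gh \<nu> a \<mu> LF :: real and x :: "nat => nat => 'w => real^'n^'m" and Ks :: "nat => 'w => nat"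
 defines "n \<equiv> real CARD('n)" and "m \<equiv> real CARD('m)" and "l \<equiv> lambda_W W" and "w \<equiv> norm W"
  and "gap \<equiv> (\<integral>w. smoothed_obj P \<eta> (average (x0 w)) \<partial>M) - (INF x. smoothed_obj P \<eta> x)"
  and "V \<equiv> (\<integral>w. consensus_error (x0 w) \<partial>M)"
  and "t \<equiv> inner_iterations (real CARD('n)) \<eta> Gh a"
  and "q \<equiv> sa_constant \<mu> \<nu> gh Gh D"
  and "\<epsilon>0 \<equiv> sa_constant \<mu> \<nu> gh Gh D / (real (inner_iterations (real CARD('n)) \<eta> Gh a 0) + Gh)"
  and "thr \<equiv> horizon_threshold (real CARD('n)) \<eta> (lambda_W W) (L0 P)"
  and "err \<equiv> (%K. stationarity_error P \<eta> M (x K) (Ks K))"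
 defines "K_eps \<equiv> iterations_needed thr err"
  and "K_bound \<equiv> (%e. max thr (upper_const gap q *
       (upper_terms n m \<eta> l w (L0 P) (Lt0 P) V \<epsilon>0 e + lower_terms a n \<eta> l w (L0 P) (Lt0 P) (LF / \<mu>) e)))"
 assumes nw: "network E W" and wpo: "well_posed P" and bdd: "bdd_below (range (objective P))" and lpd: "lipschitz_data P"
  and lowl: "lower_level P \<mu> LF D"
  and et: "0 < \<eta>" and pr: "prob_space M" and fV: "integrable M (%w. consensus_error (x0 w))"
  and fgap: "integrable M (%w. smoothed_obj P \<eta> (average (x0 w)))"
  and L0: "0 < L0 P" and ghc: "1 / \<mu> < gh" and Ghc: "gh * LF^2 / \<mu> < Gh" and a: "1/2 < a"
  and sam: "sampling P M (solver_info M J \<zeta>) \<xi> v" and lsam: "lower_sampling P \<nu> M J Q \<zeta>" and x0J: "x0 \<in> borel_measurable J"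
  and runs: "\<forall>K\<ge>1. dizs_gt P W \<eta> (horizon_stepsize n \<eta> (L0 P) K) M \<xi> v (za K) x0 (x K) (y K) &
        sa_solver P \<eta> gh Gh t M J \<xi> v \<zeta> (x K) (zl K) (za K) &
        random_horizon M (solver_info M J \<zeta>) \<xi> v K (Ks K)"
 shows "\<forall>e>0. thr <= real (K_eps e) & (\<forall>K\<ge>K_eps e. err K <= ennreal e) & int (K_eps e) <= \<lceil>K_bound e\<rceil>"
  and "\<forall>e>0. \<eta> powr (2/3) <= n powr (1/2) * real (K_eps e) powr a \<longrightarrow>
     real (overall_complexity CARD('m) t (K_eps e))
      <= overall_const m Gh a * (n powr (1/2) * real (K_eps e) powr (1 + a) / \<eta> powr (2/3))"
  and "\<exists>e0>0. \<forall>e. 0 < e & e < e0 \<longrightarrow>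
     real (overall_complexity CARD('m) t (K_eps e))
      <= overall_const m Gh a * (n powr (1/2) * K_bound e powr (1 + a) / \<eta> powr (2/3))"
proof -
 interpret prob_space M by (rule pr)
 have l: "0 <= l" "l < 1" using lambda_W_nonneg lambda_W_less_one[OF nw] by (auto simp: l_def)
 have nm: "1 <= n" "1 <= m" by (simp_all add: n_def m_def Suc_leI)
 have w: "1 <= w" using frobenius_ge_one[of W] nw by (simp add: w_def network_def)
 have V0: "0 <= V" unfolding V_def by (simp add: consensus_error_def)
 have gap0: "0 <= gap" unfolding gap_def
  by (rule initial_gap_nonneg[OF lowl wpo lpd less_imp_le[OF et] bdd pr fgap])
 have mu: "0 < \<mu>" "\<mu> <= LF" using lower_facts(1)[OF lowl] mu_le_L[OF lowl] by auto
 have kap: "1 <= LF / \<mu>" using mu by simp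
 have mgh: "1 < \<mu> * gh" using ghc mu by (simp add: pos_divide_less_eq mult.commute)
 have Gh1: "1 < Gh"
 proof -
  have "0 < gh" using mgh mu zero_less_mult_pos[of \<mu> gh] by simp
  have "\<mu> * gh = gh * \<mu>^2 / \<mu>" using mu by (simp add: sq_eq)
  also have "... <= gh * LF^2 / \<mu>" using mu \<open>0 < gh\<close> by (intro divide_right_mono mult_left_mono power_mono) auto
  finally show ?thesis using mgh Ghc by linarith
 qed
 have q: "0 <= q" unfolding q_def by (rule sa_constant_nonneg[OF mgh])
 have eps0: "0 <= \<epsilon>0" unfolding \<epsilon>0_def using q Gh1 by (simp add: q_def)
 have Lt: "0 <= Lt0 P"
 proof -
  have "0 <= sqrt (\<integral>\<xi>. (lipz P i \<xi>)^2 \<partial>law P i)" for i by simp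
  also have "... i <= Lt0 P" for i unfolding Lt0_def by (rule Max_ge) auto
  finally show ?thesis .
 qed
 have thr1: "1 <= thr" by (simp add: thr_def horizon_threshold_def)
 have target: "err K <= ennreal e" if e: "0 < e" and Kb: "K_bound e <= real K" for e K
 proof -
  have th: "thr <= real K" and up: "upper_const gap q * (upper_terms n m \<eta> l w (L0 P) (Lt0 P) V \<epsilon>0 e + lower_terms a n \<eta> l w (L0 P) (Lt0 P) (LF / \<mu>) e) <= real K"
   using Kb by (simp_all add: K_bound_def)
  have K: "1 <= K" using th thr1 by linarith
  let ?T = "\<Sum>k<K. n^2 * (Lt0 P)^2 * (q / (real (t k) + Gh)) / \<eta>^2"
  have T0: "0 <= ?T" using q Gh1 by (intro sum_nonneg) auto
  have "err K <= ennreal (stationarity_rate m (horizon_stepsize n \<eta> (L0 P) K) (L0 P * sqrt n / \<eta>) l (pi^2 * n * (L0 P)^2) gap V ?T (real K))"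
   unfolding err_def n_def m_def l_def gap_def V_def q_def
   by (rule sa_stationarity_rate[where za="za K" and y="y K" and zl="zl K", OF nw wpo bdd lpd lowl et pr fV fgap L0 ghc Ghc sam lsam x0J K])
     (use runs K th in \<open>simp_all add: n_def thr_def\<close>)
  also have "... <= ennreal e"
   by (intro ennreal_leI rate_le_target[OF nm et l w L0 Lt V0 gap0 kap q a e eps0 K up th[unfolded thr_def, folded n_def l_def] T0])
     (use solver_budget[OF nm et l w L0 Lt V0 gap0 kap q a e eps0 K Gh1] in \<open>simp add: t_def n_def\<close>)
  finally show ?thesis .
 qed
 \<comment> \<open>Every horizon from the ceiling of \<open>K_bound e\<close> on meets the target,
   so the ceiling satisfies the condition under \<open>LEAST\<close>; this yields both the property
   of \<open>K_eps\<close> and its upper bound.\<close>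
 have bound: "thr <= real (K_eps e) & (\<forall>K\<ge>K_eps e. err K <= ennreal e)" "K_eps e <= nat \<lceil>K_bound e\<rceil>" if e: "0 < e" for e
 proof -
  let ?good = "%N. thr <= real N & (\<forall>K\<ge>N. err K <= ennreal e)"
  have ge: "K_bound e <= real N" if "nat \<lceil>K_bound e\<rceil> <= N" for N using that by linarith
  have good: "?good (nat \<lceil>K_bound e\<rceil>)"
   using ge[OF order.refl] ge target[OF e] by (auto simp: K_bound_def)
  show "?good (K_eps e)" unfolding K_eps_def iterations_needed_def by (rule LeastI[of ?good, OF good])
  show "K_eps e <= nat \<lceil>K_bound e\<rceil>" unfolding K_eps_def iterations_needed_def by (rule Least_le[of ?good, OF good])
 qed
 have Kb1: "1 <= K_bound e" for e using thr1 by (simp add: K_bound_def)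
 have K1: "1 <= K_eps e" if "0 < e" for e using bound(1)[OF that] thr1 by linarith
 show "\<forall>e>0. thr <= real (K_eps e) & (\<forall>K\<ge>K_eps e. err K <= ennreal e) & int (K_eps e) <= \<lceil>K_bound e\<rceil>"
 proof (intro allI impI)
  fix e :: real assume e: "0 < e"
  have "0 <= \<lceil>K_bound e\<rceil>" using Kb1[of e] by linarith
  hence "int (K_eps e) <= \<lceil>K_bound e\<rceil>" using bound(2)[OF e] by linarith
  thus "thr <= real (K_eps e) & (\<forall>K\<ge>K_eps e. err K <= ennreal e) & int (K_eps e) <= \<lceil>K_bound e\<rceil>"
   using bound(1)[OF e] by blast
 qed
 have a0: "0 < a" using a by simp
 show "\<forall>e>0. \<eta> powr (2/3) <= n powr (1/2) * real (K_eps e) powr a \<longrightarrow>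
     real (overall_complexity CARD('m) t (K_eps e))
      <= overall_const m Gh a * (n powr (1/2) * real (K_eps e) powr (1 + a) / \<eta> powr (2/3))"
 proof (intro allI impI)
  fix e :: real assume e: "0 < e" and big: "\<eta> powr (2/3) <= n powr (1/2) * real (K_eps e) powr a"
  let ?Z = "n powr (1/2) * real (K_eps e) powr (1 + a) / \<eta> powr (2/3)"
  have "real (overall_complexity CARD('m) t (K_eps e)) <= m * (3 + 2 * Gh powr a) * ?Z"
   using overall_count[OF nm(1) et Gh1 a0 K1[OF e] order.refl big, of "CARD('m)"] by (simp add: t_def n_def m_def)
  also have "... <= (2 powr (1 + a) * m * (3 + 2 * Gh powr a)) * ?Z"
  proof (rule mult_right_mono)
   have "1 <= 2 powr (1 + a)" using a0 by (intro ge_one_powr_ge_zero) auto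
   moreover have "0 <= m * (3 + 2 * Gh powr a)" using nm by (intro mult_nonneg_nonneg add_nonneg_nonneg) auto
   ultimately show "m * (3 + 2 * Gh powr a) <= 2 powr (1 + a) * m * (3 + 2 * Gh powr a)"
    using mult_right_mono[of 1 "2 powr (1 + a)" "m * (3 + 2 * Gh powr a)"] by (simp add: mult.assoc)
  qed simp
  finally show "real (overall_complexity CARD('m) t (K_eps e)) <= overall_const m Gh a * ?Z" by (simp add: overall_const_def)
 qed
 show "\<exists>e0>0. \<forall>e. 0 < e & e < e0 \<longrightarrow>
     real (overall_complexity CARD('m) t (K_eps e))
      <= overall_const m Gh a * (n powr (1/2) * K_bound e powr (1 + a) / \<eta> powr (2/3))"
 proof -
  \<comment> \<open>\<open>k0\<close> is the horizon whose power \<open>a\<close> balances \<eta>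
    powr (2/3) / n powr (1/2). The first summand of \<open>upper_terms\<close> alone contributes c1
    / e^2 to \<open>K_bound\<close>, and for e below sqrt (c1 / k0) this exceeds
    \<open>k0\<close>.\<close>
  define k0 where "k0 = (\<eta> powr (2/3) / n powr (1/2)) powr (1 / a)"
  define c1 where "c1 = upper_const gap q * (n powr (3/2) * (L0 P)^3 / \<eta> powr (4/3))"
  have C0: "0 < upper_const gap q"
  proof -
   have "0 < (1 + gap^2 + q^2)^2" by (intro zero_less_power add_pos_nonneg) auto
   thus ?thesis by (simp add: upper_const_def)
  qed
  have k0: "0 < k0" using et nm by (simp add: k0_def)
  have c1: "0 < c1" unfolding c1_def using C0 et nm L0 by simp
  show ?thesis
  proof (intro exI[of _ "sqrt (c1 / k0)"] conjI allI impI)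
   show "0 < sqrt (c1 / k0)" using k0 c1 by simp
   fix e assume "0 < e & e < sqrt (c1 / k0)"
   hence e: "0 < e" and e2: "e^2 < c1 / k0"
    using k0 c1 real_less_rsqrt power_strict_mono[of e "sqrt (c1 / k0)" 2] by auto
   have "k0 < c1 / e^2" using e2 k0 e by (simp add: pos_less_divide_eq mult.commute)
   also have "c1 / e^2 = upper_const gap q * (n powr (3/2) * (L0 P)^3 / \<eta> powr (4/3) * e powr (-2))"
    using e by (simp add: c1_def powr_minus_divide powr_numeral)
   also have "... <= upper_const gap q * (upper_terms n m \<eta> l w (L0 P) (Lt0 P) V \<epsilon>0 e + lower_terms a n \<eta> l w (L0 P) (Lt0 P) (LF / \<mu>) e)"
    using upper_terms_split(1)[OF nm et l w L0 Lt V0 gap0 kap q a e eps0] lower_terms_split(1)[OF nm et l w L0 Lt V0 gap0 kap q a e eps0] C0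
    by (intro mult_left_mono) auto
   also have "... <= K_bound e" by (simp add: K_bound_def)
   finally have kb: "k0 <= K_bound e" by simp
   \<comment> \<open>The ceiling of a number that is at least 1 is at most twice that number; this
     is the source of 2 powr (1 + a) in \<open>overall_const\<close>.\<close>
   let ?R = "2 * K_bound e"
   have "\<eta> powr (2/3) / n powr (1/2) = k0 powr a" unfolding k0_def using a0 et nm by (simp add: powr_powr)
   also have "... <= ?R powr a" using kb k0 a0 by (intro powr_mono2) auto
   finally have big: "\<eta> powr (2/3) <= n powr (1/2) * ?R powr a" using nm by (simp add: pos_divide_le_eq mult.commute)
   have R: "real (K_eps e) <= ?R" using bound(2)[OF e] Kb1[of e] by linarith
   have "real (overall_complexity CARD('m) t (K_eps e)) <= m * (3 + 2 * Gh powr a) * (n powr (1/2) * ?R powr (1 + a) / \<eta> powr (2/3))"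
    using overall_count[OF nm(1) et Gh1 a0 K1[OF e] R big, of "CARD('m)"] by (simp add: t_def n_def m_def)
   also have "?R powr (1 + a) = 2 powr (1 + a) * K_bound e powr (1 + a)" using Kb1[of e] by (simp add: powr_mult)
   finally show "real (overall_complexity CARD('m) t (K_eps e)) <= overall_const m Gh a * (n powr (1/2) * K_bound e powr (1 + a) / \<eta> powr (2/3))"
    by (simp add: overall_const_def mult_ac)
  qed
 qed
qed

theorem theorem1:
  fixes P :: "('n::finite, 'm::finite, 'p::finite, 'd::finite) mpec"
    and W :: "real^'m^'m" and E :: "('m \<times> 'm) set"
    and M :: "'w measure"
    and \<xi> :: "'m \<Rightarrow> nat \<Rightarrow> 'w \<Rightarrow> real^'d" and v :: "'m \<Rightarrow> nat \<Rightarrow> 'w \<Rightarrow> real^'n"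
    and x0 :: "'w \<Rightarrow> real^'n^'m"
    and \<eta> \<mu>F LF :: real and D :: "'m \<Rightarrow> real"
  defines "n \<equiv> real CARD('n)" and "m \<equiv> real CARD('m)"
    and "l \<equiv> lambda_W W" and "w \<equiv> norm W"
    and "gap \<equiv> (\<integral>\<omega>. smoothed_obj P \<eta> (average (x0 \<omega>)) \<partial>M) - (INF x. smoothed_obj P \<eta> x)"
    and "G \<equiv> (1 / real CARD('m)) * (\<integral>\<omega>. (norm (stacked_gradient P \<eta> (x0 \<omega>)))\<^sup>2 \<partial>M)"
    and "V \<equiv> (\<integral>\<omega>. consensus_error (x0 \<omega>) \<partial>M)"
  assumes network: "network E W"
    and well_posed: "well_posed P"
    and bounded_below: "bdd_below (range (objective P))"
    and lipschitz: "lipschitz_data P"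
    and lower: "lower_level P \<mu>F LF D"
    and eta: "0 < \<eta>"
    and prob: "prob_space M"
    and finite_V: "integrable M (\<lambda>\<omega>. consensus_error (x0 \<omega>))"
    and finite_gap: "integrable M (\<lambda>\<omega>. smoothed_obj P \<eta> (average (x0 \<omega>)))"
  shows
   "(\<forall>\<gamma> \<epsilon> S za x y K Ks.
       0 < \<gamma> \<and> \<gamma> \<le> stepsize_factor l * (\<eta> / (sqrt n * L0 P)) \<and> (\<forall>k. 0 \<le> \<epsilon> k) \<and>
       sampling P M S \<xi> v \<and> x0 \<in> borel_measurable S \<and>
       dizs_gt P W \<eta> \<gamma> M \<xi> v za x0 x y \<and> inexact P \<eta> \<epsilon> M S \<xi> v za x0 x \<and>
       1 \<le> K \<and> random_horizon M S \<xi> v K Ks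
       \<longrightarrow>
       stationarity_error P \<eta> M x Ks
         \<le> ennreal (stationarity_bound n m \<eta> \<gamma> l w (L0 P) (Lt0 P) gap G V \<epsilon> K) \<and>
       (\<integral>\<^sup>+\<omega>. ennreal (consensus_error (x (Ks \<omega>) \<omega>)) \<partial>M)
         \<le> ennreal (consensus_bound n m \<eta> \<gamma> l w (L0 P) (Lt0 P) gap G V \<epsilon> K))
    \<and>
    (\<forall>gh Gh \<nu> a J Q \<zeta> zl za x y Ks.
       let S = solver_info M J \<zeta>;
           t = inner_iterations n \<eta> Gh a;
           q = sa_constant \<mu>F \<nu> gh Gh D;
           \<epsilon>0 = q / (real (t 0) + Gh);
           thr = horizon_threshold n \<eta> l (L0 P);
           err = (\<lambda>K. stationarity_error P \<eta> M (x K) (Ks K));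
           K_eps = iterations_needed thr err;
           K_bound = (\<lambda>e. max thr (upper_const gap q *
              (upper_terms n m \<eta> l w (L0 P) (Lt0 P) V \<epsilon>0 e
               + lower_terms a n \<eta> l w (L0 P) (Lt0 P) (LF / \<mu>F) e)))
       in
       0 < L0 P \<and> 1 / \<mu>F < gh \<and> gh * LF\<^sup>2 / \<mu>F < Gh \<and> 1/2 < a \<and>
       sampling P M S \<xi> v \<and> lower_sampling P \<nu> M J Q \<zeta> \<and> x0 \<in> borel_measurable J \<and>
       (\<forall>K\<ge>1. dizs_gt P W \<eta> (horizon_stepsize n \<eta> (L0 P) K) M \<xi> v (za K) x0 (x K) (y K) \<and>
               sa_solver P \<eta> gh Gh t M J \<xi> v \<zeta> (x K) (zl K) (za K) \<and>
               random_horizon M S \<xi> v K (Ks K))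
       \<longrightarrow>
       (\<forall>e>0. thr \<le> real (K_eps e) \<and> (\<forall>K\<ge>K_eps e. err K \<le> ennreal e) \<and>
               int (K_eps e) \<le> \<lceil>K_bound e\<rceil>) \<and>
       (\<forall>e>0. \<eta> powr (2/3) \<le> n powr (1/2) * real (K_eps e) powr a \<longrightarrow>
          real (overall_complexity CARD('m) t (K_eps e))
            \<le> overall_const m Gh a * (n powr (1/2) * real (K_eps e) powr (1 + a) / \<eta> powr (2/3))) \<and>
       (\<exists>e0>0. \<forall>e. 0 < e \<and> e < e0 \<longrightarrow>
          real (overall_complexity CARD('m) t (K_eps e))
            \<le> overall_const m Gh a * (n powr (1/2) * K_bound e powr (1 + a) / \<eta> powr (2/3))))"
proof (intro conjI allI impI, goal_cases)
  case (1 \<gamma> \<epsilon> S za x y K Ks)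
  then show ?case unfolding n_def m_def l_def w_def gap_def V_def
  proof (elim conjE, goal_cases)
    case 1
    show ?case by (rule error_bounds(1)[OF network well_posed bounded_below lipschitz lower eta prob finite_V finite_gap 1]) (simp add: G_def)
  qed
next
  case (2 \<gamma> \<epsilon> S za x y K Ks)
  then show ?case unfolding n_def m_def l_def w_def gap_def V_def
  proof (elim conjE, goal_cases)
    case 1
    show ?case by (rule error_bounds(2)[OF network well_posed bounded_below lipschitz lower eta prob finite_V finite_gap 1]) (simp add: G_def)
  qed
next
  case (3 gh Gh \<nu> a J Q \<zeta> zl za x y Ks)
  show ?case unfolding Let_def n_def m_def l_def w_def gap_def V_def
  proof (intro impI, elim conjE, goal_cases)
    case 1
    show ?case
      by (intro conjI complexity_bounds[OF network well_posed bounded_below lipschitz lower eta prob finite_V finite_gap 1])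
  qed
qed

end
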